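(* Let $\mathcal R$ be a small preadditive category such that $Mod\text{-}\mathcal R$ is locally noetherian. (a) The full subcategory $FI^{sfg}_{\mathcal R}$ of $FI_{\mathcal R}$ given by $$Ob(FI^{sfg}_{\mathcal R}):=\{\mathscr V\in Ob(FI_{\mathcal R})\ \vert\ \mathbb S^d\mathscr V \text{ is finitely generated for some } d\geq 0\}$$ is a Serre subcategory of $FI_{\mathcal R}$, i.e., it is closed under extensions, quotients and subobjects. (b) Let $\tau=(\mathcal T,\mathcal F)$ be a hereditary torsion theory on $Mod\text{-}\mathcal R$ and let $\overline{\mathcal T}^{sfg}$ be the full subcategory of $FI^{sfg}_{\mathcal R}$ with objects $$Ob(\overline{\mathcal T}^{sfg}):=\{\mathscr V\in Ob(FI_{\mathcal R}^{sfg})\ \vert\ \text{every finitely generated } \mathscr W\subseteq \mathscr V \text{ lies in } \overline{\mathcal T}\}.$$ Then $\overline{\mathcal T}^{sfg}$ is a hereditary torsion class in $FI^{sfg}_{\mathcal R}$. For any $\mathscr V\in FI_{\mathcal R}^{sfg}$, the torsion subobject of $\mathscr V$ with respect to the torsion class $\overline{\mathcal T}^{sfg}$ is given by $$\overline{\mathcal T}^{sfg}(\mathscr V)(S):=\underset{a\geq 0}{\mathrm{colim}}\ \lim\left(\mathscr V(S)\xrightarrow{\ \psi_a^{\mathscr V}(S)\ }(\mathbb S^a\mathscr V)(S)\longleftarrow \mathcal T((\mathbb S^a\mathscr V)(S))\right)$$ for each finite set $S$.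
   Context: $FI$ is the category of finite sets and injections; $[n]=\{1,\dots,n\}$ and $[0]=\emptyset$. For a small preadditive category $\mathcal R$, a right $\mathcal R$-module is an (additive) functor $\mathcal R^{op}\to Ab$, and $Mod\text{-}\mathcal R$ is the category of these. $FI_{\mathcal R}$ is the category of functors $\mathscr V:FI\to Mod\text{-}\mathcal R$ ($FI$-modules over $\mathcal R$), and $\mathscr V_n:=\mathscr V([n])$; it is a Grothendieck category with kernels and cokernels computed pointwise. An object $X$ of a Grothendieck category is finitely generated if $Hom(X,-)$ preserves filtered colimits of monomorphisms; it is noetherian if all its subobjects are finitely generated; the category is locally noetherian if it has a set of noetherian generators. $FI^{fg}_{\mathcal R}$ is the full subcategory of finitely generated objects of $FI_{\mathcal R}$. A torsion theory on an abelian category $\mathcal A$ is a pair $(\mathcal T,\mathcal F)$ of full replete subcategories such that $Hom(T,F)=0$ for all $T\in\mathcal T$, $F\in\mathcal F$, and every $X\in \mathcal A$ fits in a short exact sequence $0\to \mathcal T(X)\to X\to \mathcal F(X)\to 0$ with $\mathcal T(X)\in\mathcal T$, $\mathcal F(X)\in\mathcal F$; $\mathcal T(X)$ is the torsion subobject of $X$. A torsion class is a subcategory occurring as the $\mathcal T$ of a torsion theory; it (or the torsion theory) is hereditary if $\mathcal T$ is closed under subobjects. $\overline{\mathcal T}\subseteq FI^{fg}_{\mathcal R}$ is the full subcategory of those finitely generated $\mathscr V$ with $\mathscr V_n\in\mathcal T$ for all $n\gg0$. For each $a\ge 0$ let $[-a]$ be a fixed set of cardinality $a$ (with $[-a]\subset[-(a+1)]$).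 The shift functor $\mathbb S^a:FI_{\mathcal R}\to FI_{\mathcal R}$ is $(\mathbb S^a\mathscr V)(S):=\mathscr V(S\sqcup[-a])$ (on morphisms, extend by the identity of $[-a]$). The inclusions $S\hookrightarrow S\sqcup[-a]$ induce a morphism $\psi_a^{\mathscr V}:\mathscr V\to\mathbb S^a\mathscr V$. In the displayed formula, the limit is the pullback in $Mod\text{-}\mathcal R$ along the inclusion of the torsion subobject $\mathcal T((\mathbb S^a\mathscr V)(S))\subseteq (\mathbb S^a\mathscr V)(S)$; as $a$ grows these pullbacks form an increasing chain of subobjects of $\mathscr V(S)$, with transition maps induced by $[-a]\subset[-(a+1)]$. *)

theory Defs
  imports "HOL-Algebra.Group" "HOL-Library.FuncSet" "HOL-Library.Nat_Bijection"
begin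

text \<open>
  Universe convention: a type \<open>'u\<close> plays the role of a universe of sets.  Small categories have
  objects and arrows in \<open>'u\<close>, and abelian groups have carriers contained in \<open>'u\<close>.  If \<open>'u\<close> is
  infinite, the resulting categories of modules contain the representable modules of every small
  preadditive category and are closed under subobjects, quotients, extensions and coproducts indexed
  by subsets of \<open>'u\<close>.
\<close>

section \<open>Categories, functors, natural transformations\<close>

record ('o, 'm) cat =
  Obj :: "'o set"
  Arr :: "'m set"
  Dom :: "'m \<Rightarrow> 'o"
  Cod :: "'m \<Rightarrow> 'o"
  Ident :: "'o \<Rightarrow> 'm"
  Comp :: "'m \<Rightarrow> 'm \<Rightarrow> 'm"

text \<open>\<open>Comp C g f\<close> is \<open>g\<close> after \<open>f\<close>.\<close>

definition Hom :: "('o, 'm, 'z) cat_scheme \<Rightarrow> 'o \<Rightarrow> 'o \<Rightarrow> 'm set" where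
  "Hom C a b = {f \<in> Arr C. Dom C f = a \<and> Cod C f = b}"

locale category =
  fixes C :: "('o, 'm, 'z) cat_scheme"
  assumes Dom_in: "f \<in> Arr C \<Longrightarrow> Dom C f \<in> Obj C"
    and Cod_in: "f \<in> Arr C \<Longrightarrow> Cod C f \<in> Obj C"
    and Ident_in: "a \<in> Obj C \<Longrightarrow> Ident C a \<in> Hom C a a"
    and Comp_in: "\<lbrakk>f \<in> Hom C a b; g \<in> Hom C b c\<rbrakk> \<Longrightarrow> Comp C g f \<in> Hom C a c"
    and Ident_left: "f \<in> Hom C a b \<Longrightarrow> Comp C (Ident C b) f = f"
    and Ident_right: "f \<in> Hom C a b \<Longrightarrow> Comp C f (Ident C a) = f"
    and Comp_assoc: "\<lbrakk>f \<in> Hom C a b; g \<in> Hom C b c; h \<in> Hom C c d\<rbrakk>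
      \<Longrightarrow> Comp C h (Comp C g f) = Comp C (Comp C h g) f"

definition full_subcategory :: "('o, 'm, 'z) cat_scheme \<Rightarrow> 'o set \<Rightarrow> ('o, 'm, 'z) cat_scheme" where
  "full_subcategory C A =
    C\<lparr>Obj := Obj C \<inter> A, Arr := {f \<in> Arr C. Dom C f \<in> A \<and> Cod C f \<in> A}\<rparr>"

record ('o, 'm, 'p, 'n) cat_functor =
  FObj :: "'o \<Rightarrow> 'p"
  FArr :: "'m \<Rightarrow> 'n"

definition is_functor ::
  "('o, 'm, 'y) cat_scheme \<Rightarrow> ('p, 'n, 'z) cat_scheme \<Rightarrow> ('o, 'm, 'p, 'n) cat_functor \<Rightarrow> bool" where
  "is_functor C D F \<longleftrightarrow>
    (\<forall>a\<in>Obj C. FObj F a \<in> Obj D) \<and>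
    (\<forall>f\<in>Arr C. FArr F f \<in> Hom D (FObj F (Dom C f)) (FObj F (Cod C f))) \<and>
    (\<forall>a\<in>Obj C. FArr F (Ident C a) = Ident D (FObj F a)) \<and>
    (\<forall>f\<in>Arr C. \<forall>g\<in>Arr C. Cod C f = Dom C g \<longrightarrow>
      FArr F (Comp C g f) = Comp D (FArr F g) (FArr F f))"

definition comp_functor ::
  "('p, 'n, 'q, 'k) cat_functor \<Rightarrow> ('o, 'm, 'p, 'n) cat_functor \<Rightarrow> ('o, 'm, 'q, 'k) cat_functor" where
  "comp_functor G F = \<lparr>FObj = FObj G \<circ> FObj F, FArr = FArr G \<circ> FArr F\<rparr>"

text \<open>
  Arrows given by a source, a target and an underlying map; used for functions between sets, group
  homomorphisms and natural transformations.  In the categories below the underlying map is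
  required to be extensional, so that equal arrows are equal as records.
\<close>

record ('s, 'f) arrow =
  Src :: 's
  Tgt :: 's
  App :: 'f

definition functor_category ::
  "('o, 'm, 'y) cat_scheme \<Rightarrow> ('p, 'n, 'z) cat_scheme \<Rightarrow>
    (('o, 'm, 'p, 'n) cat_functor, (('o, 'm, 'p, 'n) cat_functor, 'o \<Rightarrow> 'n) arrow) cat" where
  "functor_category C D = \<lparr>
    Obj = {F. is_functor C D F},
    Arr = {t. is_functor C D (Src t) \<and> is_functor C D (Tgt t) \<and> App t \<in> extensional (Obj C) \<and>
      (\<forall>a\<in>Obj C. App t a \<in> Hom D (FObj (Src t) a) (FObj (Tgt t) a)) \<and>
      (\<forall>f\<in>Arr C. Comp D (App t (Cod C f)) (FArr (Src t) f) =
                  Comp D (FArr (Tgt t) f) (App t (Dom C f)))},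
    Dom = Src,
    Cod = Tgt,
    Ident = (\<lambda>F. \<lparr>Src = F, Tgt = F, App = (\<lambda>a\<in>Obj C. Ident D (FObj F a))\<rparr>),
    Comp = (\<lambda>u t. \<lparr>Src = Src t, Tgt = Tgt u, App = (\<lambda>a\<in>Obj C. Comp D (App u a) (App t a))\<rparr>)\<rparr>"

definition set_category :: "('a set, ('a set, 'a \<Rightarrow> 'a) arrow) cat" where
  "set_category = \<lparr>
    Obj = UNIV,
    Arr = {f. App f \<in> Src f \<rightarrow>\<^sub>E Tgt f},
    Dom = Src,
    Cod = Tgt,
    Ident = (\<lambda>S. \<lparr>Src = S, Tgt = S, App = (\<lambda>x\<in>S. x)\<rparr>),
    Comp = (\<lambda>g f. \<lparr>Src = Src f, Tgt = Tgt g, App = compose (Src f) (App g) (App f)\<rparr>)\<rparr>"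

definition hom_functor ::
  "('o, 'm, 'z) cat_scheme \<Rightarrow> 'o \<Rightarrow> ('o, 'm, 'm set, ('m set, 'm \<Rightarrow> 'm) arrow) cat_functor" where
  "hom_functor C X = \<lparr>
    FObj = Hom C X,
    FArr = (\<lambda>f. \<lparr>Src = Hom C X (Dom C f), Tgt = Hom C X (Cod C f),
                 App = (\<lambda>h\<in>Hom C X (Dom C f). Comp C f h)\<rparr>)\<rparr>"

definition nat_category :: "(nat, nat \<times> nat) cat" where
  "nat_category = \<lparr>
    Obj = UNIV,
    Arr = {(a, b). a \<le> b},
    Dom = fst,
    Cod = snd,
    Ident = (\<lambda>a. (a, a)),
    Comp = (\<lambda>g f. (fst f, snd g))\<rparr>"


section \<open>Notions internal to a category\<close>

definition is_mono :: "('o, 'm, 'z) cat_scheme \<Rightarrow> 'm \<Rightarrow> bool" where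
  "is_mono C f \<longleftrightarrow> f \<in> Arr C \<and>
    (\<forall>a. \<forall>g\<in>Hom C a (Dom C f). \<forall>h\<in>Hom C a (Dom C f). Comp C f g = Comp C f h \<longrightarrow> g = h)"

definition is_epi :: "('o, 'm, 'z) cat_scheme \<Rightarrow> 'm \<Rightarrow> bool" where
  "is_epi C f \<longleftrightarrow> f \<in> Arr C \<and>
    (\<forall>a. \<forall>g\<in>Hom C (Cod C f) a. \<forall>h\<in>Hom C (Cod C f) a. Comp C g f = Comp C h f \<longrightarrow> g = h)"

definition isomorphic :: "('o, 'm, 'z) cat_scheme \<Rightarrow> 'o \<Rightarrow> 'o \<Rightarrow> bool" where
  "isomorphic C a b \<longleftrightarrow>
    (\<exists>f\<in>Hom C a b. \<exists>g\<in>Hom C b a. Comp C g f = Ident C a \<and> Comp C f g = Ident C b)"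

definition zero_object :: "('o, 'm, 'z) cat_scheme \<Rightarrow> 'o \<Rightarrow> bool" where
  "zero_object C z \<longleftrightarrow> z \<in> Obj C \<and>
    (\<forall>a\<in>Obj C. (\<exists>!f. f \<in> Hom C a z) \<and> (\<exists>!f. f \<in> Hom C z a))"

definition zero_arrow :: "('o, 'm, 'z) cat_scheme \<Rightarrow> 'm \<Rightarrow> bool" where
  "zero_arrow C f \<longleftrightarrow> f \<in> Arr C \<and>
    (\<exists>z. zero_object C z \<and>
      (\<exists>g\<in>Hom C (Dom C f) z. \<exists>h\<in>Hom C z (Cod C f). f = Comp C h g))"

definition is_kernel :: "('o, 'm, 'z) cat_scheme \<Rightarrow> 'm \<Rightarrow> 'm \<Rightarrow> bool" where
  "is_kernel C k f \<longleftrightarrow> k \<in> Arr C \<and> f \<in> Arr C \<and> Cod C k = Dom C f \<and> zero_arrow C (Comp C f k) \<and>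
    (\<forall>a. \<forall>h\<in>Hom C a (Dom C f). zero_arrow C (Comp C f h) \<longrightarrow>
      (\<exists>!u. u \<in> Hom C a (Dom C k) \<and> Comp C k u = h))"

definition is_cokernel :: "('o, 'm, 'z) cat_scheme \<Rightarrow> 'm \<Rightarrow> 'm \<Rightarrow> bool" where
  "is_cokernel C c f \<longleftrightarrow> c \<in> Arr C \<and> f \<in> Arr C \<and> Cod C f = Dom C c \<and> zero_arrow C (Comp C c f) \<and>
    (\<forall>a. \<forall>h\<in>Hom C (Cod C f) a. zero_arrow C (Comp C h f) \<longrightarrow>
      (\<exists>!u. u \<in> Hom C (Cod C c) a \<and> Comp C u c = h))"

text \<open>The sequence \<open>0 \<rightarrow> Dom f \<rightarrow> Cod f = Dom g \<rightarrow> Cod g \<rightarrow> 0\<close> with arrows \<open>f\<close> and \<open>g\<close>:\<close>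

definition short_exact :: "('o, 'm, 'z) cat_scheme \<Rightarrow> 'm \<Rightarrow> 'm \<Rightarrow> bool" where
  "short_exact C f g \<longleftrightarrow> is_kernel C f g \<and> is_cokernel C g f"

text \<open>\<open>p\<close> and \<open>q\<close> are the projections of a pullback of the cospan formed by \<open>f\<close> and \<open>g\<close>:\<close>

definition is_pullback :: "('o, 'm, 'z) cat_scheme \<Rightarrow> 'm \<Rightarrow> 'm \<Rightarrow> 'm \<Rightarrow> 'm \<Rightarrow> bool" where
  "is_pullback C f g p q \<longleftrightarrow>
    f \<in> Arr C \<and> g \<in> Arr C \<and> Cod C f = Cod C g \<and>
    p \<in> Hom C (Dom C p) (Dom C f) \<and> q \<in> Hom C (Dom C p) (Dom C g) \<and>
    Comp C f p = Comp C g q \<and>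
    (\<forall>a. \<forall>x\<in>Hom C a (Dom C f). \<forall>y\<in>Hom C a (Dom C g). Comp C f x = Comp C g y \<longrightarrow>
      (\<exists>!u. u \<in> Hom C a (Dom C p) \<and> Comp C p u = x \<and> Comp C q u = y))"

definition is_cocone ::
  "('i, 'j, 'y) cat_scheme \<Rightarrow> ('o, 'm, 'z) cat_scheme \<Rightarrow> ('i, 'j, 'o, 'm) cat_functor \<Rightarrow>
    'o \<Rightarrow> ('i \<Rightarrow> 'm) \<Rightarrow> bool" where
  "is_cocone I C D L c \<longleftrightarrow> L \<in> Obj C \<and>
    (\<forall>i\<in>Obj I. c i \<in> Hom C (FObj D i) L) \<and>
    (\<forall>t\<in>Arr I. Comp C (c (Cod I t)) (FArr D t) = c (Dom I t))"

definition is_colimit ::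
  "('i, 'j, 'y) cat_scheme \<Rightarrow> ('o, 'm, 'z) cat_scheme \<Rightarrow> ('i, 'j, 'o, 'm) cat_functor \<Rightarrow>
    'o \<Rightarrow> ('i \<Rightarrow> 'm) \<Rightarrow> bool" where
  "is_colimit I C D L c \<longleftrightarrow> is_cocone I C D L c \<and>
    (\<forall>M d. is_cocone I C D M d \<longrightarrow>
      (\<exists>!u. u \<in> Hom C L M \<and> (\<forall>i\<in>Obj I. Comp C u (c i) = d i)))"

definition filtered :: "('i, 'j, 'z) cat_scheme \<Rightarrow> bool" where
  "filtered I \<longleftrightarrow> Obj I \<noteq> {} \<and>
    (\<forall>i\<in>Obj I. \<forall>j\<in>Obj I. \<exists>k\<in>Obj I. Hom I i k \<noteq> {} \<and> Hom I j k \<noteq> {}) \<and>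
    (\<forall>i j. \<forall>s\<in>Hom I i j. \<forall>t\<in>Hom I i j. \<exists>k. \<exists>r\<in>Hom I j k. Comp I r s = Comp I r t)"

text \<open>
  The argument \<open>TYPE('u)\<close> fixes the universe of the small filtered index categories.
\<close>

definition finitely_generated :: "'u itself \<Rightarrow> ('o, 'm, 'z) cat_scheme \<Rightarrow> 'o \<Rightarrow> bool" where
  "finitely_generated U C X \<longleftrightarrow> X \<in> Obj C \<and>
    (\<forall>(I :: ('u, 'u) cat) D L c.
      category I \<and> filtered I \<and> is_functor I C D \<and> (\<forall>t\<in>Arr I. is_mono C (FArr D t)) \<and>
      is_colimit I C D L c \<longrightarrow>
      is_colimit I set_category (comp_functor (hom_functor C X) D)
        (FObj (hom_functor C X) L) (\<lambda>i. FArr (hom_functor C X) (c i)))"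

definition noetherian :: "'u itself \<Rightarrow> ('o, 'm, 'z) cat_scheme \<Rightarrow> 'o \<Rightarrow> bool" where
  "noetherian U C X \<longleftrightarrow> X \<in> Obj C \<and>
    (\<forall>f. is_mono C f \<and> Cod C f = X \<longrightarrow> finitely_generated U C (Dom C f))"

definition generating_set :: "('o, 'm, 'z) cat_scheme \<Rightarrow> 'o set \<Rightarrow> bool" where
  "generating_set C G \<longleftrightarrow> G \<subseteq> Obj C \<and>
    (\<forall>a b. \<forall>f\<in>Hom C a b. \<forall>g\<in>Hom C a b. f \<noteq> g \<longrightarrow>
      (\<exists>x\<in>G. \<exists>h\<in>Hom C x a. Comp C f h \<noteq> Comp C g h))"

definition locally_noetherian :: "'u itself \<Rightarrow> ('o, 'm, 'z) cat_scheme \<Rightarrow> bool" where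
  "locally_noetherian U C \<longleftrightarrow> (\<exists>G. generating_set C G \<and> (\<forall>X\<in>G. noetherian U C X))"

text \<open>Full subcategories of \<open>C\<close> are represented by their sets of objects.\<close>

definition serre_subcategory :: "('o, 'm, 'z) cat_scheme \<Rightarrow> 'o set \<Rightarrow> bool" where
  "serre_subcategory C A \<longleftrightarrow> A \<subseteq> Obj C \<and> A \<noteq> {} \<and>
    (\<forall>f g. short_exact C f g \<and> Dom C f \<in> A \<and> Cod C g \<in> A \<longrightarrow> Cod C f \<in> A) \<and>
    (\<forall>g. is_epi C g \<and> Dom C g \<in> A \<longrightarrow> Cod C g \<in> A) \<and>
    (\<forall>f. is_mono C f \<and> Cod C f \<in> A \<longrightarrow> Dom C f \<in> A)"

definition replete :: "('o, 'm, 'z) cat_scheme \<Rightarrow> 'o set \<Rightarrow> bool" where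
  "replete C A \<longleftrightarrow> (\<forall>a b. a \<in> A \<and> isomorphic C a b \<longrightarrow> b \<in> A)"

definition torsion_theory :: "('o, 'm, 'z) cat_scheme \<Rightarrow> 'o set \<Rightarrow> 'o set \<Rightarrow> bool" where
  "torsion_theory C T F \<longleftrightarrow> T \<subseteq> Obj C \<and> F \<subseteq> Obj C \<and> replete C T \<and> replete C F \<and>
    (\<forall>a\<in>T. \<forall>b\<in>F. \<forall>f\<in>Hom C a b. zero_arrow C f) \<and>
    (\<forall>X\<in>Obj C. \<exists>t g. short_exact C t g \<and> Cod C t = X \<and> Dom C t \<in> T \<and> Cod C g \<in> F)"

definition closed_under_subobjects :: "('o, 'm, 'z) cat_scheme \<Rightarrow> 'o set \<Rightarrow> bool" where
  "closed_under_subobjects C T \<longleftrightarrow> (\<forall>f. is_mono C f \<and> Cod C f \<in> T \<longrightarrow> Dom C f \<in> T)"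

definition hereditary_torsion_theory :: "('o, 'm, 'z) cat_scheme \<Rightarrow> 'o set \<Rightarrow> 'o set \<Rightarrow> bool" where
  "hereditary_torsion_theory C T F \<longleftrightarrow> torsion_theory C T F \<and> closed_under_subobjects C T"

definition hereditary_torsion_class :: "('o, 'm, 'z) cat_scheme \<Rightarrow> 'o set \<Rightarrow> bool" where
  "hereditary_torsion_class C T \<longleftrightarrow> (\<exists>F. hereditary_torsion_theory C T F)"

text \<open>\<open>t\<close> is the inclusion of the torsion subobject of \<open>X\<close> with respect to the torsion class \<open>T\<close>:\<close>

definition torsion_subobject :: "('o, 'm, 'z) cat_scheme \<Rightarrow> 'o set \<Rightarrow> 'o \<Rightarrow> 'm \<Rightarrow> bool" where
  "torsion_subobject C T X t \<longleftrightarrow>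
    (\<exists>F g. torsion_theory C T F \<and> short_exact C t g \<and>
      Cod C t = X \<and> Dom C t \<in> T \<and> Cod C g \<in> F)"


section \<open>Preadditive categories and modules\<close>

record ('o, 'm) preadd = "('o, 'm) cat" +
  HAdd :: "'m \<Rightarrow> 'm \<Rightarrow> 'm"
  HZero :: "'o \<Rightarrow> 'o \<Rightarrow> 'm"

definition hom_group :: "('o, 'm, 'z) preadd_scheme \<Rightarrow> 'o \<Rightarrow> 'o \<Rightarrow> 'm monoid" where
  "hom_group C a b = \<lparr>carrier = Hom C a b, mult = HAdd C, one = HZero C a b\<rparr>"

locale preadditive_category = category C
  for C :: "('o, 'm, 'z) preadd_scheme" +
  assumes hom_group_comm: "\<lbrakk>a \<in> Obj C; b \<in> Obj C\<rbrakk> \<Longrightarrow> comm_group (hom_group C a b)"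
    and Comp_add_left: "\<lbrakk>f \<in> Hom C a b; g \<in> Hom C b c; h \<in> Hom C b c\<rbrakk>
      \<Longrightarrow> Comp C (HAdd C g h) f = HAdd C (Comp C g f) (Comp C h f)"
    and Comp_add_right: "\<lbrakk>f \<in> Hom C a b; g \<in> Hom C a b; h \<in> Hom C b c\<rbrakk>
      \<Longrightarrow> Comp C h (HAdd C f g) = HAdd C (Comp C h f) (Comp C h g)"

definition opposite :: "('o, 'm) preadd \<Rightarrow> ('o, 'm) preadd" where
  "opposite C = C\<lparr>Dom := Cod C, Cod := Dom C, Comp := (\<lambda>g f. Comp C f g),
    HZero := (\<lambda>a b. HZero C b a)\<rparr>"

text \<open>Abelian groups are written multiplicatively, as in \<^theory>\<open>HOL-Algebra.Group\<close>.\<close>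

definition Ab :: "('u monoid, ('u monoid, 'u \<Rightarrow> 'u) arrow) preadd" where
  "Ab = \<lparr>
    Obj = {G. comm_group G},
    Arr = {f. comm_group (Src f) \<and> comm_group (Tgt f) \<and>
      App f \<in> hom (Src f) (Tgt f) \<inter> extensional (carrier (Src f))},
    Dom = Src,
    Cod = Tgt,
    Ident = (\<lambda>G. \<lparr>Src = G, Tgt = G, App = (\<lambda>x\<in>carrier G. x)\<rparr>),
    Comp = (\<lambda>g f. \<lparr>Src = Src f, Tgt = Tgt g, App = compose (carrier (Src f)) (App g) (App f)\<rparr>),
    HAdd = (\<lambda>f g. \<lparr>Src = Src f, Tgt = Tgt f,
                    App = (\<lambda>x\<in>carrier (Src f). App f x \<otimes>\<^bsub>Tgt f\<^esub> App g x)\<rparr>),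
    HZero = (\<lambda>G H. \<lparr>Src = G, Tgt = H, App = (\<lambda>x\<in>carrier G. \<one>\<^bsub>H\<^esub>)\<rparr>)\<rparr>"

definition additive_functor ::
  "('o, 'm, 'y) preadd_scheme \<Rightarrow> ('p, 'n, 'z) preadd_scheme \<Rightarrow> ('o, 'm, 'p, 'n) cat_functor \<Rightarrow> bool"
  where
  "additive_functor C D F \<longleftrightarrow> is_functor C D F \<and>
    (\<forall>a b. \<forall>f\<in>Hom C a b. \<forall>g\<in>Hom C a b. FArr F (HAdd C f g) = HAdd D (FArr F f) (FArr F g))"

type_synonym 'u rmod = "('u, 'u, 'u monoid, ('u monoid, 'u \<Rightarrow> 'u) arrow) cat_functor"
type_synonym 'u rmod_arrow = "('u rmod, 'u \<Rightarrow> ('u monoid, 'u \<Rightarrow> 'u) arrow) arrow"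

definition Mod :: "('u, 'u) preadd \<Rightarrow> ('u rmod, 'u rmod_arrow) cat" where
  "Mod R = full_subcategory (functor_category (opposite R) Ab)
    {M. additive_functor (opposite R) Ab M}"


section \<open>FI-modules\<close>

text \<open>
  FI is modelled by the equivalent small category of finite sets of natural numbers; it contains
  all the sets \<open>[n] = {1..n}\<close>.
\<close>

type_synonym FI_arrow = "(nat set, nat \<Rightarrow> nat) arrow"

definition FI :: "(nat set, FI_arrow) cat" where
  "FI = \<lparr>
    Obj = {S. finite S},
    Arr = {f. finite (Src f) \<and> finite (Tgt f) \<and>
      App f \<in> Src f \<rightarrow>\<^sub>E Tgt f \<and> inj_on (App f) (Src f)},
    Dom = Src,
    Cod = Tgt,
    Ident = (\<lambda>S. \<lparr>Src = S, Tgt = S, App = (\<lambda>x\<in>S. x)\<rparr>),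
    Comp = (\<lambda>g f. \<lparr>Src = Src f, Tgt = Tgt g, App = compose (Src f) (App g) (App f)\<rparr>)\<rparr>"

type_synonym 'u FI_module = "(nat set, FI_arrow, 'u rmod, 'u rmod_arrow) cat_functor"
type_synonym 'u FI_module_arrow = "('u FI_module, nat set \<Rightarrow> 'u rmod_arrow) arrow"

definition FI_Mod :: "('u, 'u) preadd \<Rightarrow> ('u FI_module, 'u FI_module_arrow) cat" where
  "FI_Mod R = functor_category FI (Mod R)"

text \<open>
  The disjoint union of \<open>S\<close> and \<open>[-a]\<close>, where the chosen \<open>a\<close>-element set \<open>[-a]\<close> is \<open>{1..a}\<close>, placed
  in the second summand; \<open>sum_encode\<close> brings the result back into \<open>nat\<close>.
\<close>

definition pad :: "nat \<Rightarrow> nat set \<Rightarrow> nat set" where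
  "pad a S = sum_encode ` (S <+> {1..a})"

definition pad_arrow :: "nat \<Rightarrow> FI_arrow \<Rightarrow> FI_arrow" where
  "pad_arrow a f = \<lparr>Src = pad a (Src f), Tgt = pad a (Tgt f),
    App = (\<lambda>x\<in>pad a (Src f). sum_encode (map_sum (App f) id (sum_decode x)))\<rparr>"

definition pad_functor :: "nat \<Rightarrow> (nat set, FI_arrow, nat set, FI_arrow) cat_functor" where
  "pad_functor a = \<lparr>FObj = pad a, FArr = pad_arrow a\<rparr>"

definition into_pad :: "nat \<Rightarrow> nat set \<Rightarrow> FI_arrow" where
  "into_pad a S = \<lparr>Src = S, Tgt = pad a S, App = (\<lambda>x\<in>S. sum_encode (Inl x))\<rparr>"

definition pad_inclusion :: "nat \<Rightarrow> nat \<Rightarrow> nat set \<Rightarrow> FI_arrow" where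
  "pad_inclusion a b S = \<lparr>Src = pad a S, Tgt = pad b S, App = (\<lambda>x\<in>pad a S. x)\<rparr>"

definition shift :: "nat \<Rightarrow> 'u FI_module \<Rightarrow> 'u FI_module" where
  "shift a V = comp_functor V (pad_functor a)"

definition psi :: "nat \<Rightarrow> 'u FI_module \<Rightarrow> 'u FI_module_arrow" where
  "psi a V = \<lparr>Src = V, Tgt = shift a V, App = (\<lambda>S\<in>Obj FI. FArr V (into_pad a S))\<rparr>"

definition FI_sfg :: "('u, 'u) preadd \<Rightarrow> 'u FI_module set" where
  "FI_sfg R = {V \<in> Obj (FI_Mod R). \<exists>d. finitely_generated TYPE('u) (FI_Mod R) (shift d V)}"

definition T_bar :: "('u, 'u) preadd \<Rightarrow> 'u rmod set \<Rightarrow> 'u FI_module set" where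
  "T_bar R T = {V. finitely_generated TYPE('u) (FI_Mod R) V \<and> (\<exists>N. \<forall>n\<ge>N. FObj V {1..n} \<in> T)}"

definition T_bar_sfg :: "('u, 'u) preadd \<Rightarrow> 'u rmod set \<Rightarrow> 'u FI_module set" where
  "T_bar_sfg R T = {V \<in> FI_sfg R.
    \<forall>f. is_mono (FI_Mod R) f \<and> Cod (FI_Mod R) f = V \<and>
        finitely_generated TYPE('u) (FI_Mod R) (Dom (FI_Mod R) f)
      \<longrightarrow> Dom (FI_Mod R) f \<in> T_bar R T}"

text \<open>
  The module arrow \<open>k\<close> exhibits its domain, as a subobject of \<open>V S\<close>, as the colimit over \<open>a\<close> of the
  pullbacks \<open>P a\<close> of the torsion subobjects \<open>t a\<close> of \<open>shift a V S\<close> along \<open>psi a V S\<close>.  The pullback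
  projections are \<open>p a : P a \<rightarrow> V S\<close> and \<open>q a\<close>, the transition arrows \<open>P a \<rightarrow> P b\<close> are those induced
  by the inclusion of \<open>[-a]\<close> into \<open>[-b]\<close>, and \<open>c\<close> is the colimit cocone.
\<close>

definition is_torsion_colimit ::
  "('u, 'u) preadd \<Rightarrow> 'u rmod set \<Rightarrow> 'u FI_module \<Rightarrow> nat set \<Rightarrow> 'u rmod_arrow \<Rightarrow> bool" where
  "is_torsion_colimit R T V S k \<longleftrightarrow>
    k \<in> Hom (Mod R) (Dom (Mod R) k) (FObj V S) \<and>
    (\<exists>t p q P c.
      (\<forall>a. torsion_subobject (Mod R) T (FObj (shift a V) S) (t a)) \<and>
      (\<forall>a. is_pullback (Mod R) (App (psi a V) S) (t a) (p a) (q a)) \<and>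
      is_functor nat_category (Mod R) P \<and>
      (\<forall>a. FObj P a = Dom (Mod R) (p a)) \<and>
      (\<forall>a b. a \<le> b \<longrightarrow>
        Comp (Mod R) (p b) (FArr P (a, b)) = p a \<and>
        Comp (Mod R) (t b) (Comp (Mod R) (q b) (FArr P (a, b))) =
          Comp (Mod R) (FArr V (pad_inclusion a b S)) (Comp (Mod R) (t a) (q a))) \<and>
      is_colimit nat_category (Mod R) P (Dom (Mod R) k) c \<and>
      (\<forall>a. Comp (Mod R) k (c a) = p a))"

end

theory Submission
  imports Defs "HOL-Library.List_Lenlexorder"
begin

text \<open>
  Finite generation, defined by filtered colimits of monomorphisms, is the same as generation by
  finitely many elements: a module is the directed union of its finitely generated submodules, and
  conversely the legs of a filtered colimit of monomorphisms are injective and jointly surjective.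

  (a) Closure of \<open>FI_sfg\<close> under subobjects is the noetherian property of FI-modules.  It is proved by
  a Groebner basis argument.  Let \<open>W\<close> be a submodule of a module generated by a submodule \<open>A\<close> and an
  element \<open>x\<close> of degree \<open>d\<close>.  Order the injections \<open>f : {..<d} \<rightarrow> {..<n}\<close> lexicographically and let
  \<open>L f\<close> be the module of those \<open>y\<close> in the noetherian module generated by \<open>x\<close> in degree \<open>d\<close> such that
  \<open>f y\<close> is congruent to an element of \<open>W\<close> modulo \<open>A\<close> and the translates \<open>g x\<close> with \<open>g < f\<close>.  Then
  \<open>L f \<subseteq> L (h f)\<close> for strictly increasing \<open>h\<close>, and by Dickson's lemma divisibility \<open>f \<mapsto> h f\<close> is a well
  quasi-order, so finitely many \<open>L f\<close> determine \<open>W\<close> modulo \<open>A\<close>.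

  (b) With \<open>T0 V\<close> denoting the union of the preimages of the torsion submodules along \<open>psi a V\<close>,
  a module \<open>V\<close> lies in \<open>T_bar_sfg\<close> iff \<open>T0 V = V\<close>.  The quotient by \<open>T0 V\<close> is torsion free because the
  intersection of \<open>T0 V\<close> with a module generated by one element of \<open>V S\<close> is finitely generated, hence
  becomes torsion at one common level \<open>a\<close>.
\<close>

section \<open>Many-sorted modules\<close>

text \<open>Objects of \<open>Mod R\<close> and of \<open>FI_Mod R\<close> are families of abelian
  groups, indexed by sorts, with unary additive operations subject to equations; arrows are linear
  families of maps. Monos, exactness and torsion are therefore treated once for an abstract category
  of such modules, which is then instantiated three times: for \<open>Mod R\<close>, for
  \<open>FI_Mod R\<close> and for the full subcategory on \<open>FI_sfg R\<close>. A recurring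
  obstacle is the universe: all carriers must stay inside the type \<open>'u\<close>. Quotients use
  chosen representatives instead of cosets, directed colimits use coded pairs of an index and an
  element, and the index categories that test finite generation have coded objects and arrows. For
  extensions in (a), the two ends may become finitely generated after different shifts. Shifting
  further preserves finite generation, so a common shift can be used. In (b), the definition of a
  torsion subobject allows any torsion-free partner of the given torsion class. The computations
  therefore go through the trace \<open>tor\<close>, which refers to the torsion class
  alone.\<close>

type_synonym ('k, 'p, 'u) msm = "('k \<Rightarrow> 'u monoid) \<times> ('p \<Rightarrow> 'u \<Rightarrow> 'u)"

abbreviation gr :: "('k, 'p, 'u) msm \<Rightarrow> 'k \<Rightarrow> 'u monoid" where "gr M \<equiv> fst M"
abbreviation ac :: "('k, 'p, 'u) msm \<Rightarrow> 'p \<Rightarrow> 'u \<Rightarrow> 'u" where "ac M \<equiv> snd M"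
abbreviation el :: "('k, 'p, 'u) msm \<Rightarrow> 'k \<Rightarrow> 'u set" where "el M k \<equiv> carrier (fst M k)"

definition restr :: "('k, 'p, 'u) msm \<Rightarrow> ('k \<Rightarrow> 'u set) \<Rightarrow> ('k, 'p, 'u) msm" where
  "restr M U = (\<lambda>k. (gr M k)\<lparr>carrier := U k\<rparr>, ac M)"

definition image_elts :: "('k \<Rightarrow> 'u \<Rightarrow> 'v) \<Rightarrow> ('k \<times> 'u) set \<Rightarrow> ('k \<times> 'v) set" where
  "image_elts \<phi> E = (\<lambda>(k, x). (k, \<phi> k x)) ` E"

lemma finite_image_elts: "finite E \<Longrightarrow> finite (image_elts \<phi> E)"
  by (simp add: image_elts_def)

text \<open>Sorts and unary operations without any equations between the operations. Functoriality,
  additivity in the arrows of \<open>R\<close> and naturality are added later as separate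
  predicates, so spans, sums and noetherianity can be developed before they matter.\<close>

locale sorted_ops =
  fixes K :: "'k set" and Ops :: "'p set" and src :: "'p \<Rightarrow> 'k" and tgt :: "'p \<Rightarrow> 'k"
  assumes src_in: "p \<in> Ops \<Longrightarrow> src p \<in> K" and tgt_in: "p \<in> Ops \<Longrightarrow> tgt p \<in> K"
begin

definition premod :: "('k, 'p, 'u) msm \<Rightarrow> bool" where
  "premod M \<longleftrightarrow> (\<forall>k\<in>K. comm_group (gr M k)) \<and>
    (\<forall>p\<in>Ops. ac M p \<in> hom (gr M (src p)) (gr M (tgt p)))"

definition linear :: "('k, 'p, 'u) msm \<Rightarrow> ('k, 'p, 'v) msm \<Rightarrow> ('k \<Rightarrow> 'u \<Rightarrow> 'v) \<Rightarrow> bool" where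
  "linear M N \<phi> \<longleftrightarrow> (\<forall>k\<in>K. \<phi> k \<in> hom (gr M k) (gr N k)) \<and>
    (\<forall>p\<in>Ops. \<forall>x\<in>el M (src p). \<phi> (tgt p) (ac M p x) = ac N p (\<phi> (src p) x))"

definition submodule :: "('k, 'p, 'u) msm \<Rightarrow> ('k \<Rightarrow> 'u set) \<Rightarrow> bool" where
  "submodule M U \<longleftrightarrow> (\<forall>k\<in>K. subgroup (U k) (gr M k)) \<and>
    (\<forall>p\<in>Ops. \<forall>x\<in>U (src p). ac M p x \<in> U (tgt p))"

text \<open>Without equations between operations there is no normal form for elements of a generated
  submodule as sums of translates, so the closure is inductive. Its induction rule gives minimality
  and compatibility with linear maps.\<close>

inductive spn :: "('k, 'p, 'u) msm \<Rightarrow> ('k \<times> 'u) set \<Rightarrow> 'k \<Rightarrow> 'u \<Rightarrow> bool" for M E where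
  one: "k \<in> K \<Longrightarrow> spn M E k \<one>\<^bsub>gr M k\<^esub>"
| gen: "k \<in> K \<Longrightarrow> (k, x) \<in> E \<Longrightarrow> spn M E k x"
| mult: "k \<in> K \<Longrightarrow> spn M E k x \<Longrightarrow> spn M E k y \<Longrightarrow> spn M E k (x \<otimes>\<^bsub>gr M k\<^esub> y)"
| inv: "k \<in> K \<Longrightarrow> spn M E k x \<Longrightarrow> spn M E k (inv\<^bsub>gr M k\<^esub> x)"
| act: "p \<in> Ops \<Longrightarrow> spn M E (src p) x \<Longrightarrow> spn M E (tgt p) (ac M p x)"

definition span :: "('k, 'p, 'u) msm \<Rightarrow> ('k \<times> 'u) set \<Rightarrow> 'k \<Rightarrow> 'u set" where
  "span M E k = {x. spn M E k x}"

definition fg_sub :: "('k, 'p, 'u) msm \<Rightarrow> ('k \<Rightarrow> 'u set) \<Rightarrow> bool" where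
  "fg_sub M U \<longleftrightarrow> (\<exists>E. finite E \<and> E \<subseteq> Sigma K U \<and> (\<forall>k\<in>K. U k \<subseteq> span M E k))"

text \<open>The test runs over submodules of the ambient \<open>M\<close> that lie inside
  \<open>U\<close>. Hence the property passes to smaller families at once, and no module structure
  has to be put on \<open>U\<close>.\<close>

definition noeth_sub :: "('k, 'p, 'u) msm \<Rightarrow> ('k \<Rightarrow> 'u set) \<Rightarrow> bool" where
  "noeth_sub M U \<longleftrightarrow> (\<forall>W. submodule M W \<longrightarrow> (\<forall>k\<in>K. W k \<subseteq> U k) \<longrightarrow> fg_sub M W)"

definition preim :: "('k, 'p, 'u) msm \<Rightarrow> ('k \<Rightarrow> 'u \<Rightarrow> 'v) \<Rightarrow> ('k \<Rightarrow> 'v set) \<Rightarrow> 'k \<Rightarrow> 'u set" where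
  "preim M \<phi> U k = {x \<in> el M k. \<phi> k x \<in> U k}"

definition set_sum :: "('k, 'p, 'u) msm \<Rightarrow> ('k \<Rightarrow> 'u set) \<Rightarrow> ('k \<Rightarrow> 'u set) \<Rightarrow> 'k \<Rightarrow> 'u set" where
  "set_sum M U W k = {u \<otimes>\<^bsub>gr M k\<^esub> w | u w. u \<in> U k \<and> w \<in> W k}"

text \<open>Operations are compared on the carriers only: arrows of \<open>Ab\<close> have
  extensional underlying maps, while the operations of an abstract module are arbitrary off the
  carriers.\<close>

definition eqmod :: "('k, 'p, 'u) msm \<Rightarrow> ('k, 'p, 'u) msm \<Rightarrow> bool" where
  "eqmod M N \<longleftrightarrow> (\<forall>k\<in>K. gr M k = gr N k) \<and> (\<forall>p\<in>Ops. \<forall>x\<in>el N (src p). ac M p x = ac N p x)"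

section \<open>Elementwise calculus of modules, linear maps, submodules and spans\<close>

lemma premod_grp: "premod M \<Longrightarrow> k \<in> K \<Longrightarrow> comm_group (gr M k)"
  by (simp add: premod_def)

lemma premod_group: "premod M \<Longrightarrow> k \<in> K \<Longrightarrow> group (gr M k)"
  by (simp add: premod_def comm_group_def)

lemma premod_hom: "premod M \<Longrightarrow> p \<in> Ops \<Longrightarrow> ac M p \<in> hom (gr M (src p)) (gr M (tgt p))"
  by (simp add: premod_def)

lemma el_one: "premod M \<Longrightarrow> k \<in> K \<Longrightarrow> \<one>\<^bsub>gr M k\<^esub> \<in> el M k"
  using premod_group[of M k] by (simp add: group.is_monoid monoid.one_closed)

lemma el_mult: "premod M \<Longrightarrow> k \<in> K \<Longrightarrow> x \<in> el M k \<Longrightarrow> y \<in> el M k \<Longrightarrow> x \<otimes>\<^bsub>gr M k\<^esub> y \<in> el M k"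
  using premod_group[of M k] by (simp add: group.is_monoid monoid.m_closed)

lemma el_inv: "premod M \<Longrightarrow> k \<in> K \<Longrightarrow> x \<in> el M k \<Longrightarrow> inv\<^bsub>gr M k\<^esub> x \<in> el M k"
  using premod_group[of M k] by (simp add: group.inv_closed)

lemma el_act: "premod M \<Longrightarrow> p \<in> Ops \<Longrightarrow> x \<in> el M (src p) \<Longrightarrow> ac M p x \<in> el M (tgt p)"
  using premod_hom[of M p] by (auto simp: hom_def)

lemma act_one: "premod M \<Longrightarrow> p \<in> Ops \<Longrightarrow> ac M p \<one>\<^bsub>gr M (src p)\<^esub> = \<one>\<^bsub>gr M (tgt p)\<^esub>"
  using premod_hom[of M p] premod_group[of M] src_in tgt_in hom_one by blast

lemma act_mult: "premod M \<Longrightarrow> p \<in> Ops \<Longrightarrow> x \<in> el M (src p) \<Longrightarrow> y \<in> el M (src p) \<Longrightarrow>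
    ac M p (x \<otimes>\<^bsub>gr M (src p)\<^esub> y) = ac M p x \<otimes>\<^bsub>gr M (tgt p)\<^esub> ac M p y"
  using premod_hom[of M p] by (auto simp: hom_def)

lemma hom_inv_eq:
  "group G \<Longrightarrow> group H \<Longrightarrow> h \<in> hom G H \<Longrightarrow> x \<in> carrier G \<Longrightarrow> h (inv\<^bsub>G\<^esub> x) = inv\<^bsub>H\<^esub> (h x)"
  by (simp add: group_hom.hom_inv group_hom.intro group_hom_axioms.intro)

lemma act_inv: "premod M \<Longrightarrow> p \<in> Ops \<Longrightarrow> x \<in> el M (src p) \<Longrightarrow>
    ac M p (inv\<^bsub>gr M (src p)\<^esub> x) = inv\<^bsub>gr M (tgt p)\<^esub> (ac M p x)"
  by (rule hom_inv_eq) (simp_all add: premod_hom premod_group src_in tgt_in)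

lemma linear_hom: "linear M N \<phi> \<Longrightarrow> k \<in> K \<Longrightarrow> \<phi> k \<in> hom (gr M k) (gr N k)"
  by (simp add: linear_def)

lemma linear_el: "linear M N \<phi> \<Longrightarrow> k \<in> K \<Longrightarrow> x \<in> el M k \<Longrightarrow> \<phi> k x \<in> el N k"
  by (auto simp: linear_def hom_def)

lemma linear_mult: "linear M N \<phi> \<Longrightarrow> k \<in> K \<Longrightarrow> x \<in> el M k \<Longrightarrow> y \<in> el M k \<Longrightarrow>
    \<phi> k (x \<otimes>\<^bsub>gr M k\<^esub> y) = \<phi> k x \<otimes>\<^bsub>gr N k\<^esub> \<phi> k y"
  by (auto simp: linear_def hom_def)

lemma linear_act: "linear M N \<phi> \<Longrightarrow> p \<in> Ops \<Longrightarrow> x \<in> el M (src p) \<Longrightarrow>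
    \<phi> (tgt p) (ac M p x) = ac N p (\<phi> (src p) x)"
  by (simp add: linear_def)

lemma linear_one: "linear M N \<phi> \<Longrightarrow> premod M \<Longrightarrow> premod N \<Longrightarrow> k \<in> K \<Longrightarrow>
    \<phi> k \<one>\<^bsub>gr M k\<^esub> = \<one>\<^bsub>gr N k\<^esub>"
  by (rule hom_one) (simp_all add: linear_hom premod_group)

lemma linear_inv: "linear M N \<phi> \<Longrightarrow> premod M \<Longrightarrow> premod N \<Longrightarrow> k \<in> K \<Longrightarrow> x \<in> el M k \<Longrightarrow>
    \<phi> k (inv\<^bsub>gr M k\<^esub> x) = inv\<^bsub>gr N k\<^esub> (\<phi> k x)"
  by (rule hom_inv_eq) (simp_all add: linear_hom premod_group)

lemma linear_comp: "linear M N \<phi> \<Longrightarrow> linear N P \<chi> \<Longrightarrow> linear M P (\<lambda>k x. \<chi> k (\<phi> k x))"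
  by (auto simp: linear_def hom_def Pi_iff src_in)

lemma linear_cong:
  assumes "linear M N \<phi>" "premod M" "\<And>k x. k \<in> K \<Longrightarrow> x \<in> el M k \<Longrightarrow> \<chi> k x = \<phi> k x"
  shows "linear M N \<chi>"
  unfolding linear_def
proof (intro conjI ballI)
  show "\<chi> k \<in> hom (gr M k) (gr N k)" if "k \<in> K" for k
    using linear_hom[OF assms(1) that] assms(3)[OF that] el_mult[OF assms(2) that]
    by (auto simp: hom_def)
  show "\<chi> (tgt p) (ac M p x) = ac N p (\<chi> (src p) x)" if "p \<in> Ops" "x \<in> el M (src p)" for p x
    using that assms linear_act src_in tgt_in el_act by metis
qed

lemma linear_trivial:
  "premod N \<Longrightarrow> linear M N (\<lambda>k x. \<one>\<^bsub>gr N k\<^esub>)"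
  unfolding linear_def hom_def using act_one[of N] el_one[of N] premod_group[of N]
  by (auto simp: group.is_monoid monoid.l_one monoid.one_closed)

lemma linear_injI:
  assumes "linear M N \<phi>" "premod M" "premod N" "k \<in> K"
    and "\<And>x. x \<in> el M k \<Longrightarrow> \<phi> k x = \<one>\<^bsub>gr N k\<^esub> \<Longrightarrow> x = \<one>\<^bsub>gr M k\<^esub>"
  shows "inj_on (\<phi> k) (el M k)"
proof -
  interpret group_hom "gr M k" "gr N k" "\<phi> k"
    using assms by (simp add: group_hom_def group_hom_axioms_def premod_group linear_hom)
  show ?thesis
  proof (rule inj_onI)
    fix x y assume xy: "x \<in> el M k" "y \<in> el M k" and e: "\<phi> k x = \<phi> k y"
    have "x \<otimes>\<^bsub>gr M k\<^esub> inv\<^bsub>gr M k\<^esub> y = \<one>\<^bsub>gr M k\<^esub>" using xy e by (intro assms(5)) simp_all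
    then show "x = y" using xy by (metis G.inv_closed G.inv_equality G.inv_inv)
  qed
qed

lemma submodule_grp: "submodule M U \<Longrightarrow> k \<in> K \<Longrightarrow> subgroup (U k) (gr M k)"
  by (simp add: submodule_def)

lemma sub_el: "submodule M U \<Longrightarrow> k \<in> K \<Longrightarrow> x \<in> U k \<Longrightarrow> x \<in> el M k"
  using submodule_grp subgroup.mem_carrier by metis

lemma sub_one: "submodule M U \<Longrightarrow> k \<in> K \<Longrightarrow> \<one>\<^bsub>gr M k\<^esub> \<in> U k"
  using submodule_grp subgroup.one_closed by metis

lemma sub_mult: "submodule M U \<Longrightarrow> k \<in> K \<Longrightarrow> x \<in> U k \<Longrightarrow> y \<in> U k \<Longrightarrow> x \<otimes>\<^bsub>gr M k\<^esub> y \<in> U k"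
  using submodule_grp subgroup.m_closed by metis

lemma sub_inv: "submodule M U \<Longrightarrow> k \<in> K \<Longrightarrow> x \<in> U k \<Longrightarrow> inv\<^bsub>gr M k\<^esub> x \<in> U k"
  using submodule_grp subgroup.m_inv_closed by metis

lemma sub_act: "submodule M U \<Longrightarrow> p \<in> Ops \<Longrightarrow> x \<in> U (src p) \<Longrightarrow> ac M p x \<in> U (tgt p)"
  by (simp add: submodule_def)

lemma submoduleI:
  assumes "premod M" "\<And>k x. k \<in> K \<Longrightarrow> x \<in> U k \<Longrightarrow> x \<in> el M k"
    "\<And>k. k \<in> K \<Longrightarrow> \<one>\<^bsub>gr M k\<^esub> \<in> U k"
    "\<And>k x y. k \<in> K \<Longrightarrow> x \<in> U k \<Longrightarrow> y \<in> U k \<Longrightarrow> x \<otimes>\<^bsub>gr M k\<^esub> y \<in> U k"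
    "\<And>k x. k \<in> K \<Longrightarrow> x \<in> U k \<Longrightarrow> inv\<^bsub>gr M k\<^esub> x \<in> U k"
    "\<And>p x. p \<in> Ops \<Longrightarrow> x \<in> U (src p) \<Longrightarrow> ac M p x \<in> U (tgt p)"
  shows "submodule M U"
  using assms by (auto simp: submodule_def intro!: subgroup.intro)

lemma submodule_el: "premod M \<Longrightarrow> submodule M (el M)"
  by (rule submoduleI) (auto intro: el_one el_mult el_inv el_act)

lemma submodule_Int: "premod M \<Longrightarrow> submodule M U \<Longrightarrow> submodule M W \<Longrightarrow> submodule M (\<lambda>k. U k \<inter> W k)"
  by (rule submoduleI) (auto intro: sub_el sub_one sub_mult sub_inv sub_act)

lemma spanD: assumes "x \<in> span M E k" "premod M" "E \<subseteq> Sigma K (el M)" shows "k \<in> K \<and> x \<in> el M k"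
proof -
  have "spn M E k x" using assms(1) by (simp add: span_def)
  then show ?thesis
    by induction (use assms in \<open>auto intro: el_one el_mult el_inv el_act tgt_in\<close>)
qed

lemma span_gen: "k \<in> K \<Longrightarrow> (k, x) \<in> E \<Longrightarrow> x \<in> span M E k"
  by (simp add: span_def spn.gen)

lemma submodule_span: "premod M \<Longrightarrow> E \<subseteq> Sigma K (el M) \<Longrightarrow> submodule M (span M E)"
  by (rule submoduleI) (auto dest: spanD, auto simp: span_def intro: spn.intros)

lemma span_least:
  assumes "submodule M U" "E \<subseteq> Sigma K U" "x \<in> span M E k"
  shows "x \<in> U k"
proof -
  have "spn M E k x" using assms(3) by (simp add: span_def)
  then show ?thesis
    by induction (use assms in \<open>auto intro: sub_one sub_mult sub_inv sub_act\<close>)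
qed

lemma span_mono: "E \<subseteq> F \<Longrightarrow> x \<in> span M E k \<Longrightarrow> x \<in> span M F k"
proof -
  assume "E \<subseteq> F" "x \<in> span M E k"
  then have "spn M E k x" by (simp add: span_def)
  then have "spn M F k x" by induction (use \<open>E \<subseteq> F\<close> in \<open>auto intro: spn.intros\<close>)
  then show ?thesis by (simp add: span_def)
qed

lemma spn_linear:
  assumes "spn M E k x" "linear M N \<phi>" "premod M" "premod N" "E \<subseteq> Sigma K (el M)"
  shows "spn N (image_elts \<phi> E) k (\<phi> k x)"
  using assms(1)
proof induction
  case (one k) then show ?case using linear_one[OF assms(2-4)] by (simp add: spn.one)
next
  case (gen k x) then show ?case by (force intro: spn.gen simp: image_elts_def)
next
  case (mult k x y)
  then have "x \<in> el M k" "y \<in> el M k" using spanD[OF _ assms(3,5)] by (auto simp: span_def)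
  then show ?case using mult linear_mult[OF assms(2)] by (auto intro: spn.mult)
next
  case (inv k x)
  then have "x \<in> el M k" using spanD[OF _ assms(3,5)] by (auto simp: span_def)
  then show ?case using inv linear_inv[OF assms(2-4)] by (auto intro: spn.inv)
next
  case (act p x)
  then have "x \<in> el M (src p)" using spanD[OF _ assms(3,5)] by (auto simp: span_def)
  then show ?case using act linear_act[OF assms(2)] by (auto intro: spn.act)
qed

lemma span_linear:
  assumes "linear M N \<phi>" "premod M" "premod N" "E \<subseteq> Sigma K (el M)" "x \<in> span M E k"
  shows "\<phi> k x \<in> span N (image_elts \<phi> E) k"
  using spn_linear[OF _ assms(1-4)] assms(5) by (auto simp: span_def)

lemma image_elts_subset:
  "E \<subseteq> Sigma K U \<Longrightarrow> (\<And>k x. k \<in> K \<Longrightarrow> x \<in> U k \<Longrightarrow> \<phi> k x \<in> W k) \<Longrightarrow> image_elts \<phi> E \<subseteq> Sigma K W"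
  by (auto simp: image_elts_def)

lemma submodule_preim:
  assumes "linear M N \<phi>" "premod M" "premod N" "submodule N U"
  shows "submodule M (preim M \<phi> U)"
  using assms
  by (intro submoduleI)
    (auto simp: preim_def linear_one linear_mult linear_inv linear_act src_in
      intro: el_one el_mult el_inv el_act sub_one sub_mult sub_inv sub_act)

lemma submodule_image:
  assumes "linear M N \<phi>" "premod M" "premod N" "submodule M U"
  shows "submodule N (\<lambda>k. \<phi> k ` U k)"
proof (rule submoduleI)
  have U: "x \<in> el M k" if "k \<in> K" "x \<in> U k" for k x using sub_el[OF assms(4) that] .
  show "x \<in> el N k" if "k \<in> K" "x \<in> \<phi> k ` U k" for k x
    using that U linear_el[OF assms(1)] by blast
  show "\<one>\<^bsub>gr N k\<^esub> \<in> \<phi> k ` U k" if "k \<in> K" for k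
    using that assms by (metis image_eqI linear_one sub_one)
  show "x \<otimes>\<^bsub>gr N k\<^esub> y \<in> \<phi> k ` U k" if "k \<in> K" "x \<in> \<phi> k ` U k" "y \<in> \<phi> k ` U k" for k x y
    using that U assms(1,4) by (auto simp: linear_mult[symmetric] intro: sub_mult)
  show "inv\<^bsub>gr N k\<^esub> x \<in> \<phi> k ` U k" if "k \<in> K" "x \<in> \<phi> k ` U k" for k x
    using that U assms by (auto simp: linear_inv[symmetric] intro: sub_inv)
  show "ac N p x \<in> \<phi> (tgt p) ` U (tgt p)" if "p \<in> Ops" "x \<in> \<phi> (src p) ` U (src p)" for p x
    using that U assms(1,4) by (auto simp: linear_act[symmetric] src_in intro: sub_act)
qed (use assms in auto)

lemma submodule_set_sum:
  assumes "premod M" "submodule M U" "submodule M W"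
  shows "submodule M (set_sum M U W)"
  unfolding submodule_def
proof (intro conjI ballI)
  show "subgroup (set_sum M U W k) (gr M k)" if k: "k \<in> K" for k
  proof -
    interpret comm_group "gr M k" using premod_grp[OF assms(1) k] .
    note U = sub_el[OF assms(2) k] sub_one[OF assms(2) k] sub_mult[OF assms(2) k] sub_inv[OF assms(2) k]
      and W = sub_el[OF assms(3) k] sub_one[OF assms(3) k] sub_mult[OF assms(3) k] sub_inv[OF assms(3) k]
    show ?thesis
    proof (rule subgroup.intro)
      show "\<one>\<^bsub>gr M k\<^esub> \<in> set_sum M U W k"
        unfolding set_sum_def using U(2) W(2) r_one[OF one_closed, symmetric] by blast
      fix x assume "x \<in> set_sum M U W k"
      then obtain u w where x: "u \<in> U k" "w \<in> W k" "x = u \<otimes>\<^bsub>gr M k\<^esub> w" by (auto simp: set_sum_def)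
      have "inv\<^bsub>gr M k\<^esub> x = inv\<^bsub>gr M k\<^esub> u \<otimes>\<^bsub>gr M k\<^esub> inv\<^bsub>gr M k\<^esub> w" using x U(1) W(1) by (simp add: inv_mult)
      then show "inv\<^bsub>gr M k\<^esub> x \<in> set_sum M U W k" using x U(4) W(4) unfolding set_sum_def by blast
      fix y assume "y \<in> set_sum M U W k"
      then obtain v z where y: "v \<in> U k" "z \<in> W k" "y = v \<otimes>\<^bsub>gr M k\<^esub> z" by (auto simp: set_sum_def)
      have "x \<otimes>\<^bsub>gr M k\<^esub> y = (u \<otimes>\<^bsub>gr M k\<^esub> v) \<otimes>\<^bsub>gr M k\<^esub> (w \<otimes>\<^bsub>gr M k\<^esub> z)"
        using x y U(1) W(1) by (simp add: m_ac)
      then show "x \<otimes>\<^bsub>gr M k\<^esub> y \<in> set_sum M U W k" using U(3)[OF x(1) y(1)] W(3)[OF x(2) y(2)] unfolding set_sum_def by blast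
    qed (use U(1) W(1) in \<open>auto simp: set_sum_def\<close>)
  qed
  show "ac M p x \<in> set_sum M U W (tgt p)" if p: "p \<in> Ops" and x: "x \<in> set_sum M U W (src p)" for p x
  proof -
    obtain u w where "u \<in> U (src p)" "w \<in> W (src p)" "x = u \<otimes>\<^bsub>gr M (src p)\<^esub> w"
      using x by (auto simp: set_sum_def)
    moreover from this have "ac M p x = ac M p u \<otimes>\<^bsub>gr M (tgt p)\<^esub> ac M p w"
      using p assms by (simp add: act_mult sub_el src_in)
    ultimately show ?thesis using sub_act[OF assms(2) p] sub_act[OF assms(3) p] by (auto simp: set_sum_def)
  qed
qed

lemma set_sumI: "u \<in> U k \<Longrightarrow> w \<in> W k \<Longrightarrow> u \<otimes>\<^bsub>gr M k\<^esub> w \<in> set_sum M U W k"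
  by (auto simp: set_sum_def)

lemma set_sum_left:
  assumes "premod M" "submodule M U" "submodule M W" "k \<in> K" "u \<in> U k" shows "u \<in> set_sum M U W k"
  using set_sumI[of u U k "\<one>\<^bsub>gr M k\<^esub>" W M] assms sub_one[of M W k] sub_el[of M U k u] premod_group[of M k]
  by (simp add: group.is_monoid monoid.r_one)

lemma set_sum_right:
  assumes "premod M" "submodule M U" "submodule M W" "k \<in> K" "w \<in> W k" shows "w \<in> set_sum M U W k"
  using set_sumI[of "\<one>\<^bsub>gr M k\<^esub>" U k w W M] assms sub_one[of M U k] sub_el[of M W k w] premod_group[of M k]
  by (simp add: group.is_monoid monoid.l_one)

text \<open>The sum of the two spans is a submodule containing all the generators, so minimality of
  the span applies.\<close>

lemma span_Un:
  assumes "premod M" "E \<subseteq> Sigma K (el M)" "F \<subseteq> Sigma K (el M)" "x \<in> span M (E \<union> F) k"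
  shows "x \<in> set_sum M (span M E) (span M F) k"
proof -
  note * = submodule_span[OF assms(1,2)] submodule_span[OF assms(1,3)]
  have "E \<union> F \<subseteq> Sigma K (set_sum M (span M E) (span M F))"
    using set_sum_left[OF assms(1) *] set_sum_right[OF assms(1) *] assms(2,3)
    by (auto simp: span_gen)
  then show ?thesis using span_least submodule_set_sum[OF assms(1) *] assms(4) by metis
qed

section \<open>Noetherian submodules\<close>

lemma noeth_sub_mono: "noeth_sub M U \<Longrightarrow> (\<And>k x. k \<in> K \<Longrightarrow> x \<in> W k \<Longrightarrow> x \<in> U k) \<Longrightarrow> noeth_sub M W"
  unfolding noeth_sub_def by blast

text \<open>Generators of \<open>W\<close> modulo \<open>A\<close> become honest generators after
  adding generators of the intersection of \<open>W\<close> and \<open>A\<close>: in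
  \<open>w = u v\<close> with \<open>u\<close> in the span of \<open>E\<close>, the factor
  \<open>v\<close> lies in both. The intersection is finitely generated because \<open>A\<close> is
  noetherian.\<close>

lemma fg_sub_relative:
  assumes M: "premod M" and A: "submodule M A" "noeth_sub M A" and W: "submodule M W"
    and E: "finite E" "E \<subseteq> Sigma K W"
    and cover: "\<And>k w. k \<in> K \<Longrightarrow> w \<in> W k \<Longrightarrow> w \<in> set_sum M (span M E) A k"
  shows "fg_sub M W"
proof -
  have "fg_sub M (\<lambda>k. W k \<inter> A k)"
    using A(2) submodule_Int[OF M W A(1)] by (auto simp: noeth_sub_def)
  then obtain F where F: "finite F" "F \<subseteq> Sigma K (\<lambda>k. W k \<inter> A k)" "\<forall>k\<in>K. W k \<inter> A k \<subseteq> span M F k"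
    by (auto simp: fg_sub_def)
  have EF: "E \<union> F \<subseteq> Sigma K W" "E \<union> F \<subseteq> Sigma K (el M)"
    using E(2) F(2) sub_el[OF W] by (blast, fastforce)
  have "w \<in> span M (E \<union> F) k" if k: "k \<in> K" and w: "w \<in> W k" for k w
  proof -
    interpret group "gr M k" using premod_group[OF M k] .
    obtain u v where uv: "u \<in> span M E k" "v \<in> A k" "w = u \<otimes>\<^bsub>gr M k\<^esub> v"
      using cover[OF k w] by (auto simp: set_sum_def)
    have u: "u \<in> W k" using span_least[OF W E(2) uv(1)] .
    have "v = inv\<^bsub>gr M k\<^esub> u \<otimes>\<^bsub>gr M k\<^esub> w"
      using uv k sub_el[OF W k u] sub_el[OF A(1) k uv(2)] by (simp add: m_assoc[symmetric])
    then have "v \<in> W k" using k u w W sub_inv sub_mult by metis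
    then have "v \<in> span M F k" using F(3) uv(2) k by blast
    then show ?thesis using uv k span_mono[of E "E \<union> F"] span_mono[of F "E \<union> F"]
      submodule_span[OF M EF(2)] sub_mult by (metis sup_ge1 sup_ge2)
  qed
  then show ?thesis using E F EF by (auto simp: fg_sub_def intro!: exI[of _ "E \<union> F"])
qed

lemma noeth_sub_image:
  assumes M: "premod M" and N: "premod N" and \<phi>: "linear M N \<phi>" and no: "noeth_sub M (el M)"
  shows "noeth_sub N (\<lambda>k. \<phi> k ` el M k)"
  unfolding noeth_sub_def
proof (intro allI impI)
  fix W assume W: "submodule N W" "\<forall>k\<in>K. W k \<subseteq> \<phi> k ` el M k"
  have "fg_sub M (preim M \<phi> W)"
    using no submodule_preim[OF \<phi> M N W(1)] by (auto simp: noeth_sub_def preim_def)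
  then obtain E where E: "finite E" "E \<subseteq> Sigma K (preim M \<phi> W)" "\<forall>k\<in>K. preim M \<phi> W k \<subseteq> span M E k"
    by (auto simp: fg_sub_def)
  have E': "E \<subseteq> Sigma K (el M)" using E(2) by (auto simp: preim_def)
  have "w \<in> span N (image_elts \<phi> E) k" if "k \<in> K" "w \<in> W k" for k w
    using that W(2) E(3) span_linear[OF \<phi> M N E'] by (force simp: preim_def)
  moreover have "image_elts \<phi> E \<subseteq> Sigma K W"
    by (rule image_elts_subset[OF E(2)]) (auto simp: preim_def)
  ultimately show "fg_sub N W"
    unfolding fg_sub_def using finite_image_elts[OF E(1)] by (intro exI[of _ "image_elts \<phi> E"]) auto
qed

text \<open>This is the extension argument for the quotient of the sum by \<open>U\<close>, carried
  out without forming a quotient: \<open>W\<close> is first generated modulo \<open>U\<close>, and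
  \<open>fg_sub_relative\<close> then absorbs \<open>U\<close>.\<close>

lemma noeth_sub_set_sum:
  assumes M: "premod M" and U: "submodule M U" "noeth_sub M U" and V: "submodule M V" "noeth_sub M V"
  shows "noeth_sub M (set_sum M U V)"
  unfolding noeth_sub_def
proof (intro allI impI)
  fix W assume W: "submodule M W" "\<forall>k\<in>K. W k \<subseteq> set_sum M U V k"
  \<comment> \<open>\<open>?P\<close> plays the role of the image of \<open>W\<close> in the
    quotient by \<open>U\<close>, represented by elements of \<open>V\<close>. Each of its
    generators is congruent modulo \<open>U\<close> to an element of \<open>W\<close>, and these
    elements form \<open>E\<close> below.\<close>
  let ?P = "\<lambda>k. V k \<inter> set_sum M W U k"
  have "fg_sub M ?P"
    using V(2) submodule_Int[OF M V(1) submodule_set_sum[OF M W(1) U(1)]] by (auto simp: noeth_sub_def)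
  then obtain F where F: "finite F" "F \<subseteq> Sigma K ?P" "\<forall>k\<in>K. ?P k \<subseteq> span M F k"
    by (auto simp: fg_sub_def)
  have "\<exists>w. w \<in> W k \<and> (\<exists>u\<in>U k. y = w \<otimes>\<^bsub>gr M k\<^esub> u)" if "(k, y) \<in> F" for k y
    using subsetD[OF F(2) that] by (auto simp: set_sum_def)
  then obtain g where g: "\<And>k y. (k, y) \<in> F \<Longrightarrow> g k y \<in> W k \<and> (\<exists>u\<in>U k. y = g k y \<otimes>\<^bsub>gr M k\<^esub> u)"
    by metis
  define E where "E = image_elts g F"
  have E: "finite E" "E \<subseteq> Sigma K W" using F g by (auto simp: E_def image_elts_def)
  have "E \<subseteq> Sigma K (el M)" using E(2) sub_el[OF W(1)] by auto
  then have S: "submodule M (span M E)" using M submodule_span by blast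
  have "y \<in> set_sum M (span M E) U k" if "(k, y) \<in> F" for k y
  proof -
    have "k \<in> K" "(k, g k y) \<in> E" using that F(2) by (auto simp: E_def image_elts_def)
    then show ?thesis using g[OF that] span_gen set_sumI by metis
  qed
  then have F': "F \<subseteq> Sigma K (set_sum M (span M E) U)" using F(2) by auto
  have *: "y \<in> set_sum M (span M E) U k" if "k \<in> K" "y \<in> ?P k" for k y
    using F(3) that span_least[OF submodule_set_sum[OF M S U(1)] F'] by blast
  show "fg_sub M W"
  proof (rule fg_sub_relative[OF M U W(1) E])
    fix k w assume k: "k \<in> K" and w: "w \<in> W k"
    interpret comm_group "gr M k" using premod_grp[OF M k] .
    obtain u v where uv: "u \<in> U k" "v \<in> V k" "w = u \<otimes>\<^bsub>gr M k\<^esub> v"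
      using w W(2) k unfolding set_sum_def by blast
    have c: "u \<in> el M k" "v \<in> el M k" "w \<in> el M k"
      using uv w k sub_el U(1) V(1) W(1) by metis+
    then have "v = w \<otimes>\<^bsub>gr M k\<^esub> inv\<^bsub>gr M k\<^esub> u"
      using uv(3) by (metis inv_solve_right' m_comm)
    then have "v \<in> ?P k" using w uv(2) set_sumI[of w W k _ U M] sub_inv[OF U(1) k uv(1)] by simp
    then have "v \<in> set_sum M (span M E) U k" using * k by blast
    then show "w \<in> set_sum M (span M E) U k"
      using uv(3) sub_mult[OF submodule_set_sum[OF M S U(1)] k]
        set_sum_right[OF M S U(1) k uv(1)] by blast
  qed
qed

text \<open>A finite set of such elements spans a noetherian submodule, by
  \<open>noeth_sub_set_sum\<close>, and anything in that span inherits the property. The resulting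
  submodule is factored out in \<open>locally_noetherian_span\<close> to pass from generators of the
  category to elements.\<close>

lemma noeth_sub_span_closed:
  assumes M: "premod M"
  shows "submodule M (\<lambda>k. {x \<in> el M k. noeth_sub M (span M {(k, x)})})"
proof -
  have *: "noeth_sub M (span M {(k, x)})"
    if "finite F" "F \<subseteq> Sigma K (el M)" "\<forall>(j, y)\<in>F. noeth_sub M (span M {(j, y)})" 
      "k \<in> K" "x \<in> span M F k" for F k x
  proof -
    have "noeth_sub M (span M F)" using that(1-3)
    proof (induction F)
      case empty
      have "submodule M (\<lambda>k. {\<one>\<^bsub>gr M k\<^esub>})"
        using M by (auto intro!: submoduleI simp: el_one premod_group group.is_monoid monoid.l_one
            monoid.one_closed monoid.inv_one act_one)
      then have "span M {} k \<subseteq> {\<one>\<^bsub>gr M k\<^esub>}" for k using span_least[of M _ "{}"] by blast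
      then have "W k \<subseteq> {\<one>\<^bsub>gr M k\<^esub>}" if "submodule M W" "\<forall>k\<in>K. W k \<subseteq> span M {} k" "k \<in> K" for W k
        using that by blast
      then show ?case unfolding noeth_sub_def fg_sub_def
        by (intro allI impI exI[of _ "{}"]) (auto simp: span_def)
    next
      case (insert e F)
      obtain j y where e: "e = (j, y)" by fastforce
      have s: "{e} \<subseteq> Sigma K (el M)" "F \<subseteq> Sigma K (el M)" using insert.prems by auto
      have "noeth_sub M (set_sum M (span M {e}) (span M F))"
        using noeth_sub_set_sum[OF M] submodule_span[OF M] s insert e by auto
      then show ?case by (rule noeth_sub_mono) (use span_Un[OF M s] in auto)
    qed
    moreover have "submodule M (span M F)" using submodule_span[OF M that(2)] .
    then have "span M {(k, x)} j \<subseteq> span M F j" for j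
      using that span_least[of M "span M F" "{(k, x)}"] by blast
    ultimately show ?thesis by (blast intro: noeth_sub_mono)
  qed
  have e: "x \<in> el M k" if "x \<in> span M F k" "F \<subseteq> Sigma K (el M)" for F x k
    using spanD[OF that(1) M that(2)] by blast
  show ?thesis
  proof (rule submoduleI[OF M])
    show "\<one>\<^bsub>gr M k\<^esub> \<in> {x \<in> el M k. noeth_sub M (span M {(k, x)})}" if "k \<in> K" for k
      using *[of "{}"] that el_one[OF M] by (auto simp: span_def intro: spn.one)
    show "x \<otimes>\<^bsub>gr M k\<^esub> y \<in> {x \<in> el M k. noeth_sub M (span M {(k, x)})}"
      if "k \<in> K" "x \<in> {x \<in> el M k. noeth_sub M (span M {(k, x)})}"
        "y \<in> {x \<in> el M k. noeth_sub M (span M {(k, x)})}" for k x y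
      using *[of "{(k, x), (k, y)}" k] that el_mult[OF M]
      by (auto simp: span_def intro!: spn.mult intro: spn.gen)
    show "inv\<^bsub>gr M k\<^esub> x \<in> {x \<in> el M k. noeth_sub M (span M {(k, x)})}"
      if "k \<in> K" "x \<in> {x \<in> el M k. noeth_sub M (span M {(k, x)})}" for k x
      using *[of "{(k, x)}" k] that el_inv[OF M]
      by (auto simp: span_def intro!: spn.inv intro: spn.gen)
    show "ac M p x \<in> {x \<in> el M (tgt p). noeth_sub M (span M {(tgt p, x)})}"
      if "p \<in> Ops" "x \<in> {x \<in> el M (src p). noeth_sub M (span M {(src p, x)})}" for p x
    proof -
      have "ac M p x \<in> span M {(src p, x)} (tgt p)"
        using that src_in by (auto simp: span_def intro!: spn.act intro: spn.gen)
      then show ?thesis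
        using *[of "{(src p, x)}" "tgt p" "ac M p x"] that el_act[OF M] src_in tgt_in by auto
    qed
  qed auto
qed

text \<open>The union of the chain is a submodule inside \<open>X\<close>, hence finitely generated,
  and its finitely many generators already lie in one term. The index \<open>N\<close> is uniform in
  the sort.\<close>

lemma noeth_chain_stable:
  fixes U :: "nat \<Rightarrow> 'k \<Rightarrow> 'u set"
  assumes M: "premod M" and no: "noeth_sub M X" and U: "\<And>i. submodule M (U i)"
    and UX: "\<And>i k. k \<in> K \<Longrightarrow> U i k \<subseteq> X k"
    and asc: "\<And>i j k. i \<le> j \<Longrightarrow> k \<in> K \<Longrightarrow> U i k \<subseteq> U j k"
  shows "\<exists>N. \<forall>i\<ge>N. \<forall>k\<in>K. U i k = U N k"
proof -
  let ?W = "\<lambda>k. \<Union>i. U i k"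
  have "submodule M ?W"
  proof (rule submoduleI[OF M])
    show "x \<in> el M k" if "k \<in> K" "x \<in> ?W k" for k x using that sub_el[OF U] by blast
    show "\<one>\<^bsub>gr M k\<^esub> \<in> ?W k" if "k \<in> K" for k using sub_one[OF U that] by blast
    show "x \<otimes>\<^bsub>gr M k\<^esub> y \<in> ?W k" if k: "k \<in> K" and xy: "x \<in> ?W k" "y \<in> ?W k" for k x y
    proof -
      obtain i j where "x \<in> U i k" "y \<in> U j k" using xy by blast
      then have "x \<in> U (max i j) k" "y \<in> U (max i j) k" using asc[OF _ k] by (meson max.cobounded1 max.cobounded2 subsetD)+
      then show ?thesis using sub_mult[OF U k] by blast
    qed
    show "inv\<^bsub>gr M k\<^esub> x \<in> ?W k" if "k \<in> K" "x \<in> ?W k" for k x using that sub_inv[OF U] by blast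
    show "ac M p x \<in> ?W (tgt p)" if "p \<in> Ops" "x \<in> ?W (src p)" for p x using that sub_act[OF U] by blast
  qed
  then have "fg_sub M ?W" using no UX unfolding noeth_sub_def by (meson UN_least)
  then obtain E where E: "finite E" "E \<subseteq> Sigma K ?W" "\<forall>k\<in>K. ?W k \<subseteq> span M E k"
    by (auto simp: fg_sub_def)
  have "\<exists>N. E \<subseteq> Sigma K (U N)" using E(1,2)
  proof (induction E)
    case (insert e E)
    then obtain N where N: "E \<subseteq> Sigma K (U N)" by auto
    obtain k x i where "e = (k, x)" "k \<in> K" "x \<in> U i k" using insert.prems by auto
    moreover have "U i k \<subseteq> U (max i N) k" "\<forall>k\<in>K. U N k \<subseteq> U (max i N) k" if "k \<in> K" for k
      using asc that by simp_all
    ultimately show ?case using N by (intro exI[of _ "max i N"]) blast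
  qed auto
  then obtain N where "E \<subseteq> Sigma K (U N)" by blast
  then have "?W k \<subseteq> U N k" if "k \<in> K" for k using E(3) that span_least[OF U] by blast
  then show ?thesis using asc by blast
qed

lemma linear_restr: "linear (restr M U) M (\<lambda>k x. x)" if "premod M" "submodule M U"
  using that submodule_grp[of M U] by (auto simp: linear_def restr_def hom_def intro: subgroup.mem_carrier)

lemma premod_restr: assumes "premod M" "submodule M U" shows "premod (restr M U)"
  unfolding premod_def
proof (intro conjI ballI)
  show "comm_group (gr (restr M U) k)" if "k \<in> K" for k
  proof -
    interpret comm_group "gr M k" using premod_grp[OF assms(1) that] .
    have "group ((gr M k)\<lparr>carrier := U k\<rparr>)"
      using subgroup.subgroup_is_group[OF submodule_grp[OF assms(2) that]] is_group .
    then show ?thesis unfolding restr_def fst_conv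
      by (rule group.group_comm_groupI) (use sub_el[OF assms(2) that] m_comm in auto)
  qed
  show "ac (restr M U) p \<in> hom (gr (restr M U) (src p)) (gr (restr M U) (tgt p))" if "p \<in> Ops" for p
    using that act_mult[OF assms(1) that] sub_act[OF assms(2)] sub_el[OF assms(2)] src_in
    by (auto simp: restr_def hom_def)
qed

end

lemma fst_restr_carrier [simp]: "carrier (fst (restr M U) k) = U k"
  and restr_mult [simp]: "mult (fst (restr M U) k) = mult (fst M k)"
  and restr_one [simp]: "one (fst (restr M U) k) = one (fst M k)"
  and restr_act [simp]: "snd (restr M U) = snd M"
  by (simp_all add: restr_def)

section \<open>Categories of many-sorted modules\<close>

text \<open>No group axioms are assumed for \<open>H\<close>: they are all pushed forward along the
  surjection, which is how the quotient structure on representatives is seen to be a group.\<close>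

lemma comm_group_image:
  assumes "comm_group G" "carrier H = \<phi> ` carrier G" "\<one>\<^bsub>H\<^esub> = \<phi> \<one>\<^bsub>G\<^esub>"
    and mult: "\<And>x y. x \<in> carrier G \<Longrightarrow> y \<in> carrier G \<Longrightarrow> \<phi> x \<otimes>\<^bsub>H\<^esub> \<phi> y = \<phi> (x \<otimes>\<^bsub>G\<^esub> y)"
  shows "comm_group H"
proof -
  interpret G: comm_group G by fact
  show ?thesis
  proof (rule comm_groupI)
    fix x assume "x \<in> carrier H"
    then obtain a where "a \<in> carrier G" "x = \<phi> a" using assms(2) by blast
    then show "\<exists>y\<in>carrier H. y \<otimes>\<^bsub>H\<^esub> x = \<one>\<^bsub>H\<^esub>"
      using assms(2,3) mult by (intro bexI[of _ "\<phi> (inv\<^bsub>G\<^esub> a)"]) auto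
  qed (use assms(2,3) mult in \<open>auto simp: G.m_ac\<close>)
qed

lemma Hom_iff: "f \<in> Hom C a b \<longleftrightarrow> f \<in> Arr C \<and> Dom C f = a \<and> Cod C f = b"
  by (simp add: Hom_def)

section \<open>Quotient modules on chosen representatives\<close>

context sorted_ops
begin

text \<open>A coset is a set of elements and would leave the universe. Congruent elements define the
  same predicate under \<open>SOME\<close>, so the chosen representative depends on the coset alone
  and the quotient again has its carriers in \<open>'u\<close>.\<close>

definition crep :: "('k, 'p, 'u) msm \<Rightarrow> ('k \<Rightarrow> 'u set) \<Rightarrow> 'k \<Rightarrow> 'u \<Rightarrow> 'u" where
  "crep M U k x = (SOME y. y \<in> el M k \<and> y \<otimes>\<^bsub>gr M k\<^esub> inv\<^bsub>gr M k\<^esub> x \<in> U k)"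

definition quotm :: "('k, 'p, 'u) msm \<Rightarrow> ('k \<Rightarrow> 'u set) \<Rightarrow> ('k, 'p, 'u) msm" where
  "quotm M U = (\<lambda>k. \<lparr>carrier = crep M U k ` el M k,
      mult = (\<lambda>x y. crep M U k (x \<otimes>\<^bsub>gr M k\<^esub> y)), one = crep M U k \<one>\<^bsub>gr M k\<^esub>\<rparr>,
    \<lambda>p x. crep M U (tgt p) (ac M p x))"

lemma coset_eq:
  assumes "premod M" "submodule M U" "k \<in> K" "x \<in> el M k" "y \<in> el M k" "z \<in> el M k"
    "x \<otimes>\<^bsub>gr M k\<^esub> inv\<^bsub>gr M k\<^esub> y \<in> U k"
  shows "y \<otimes>\<^bsub>gr M k\<^esub> inv\<^bsub>gr M k\<^esub> x \<in> U k"
    and "z \<otimes>\<^bsub>gr M k\<^esub> inv\<^bsub>gr M k\<^esub> x \<in> U k \<longleftrightarrow> z \<otimes>\<^bsub>gr M k\<^esub> inv\<^bsub>gr M k\<^esub> y \<in> U k"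
proof -
  interpret comm_group "gr M k" using premod_grp[OF assms(1,3)] .
  interpret U: subgroup "U k" "gr M k" using submodule_grp[OF assms(2,3)] .
  have "y \<otimes>\<^bsub>gr M k\<^esub> inv\<^bsub>gr M k\<^esub> x = inv\<^bsub>gr M k\<^esub> (x \<otimes>\<^bsub>gr M k\<^esub> inv\<^bsub>gr M k\<^esub> y)"
    using assms by (simp add: inv_mult_group)
  then show 1: "y \<otimes>\<^bsub>gr M k\<^esub> inv\<^bsub>gr M k\<^esub> x \<in> U k" using assms(7) by simp
  have "z \<otimes>\<^bsub>gr M k\<^esub> inv\<^bsub>gr M k\<^esub> y = (z \<otimes>\<^bsub>gr M k\<^esub> inv\<^bsub>gr M k\<^esub> x) \<otimes>\<^bsub>gr M k\<^esub> (x \<otimes>\<^bsub>gr M k\<^esub> inv\<^bsub>gr M k\<^esub> y)"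
    "z \<otimes>\<^bsub>gr M k\<^esub> inv\<^bsub>gr M k\<^esub> x = (z \<otimes>\<^bsub>gr M k\<^esub> inv\<^bsub>gr M k\<^esub> y) \<otimes>\<^bsub>gr M k\<^esub> (y \<otimes>\<^bsub>gr M k\<^esub> inv\<^bsub>gr M k\<^esub> x)"
    using assms by (simp_all add: m_assoc inv_solve_left inv_solve_right flip: m_assoc[of "inv\<^bsub>gr M k\<^esub> x"] m_assoc[of "inv\<^bsub>gr M k\<^esub> y"])
  then show "z \<otimes>\<^bsub>gr M k\<^esub> inv\<^bsub>gr M k\<^esub> x \<in> U k \<longleftrightarrow> z \<otimes>\<^bsub>gr M k\<^esub> inv\<^bsub>gr M k\<^esub> y \<in> U k"
    using 1 assms(7) by (metis U.m_closed)
qed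

lemma crep:
  assumes "premod M" "submodule M U" "k \<in> K" "x \<in> el M k"
  shows "crep M U k x \<in> el M k" "crep M U k x \<otimes>\<^bsub>gr M k\<^esub> inv\<^bsub>gr M k\<^esub> x \<in> U k"
proof -
  interpret comm_group "gr M k" using premod_grp[OF assms(1,3)] .
  have "x \<in> el M k \<and> x \<otimes>\<^bsub>gr M k\<^esub> inv\<^bsub>gr M k\<^esub> x \<in> U k"
    using assms sub_one[OF assms(2,3)] by simp
  then show "crep M U k x \<in> el M k" "crep M U k x \<otimes>\<^bsub>gr M k\<^esub> inv\<^bsub>gr M k\<^esub> x \<in> U k"
    unfolding crep_def by (metis (mono_tags, lifting) someI)+
qed

lemma crep_eq_iff:
  assumes "premod M" "submodule M U" "k \<in> K" "x \<in> el M k" "y \<in> el M k"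
  shows "crep M U k x = crep M U k y \<longleftrightarrow> x \<otimes>\<^bsub>gr M k\<^esub> inv\<^bsub>gr M k\<^esub> y \<in> U k"
proof
  note * = crep[OF assms(1-4)] crep[OF assms(1-3,5)]
  assume "crep M U k x = crep M U k y"
  then have "crep M U k x \<otimes>\<^bsub>gr M k\<^esub> inv\<^bsub>gr M k\<^esub> y \<in> U k" using *(4) by simp
  then show "x \<otimes>\<^bsub>gr M k\<^esub> inv\<^bsub>gr M k\<^esub> y \<in> U k"
    using coset_eq(2)[OF assms(1-3), of x "crep M U k x" y] coset_eq(2)[OF assms(1-3) *(1) assms(4,5) *(2)]
      coset_eq(1)[OF assms(1-3)] assms * by metis
next
  assume "x \<otimes>\<^bsub>gr M k\<^esub> inv\<^bsub>gr M k\<^esub> y \<in> U k"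
  then have "z \<in> el M k \<and> z \<otimes>\<^bsub>gr M k\<^esub> inv\<^bsub>gr M k\<^esub> x \<in> U k \<longleftrightarrow> z \<in> el M k \<and> z \<otimes>\<^bsub>gr M k\<^esub> inv\<^bsub>gr M k\<^esub> y \<in> U k" for z
    using coset_eq(2)[OF assms] by blast
  then show "crep M U k x = crep M U k y" by (simp add: crep_def)
qed

lemma crep_mult:
  assumes "premod M" "submodule M U" "k \<in> K" "x \<in> el M k" "y \<in> el M k"
  shows "crep M U k (crep M U k x \<otimes>\<^bsub>gr M k\<^esub> crep M U k y) = crep M U k (x \<otimes>\<^bsub>gr M k\<^esub> y)"
proof -
  interpret comm_group "gr M k" using premod_grp[OF assms(1,3)] .
  note * = crep[OF assms(1-4)] crep[OF assms(1-3,5)]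
  have "(crep M U k x \<otimes>\<^bsub>gr M k\<^esub> crep M U k y) \<otimes>\<^bsub>gr M k\<^esub> inv\<^bsub>gr M k\<^esub> (x \<otimes>\<^bsub>gr M k\<^esub> y) =
    (crep M U k x \<otimes>\<^bsub>gr M k\<^esub> inv\<^bsub>gr M k\<^esub> x) \<otimes>\<^bsub>gr M k\<^esub> (crep M U k y \<otimes>\<^bsub>gr M k\<^esub> inv\<^bsub>gr M k\<^esub> y)"
    using * assms(4,5) by (simp add: inv_mult_group m_ac)
  then have "\<dots> \<in> U k \<Longrightarrow> ?thesis"
    using crep_eq_iff[OF assms(1-3) m_closed[OF *(1,3)] m_closed[OF assms(4,5)]] by simp
  then show ?thesis using sub_mult[OF assms(2,3)] * by blast
qed

lemma crep_act:
  assumes "premod M" "submodule M U" "p \<in> Ops" "x \<in> el M (src p)"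
  shows "crep M U (tgt p) (ac M p (crep M U (src p) x)) = crep M U (tgt p) (ac M p x)"
proof -
  note * = crep[OF assms(1,2) src_in[OF assms(3)] assms(4)]
  have "ac M p (crep M U (src p) x \<otimes>\<^bsub>gr M (src p)\<^esub> inv\<^bsub>gr M (src p)\<^esub> x) \<in> U (tgt p)"
    using sub_act[OF assms(2,3)] * by blast
  then show ?thesis
    using crep_eq_iff[OF assms(1,2) tgt_in[OF assms(3)] el_act el_act] * assms
    by (simp add: act_mult act_inv el_inv src_in)
qed

lemma quotm_el [simp]: "el (quotm M U) k = crep M U k ` el M k"
  and quotm_one: "\<one>\<^bsub>gr (quotm M U) k\<^esub> = crep M U k \<one>\<^bsub>gr M k\<^esub>"
  and quotm_mult: "x \<otimes>\<^bsub>gr (quotm M U) k\<^esub> y = crep M U k (x \<otimes>\<^bsub>gr M k\<^esub> y)"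
  and quotm_act: "ac (quotm M U) p z = crep M U (tgt p) (ac M p z)"
  by (simp_all add: quotm_def)

lemma linear_crep: "premod M \<Longrightarrow> submodule M U \<Longrightarrow> linear M (quotm M U) (crep M U)"
  by (auto simp: linear_def hom_def quotm_mult quotm_act crep_mult crep_act)

lemma premod_quotm: assumes "premod M" "submodule M U" shows "premod (quotm M U)"
  unfolding premod_def
proof (intro conjI ballI)
  show "comm_group (gr (quotm M U) k)" if "k \<in> K" for k
    using premod_grp[OF assms(1) that]
    by (rule comm_group_image[where \<phi> = "crep M U k"])
      (simp_all add: quotm_one quotm_mult crep_mult assms that)
  show "ac (quotm M U) p \<in> hom (gr (quotm M U) (src p)) (gr (quotm M U) (tgt p))" if p: "p \<in> Ops" for p
  proof (rule homI)
    fix x y assume "x \<in> el (quotm M U) (src p)" "y \<in> el (quotm M U) (src p)"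
    then obtain a b where ab: "a \<in> el M (src p)" "x = crep M U (src p) a" "b \<in> el M (src p)" "y = crep M U (src p) b"
      by auto
    note k = src_in[OF p]
    show "ac (quotm M U) p x \<in> el (quotm M U) (tgt p)"
      using ab el_act[OF assms(1) p] by (simp add: quotm_act crep_act assms p)
    show "ac (quotm M U) p (x \<otimes>\<^bsub>gr (quotm M U) (src p)\<^esub> y) =
      ac (quotm M U) p x \<otimes>\<^bsub>gr (quotm M U) (tgt p)\<^esub> ac (quotm M U) p y"
      using ab el_act[OF assms(1) p] el_mult[OF assms(1) k]
      by (simp add: quotm_act quotm_mult crep_act crep_mult assms p k tgt_in act_mult)
  qed
qed

lemma crep_trivial_iff:
  assumes "premod M" "submodule M U" "k \<in> K" "x \<in> el M k"
  shows "crep M U k x = \<one>\<^bsub>gr (quotm M U) k\<^esub> \<longleftrightarrow> x \<in> U k"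
proof -
  interpret comm_group "gr M k" using premod_grp[OF assms(1,3)] .
  show ?thesis using crep_eq_iff[OF assms(1-4) one_closed] assms by (simp add: quotm_one)
qed

end

text \<open>The interface says that \<open>md\<close> is fully faithful and that, up to
  \<open>eqmod\<close>, its image is closed under submodules and quotients. Closure is demanded on
  the level of carriers rather than up to isomorphism, so that inclusions act as the identity on
  elements.\<close>

locale module_category = sorted_ops K Ops src tgt + category C
  for K :: "'k set" and Ops :: "'p set" and src tgt and C :: "('o, 'm, 'z) cat_scheme" +
  fixes md :: "'o \<Rightarrow> ('k, 'p, 'u) msm" and app :: "'m \<Rightarrow> 'k \<Rightarrow> 'u \<Rightarrow> 'u"
  assumes md: "X \<in> Obj C \<Longrightarrow> premod (md X)"
    and app_linear: "f \<in> Hom C X Y \<Longrightarrow> linear (md X) (md Y) (app f)"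
    and app_Ident: "X \<in> Obj C \<Longrightarrow> k \<in> K \<Longrightarrow> x \<in> el (md X) k \<Longrightarrow> app (Ident C X) k x = x"
    and app_Comp: "f \<in> Hom C X Y \<Longrightarrow> g \<in> Hom C Y Z \<Longrightarrow> k \<in> K \<Longrightarrow> x \<in> el (md X) k \<Longrightarrow>
      app (Comp C g f) k x = app g k (app f k x)"
    and arr_ext: "f \<in> Hom C X Y \<Longrightarrow> g \<in> Hom C X Y \<Longrightarrow>
      (\<And>k x. k \<in> K \<Longrightarrow> x \<in> el (md X) k \<Longrightarrow> app f k x = app g k x) \<Longrightarrow> f = g"
    and arr_ex: "X \<in> Obj C \<Longrightarrow> Y \<in> Obj C \<Longrightarrow> linear (md X) (md Y) \<phi> \<Longrightarrow>
      \<exists>f\<in>Hom C X Y. \<forall>k\<in>K. \<forall>x\<in>el (md X) k. app f k x = \<phi> k x"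
    and Obj_nonempty: "Obj C \<noteq> {}"
    and ob_sub: "premod M \<Longrightarrow> X \<in> Obj C \<Longrightarrow> linear M (md X) \<phi> \<Longrightarrow>
      (\<And>k. k \<in> K \<Longrightarrow> inj_on (\<phi> k) (el M k)) \<Longrightarrow> \<exists>Z\<in>Obj C. eqmod (md Z) M"
    and ob_quot: "premod M \<Longrightarrow> X \<in> Obj C \<Longrightarrow> linear (md X) M \<phi> \<Longrightarrow>
      (\<And>k. k \<in> K \<Longrightarrow> el M k \<subseteq> \<phi> k ` el (md X) k) \<Longrightarrow> \<exists>Z\<in>Obj C. eqmod (md Z) M"
begin

lemma Hom_Obj: "f \<in> Hom C X Y \<Longrightarrow> X \<in> Obj C \<and> Y \<in> Obj C"
  using Dom_in Cod_in by (auto simp: Hom_iff)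

definition mk :: "'o \<Rightarrow> 'o \<Rightarrow> ('k \<Rightarrow> 'u \<Rightarrow> 'u) \<Rightarrow> 'm" where
  "mk X Y \<phi> = (SOME f. f \<in> Hom C X Y \<and> (\<forall>k\<in>K. \<forall>x\<in>el (md X) k. app f k x = \<phi> k x))"

lemma mk:
  assumes "X \<in> Obj C" "Y \<in> Obj C" "linear (md X) (md Y) \<phi>"
  shows "mk X Y \<phi> \<in> Hom C X Y" "k \<in> K \<Longrightarrow> x \<in> el (md X) k \<Longrightarrow> app (mk X Y \<phi>) k x = \<phi> k x"
proof -
  have "mk X Y \<phi> \<in> Hom C X Y \<and> (\<forall>k\<in>K. \<forall>x\<in>el (md X) k. app (mk X Y \<phi>) k x = \<phi> k x)"
    unfolding mk_def by (rule someI_ex) (use arr_ex[OF assms] in blast)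
  then show "mk X Y \<phi> \<in> Hom C X Y" "k \<in> K \<Longrightarrow> x \<in> el (md X) k \<Longrightarrow> app (mk X Y \<phi>) k x = \<phi> k x"
    by auto
qed

lemma app_el: "f \<in> Hom C X Y \<Longrightarrow> k \<in> K \<Longrightarrow> x \<in> el (md X) k \<Longrightarrow> app f k x \<in> el (md Y) k"
  using linear_el[OF app_linear] .

lemma app_one: "f \<in> Hom C X Y \<Longrightarrow> k \<in> K \<Longrightarrow> app f k \<one>\<^bsub>gr (md X) k\<^esub> = \<one>\<^bsub>gr (md Y) k\<^esub>"
  using linear_one[OF app_linear] md Hom_Obj by blast

lemma eqmod_linear:
  assumes "eqmod M N" "premod N" shows "linear M N (\<lambda>k x. x)" "linear N M (\<lambda>k x. x)" "premod M"
proof -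
  have e: "gr M k = gr N k" if "k \<in> K" for k using assms that by (simp add: eqmod_def)
  have a: "ac M p x = ac N p x" if "p \<in> Ops" "x \<in> el N (src p)" for p x
    using assms that by (simp add: eqmod_def)
  show "linear M N (\<lambda>k x. x)" "linear N M (\<lambda>k x. x)"
    using e a src_in by (auto simp: linear_def hom_def)
  show "premod M" using assms(2) e a src_in tgt_in el_mult[OF assms(2)] by (auto simp: premod_def hom_def Pi_iff)
qed

lemma linear_eqmod_left: "eqmod M N \<Longrightarrow> premod N \<Longrightarrow> linear N P \<phi> \<Longrightarrow> linear M P \<phi>"
  using linear_comp[OF eqmod_linear(1)] .

lemma linear_eqmod_right: "eqmod M N \<Longrightarrow> premod N \<Longrightarrow> linear P N \<phi> \<Longrightarrow> linear P M \<phi>"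
  using linear_comp[OF _ eqmod_linear(2)] .

definition sub_ob :: "'o \<Rightarrow> ('k \<Rightarrow> 'u set) \<Rightarrow> 'o" where
  "sub_ob X U = (SOME Z. Z \<in> Obj C \<and> eqmod (md Z) (restr (md X) U))"

definition incl :: "'o \<Rightarrow> ('k \<Rightarrow> 'u set) \<Rightarrow> 'm" where
  "incl X U = mk (sub_ob X U) X (\<lambda>k x. x)"

definition quot_ob :: "'o \<Rightarrow> ('k \<Rightarrow> 'u set) \<Rightarrow> 'o" where
  "quot_ob X U = (SOME Z. Z \<in> Obj C \<and> eqmod (md Z) (quotm (md X) U))"

definition proj :: "'o \<Rightarrow> ('k \<Rightarrow> 'u set) \<Rightarrow> 'm" where
  "proj X U = mk X (quot_ob X U) (crep (md X) U)"

lemma sub_ob: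
  assumes "X \<in> Obj C" "submodule (md X) U"
  shows "sub_ob X U \<in> Obj C" "eqmod (md (sub_ob X U)) (restr (md X) U)"
proof -
  have "\<exists>Z. Z \<in> Obj C \<and> eqmod (md Z) (restr (md X) U)"
    using ob_sub[OF premod_restr[OF md assms(2)] assms(1) linear_restr[OF md assms(2)]] assms(1)
    by (auto simp: inj_on_def)
  from someI_ex[OF this] show "sub_ob X U \<in> Obj C" "eqmod (md (sub_ob X U)) (restr (md X) U)"
    by (simp_all add: sub_ob_def)
qed

lemma sub_ob_el: "X \<in> Obj C \<Longrightarrow> submodule (md X) U \<Longrightarrow> k \<in> K \<Longrightarrow> el (md (sub_ob X U)) k = U k"
  using sub_ob(2) by (simp add: eqmod_def)

lemma sub_ob_one: "X \<in> Obj C \<Longrightarrow> submodule (md X) U \<Longrightarrow> k \<in> K \<Longrightarrow>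
    \<one>\<^bsub>gr (md (sub_ob X U)) k\<^esub> = \<one>\<^bsub>gr (md X) k\<^esub>"
  using sub_ob(2) by (simp add: eqmod_def)

lemma incl:
  assumes "X \<in> Obj C" "submodule (md X) U"
  shows "incl X U \<in> Hom C (sub_ob X U) X" "k \<in> K \<Longrightarrow> x \<in> U k \<Longrightarrow> app (incl X U) k x = x"
proof -
  have l: "linear (md (sub_ob X U)) (md X) (\<lambda>k x. x)"
    using linear_eqmod_left[OF sub_ob(2)[OF assms] premod_restr[OF md assms(2)] linear_restr[OF md assms(2)]] assms(1)
    by simp
  show "incl X U \<in> Hom C (sub_ob X U) X" "k \<in> K \<Longrightarrow> x \<in> U k \<Longrightarrow> app (incl X U) k x = x"
    using mk[OF sub_ob(1)[OF assms] assms(1) l] sub_ob_el[OF assms] by (simp_all add: incl_def)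
qed

lemma linear_into_sub_ob:
  assumes "X \<in> Obj C" "submodule (md X) U" "premod M" "linear M (md X) \<phi>"
    "\<And>k x. k \<in> K \<Longrightarrow> x \<in> el M k \<Longrightarrow> \<phi> k x \<in> U k"
  shows "linear M (md (sub_ob X U)) \<phi>"
  by (rule linear_eqmod_right[OF sub_ob(2)[OF assms(1,2)] premod_restr[OF md assms(2)]])
    (use assms in \<open>auto simp: linear_def hom_def\<close>)

lemma quot_ob:
  assumes "X \<in> Obj C" "submodule (md X) U"
  shows "quot_ob X U \<in> Obj C" "eqmod (md (quot_ob X U)) (quotm (md X) U)"
proof -
  have "\<exists>Z. Z \<in> Obj C \<and> eqmod (md Z) (quotm (md X) U)"
    using ob_quot[OF premod_quotm[OF md assms(2)] assms(1) linear_crep[OF md assms(2)]] assms(1)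
    by auto
  from someI_ex[OF this] show "quot_ob X U \<in> Obj C" "eqmod (md (quot_ob X U)) (quotm (md X) U)"
    by (simp_all add: quot_ob_def)
qed

lemma proj:
  assumes "X \<in> Obj C" "submodule (md X) U"
  shows "proj X U \<in> Hom C X (quot_ob X U)"
    "k \<in> K \<Longrightarrow> app (proj X U) k ` el (md X) k = el (md (quot_ob X U)) k"
    "k \<in> K \<Longrightarrow> x \<in> el (md X) k \<Longrightarrow> app (proj X U) k x = \<one>\<^bsub>gr (md (quot_ob X U)) k\<^esub> \<longleftrightarrow> x \<in> U k"
proof -
  note e = quot_ob[OF assms]
  have l: "linear (md X) (md (quot_ob X U)) (crep (md X) U)"
    using linear_eqmod_right[OF e(2) premod_quotm[OF md assms(2)] linear_crep[OF md assms(2)]] assms(1)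
    by simp
  note m = mk[OF assms(1) e(1) l, folded proj_def]
  show "proj X U \<in> Hom C X (quot_ob X U)" by (rule m)
  show "k \<in> K \<Longrightarrow> app (proj X U) k ` el (md X) k = el (md (quot_ob X U)) k"
    using m e(2) by (auto simp: eqmod_def)
  show "k \<in> K \<Longrightarrow> x \<in> el (md X) k \<Longrightarrow> app (proj X U) k x = \<one>\<^bsub>gr (md (quot_ob X U)) k\<^esub> \<longleftrightarrow> x \<in> U k"
    using m e(2) crep_trivial_iff[OF md assms(2)] assms(1) by (simp add: eqmod_def)
qed

section \<open>Zero objects, monos, epis and exactness read off on elements\<close>

lemma submodule_trivial: "premod M \<Longrightarrow> submodule M (\<lambda>k. {\<one>\<^bsub>gr M k\<^esub>})"
  by (auto intro!: submoduleI simp: el_one premod_group group.is_monoid monoid.l_one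
      monoid.one_closed monoid.inv_one act_one)

definition trivial_arrow :: "'o \<Rightarrow> 'o \<Rightarrow> 'm" where
  "trivial_arrow X Y = mk X Y (\<lambda>k x. \<one>\<^bsub>gr (md Y) k\<^esub>)"

lemma trivial_arrow:
  assumes "X \<in> Obj C" "Y \<in> Obj C"
  shows "trivial_arrow X Y \<in> Hom C X Y"
    "k \<in> K \<Longrightarrow> x \<in> el (md X) k \<Longrightarrow> app (trivial_arrow X Y) k x = \<one>\<^bsub>gr (md Y) k\<^esub>"
  using mk[OF assms linear_trivial[OF md[OF assms(2)]]] by (simp_all add: trivial_arrow_def)

lemma trivial_zero_object:
  assumes "Z \<in> Obj C" "\<And>k. k \<in> K \<Longrightarrow> el (md Z) k = {\<one>\<^bsub>gr (md Z) k\<^esub>}"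
  shows "zero_object C Z"
  unfolding zero_object_def
proof (intro conjI ballI)
  fix a assume a: "a \<in> Obj C"
  show "\<exists>!f. f \<in> Hom C a Z"
  proof (rule ex1I[of _ "trivial_arrow a Z"])
    show "f = trivial_arrow a Z" if "f \<in> Hom C a Z" for f
      using that trivial_arrow[OF a assms(1)] app_el[OF that] assms(2) by (intro arr_ext[OF that]) auto
  qed (rule trivial_arrow[OF a assms(1)])
  show "\<exists>!f. f \<in> Hom C Z a"
  proof (rule ex1I[of _ "trivial_arrow Z a"])
    show "f = trivial_arrow Z a" if "f \<in> Hom C Z a" for f
      using that trivial_arrow[OF assms(1) a] app_one[OF that] assms(2) by (intro arr_ext[OF that]) auto
  qed (rule trivial_arrow[OF assms(1) a])
qed (rule assms(1))

lemma zero_object_ex: "\<exists>Z. zero_object C Z \<and> (\<forall>k\<in>K. el (md Z) k = {\<one>\<^bsub>gr (md Z) k\<^esub>})"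
proof -
  obtain X where X: "X \<in> Obj C" using Obj_nonempty by blast
  let ?Z = "sub_ob X (\<lambda>k. {\<one>\<^bsub>gr (md X) k\<^esub>})"
  have "\<forall>k\<in>K. el (md ?Z) k = {\<one>\<^bsub>gr (md ?Z) k\<^esub>}"
    using sub_ob_el[OF X submodule_trivial] sub_ob_one[OF X submodule_trivial] md[OF X] by simp
  then show ?thesis using trivial_zero_object sub_ob(1)[OF X submodule_trivial] md[OF X] by metis
qed

text \<open>A zero object has only one endomorphism, so its identity coincides with the trivial
  arrow.\<close>

lemma zero_object_trivial:
  assumes "zero_object C Z" "k \<in> K" shows "el (md Z) k = {\<one>\<^bsub>gr (md Z) k\<^esub>}"
proof -
  have Z: "Z \<in> Obj C" using assms(1) by (simp add: zero_object_def)
  have "\<exists>!f. f \<in> Hom C Z Z" using assms(1) Z by (simp add: zero_object_def)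
  then have "Ident C Z = trivial_arrow Z Z" using trivial_arrow(1)[OF Z Z] Ident_in[OF Z] by blast
  then have "x = \<one>\<^bsub>gr (md Z) k\<^esub>" if "x \<in> el (md Z) k" for x
    using app_Ident[OF Z assms(2) that] trivial_arrow(2)[OF Z Z assms(2) that] by simp
  then show ?thesis using el_one[OF md[OF Z] assms(2)] by blast
qed

lemma zero_arrow_iff:
  assumes "f \<in> Hom C X Y"
  shows "zero_arrow C f \<longleftrightarrow> (\<forall>k\<in>K. \<forall>x\<in>el (md X) k. app f k x = \<one>\<^bsub>gr (md Y) k\<^esub>)"
proof
  assume "zero_arrow C f"
  then obtain Z g h where *: "zero_object C Z" "g \<in> Hom C X Z" "h \<in> Hom C Z Y" "f = Comp C h g"
    using assms by (auto simp: zero_arrow_def Hom_iff)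
  then show "\<forall>k\<in>K. \<forall>x\<in>el (md X) k. app f k x = \<one>\<^bsub>gr (md Y) k\<^esub>"
    using app_Comp[OF *(2,3)] app_el[OF *(2)] app_one[OF *(3)] zero_object_trivial[OF *(1)] by fastforce
next
  assume r: "\<forall>k\<in>K. \<forall>x\<in>el (md X) k. app f k x = \<one>\<^bsub>gr (md Y) k\<^esub>"
  obtain Z where Z: "zero_object C Z" "Z \<in> Obj C" using zero_object_ex by (auto simp: zero_object_def)
  note o = Hom_Obj[OF assms]
  have fX: "f \<in> Arr C" "Dom C f = X" "Cod C f = Y" using assms by (auto simp: Hom_iff)
  note t = trivial_arrow(1)[of X Z] trivial_arrow(1)[of Z Y]
  have "f = Comp C (trivial_arrow Z Y) (trivial_arrow X Z)"
    using o Z(2) t r Comp_in[OF t] app_Comp[OF t] trivial_arrow(2)[of X Z] app_one[OF t(2)]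
    by (intro arr_ext[OF assms]) auto
  then show "zero_arrow C f" using assms Z(1) t(1)[OF conjunct1[OF o] Z(2)] t(2)[OF Z(2) conjunct2[OF o]] fX
    unfolding zero_arrow_def fX by blast
qed

text \<open>For the direction from monos to injectivity, the inclusion of the elementwise kernel and
  the trivial arrow have the same composite with \<open>f\<close>, so they coincide and the kernel
  is trivial.\<close>

lemma is_mono_iff:
  assumes f: "f \<in> Hom C X Y"
  shows "is_mono C f \<longleftrightarrow> (\<forall>k\<in>K. inj_on (app f k) (el (md X) k))"
proof
  assume m: "is_mono C f"
  have d: "Dom C f = X" using f by (simp add: Hom_iff)
  have o: "X \<in> Obj C" "Y \<in> Obj C" using Hom_Obj[OF f] by auto
  define U where "U = preim (md X) (app f) (\<lambda>k. {\<one>\<^bsub>gr (md Y) k\<^esub>})"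
  have U: "submodule (md X) U"
    unfolding U_def using submodule_preim[OF app_linear[OF f] md[OF o(1)] md[OF o(2)]]
      submodule_trivial[OF md[OF o(2)]] by simp
  note i = incl[OF o(1) U]
  note t = trivial_arrow[OF sub_ob(1)[OF o(1) U] o(1)]
  have "Comp C f (incl X U) = Comp C f (trivial_arrow (sub_ob X U) X)"
    using app_Comp[OF i(1) f] app_Comp[OF t(1) f] sub_ob_el[OF o(1) U] i(2) t(2) app_one[OF f]
    by (intro arr_ext[OF Comp_in[OF i(1) f] Comp_in[OF t(1) f]]) (auto simp: U_def preim_def)
  then have "incl X U = trivial_arrow (sub_ob X U) X"
    using m i(1) t(1) d unfolding is_mono_def by blast
  then have "x = \<one>\<^bsub>gr (md X) k\<^esub>" if "k \<in> K" "x \<in> U k" for k x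
    using i(2)[OF that] t(2)[of k x] that sub_ob_el[OF o(1) U] by simp
  then show "\<forall>k\<in>K. inj_on (app f k) (el (md X) k)"
    using linear_injI[OF app_linear[OF f] md[OF o(1)] md[OF o(2)]] by (auto simp: U_def preim_def)
next
  assume inj: "\<forall>k\<in>K. inj_on (app f k) (el (md X) k)"
  show "is_mono C f" unfolding is_mono_def
  proof (intro conjI allI ballI impI)
    fix a g h assume gh: "g \<in> Hom C a (Dom C f)" "h \<in> Hom C a (Dom C f)" and e: "Comp C f g = Comp C f h"
    have gh': "g \<in> Hom C a X" "h \<in> Hom C a X" using gh f by (auto simp: Hom_iff)
    have "app f k (app g k x) = app f k (app h k x)" if "k \<in> K" "x \<in> el (md a) k" for k x
      using e app_Comp[OF gh'(1) f that] app_Comp[OF gh'(2) f that] by simp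
    then show "g = h"
      using inj app_el[OF gh'(1)] app_el[OF gh'(2)] by (intro arr_ext[OF gh']) (meson inj_onD)
  qed (use f in \<open>simp add: Hom_iff\<close>)
qed

text \<open>Dually to monos, the projection of \<open>Y\<close> modulo the image of \<open>f\<close>
  and the trivial arrow agree after \<open>f\<close>. Equality of the two forces every element of
  \<open>Y\<close> into the image.\<close>

lemma is_epi_iff:
  assumes f: "f \<in> Hom C X Y"
  shows "is_epi C f \<longleftrightarrow> (\<forall>k\<in>K. app f k ` el (md X) k = el (md Y) k)"
proof
  assume m: "is_epi C f"
  have d: "Cod C f = Y" using f by (simp add: Hom_iff)
  have o: "X \<in> Obj C" "Y \<in> Obj C" using Hom_Obj[OF f] by auto
  define U where "U = (\<lambda>k. app f k ` el (md X) k)"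
  have U: "submodule (md Y) U"
    unfolding U_def using submodule_image[OF app_linear[OF f]] md o submodule_el by blast
  note i = proj[OF o(2) U]
  note t = trivial_arrow[OF o(2) quot_ob(1)[OF o(2) U]]
  have "Comp C (proj Y U) f = Comp C (trivial_arrow Y (quot_ob Y U)) f"
    using app_Comp[OF f i(1)] app_Comp[OF f t(1)] i(3) t(2) app_el[OF f]
    by (intro arr_ext[OF Comp_in[OF f i(1)] Comp_in[OF f t(1)]]) (auto simp: U_def)
  then have "proj Y U = trivial_arrow Y (quot_ob Y U)"
    using m i(1) t(1) d unfolding is_epi_def by blast
  then have "x \<in> U k" if "k \<in> K" "x \<in> el (md Y) k" for k x using i(3)[OF that] t(2)[OF that] by simp
  then show "\<forall>k\<in>K. app f k ` el (md X) k = el (md Y) k" using app_el[OF f] by (auto simp: U_def)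
next
  assume surj: "\<forall>k\<in>K. app f k ` el (md X) k = el (md Y) k"
  show "is_epi C f" unfolding is_epi_def
  proof (intro conjI allI ballI impI)
    fix a g h assume gh: "g \<in> Hom C (Cod C f) a" "h \<in> Hom C (Cod C f) a" and e: "Comp C g f = Comp C h f"
    have gh': "g \<in> Hom C Y a" "h \<in> Hom C Y a" using gh f by (auto simp: Hom_iff)
    have "app g k (app f k x) = app h k (app f k x)" if "k \<in> K" "x \<in> el (md X) k" for k x
      using e app_Comp[OF f gh'(1) that] app_Comp[OF f gh'(2) that] by simp
    moreover have "\<exists>a\<in>el (md X) k. y = app f k a" if "k \<in> K" "y \<in> el (md Y) k" for k y
      using surj that by blast
    ultimately show "g = h" by (intro arr_ext[OF gh']) metis
  qed (use f in \<open>simp add: Hom_iff\<close>)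
qed

text \<open>Preimages under an injective linear family are unique and hence depend linearly on the
  element. Kernels, inverses, pullbacks and the legs of the final colimit are all obtained from this
  factorisation.\<close>

lemma lift_mono:
  assumes f: "f \<in> Hom C X Y" and h: "h \<in> Hom C Z Y" and inj: "\<And>k. k \<in> K \<Longrightarrow> inj_on (app f k) (el (md X) k)"
    and im: "\<And>k x. k \<in> K \<Longrightarrow> x \<in> el (md Z) k \<Longrightarrow> app h k x \<in> app f k ` el (md X) k"
  shows "\<exists>!u. u \<in> Hom C Z X \<and> Comp C f u = h"
proof -
  have o: "X \<in> Obj C" "Y \<in> Obj C" "Z \<in> Obj C" using Hom_Obj[OF f] Hom_Obj[OF h] by auto
  note f' = app_linear[OF f] and h' = app_linear[OF h]
  define \<phi> where "\<phi> k x = inv_into (el (md X) k) (app f k) (app h k x)" for k x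
  have \<phi>: "\<phi> k x \<in> el (md X) k" "app f k (\<phi> k x) = app h k x" if "k \<in> K" "x \<in> el (md Z) k" for k x
    using im[OF that] by (auto simp: \<phi>_def inv_into_into f_inv_into_f)
  have eq: "y = z" if "k \<in> K" "y \<in> el (md X) k" "z \<in> el (md X) k" "app f k y = app f k z" for k y z
    using inj that by (meson inj_onD)
  have "linear (md Z) (md X) \<phi>" unfolding linear_def hom_def
  proof (intro conjI ballI CollectI Pi_I)
    fix k x y assume k: "k \<in> K" and xy: "x \<in> el (md Z) k" "y \<in> el (md Z) k"
    show "\<phi> k (x \<otimes>\<^bsub>gr (md Z) k\<^esub> y) = \<phi> k x \<otimes>\<^bsub>gr (md X) k\<^esub> \<phi> k y"
      by (rule eq[OF k]) (simp_all add: k xy \<phi> el_mult[OF md[OF o(1)]] el_mult[OF md[OF o(3)]]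
          linear_mult[OF f'] linear_mult[OF h'])
  next
    fix p x assume p: "p \<in> Ops" and x: "x \<in> el (md Z) (src p)"
    show "\<phi> (tgt p) (ac (md Z) p x) = ac (md X) p (\<phi> (src p) x)"
      by (rule eq[OF tgt_in[OF p]]) (simp_all add: p x \<phi> src_in tgt_in el_act[OF md[OF o(1)]]
          el_act[OF md[OF o(3)]] linear_act[OF f'] linear_act[OF h'])
  qed (rule \<phi>(1))
  note m = mk[OF o(3,1) this]
  show ?thesis
  proof (rule ex1I[of _ "mk Z X \<phi>"])
    show "mk Z X \<phi> \<in> Hom C Z X \<and> Comp C f (mk Z X \<phi>) = h"
      using m app_Comp[OF m(1) f] \<phi>(2) by (auto intro: arr_ext[OF Comp_in[OF m(1) f] h])
    show "u = mk Z X \<phi>" if "u \<in> Hom C Z X \<and> Comp C f u = h" for u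
    proof (rule arr_ext[OF _ m(1)])
      fix k x assume kx: "k \<in> K" "x \<in> el (md Z) k"
      have u: "u \<in> Hom C Z X" "Comp C f u = h" using that by auto
      have "app f k (app u k x) = app f k (\<phi> k x)" using app_Comp[OF u(1) f kx] u(2) \<phi>(2)[OF kx] by simp
      then have "app u k x = \<phi> k x"
        by (rule inj_onD[OF inj[OF kx(1)] _ app_el[OF u(1) kx] \<phi>(1)[OF kx]])
      then show "app u k x = app (mk Z X \<phi>) k x" using m(2)[OF kx] by simp
    qed (use that in blast)
  qed
qed

lemma lift_epi:
  assumes f: "f \<in> Hom C X Y" and h: "h \<in> Hom C X Z" and surj: "\<And>k. k \<in> K \<Longrightarrow> app f k ` el (md X) k = el (md Y) k"
    and ker: "\<And>k x. k \<in> K \<Longrightarrow> x \<in> el (md X) k \<Longrightarrow> app f k x = \<one>\<^bsub>gr (md Y) k\<^esub> \<Longrightarrow> app h k x = \<one>\<^bsub>gr (md Z) k\<^esub>"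
  shows "\<exists>!u. u \<in> Hom C Y Z \<and> Comp C u f = h"
proof -
  have o: "X \<in> Obj C" "Y \<in> Obj C" "Z \<in> Obj C" using Hom_Obj[OF f] Hom_Obj[OF h] by auto
  note f' = app_linear[OF f] and h' = app_linear[OF h]
  define \<phi> where "\<phi> k y = app h k (inv_into (el (md X) k) (app f k) y)" for k y
  \<comment> \<open>Two elements with the same image under \<open>f\<close> differ by an element of
    its kernel, which \<open>h\<close> kills. So \<open>\<phi>\<close> does not depend on the
    preimage chosen by \<open>inv_into\<close>.\<close>
  have eq: "app h k x = app h k y"
    if k: "k \<in> K" and x: "x \<in> el (md X) k" and y: "y \<in> el (md X) k" and e: "app f k x = app f k y" for k x y
  proof -
    interpret X: comm_group "gr (md X) k" using premod_grp[OF md[OF o(1)] k] .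
    interpret Y: comm_group "gr (md Y) k" using premod_grp[OF md[OF o(2)] k] .
    interpret Z: comm_group "gr (md Z) k" using premod_grp[OF md[OF o(3)] k] .
    note c = app_el[OF f k y] app_el[OF h k y] app_el[OF h k x]
    have "app f k (x \<otimes>\<^bsub>gr (md X) k\<^esub> inv\<^bsub>gr (md X) k\<^esub> y) = \<one>\<^bsub>gr (md Y) k\<^esub>"
      using k x y e c md o by (simp add: linear_mult[OF f'] linear_inv[OF f'])
    then have "app h k (x \<otimes>\<^bsub>gr (md X) k\<^esub> inv\<^bsub>gr (md X) k\<^esub> y) = \<one>\<^bsub>gr (md Z) k\<^esub>"
      using ker k x y by simp
    then have "app h k x \<otimes>\<^bsub>gr (md Z) k\<^esub> inv\<^bsub>gr (md Z) k\<^esub> app h k y = \<one>\<^bsub>gr (md Z) k\<^esub>"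
      using k x y md o by (simp add: linear_mult[OF h'] linear_inv[OF h'])
    then show ?thesis using c Z.inv_solve_right' by (metis Z.l_one Z.one_closed)
  qed
  have \<phi>: "\<phi> k (app f k x) = app h k x" if "k \<in> K" "x \<in> el (md X) k" for k x
    unfolding \<phi>_def using that
    by (intro eq) (auto intro: inv_into_into f_inv_into_f)
  have ob: "\<exists>a. a \<in> el (md X) k \<and> x = app f k a" if "k \<in> K" "x \<in> el (md Y) k" for k x
    using surj that by blast
  have "linear (md Y) (md Z) \<phi>" unfolding linear_def hom_def
  proof (intro conjI ballI CollectI Pi_I)
    fix k x assume k: "k \<in> K" and x: "x \<in> el (md Y) k"
    obtain a where a: "a \<in> el (md X) k" "x = app f k a" using ob[OF k x] by blast
    then show "\<phi> k x \<in> el (md Z) k" using k \<phi> app_el[OF h] by simp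
    fix y assume y: "y \<in> el (md Y) k"
    obtain b where b: "b \<in> el (md X) k" "y = app f k b" using ob[OF k y] by blast
    have "\<phi> k (app f k (a \<otimes>\<^bsub>gr (md X) k\<^esub> b)) = app h k a \<otimes>\<^bsub>gr (md Z) k\<^esub> app h k b"
      using \<phi>[OF k] a b el_mult[OF md[OF o(1)] k] linear_mult[OF h' k] by simp
    then show "\<phi> k (x \<otimes>\<^bsub>gr (md Y) k\<^esub> y) = \<phi> k x \<otimes>\<^bsub>gr (md Z) k\<^esub> \<phi> k y"
      using \<phi>[OF k] a b linear_mult[OF f' k] by simp
  next
    fix p x assume p: "p \<in> Ops" and x: "x \<in> el (md Y) (src p)"
    obtain a where a: "a \<in> el (md X) (src p)" "x = app f (src p) a" using ob[OF src_in[OF p] x] by blast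
    have "\<phi> (tgt p) (app f (tgt p) (ac (md X) p a)) = ac (md Z) p (app h (src p) a)"
      using \<phi>[OF tgt_in[OF p]] a el_act[OF md[OF o(1)] p] linear_act[OF h' p] by simp
    then show "\<phi> (tgt p) (ac (md Y) p x) = ac (md Z) p (\<phi> (src p) x)"
      using \<phi>[OF src_in[OF p]] a linear_act[OF f' p] by simp
  qed
  note m = mk[OF o(2,3) this]
  show ?thesis
  proof (rule ex1I[of _ "mk Y Z \<phi>"])
    show "mk Y Z \<phi> \<in> Hom C Y Z \<and> Comp C (mk Y Z \<phi>) f = h"
      using m app_Comp[OF f m(1)] app_el[OF f] \<phi> by (auto intro: arr_ext[OF Comp_in[OF f m(1)] h])
    show "u = mk Y Z \<phi>" if "u \<in> Hom C Y Z \<and> Comp C u f = h" for u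
    proof (rule arr_ext[OF _ m(1)])
      fix k x assume kx: "k \<in> K" "x \<in> el (md Y) k"
      then obtain a where "a \<in> el (md X) k" "x = app f k a" using ob by blast
      then show "app u k x = app (mk Y Z \<phi>) k x" using that m kx app_Comp[OF f] \<phi> by auto
    qed (use that in blast)
  qed
qed

lemma is_kernelD:
  assumes "is_kernel C f g" and f: "f \<in> Hom C X Y" and g: "g \<in> Hom C Y Z"
  shows "k \<in> K \<Longrightarrow> inj_on (app f k) (el (md X) k)"
    and "k \<in> K \<Longrightarrow> y \<in> el (md Y) k \<Longrightarrow> app g k y = \<one>\<^bsub>gr (md Z) k\<^esub> \<longleftrightarrow> y \<in> app f k ` el (md X) k"
proof -
  have o: "X \<in> Obj C" "Y \<in> Obj C" "Z \<in> Obj C" using Hom_Obj[OF f] Hom_Obj[OF g] by auto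
  have z: "zero_arrow C (Comp C g f)" and
    u: "\<And>a h. h \<in> Hom C a Y \<Longrightarrow> zero_arrow C (Comp C g h) \<Longrightarrow> \<exists>!u. u \<in> Hom C a X \<and> Comp C f u = h"
    using assms by (auto simp: is_kernel_def Hom_iff)
  have zz: "app g k (app f k x) = \<one>\<^bsub>gr (md Z) k\<^esub>" if "k \<in> K" "x \<in> el (md X) k" for k x
    using z zero_arrow_iff[OF Comp_in[OF f g]] app_Comp[OF f g] that by auto
  \<comment> \<open>Only the uniqueness half of the universal property is used here: both
    \<open>s\<close> and \<open>t\<close> factor the same arrow through \<open>f\<close>.\<close>
  have "is_mono C f" unfolding is_mono_def
  proof (intro conjI allI ballI impI)
    fix a s t assume st: "s \<in> Hom C a (Dom C f)" "t \<in> Hom C a (Dom C f)" and e: "Comp C f s = Comp C f t"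
    have s: "s \<in> Hom C a X" and t: "t \<in> Hom C a X" using st f by (auto simp: Hom_iff)
    note h = Comp_in[OF s f]
    have "zero_arrow C (Comp C g (Comp C f s))"
      using zz app_el[OF s] by (simp add: zero_arrow_iff[OF Comp_in[OF h g]] app_Comp[OF h g] app_Comp[OF s f])
    then show "s = t" using u[OF h] s t e by metis
  qed (use f in \<open>simp add: Hom_iff\<close>)
  then show "k \<in> K \<Longrightarrow> inj_on (app f k) (el (md X) k)" using is_mono_iff[OF f] by blast
  show "app g k y = \<one>\<^bsub>gr (md Z) k\<^esub> \<longleftrightarrow> y \<in> app f k ` el (md X) k" if k: "k \<in> K" and y: "y \<in> el (md Y) k"
  proof
    assume gy: "app g k y = \<one>\<^bsub>gr (md Z) k\<^esub>"
    \<comment> \<open>The existence half is applied to the inclusion of the elementwise kernel of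
      \<open>g\<close>; its factorisation through \<open>f\<close> exhibits each kernel element as a
      value of \<open>f\<close>.\<close>
    let ?U = "preim (md Y) (app g) (\<lambda>k. {\<one>\<^bsub>gr (md Z) k\<^esub>})"
    have U: "submodule (md Y) ?U"
      using submodule_preim[OF app_linear[OF g] md[OF o(2)] md[OF o(3)]]
        submodule_trivial[OF md[OF o(3)]] by simp
    note i = incl[OF o(2) U]
    have "zero_arrow C (Comp C g (incl Y ?U))"
      using app_Comp[OF i(1) g] i(2) sub_ob_el[OF o(2) U]
      by (auto simp: zero_arrow_iff[OF Comp_in[OF i(1) g]] preim_def)
    then obtain v where v: "v \<in> Hom C (sub_ob Y ?U) X" "Comp C f v = incl Y ?U" using u[OF i(1)] by blast
    have yU: "y \<in> ?U k" using y gy by (simp add: preim_def)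
    then have "app f k (app v k y) = y"
      using app_Comp[OF v(1) f k] v(2) i(2)[OF k] sub_ob_el[OF o(2) U k] by simp
    then show "y \<in> app f k ` el (md X) k"
      using app_el[OF v(1) k] yU sub_ob_el[OF o(2) U k] by (metis imageI)
  next
    assume "y \<in> app f k ` el (md X) k"
    then show "app g k y = \<one>\<^bsub>gr (md Z) k\<^esub>" using zz k by auto
  qed
qed

lemma short_exactD:
  assumes "short_exact C f g"
  obtains X Y Z where "f \<in> Hom C X Y" "g \<in> Hom C Y Z"
    "\<And>k. k \<in> K \<Longrightarrow> inj_on (app f k) (el (md X) k)"
    "\<And>k. k \<in> K \<Longrightarrow> app g k ` el (md Y) k = el (md Z) k"
    "\<And>k y. k \<in> K \<Longrightarrow> y \<in> el (md Y) k \<Longrightarrow> app g k y = \<one>\<^bsub>gr (md Z) k\<^esub> \<longleftrightarrow> y \<in> app f k ` el (md X) k"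
proof -
  have f: "f \<in> Hom C (Dom C f) (Cod C f)" and g: "g \<in> Hom C (Cod C f) (Cod C g)"
    using assms by (auto simp: short_exact_def is_kernel_def Hom_iff)
  have ker: "is_kernel C f g" and cok: "is_cokernel C g f" using assms by (auto simp: short_exact_def)
  \<comment> \<open>Surjectivity comes from uniqueness in the cokernel property: two arrows that
    agree after \<open>g\<close> both factor one arrow that kills \<open>f\<close>.\<close>
  have "is_epi C g" unfolding is_epi_def
  proof (intro conjI allI ballI impI)
    fix a s t assume st: "s \<in> Hom C (Cod C g) a" "t \<in> Hom C (Cod C g) a" and e: "Comp C s g = Comp C t g"
    note h = Comp_in[OF g st(1)]
    have gf: "app g k (app f k x) = \<one>\<^bsub>gr (md (Cod C g)) k\<^esub>" if "k \<in> K" "x \<in> el (md (Dom C f)) k" for k x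
      using is_kernelD(2)[OF ker f g that(1)] app_el[OF f] that by blast
    have "zero_arrow C (Comp C (Comp C s g) f)"
      using gf app_one[OF st(1)] app_el[OF f]
      by (auto simp: zero_arrow_iff[OF Comp_in[OF f h]] app_Comp[OF f h] app_Comp[OF g st(1)])
    then have "\<exists>!u. u \<in> Hom C (Cod C g) a \<and> Comp C u g = Comp C s g"
      using cok h by (auto simp: is_cokernel_def)
    then show "s = t" using st e by metis
  qed (use g in \<open>simp add: Hom_iff\<close>)
  then show ?thesis
    using that[OF f g] is_kernelD[OF ker f g] is_epi_iff[OF g] by blast
qed

lemma short_exactI:
  assumes f: "f \<in> Hom C X Y" and g: "g \<in> Hom C Y Z"
    and inj: "\<And>k. k \<in> K \<Longrightarrow> inj_on (app f k) (el (md X) k)"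
    and surj: "\<And>k. k \<in> K \<Longrightarrow> app g k ` el (md Y) k = el (md Z) k"
    and ex: "\<And>k y. k \<in> K \<Longrightarrow> y \<in> el (md Y) k \<Longrightarrow> app g k y = \<one>\<^bsub>gr (md Z) k\<^esub> \<longleftrightarrow> y \<in> app f k ` el (md X) k"
  shows "short_exact C f g"
proof -
  have fg: "f \<in> Arr C" "g \<in> Arr C" "Dom C f = X" "Cod C f = Y" "Dom C g = Y" "Cod C g = Z"
    using f g by (auto simp: Hom_iff)
  have z: "zero_arrow C (Comp C g f)"
    using ex app_el[OF f] by (auto simp: zero_arrow_iff[OF Comp_in[OF f g]] app_Comp[OF f g])
  have "\<exists>!u. u \<in> Hom C a X \<and> Comp C f u = h" if h: "h \<in> Hom C a Y" "zero_arrow C (Comp C g h)" for a h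
    using h(2) ex app_el[OF h(1)]
    by (intro lift_mono[OF f h(1) inj]) (auto simp: zero_arrow_iff[OF Comp_in[OF h(1) g]] app_Comp[OF h(1) g])
  moreover have "\<exists>!u. u \<in> Hom C Z a \<and> Comp C u g = h" if h: "h \<in> Hom C Y a" "zero_arrow C (Comp C h f)" for a h
    using h(2) ex
    by (intro lift_epi[OF g h(1) surj]) (auto simp: zero_arrow_iff[OF Comp_in[OF f h(1)]] app_Comp[OF f h(1)])
  ultimately show ?thesis
    using fg z by (simp add: short_exact_def is_kernel_def is_cokernel_def)
qed

lemma short_exact_sub:
  assumes "X \<in> Obj C" "submodule (md X) U"
  shows "short_exact C (incl X U) (proj X U)"
proof (rule short_exactI[OF incl(1)[OF assms] proj(1)[OF assms]])
  show "inj_on (app (incl X U) k) (el (md (sub_ob X U)) k)" if "k \<in> K" for k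
    using that by (auto simp: inj_on_def incl(2)[OF assms] sub_ob_el[OF assms])
  show "app (proj X U) k ` el (md X) k = el (md (quot_ob X U)) k" if "k \<in> K" for k
    using proj(2)[OF assms that] .
  show "app (proj X U) k y = \<one>\<^bsub>gr (md (quot_ob X U)) k\<^esub> \<longleftrightarrow>
      y \<in> app (incl X U) k ` el (md (sub_ob X U)) k" if "k \<in> K" "y \<in> el (md X) k" for k y
    using proj(3)[OF assms that] incl(2)[OF assms that(1)] sub_ob_el[OF assms that(1)] by force
qed

lemma isomorphicI:
  assumes "f \<in> Hom C X Y" "\<And>k. k \<in> K \<Longrightarrow> bij_betw (app f k) (el (md X) k) (el (md Y) k)"
  shows "isomorphic C X Y"
proof -
  have o: "X \<in> Obj C" "Y \<in> Obj C" using Hom_Obj[OF assms(1)] by auto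
  have b: "inj_on (app f k) (el (md X) k)" "app f k ` el (md X) k = el (md Y) k" if "k \<in> K" for k
    using assms(2)[OF that] by (auto simp: bij_betw_def)
  have "\<exists>!u. u \<in> Hom C Y X \<and> Comp C f u = Ident C Y"
    using b by (intro lift_mono[OF assms(1) Ident_in[OF o(2)]]) (auto simp: app_Ident[OF o(2)])
  then obtain g where g: "g \<in> Hom C Y X" "Comp C f g = Ident C Y" by blast
  have "Comp C g f = Ident C X"
  proof (rule arr_ext[OF Comp_in[OF assms(1) g(1)] Ident_in[OF o(1)]])
    fix k x assume kx: "k \<in> K" "x \<in> el (md X) k"
    have y: "app f k x \<in> el (md Y) k" using app_el[OF assms(1) kx] .
    have "app f k (app g k (app f k x)) = app f k x"
      using app_Comp[OF g(1) assms(1) kx(1) y] g(2) app_Ident[OF o(2) kx(1) y] by simp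
    then have "app g k (app f k x) = x"
      using b(1)[OF kx(1)] app_el[OF g(1) kx(1) y] kx(2) by (meson inj_onD)
    then show "app (Comp C g f) k x = app (Ident C X) k x"
      using app_Comp[OF assms(1) g(1) kx] app_Ident[OF o(1) kx] by simp
  qed
  then show ?thesis using assms(1) g by (auto simp: isomorphic_def)
qed

lemma isomorphicD:
  assumes "isomorphic C X Y"
  obtains f where "f \<in> Hom C X Y" "\<And>k. k \<in> K \<Longrightarrow> bij_betw (app f k) (el (md X) k) (el (md Y) k)"
proof -
  obtain f g where f: "f \<in> Hom C X Y" and g: "g \<in> Hom C Y X"
    and e: "Comp C g f = Ident C X" "Comp C f g = Ident C Y" using assms by (auto simp: isomorphic_def)
  have o: "X \<in> Obj C" "Y \<in> Obj C" using Hom_Obj[OF f] by auto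
  have "bij_betw (app f k) (el (md X) k) (el (md Y) k)" if k: "k \<in> K" for k
  proof (rule bij_betw_byWitness[where f' = "app g k"])
    show "\<forall>x\<in>el (md X) k. app g k (app f k x) = x"
      using app_Comp[OF f g k] e(1) app_Ident[OF o(1) k] by simp
    show "\<forall>x\<in>el (md Y) k. app f k (app g k x) = x"
      using app_Comp[OF g f k] e(2) app_Ident[OF o(2) k] by simp
  qed (use app_el[OF f k] app_el[OF g k] in auto)
  then show ?thesis using that f by blast
qed

end

section \<open>Hereditary torsion theories\<close>

locale module_torsion = module_category K Ops src tgt C md app
  for K :: "'k set" and Ops :: "'p set" and src tgt and C :: "('o, 'm, 'z) cat_scheme"
    and md :: "'o \<Rightarrow> ('k, 'p, 'u) msm" and app +
  fixes T F
  assumes htt: "hereditary_torsion_theory C T F"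
begin

text \<open>This is the trace of the class \<open>T\<close> in \<open>X\<close>. It involves no
  chosen torsion sequence and no torsion-free class, which is what allows different sequences for
  the same \<open>T\<close> to be compared.\<close>

definition tor :: "'o \<Rightarrow> 'k \<Rightarrow> 'u set" where
  "tor X k = {x \<in> el (md X) k. \<exists>Z\<in>T. \<exists>f\<in>Hom C Z X. x \<in> app f k ` el (md Z) k}"

lemma torsion: "torsion_theory C T F" and T_sub: "is_mono C f \<Longrightarrow> Cod C f \<in> T \<Longrightarrow> Dom C f \<in> T"
  and T_F_zero: "X \<in> T \<Longrightarrow> Y \<in> F \<Longrightarrow> f \<in> Hom C X Y \<Longrightarrow> zero_arrow C f"
  and T_iso: "X \<in> T \<Longrightarrow> isomorphic C X Y \<Longrightarrow> Y \<in> T"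
  using htt
  by (auto simp: hereditary_torsion_theory_def torsion_theory_def closed_under_subobjects_def replete_def)

lemma torsion_seq:
  assumes "X \<in> Obj C" obtains t g where "short_exact C t g" "Cod C t = X" "Dom C t \<in> T" "Cod C g \<in> F"
  using torsion assms unfolding torsion_theory_def by meson

text \<open>An arrow from a torsion object becomes zero after \<open>g\<close>, because its target
  then lies in \<open>F'\<close>; so its values lie in the kernel of \<open>g\<close>. The class
  \<open>F'\<close> is arbitrary because \<open>torsion_subobject\<close> quantifies over it
  existentially.\<close>

lemma tor_eq_image:
  assumes "short_exact C t g" "Cod C t = X" "Dom C t \<in> T" "Cod C g \<in> F'" "torsion_theory C T F'" "k \<in> K"
  shows "tor X k = app t k ` el (md (Dom C t)) k"
proof -
  obtain A B Z where t: "t \<in> Hom C A B" and g: "g \<in> Hom C B Z"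
    and ex: "\<And>k y. k \<in> K \<Longrightarrow> y \<in> el (md B) k \<Longrightarrow> app g k y = \<one>\<^bsub>gr (md Z) k\<^esub> \<longleftrightarrow> y \<in> app t k ` el (md A) k"
    using short_exactD[OF assms(1)] by metis
  have e: "A = Dom C t" "B = X" "Z = Cod C g" using t g assms(2) by (auto simp: Hom_iff)
  show ?thesis
  proof
    show "app t k ` el (md (Dom C t)) k \<subseteq> tor X k"
      using assms(3,6) t app_el[OF t] by (auto simp: tor_def e)
    show "tor X k \<subseteq> app t k ` el (md (Dom C t)) k"
    proof
      fix x assume "x \<in> tor X k"
      then obtain W f w where W: "W \<in> T" "f \<in> Hom C W X" "w \<in> el (md W) k" "x = app f k w" "x \<in> el (md X) k"
        by (auto simp: tor_def)
      have c: "Comp C g f \<in> Hom C W Z" using Comp_in W(2) g e by metis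
      have "zero_arrow C (Comp C g f)"
        using assms(4,5) W(1) c e unfolding torsion_theory_def by blast
      then have "app g k x = \<one>\<^bsub>gr (md Z) k\<^esub>"
        using app_Comp[OF _ g] W assms(6) e zero_arrow_iff[OF c] by auto
      then show "x \<in> app t k ` el (md (Dom C t)) k" using ex[OF assms(6)] W(5) e by simp
    qed
  qed
qed

lemma tor_cokernel:
  assumes "X \<in> Obj C"
  obtains g Z where "g \<in> Hom C X Z" "Z \<in> F"
    "\<And>k x. k \<in> K \<Longrightarrow> x \<in> el (md X) k \<Longrightarrow> app g k x = \<one>\<^bsub>gr (md Z) k\<^esub> \<longleftrightarrow> x \<in> tor X k"
proof -
  obtain t g where s: "short_exact C t g" "Cod C t = X" "Dom C t \<in> T" "Cod C g \<in> F"
    using torsion_seq[OF assms] by metis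
  obtain A B Z where t: "t \<in> Hom C A B" and g: "g \<in> Hom C B Z"
    and ex: "\<And>k y. k \<in> K \<Longrightarrow> y \<in> el (md B) k \<Longrightarrow> app g k y = \<one>\<^bsub>gr (md Z) k\<^esub> \<longleftrightarrow> y \<in> app t k ` el (md A) k"
    using short_exactD[OF s(1)] by metis
  have e: "A = Dom C t" "B = X" "Z = Cod C g" using t g s(2) by (auto simp: Hom_iff)
  show ?thesis using that[of g Z] g s(4) ex tor_eq_image[OF s torsion] e by simp
qed

lemma submodule_tor: assumes "X \<in> Obj C" shows "submodule (md X) (tor X)"
proof -
  obtain t g where s: "short_exact C t g" "Cod C t = X" "Dom C t \<in> T" "Cod C g \<in> F"
    using torsion_seq[OF assms] by metis
  have t: "t \<in> Hom C (Dom C t) X" using s by (auto simp: short_exact_def is_kernel_def Hom_iff)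
  have "submodule (md X) (\<lambda>k. app t k ` el (md (Dom C t)) k)"
    using submodule_image[OF app_linear[OF t]] md Hom_Obj[OF t] submodule_el by blast
  then show ?thesis
    using tor_eq_image[OF s torsion] src_in tgt_in by (auto simp: submodule_def)
qed

lemma tor_app:
  assumes "f \<in> Hom C X Y" "k \<in> K" "x \<in> tor X k" shows "app f k x \<in> tor Y k"
proof -
  obtain Z g z where z: "Z \<in> T" "g \<in> Hom C Z X" "z \<in> el (md Z) k" "x = app g k z" "x \<in> el (md X) k"
    using assms(3) by (auto simp: tor_def)
  have "app (Comp C f g) k z = app f k x" using app_Comp[OF z(2) assms(1,2) z(3)] z(4) by simp
  then show ?thesis
    unfolding tor_def
    using z(1,3) Comp_in[OF z(2) assms(1)] app_el[OF assms(1,2) z(5)] by (metis (mono_tags, lifting) CollectI imageI)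
qed

text \<open>If the trace is everything, the torsion part of a torsion sequence of \<open>X\<close>
  is bijective onto \<open>X\<close>, and repleteness transfers membership.\<close>

lemma T_iff: assumes "X \<in> Obj C" shows "X \<in> T \<longleftrightarrow> (\<forall>k\<in>K. el (md X) k \<subseteq> tor X k)"
proof
  assume "X \<in> T"
  then show "\<forall>k\<in>K. el (md X) k \<subseteq> tor X k"
    using Ident_in[OF assms] app_Ident[OF assms] by (force simp: tor_def)
next
  assume r: "\<forall>k\<in>K. el (md X) k \<subseteq> tor X k"
  obtain t g where s: "short_exact C t g" "Cod C t = X" "Dom C t \<in> T" "Cod C g \<in> F"
    using torsion_seq[OF assms] by metis
  obtain A B Z where t: "t \<in> Hom C A B" and g: "g \<in> Hom C B Z"
    and inj: "\<And>k. k \<in> K \<Longrightarrow> inj_on (app t k) (el (md A) k)"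
    using short_exactD[OF s(1)] by metis
  have e: "A = Dom C t" "B = X" using t s(2) by (auto simp: Hom_iff)
  have "isomorphic C A X"
  proof (rule isomorphicI)
    show "bij_betw (app t k) (el (md A) k) (el (md X) k)" if "k \<in> K" for k
      using inj[OF that] tor_eq_image[OF s torsion that] bspec[OF r that] app_el[OF t that] e by (auto simp: bij_betw_def)
  qed (use t e in simp)
  then show "X \<in> T" using T_iso s(3) e by blast
qed

text \<open>Closure under subobjects enters here: the preimage of \<open>tor Y\<close> embeds into
  the torsion object \<open>A\<close> of a torsion sequence of \<open>Y\<close>, so it is itself
  torsion and contributes to the trace in \<open>X\<close>.\<close>

lemma tor_preimage:
  assumes f: "f \<in> Hom C X Y" and inj: "\<And>k. k \<in> K \<Longrightarrow> inj_on (app f k) (el (md X) k)"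
    and k: "k \<in> K" and x: "x \<in> el (md X) k" "app f k x \<in> tor Y k"
  shows "x \<in> tor X k"
proof -
  have o: "X \<in> Obj C" "Y \<in> Obj C" using Hom_Obj[OF f] by auto
  obtain t g where s: "short_exact C t g" "Cod C t = Y" "Dom C t \<in> T" "Cod C g \<in> F"
    using torsion_seq[OF o(2)] by metis
  obtain A B Z where t: "t \<in> Hom C A B" and injt: "\<And>k. k \<in> K \<Longrightarrow> inj_on (app t k) (el (md A) k)"
    using short_exactD[OF s(1)] by metis
  have e: "A = Dom C t" "B = Y" using t s(2) by (auto simp: Hom_iff)
  let ?P = "preim (md X) (app f) (tor Y)"
  have P: "submodule (md X) ?P"
    using submodule_preim[OF app_linear[OF f] md md submodule_tor] o by blast
  note i = incl[OF o(1) P] and h = Comp_in[OF incl(1)[OF o(1) P] f]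
  have he: "app (Comp C f (incl X ?P)) k y = app f k y" if "k \<in> K" "y \<in> ?P k" for k y
    using app_Comp[OF i(1) f] sub_ob_el[OF o(1) P] i(2) that by simp
  have "\<exists>!u. u \<in> Hom C (sub_ob X ?P) A \<and> Comp C t u = Comp C f (incl X ?P)"
  proof (rule lift_mono[OF _ h injt])
    show "t \<in> Hom C A Y" using t e by simp
    show "app (Comp C f (incl X ?P)) k y \<in> app t k ` el (md A) k" if "k \<in> K" "y \<in> el (md (sub_ob X ?P)) k" for k y
      using that tor_eq_image[OF s torsion] sub_ob_el[OF o(1) P] he e by (auto simp: preim_def)
  qed
  then obtain u where u: "u \<in> Hom C (sub_ob X ?P) A" "Comp C t u = Comp C f (incl X ?P)" by blast
  have "inj_on (app u k) (el (md (sub_ob X ?P)) k)" if k: "k \<in> K" for k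
  proof (rule inj_onI)
    fix y z assume "y \<in> el (md (sub_ob X ?P)) k" "z \<in> el (md (sub_ob X ?P)) k" "app u k y = app u k z"
    then have "app f k y = app f k z" "y \<in> ?P k" "z \<in> ?P k"
      using he[OF k] app_Comp[OF u(1) t k] u(2) sub_ob_el[OF o(1) P k] by metis+
    then show "y = z" using inj[OF k] by (auto simp: preim_def dest: inj_onD)
  qed
  then have "is_mono C u" using is_mono_iff[OF u(1)] by blast
  then have "sub_ob X ?P \<in> T" using T_sub[of u] u(1) s(3) e by (auto simp: Hom_iff)
  moreover have xP: "x \<in> ?P k" using x by (simp add: preim_def)
  then have "x \<in> app (incl X ?P) k ` el (md (sub_ob X ?P)) k"
    using i(2)[OF k xP] sub_ob_el[OF o(1) P k] by (metis imageI)
  ultimately show ?thesis using i(1) x(1) unfolding tor_def by blast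
qed

text \<open>An elementwise form of closure under extensions. The image of \<open>q\<close> is
  torsion by heredity. The composite of \<open>f\<close> with the map of \<open>Z\<close> onto its
  torsion-free part kills the kernel of \<open>q\<close>, so it factors through that image and
  vanishes.\<close>

lemma tor_transfer:
  assumes q: "q \<in> Hom C X Y" and f: "f \<in> Hom C X Z"
    and qt: "\<And>k x. k \<in> K \<Longrightarrow> x \<in> el (md X) k \<Longrightarrow> app q k x \<in> tor Y k"
    and ker: "\<And>k x. k \<in> K \<Longrightarrow> x \<in> el (md X) k \<Longrightarrow> app q k x = \<one>\<^bsub>gr (md Y) k\<^esub> \<Longrightarrow> app f k x \<in> tor Z k"
    and k: "k \<in> K" and x: "x \<in> el (md X) k"
  shows "app f k x \<in> tor Z k"
proof -
  have o: "X \<in> Obj C" "Y \<in> Obj C" "Z \<in> Obj C" using Hom_Obj[OF f] Hom_Obj[OF q] by auto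
  let ?Q = "\<lambda>k. app q k ` el (md X) k"
  have Q: "submodule (md Y) ?Q"
    using submodule_image[OF app_linear[OF q]] md o submodule_el by blast
  note S = sub_ob[OF o(2) Q] and i = incl[OF o(2) Q]
  have "x \<in> tor (sub_ob Y ?Q) k" if "k \<in> K" "x \<in> el (md (sub_ob Y ?Q)) k" for k x
    using that qt sub_ob_el[OF o(2) Q] i
    by (intro tor_preimage[OF i(1)]) (auto simp: inj_on_def)
  then have QT: "sub_ob Y ?Q \<in> T" using T_iff[OF S(1)] by blast
  obtain g W where g: "g \<in> Hom C Z W" "W \<in> F"
    "\<And>k x. k \<in> K \<Longrightarrow> x \<in> el (md Z) k \<Longrightarrow> app g k x = \<one>\<^bsub>gr (md W) k\<^esub> \<longleftrightarrow> x \<in> tor Z k"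
    using tor_cokernel[OF o(3)] by metis
  have lq: "linear (md X) (md (sub_ob Y ?Q)) (app q)"
    by (rule linear_into_sub_ob[OF o(2) Q md[OF o(1)] app_linear[OF q]]) auto
  define q' where "q' = mk X (sub_ob Y ?Q) (app q)"
  note q' = mk[OF o(1) S(1) lq, folded q'_def]
  note gf = Comp_in[OF f g(1)]
  have "\<exists>!u. u \<in> Hom C (sub_ob Y ?Q) W \<and> Comp C u q' = Comp C g f"
    using q' ker g(3) app_el[OF f] sub_ob_el[OF o(2) Q] sub_ob_one[OF o(2) Q]
    by (intro lift_epi[OF q'(1) gf]) (auto simp: app_Comp[OF f g(1)])
  then obtain u where u: "u \<in> Hom C (sub_ob Y ?Q) W" "Comp C u q' = Comp C g f" by blast
  have "zero_arrow C u" using T_F_zero[OF QT g(2) u(1)] .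
  then have "app u k (app q' k x) = \<one>\<^bsub>gr (md W) k\<^esub>"
    using zero_arrow_iff[OF u(1)] k x app_el[OF q'(1)] by blast
  then have "app g k (app f k x) = \<one>\<^bsub>gr (md W) k\<^esub>"
    using app_Comp[OF q'(1) u(1) k x] app_Comp[OF f g(1) k x] u(2) by simp
  then show ?thesis using g(3)[OF k app_el[OF f k x]] by blast
qed

end

section \<open>Finite generation\<close>

lemma inj_pairing:
  assumes "infinite (UNIV :: 'u set)" shows "\<exists>f :: 'u \<times> 'u \<Rightarrow> 'u. inj f"
proof -
  have "\<exists>f. bij_betw f (UNIV \<times> UNIV :: ('u \<times> 'u) set) (UNIV :: 'u set)"
    using card_of_Times_same_infinite[OF assms] card_of_ordIso by blast
  then show ?thesis by (auto simp: bij_betw_def)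
qed

lemma inj_list_coding:
  assumes "infinite (UNIV :: 'u set)" shows "\<exists>f :: 'u list \<Rightarrow> 'u. inj f"
proof -
  obtain g :: "'u \<times> 'u \<Rightarrow> 'u" where g: "inj g" using inj_pairing[OF assms] by blast
  obtain a b :: 'u where ab: "a \<noteq> b" using assms by (metis (full_types) finite.simps UNIV_eq_I singletonI)
  \<comment> \<open>The tags \<open>a\<close> and \<open>b\<close> in the first component of the
    pairing separate the empty list from a cons cell.\<close>
  let ?f = "\<lambda>xs. foldr (\<lambda>x c. g (b, g (x, c))) xs (g (a, a))"
  have "?f xs = ?f ys \<Longrightarrow> xs = ys" for xs ys
  proof (induction xs arbitrary: ys)
    case Nil then show ?case using ab by (cases ys) (auto simp: inj_eq[OF g])
  next
    case (Cons x xs) then show ?case using ab by (cases ys) (auto simp: inj_eq[OF g])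
  qed
  then show ?thesis by (meson injI)
qed

text \<open>The preorder \<open>lq\<close> on \<open>Q\<close> as a category. Its arrows are pairs
  coded by \<open>g\<close>, since \<open>finitely_generated\<close> only quantifies over index
  categories whose objects and arrows have type \<open>'u\<close>.\<close>

definition thin_category :: "('u \<times> 'u \<Rightarrow> 'u) \<Rightarrow> 'u set \<Rightarrow> ('u \<Rightarrow> 'u \<Rightarrow> bool) \<Rightarrow> ('u, 'u) cat" where
  "thin_category g Q lq = \<lparr>Obj = Q, Arr = g ` {(a, b). a \<in> Q \<and> b \<in> Q \<and> lq a b},
    Dom = (\<lambda>t. fst (inv_into UNIV g t)), Cod = (\<lambda>t. snd (inv_into UNIV g t)), Ident = (\<lambda>a. g (a, a)),
    Comp = (\<lambda>s t. g (fst (inv_into UNIV g t), snd (inv_into UNIV g s)))\<rparr>"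

lemma Hom_thin_category:
  assumes "inj g"
  shows "Hom (thin_category g Q lq) a b = (if a \<in> Q \<and> b \<in> Q \<and> lq a b then {g (a, b)} else {})"
  using assms by (auto simp: Hom_def thin_category_def)

lemma thin_category:
  assumes "inj g" "\<And>a. a \<in> Q \<Longrightarrow> lq a a" "\<And>a b c. lq a b \<Longrightarrow> lq b c \<Longrightarrow> lq a c"
  shows "category (thin_category g Q lq)"
proof
  fix f a b assume "f \<in> Hom (thin_category g Q lq) a b"
  then have f: "f = g (a, b)" "a \<in> Q" "b \<in> Q" "lq a b"
    by (auto simp: Hom_thin_category[OF assms(1)] split: if_splits)
  show "Comp (thin_category g Q lq) (Ident (thin_category g Q lq) b) f = f"
    "Comp (thin_category g Q lq) f (Ident (thin_category g Q lq) a) = f"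
    using f assms(1) by (simp_all add: thin_category_def)
  fix h c assume "h \<in> Hom (thin_category g Q lq) b c"
  then have h: "h = g (b, c)" "c \<in> Q" "lq b c"
    by (auto simp: Hom_thin_category[OF assms(1)] split: if_splits)
  show "Comp (thin_category g Q lq) h f \<in> Hom (thin_category g Q lq) a c"
    using f h assms(3)[of a b c] assms(1) by (simp add: Hom_thin_category[OF assms(1)], simp add: thin_category_def)
  fix k d assume "k \<in> Hom (thin_category g Q lq) c d"
  then show "Comp (thin_category g Q lq) k (Comp (thin_category g Q lq) h f) =
      Comp (thin_category g Q lq) (Comp (thin_category g Q lq) k h) f"
    using f h assms(1) by (auto simp: Hom_thin_category[OF assms(1)] thin_category_def split: if_splits)
next
  fix a assume "a \<in> Obj (thin_category g Q lq)"
  then show "Ident (thin_category g Q lq) a \<in> Hom (thin_category g Q lq) a a"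
    using assms(2) by (simp add: Hom_thin_category[OF assms(1)]) (simp add: thin_category_def)
qed (use assms(1) in \<open>auto simp: thin_category_def\<close>)

lemma filtered_thin_category:
  assumes "inj g" "Q \<noteq> {}" "\<And>a b. a \<in> Q \<Longrightarrow> b \<in> Q \<Longrightarrow> \<exists>c\<in>Q. lq a c \<and> lq b c" "\<And>a. a \<in> Q \<Longrightarrow> lq a a"
  shows "filtered (thin_category g Q lq)"
  unfolding filtered_def
proof (intro conjI ballI allI)
  show "Obj (thin_category g Q lq) \<noteq> {}" using assms(2) by (simp add: thin_category_def)
  fix i j assume "i \<in> Obj (thin_category g Q lq)" "j \<in> Obj (thin_category g Q lq)"
  then show "\<exists>k\<in>Obj (thin_category g Q lq). Hom (thin_category g Q lq) i k \<noteq> {} \<and> Hom (thin_category g Q lq) j k \<noteq> {}"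
    using assms(3)[of i j] by (simp add: Hom_thin_category[OF assms(1)]) (auto simp: thin_category_def)
next
  fix i j s t assume "s \<in> Hom (thin_category g Q lq) i j" "t \<in> Hom (thin_category g Q lq) i j"
  then have "s = t" "Hom (thin_category g Q lq) j j \<noteq> {}"
    using assms(4) by (auto simp: Hom_thin_category[OF assms(1)] split: if_splits)
  then show "\<exists>k. \<exists>r\<in>Hom (thin_category g Q lq) j k. Comp (thin_category g Q lq) r s = Comp (thin_category g Q lq) r t"
    by blast
qed

section \<open>Colimits of sets and unions of modules\<close>

lemma set_category_simps [simp]:
  "Obj set_category = UNIV" "Dom set_category = Src" "Cod set_category = Tgt"
  "Comp set_category g f = \<lparr>Src = Src f, Tgt = Tgt g, App = compose (Src f) (App g) (App f)\<rparr>"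
  by (simp_all add: set_category_def)

lemma Hom_set_category: "f \<in> Hom set_category A B \<longleftrightarrow> Src f = A \<and> Tgt f = B \<and> App f \<in> A \<rightarrow>\<^sub>E B"
  by (auto simp: Hom_def set_category_def)

text \<open>The union \<open>E\<close> of the images of the legs is the apex of a cocone. The
  mediating map to \<open>E\<close>, read as a map from \<open>L\<close> to itself, agrees with the
  identity on all legs, so it is the identity and \<open>E\<close> is all of
  \<open>L\<close>.\<close>

lemma set_colimit_surj:
  assumes "category I" "is_colimit I set_category D L c" "y \<in> L"
  shows "\<exists>i\<in>Obj I. \<exists>x\<in>FObj D i. y = App (c i) x"
proof -
  define E where "E = (\<Union>i\<in>Obj I. App (c i) ` FObj D i)"
  define d where "d i = \<lparr>Src = FObj D i, Tgt = E, App = App (c i)\<rparr>" for i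
  have cocone: "is_cocone I set_category D L c"
    and univ: "\<And>M d. is_cocone I set_category D M d \<Longrightarrow>
      \<exists>!u. u \<in> Hom set_category L M \<and> (\<forall>i\<in>Obj I. Comp set_category u (c i) = d i)"
    using assms(2) by (auto simp: is_colimit_def)
  have c: "Src (c i) = FObj D i" "Tgt (c i) = L" "App (c i) \<in> FObj D i \<rightarrow>\<^sub>E L" if "i \<in> Obj I" for i
    using cocone that unfolding is_cocone_def Hom_set_category by blast+
  have EL: "E \<subseteq> L" using PiE_mem[OF c(3)] by (auto simp: E_def)
  have "is_cocone I set_category D E d" unfolding is_cocone_def
  proof (intro conjI ballI)
    show "d i \<in> Hom set_category (FObj D i) E" if "i \<in> Obj I" for i
      using c[OF that] that by (auto simp: Hom_set_category d_def E_def PiE_iff)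
    show "Comp set_category (d (Cod I t)) (FArr D t) = d (Dom I t)" if t: "t \<in> Arr I" for t
    proof -
      have e: "Comp set_category (c (Cod I t)) (FArr D t) = c (Dom I t)"
        using cocone t by (simp add: is_cocone_def)
      show ?thesis
        using arg_cong[OF e, of Src] arg_cong[OF e, of App] c(1)[OF category.Dom_in[OF assms(1) t]]
        by (simp add: d_def)
    qed
  qed simp
  then obtain u where u: "u \<in> Hom set_category L E" "\<And>i. i \<in> Obj I \<Longrightarrow> Comp set_category u (c i) = d i"
    using univ by blast
  have u': "App u \<in> L \<rightarrow>\<^sub>E E" "Src u = L" using u(1) by (auto simp: Hom_set_category)
  have uc: "compose (FObj D i) (App u) (App (c i)) = App (c i)" if "i \<in> Obj I" for i
    using u(2)[OF that] c[OF that] by (simp add: d_def)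
  let ?j = "\<lparr>Src = L, Tgt = L, App = App u\<rparr>" and ?id = "\<lparr>Src = L, Tgt = L, App = (\<lambda>x\<in>L. x)\<rparr>"
  have ci: "\<lparr>Src = FObj D i, Tgt = L, App = App (c i)\<rparr> = c i" if "i \<in> Obj I" for i
    using c[OF that] by simp
  have "compose (FObj D i) (\<lambda>x\<in>L. x) (App (c i)) = App (c i)" if "i \<in> Obj I" for i
    using c[OF that] by (auto simp: compose_def fun_eq_iff PiE_iff extensional_def)
  then have "\<forall>i\<in>Obj I. Comp set_category ?id (c i) = c i" "?id \<in> Hom set_category L L"
    using c ci by (simp_all add: Hom_set_category)
  moreover have "\<forall>i\<in>Obj I. Comp set_category ?j (c i) = c i" "?j \<in> Hom set_category L L"
    using c uc ci u' EL by (auto simp: Hom_set_category PiE_iff)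
  ultimately have "?j = ?id" using univ[OF cocone] by blast
  then have "App u y = y" using assms(3) by (metis arrow.select_convs(3) restrict_apply')
  then have "y \<in> E" using PiE_mem[OF u'(1) assms(3)] by simp
  then show ?thesis by (auto simp: E_def)
qed

context module_category
begin

text \<open>Index categories are only required to be directed here, so that the sequential colimits of
  submodules are covered as well.\<close>

lemma is_colimit_union:
  assumes I: "category I" and D: "is_functor I C D" and co: "is_cocone I C D L c"
    and dir: "\<And>i j. i \<in> Obj I \<Longrightarrow> j \<in> Obj I \<Longrightarrow> \<exists>l\<in>Obj I. Hom I i l \<noteq> {} \<and> Hom I j l \<noteq> {}"
    and inj: "\<And>i k. i \<in> Obj I \<Longrightarrow> k \<in> K \<Longrightarrow> inj_on (app (c i) k) (el (md (FObj D i)) k)"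
    and cover: "\<And>k y. k \<in> K \<Longrightarrow> y \<in> el (md L) k \<Longrightarrow> \<exists>i\<in>Obj I. y \<in> app (c i) k ` el (md (FObj D i)) k"
  shows "is_colimit I C D L c"
proof -
  have L: "L \<in> Obj C" and c: "\<And>i. i \<in> Obj I \<Longrightarrow> c i \<in> Hom C (FObj D i) L"
    and ct: "\<And>t. t \<in> Arr I \<Longrightarrow> Comp C (c (Cod I t)) (FArr D t) = c (Dom I t)"
    using co by (auto simp: is_cocone_def)
  have Dt: "FArr D t \<in> Hom C (FObj D i) (FObj D j)" if "t \<in> Hom I i j" for t i j
    using D that by (auto simp: is_functor_def Hom_iff)
  have HomI: "i \<in> Obj I" "j \<in> Obj I" if "t \<in> Hom I i j" for t i j
    using that category.Dom_in[OF I] category.Cod_in[OF I] by (auto simp: Hom_iff)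
  have push: "app (c j) k (app (FArr D t) k x) = app (c i) k x"
    if "t \<in> Hom I i j" "k \<in> K" "x \<in> el (md (FObj D i)) k" for t i j k x
    using ct[of t] app_Comp[OF Dt[OF that(1)] c[OF HomI(2)[OF that(1)]] that(2,3)] that(1) by (auto simp: Hom_iff)
  have two: "\<exists>l\<in>Obj I. \<exists>x'\<in>el (md (FObj D l)) k. \<exists>y'\<in>el (md (FObj D l)) k.
      x = app (c l) k x' \<and> y = app (c l) k y'" if k: "k \<in> K" and xy: "x \<in> el (md L) k" "y \<in> el (md L) k" for k x y
  proof -
    obtain i a where i: "i \<in> Obj I" "a \<in> el (md (FObj D i)) k" "x = app (c i) k a" using cover[OF k xy(1)] by blast
    obtain j b where j: "j \<in> Obj I" "b \<in> el (md (FObj D j)) k" "y = app (c j) k b" using cover[OF k xy(2)] by blast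
    obtain l s t where l: "l \<in> Obj I" "s \<in> Hom I i l" "t \<in> Hom I j l" using dir i j by blast
    then show ?thesis using push[OF l(2) k i(2)] push[OF l(3) k j(2)] i j app_el[OF Dt k] by metis
  qed
  have "\<exists>!u. u \<in> Hom C L M \<and> (\<forall>i\<in>Obj I. Comp C u (c i) = d i)" if "is_cocone I C D M d" for M d
  proof -
    have M: "M \<in> Obj C" and d: "\<And>i. i \<in> Obj I \<Longrightarrow> d i \<in> Hom C (FObj D i) M"
      and dt: "\<And>t. t \<in> Arr I \<Longrightarrow> Comp C (d (Cod I t)) (FArr D t) = d (Dom I t)"
      using that by (auto simp: is_cocone_def)
    have pushd: "app (d j) k (app (FArr D t) k x) = app (d i) k x"
      if "t \<in> Hom I i j" "k \<in> K" "x \<in> el (md (FObj D i)) k" for t i j k x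
      using dt[of t] app_Comp[OF Dt[OF that(1)] d[OF HomI(2)[OF that(1)]] that(2,3)] that(1) by (auto simp: Hom_iff)
    \<comment> \<open>Equal values in \<open>L\<close> can be compared at a common later stage,
      where injectivity of the leg makes the two representatives equal. Hence the mediating map may
      be computed on any stage.\<close>
    have wd: "app (d i) k x = app (d j) k y"
      if k: "k \<in> K" and ij: "i \<in> Obj I" "j \<in> Obj I" "x \<in> el (md (FObj D i)) k" "y \<in> el (md (FObj D j)) k"
        "app (c i) k x = app (c j) k y" for k i j x y
    proof -
      obtain l s t where l: "l \<in> Obj I" "s \<in> Hom I i l" "t \<in> Hom I j l" using dir ij by blast
      have "app (c l) k (app (FArr D s) k x) = app (c l) k (app (FArr D t) k y)"
        using push[OF l(2) k] push[OF l(3) k] ij by simp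
      then have "app (FArr D s) k x = app (FArr D t) k y"
        by (rule inj_onD[OF inj[OF l(1) k]]) (use app_el[OF Dt k] l ij in blast)+
      then show ?thesis using pushd[OF l(2) k] pushd[OF l(3) k] ij by metis
    qed
    define \<phi> where "\<phi> k y = (SOME z. \<exists>i\<in>Obj I. \<exists>x\<in>el (md (FObj D i)) k. y = app (c i) k x \<and> z = app (d i) k x)" for k y
    have \<phi>: "\<phi> k (app (c i) k x) = app (d i) k x"
      if k: "k \<in> K" and i: "i \<in> Obj I" "x \<in> el (md (FObj D i)) k" for k i x
      unfolding \<phi>_def
    proof (rule some_equality)
      show "\<exists>j\<in>Obj I. \<exists>y\<in>el (md (FObj D j)) k. app (c i) k x = app (c j) k y \<and> app (d i) k x = app (d j) k y"
        using i by blast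
    qed (use wd[OF k i(1) _ i(2)] in metis)
    have "linear (md L) (md M) \<phi>" unfolding linear_def hom_def
    proof (intro conjI ballI CollectI Pi_I)
      fix k x assume k: "k \<in> K" and x: "x \<in> el (md L) k"
      show "\<phi> k x \<in> el (md M) k" using cover[OF k x] \<phi>[OF k] app_el[OF d k] by auto
      fix y assume y: "y \<in> el (md L) k"
      obtain l a b where l: "l \<in> Obj I" "a \<in> el (md (FObj D l)) k" "b \<in> el (md (FObj D l)) k"
        "x = app (c l) k a" "y = app (c l) k b" using two[OF k x y] by blast
      have "a \<otimes>\<^bsub>gr (md (FObj D l)) k\<^esub> b \<in> el (md (FObj D l)) k"
        using el_mult[OF md k l(2,3)] Hom_Obj[OF c[OF l(1)]] by blast
      from \<phi>[OF k l(1) this] show "\<phi> k (x \<otimes>\<^bsub>gr (md L) k\<^esub> y) = \<phi> k x \<otimes>\<^bsub>gr (md M) k\<^esub> \<phi> k y"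
        using l \<phi>[OF k l(1)] linear_mult[OF app_linear[OF c[OF l(1)]] k l(2,3)]
          linear_mult[OF app_linear[OF d[OF l(1)]] k l(2,3)] by simp
    next
      fix p x assume p: "p \<in> Ops" and x: "x \<in> el (md L) (src p)"
      obtain l a where l: "l \<in> Obj I" "a \<in> el (md (FObj D l)) (src p)" "x = app (c l) (src p) a"
        using cover[OF src_in[OF p] x] by blast
      have "ac (md (FObj D l)) p a \<in> el (md (FObj D l)) (tgt p)"
        using el_act[OF md p l(2)] Hom_Obj[OF c[OF l(1)]] by blast
      from \<phi>[OF tgt_in[OF p] l(1) this] show "\<phi> (tgt p) (ac (md L) p x) = ac (md M) p (\<phi> (src p) x)"
        using l \<phi>[OF src_in[OF p] l(1,2)] linear_act[OF app_linear[OF c[OF l(1)]] p l(2)]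
          linear_act[OF app_linear[OF d[OF l(1)]] p l(2)] by simp
    qed
    note m = mk[OF L M this]
    show ?thesis
    proof (rule ex1I[of _ "mk L M \<phi>"])
      have "Comp C (mk L M \<phi>) (c i) = d i" if i: "i \<in> Obj I" for i
        using app_Comp[OF c[OF i] m(1)] m(2) app_el[OF c[OF i]] \<phi>[OF _ i]
        by (intro arr_ext[OF Comp_in[OF c[OF i] m(1)] d[OF i]]) simp
      then show "mk L M \<phi> \<in> Hom C L M \<and> (\<forall>i\<in>Obj I. Comp C (mk L M \<phi>) (c i) = d i)" using m(1) by blast
      fix u assume u: "u \<in> Hom C L M \<and> (\<forall>i\<in>Obj I. Comp C u (c i) = d i)"
      show "u = mk L M \<phi>"
      proof (rule arr_ext[OF conjunct1[OF u] m(1)])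
        fix k x assume k: "k \<in> K" and x: "x \<in> el (md L) k"
        obtain i a where i: "i \<in> Obj I" "a \<in> el (md (FObj D i)) k" "x = app (c i) k a"
          using cover[OF k x] by blast
        then show "app u k x = app (mk L M \<phi>) k x"
          using u m(2)[OF k x] \<phi>[OF k i(1,2)] app_Comp[OF c[OF i(1)] conjunct1[OF u] k i(2)] by simp
      qed
    qed
  qed
  then show ?thesis using co by (auto simp: is_colimit_def)
qed

end

text \<open>\<open>enc_ex\<close> lets finite sets of elements of all sorts serve as indices in
  \<open>'u\<close>. \<open>ob_cover\<close> admits every module whose elements each come from some
  object, as is the case for a directed colimit of objects.\<close>

locale big_module_category = module_category K Ops src tgt C md app
  for K :: "'k set" and Ops :: "'p set" and src tgt and C :: "('o, 'm, 'z) cat_scheme"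
    and md :: "'o \<Rightarrow> ('k, 'p, 'u) msm" and app +
  assumes universe: "infinite (UNIV :: 'u set)"
    and enc_ex: "\<exists>e :: 'k \<times> 'u \<Rightarrow> 'u. inj_on e (K \<times> UNIV)"
    and ob_cover: "premod M \<Longrightarrow> (\<And>k y. k \<in> K \<Longrightarrow> y \<in> el M k \<Longrightarrow>
        \<exists>X\<in>Obj C. \<exists>\<phi>. linear (md X) M \<phi> \<and> y \<in> \<phi> k ` el (md X) k) \<Longrightarrow> \<exists>Z\<in>Obj C. eqmod (md Z) M"
begin

text \<open>\<open>X\<close> is the colimit of its submodules spanned by finite sets. Since Hom out
  of \<open>X\<close> preserves this colimit, the identity of \<open>X\<close> factors through one
  stage, which is then everything.\<close>

lemma fg_of_finitely_generated:
  assumes fg: "finitely_generated TYPE('u) C X"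
  shows "fg_sub (md X) (el (md X))"
proof -
  have X: "X \<in> Obj C" using fg by (simp add: finitely_generated_def)
  note mX = md[OF X]
  obtain e :: "'k \<times> 'u \<Rightarrow> 'u" where e: "inj_on e (K \<times> UNIV)" using enc_ex by blast
  obtain code :: "'u list \<Rightarrow> 'u" where code: "inj code" using inj_list_coding[OF universe] by blast
  obtain g :: "'u \<times> 'u \<Rightarrow> 'u" where g: "inj g" using inj_pairing[OF universe] by blast
  \<comment> \<open>An index is the code of a list of codes of elements, and \<open>E a\<close> is
    the finite set of elements of \<open>X\<close> that it names; entries that name no such element
    are ignored. Concatenation of lists provides the upper bounds in \<open>dirQ\<close>.\<close>
  define E where "E a = {(k, x). k \<in> K \<and> x \<in> el (md X) k \<and> e (k, x) \<in> set (inv_into UNIV code a)}" for a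
  define U where "U a = span (md X) (E a)" for a
  define lq where "lq a b \<longleftrightarrow> set (inv_into UNIV code a) \<subseteq> set (inv_into UNIV code b)" for a b
  let ?I = "thin_category g (range code) lq"
  have Esub: "E a \<subseteq> Sigma K (el (md X))" for a by (auto simp: E_def)
  have Efin: "finite (E a)" for a
  proof (rule inj_on_finite[of e])
    show "inj_on e (E a)" by (rule inj_on_subset[OF e]) (auto simp: E_def)
    show "e ` E a \<subseteq> set (inv_into UNIV code a)" by (auto simp: E_def)
  qed simp
  have Ucode: "inv_into UNIV code (code l) = l" for l using code by simp
  have U: "submodule (md X) (U a)" for a using submodule_span[OF mX Esub] by (simp add: U_def)
  have Umono: "x \<in> U b k" if "lq a b" "x \<in> U a k" for a b x k
  proof -
    have "E a \<subseteq> E b" using that(1) by (auto simp: E_def lq_def)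
    then show ?thesis using span_mono[OF _ that(2)[unfolded U_def]] by (simp add: U_def)
  qed
  have I: "category ?I" by (rule thin_category[OF g]) (auto simp: lq_def)
  have dirQ: "\<exists>c\<in>range code. lq a c \<and> lq b c" for a b
    by (rule bexI[of _ "code (inv_into UNIV code a @ inv_into UNIV code b)"]) (auto simp: lq_def Ucode)
  have fi: "filtered ?I" by (rule filtered_thin_category[OF g _ dirQ]) (auto simp: lq_def)
  define D where "D = \<lparr>FObj = (\<lambda>a. sub_ob X (U a)),
    FArr = (\<lambda>t. mk (sub_ob X (U (fst (inv_into UNIV g t)))) (sub_ob X (U (snd (inv_into UNIV g t)))) (\<lambda>k x. x))\<rparr>"
  define c where "c a = incl X (U a)" for a
  note S = sub_ob[OF X U] and Sel = sub_ob_el[OF X U] and i = incl[OF X U]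
  have lin: "linear (md (sub_ob X (U a))) (md (sub_ob X (U b))) (\<lambda>k x. x)" if "lq a b" for a b
  proof (rule linear_into_sub_ob[OF X U md[OF S(1)]])
    show "linear (md (sub_ob X (U a))) (md X) (\<lambda>k x. x)"
      by (rule linear_cong[OF app_linear[OF i(1)] md[OF S(1)]]) (simp add: i(2) Sel)
  qed (use Umono[OF that] Sel in simp)
  have DA: "FArr D t \<in> Hom C (FObj D (fst (inv_into UNIV g t))) (FObj D (snd (inv_into UNIV g t)))"
    "k \<in> K \<Longrightarrow> x \<in> U (fst (inv_into UNIV g t)) k \<Longrightarrow> app (FArr D t) k x = x" if t: "t \<in> Arr ?I" for t k x
  proof -
    have "lq (fst (inv_into UNIV g t)) (snd (inv_into UNIV g t))" using t g by (auto simp: thin_category_def)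
    note m = mk[OF S(1) S(1) lin[OF this]]
    show "FArr D t \<in> Hom C (FObj D (fst (inv_into UNIV g t))) (FObj D (snd (inv_into UNIV g t)))" using m(1) by (simp add: D_def)
    show "k \<in> K \<Longrightarrow> x \<in> U (fst (inv_into UNIV g t)) k \<Longrightarrow> app (FArr D t) k x = x"
      using m(2) Sel by (simp add: D_def)
  qed
  have Ts: "Obj ?I = range code" "Dom ?I = (\<lambda>t. fst (inv_into UNIV g t))" "Cod ?I = (\<lambda>t. snd (inv_into UNIV g t))"
    "Ident ?I = (\<lambda>a. g (a, a))" "Comp ?I = (\<lambda>s t. g (fst (inv_into UNIV g t), snd (inv_into UNIV g s)))"
    by (simp_all add: thin_category_def)
  have Delt: "el (md (FObj D a)) k = U a k" if "k \<in> K" for a k using Sel[OF that] by (simp add: D_def)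
  have DO: "FObj D a \<in> Obj C" for a using S(1) by (simp add: D_def)
  have D: "is_functor ?I C D" unfolding is_functor_def
  proof (intro conjI ballI impI)
    show "FObj D a \<in> Obj C" for a by (rule DO)
    show "FArr D f \<in> Hom C (FObj D (Dom ?I f)) (FObj D (Cod ?I f))" if "f \<in> Arr ?I" for f
      using DA(1)[OF that] by (simp add: Ts)
    show "FArr D (Ident ?I a) = Ident C (FObj D a)" if a: "a \<in> Obj ?I" for a
    proof -
      have t: "Ident ?I a \<in> Arr ?I" using category.Ident_in[OF I a] by (simp add: Hom_iff)
      have e: "fst (inv_into UNIV g (Ident ?I a)) = a" "snd (inv_into UNIV g (Ident ?I a)) = a" using g by (simp_all add: Ts)
      show ?thesis
        using DA[OF t] app_Ident[OF DO] Delt unfolding e by (intro arr_ext[OF _ Ident_in[OF DO]]) auto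
    qed
    show "FArr D (Comp ?I s t) = Comp C (FArr D s) (FArr D t)"
      if t: "t \<in> Arr ?I" and s: "s \<in> Arr ?I" and st: "Cod ?I t = Dom ?I s" for s t
    proof -
      have "t \<in> Hom ?I (Dom ?I t) (Cod ?I t)" "s \<in> Hom ?I (Cod ?I t) (Cod ?I s)" using s t st by (auto simp: Hom_iff)
      then have u: "Comp ?I s t \<in> Arr ?I" using category.Comp_in[OF I] by (metis Hom_iff)
      have e: "fst (inv_into UNIV g (Comp ?I s t)) = fst (inv_into UNIV g t)" "snd (inv_into UNIV g (Comp ?I s t)) = snd (inv_into UNIV g s)"
        using g by (simp_all add: Ts)
      have e': "snd (inv_into UNIV g t) = fst (inv_into UNIV g s)" using st by (simp add: Ts)
      note h = DA(1)[OF t, unfolded e'] DA(1)[OF s]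
      have "lq (fst (inv_into UNIV g t)) (fst (inv_into UNIV g s))" using t g by (auto simp: thin_category_def e'[symmetric])
      then have "app (FArr D (Comp ?I s t)) k x = app (Comp C (FArr D s) (FArr D t)) k x"
        if k: "k \<in> K" and x: "x \<in> U (fst (inv_into UNIV g t)) k" for k x
        using DA(2)[OF u k] DA(2)[OF s k] DA(2)[OF t k x] app_Comp[OF h k] Delt[OF k] x Umono
        unfolding e by metis
      then show ?thesis using DA(1)[OF u] Delt unfolding e by (intro arr_ext[OF _ Comp_in[OF h]]) auto
    qed
  qed
  have ch: "c a \<in> Hom C (FObj D a) X" for a using i(1) by (simp add: c_def D_def)
  have ca: "app (c a) k x = x" if "k \<in> K" "x \<in> U a k" for a k x using i(2)[OF that] by (simp add: c_def)
  have co: "is_cocone ?I C D X c" unfolding is_cocone_def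
  proof (intro conjI ballI)
    fix t assume t: "t \<in> Arr ?I"
    note h = DA(1)[OF t] ch[of "snd (inv_into UNIV g t)"]
    have "lq (fst (inv_into UNIV g t)) (snd (inv_into UNIV g t))" using t g by (auto simp: thin_category_def)
    then have "app (Comp C (c (snd (inv_into UNIV g t))) (FArr D t)) k x = app (c (fst (inv_into UNIV g t))) k x"
      if "k \<in> K" "x \<in> U (fst (inv_into UNIV g t)) k" for k x
      using app_Comp[OF h that(1)] DA(2)[OF t that] ca[OF that] ca[OF that(1) Umono] Delt[OF that(1)] that by auto
    then show "Comp C (c (Cod ?I t)) (FArr D t) = c (Dom ?I t)"
      unfolding Ts using Delt by (intro arr_ext[OF Comp_in[OF h] ch]) auto
  qed (use X ch in auto)
  have col: "is_colimit ?I C D X c"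
  proof (rule is_colimit_union[OF I D co])
    show "\<exists>l\<in>Obj ?I. Hom ?I i l \<noteq> {} \<and> Hom ?I j l \<noteq> {}" if "i \<in> Obj ?I" "j \<in> Obj ?I" for i j
      using fi that unfolding filtered_def by blast
    show "inj_on (app (c i) k) (el (md (FObj D i)) k)" if "k \<in> K" for i k
      using ca[OF that] Delt[OF that] by (auto simp: inj_on_def)
    show "\<exists>i\<in>Obj ?I. y \<in> app (c i) k ` el (md (FObj D i)) k" if k: "k \<in> K" and y: "y \<in> el (md X) k" for k y
    proof
      let ?a = "code [e (k, y)]"
      have "y \<in> U ?a k" unfolding U_def by (rule span_gen[OF k]) (use k y in \<open>simp add: E_def Ucode\<close>)
      then show "y \<in> app (c ?a) k ` el (md (FObj D ?a)) k" using ca[OF k] Delt[OF k] by force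
    qed (simp add: Ts)
  qed
  have "\<forall>t\<in>Arr ?I. is_mono C (FArr D t)"
  proof
    fix t assume t: "t \<in> Arr ?I"
    show "is_mono C (FArr D t)"
      unfolding is_mono_iff[OF DA(1)[OF t]] using DA(2)[OF t] Delt by (auto simp: inj_on_def)
  qed
  then have "is_colimit ?I set_category (comp_functor (hom_functor C X) D)
        (FObj (hom_functor C X) X) (\<lambda>i. FArr (hom_functor C X) (c i))"
    using fg I fi D col unfolding finitely_generated_def by blast
  \<comment> \<open>The identity of \<open>X\<close> is a point of the Hom set over the colimit, so
    it comes from some stage \<open>a\<close>.\<close>
  from set_colimit_surj[OF I this, of "Ident C X"] obtain a u where
    "u \<in> Hom C X (FObj D a)" "Ident C X = App (FArr (hom_functor C X) (c a)) u"
    using Ident_in[OF X] by (auto simp: comp_functor_def hom_functor_def)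
  then have u: "u \<in> Hom C X (FObj D a)" "Ident C X = Comp C (c a) u"
    using ch[of a] by (auto simp: hom_functor_def Hom_iff)
  have "x \<in> U a k" if k: "k \<in> K" and x: "x \<in> el (md X) k" for k x
    using app_Comp[OF u(1) ch k x] u(2) app_Ident[OF X k x] ca[OF k] app_el[OF u(1) k x] Delt[OF k] by metis
  then show ?thesis unfolding fg_sub_def U_def
    by (intro exI[of _ "E a"] conjI Efin Esub ballI subsetI)
qed

end

text \<open>A directed system of injective maps in which the transition \<open>T i j\<close> depends
  only on its ends. A filtered diagram of monos reduces to this form, because parallel arrows act
  equally there. The injection \<open>pr\<close> brings pairs of an index and an element back into
  \<open>'u\<close>.\<close>

locale directed_system = sorted_ops K Ops src tgt
  for K :: "'k set" and Ops :: "'p set" and src tgt +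
  fixes J :: "'i set" and below :: "'i \<Rightarrow> 'i \<Rightarrow> bool" and N :: "'i \<Rightarrow> ('k, 'p, 'u) msm"
    and T :: "'i \<Rightarrow> 'i \<Rightarrow> 'k \<Rightarrow> 'u \<Rightarrow> 'u" and pr :: "'i \<times> 'u \<Rightarrow> 'u"
  assumes J_nonempty: "J \<noteq> {}"
    and directed: "i \<in> J \<Longrightarrow> j \<in> J \<Longrightarrow> \<exists>l\<in>J. below i l \<and> below j l"
    and below_refl: "i \<in> J \<Longrightarrow> below i i"
    and below_trans: "below i j \<Longrightarrow> below j l \<Longrightarrow> below i l"
    and premod_N: "i \<in> J \<Longrightarrow> premod (N i)"
    and T_linear: "i \<in> J \<Longrightarrow> j \<in> J \<Longrightarrow> below i j \<Longrightarrow> linear (N i) (N j) (T i j)"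
    and T_inj: "i \<in> J \<Longrightarrow> j \<in> J \<Longrightarrow> below i j \<Longrightarrow> k \<in> K \<Longrightarrow> inj_on (T i j k) (el (N i) k)"
    and T_comp: "i \<in> J \<Longrightarrow> j \<in> J \<Longrightarrow> l \<in> J \<Longrightarrow> below i j \<Longrightarrow> below j l \<Longrightarrow> k \<in> K \<Longrightarrow>
      x \<in> el (N i) k \<Longrightarrow> T j l k (T i j k x) = T i l k x"
    and pr_inj: "inj pr"
begin

definition rel :: "'k \<Rightarrow> 'i \<Rightarrow> 'u \<Rightarrow> 'i \<Rightarrow> 'u \<Rightarrow> bool" where
  "rel k i x j y \<longleftrightarrow> (\<exists>l\<in>J. below i l \<and> below j l \<and> T i l k x = T j l k y)"

text \<open>The class of the pair \<open>(i, x)\<close> is represented by a chosen pair, coded by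
  \<open>pr\<close>. Related pairs give the same predicate under \<open>SOME\<close>, hence the same
  code.\<close>

definition leg :: "'i \<Rightarrow> 'k \<Rightarrow> 'u \<Rightarrow> 'u" where
  "leg i k x = pr (SOME (j, y). j \<in> J \<and> y \<in> el (N j) k \<and> rel k j y i x)"

lemma T_el: "i \<in> J \<Longrightarrow> j \<in> J \<Longrightarrow> below i j \<Longrightarrow> k \<in> K \<Longrightarrow> x \<in> el (N i) k \<Longrightarrow> T i j k x \<in> el (N j) k"
  using linear_el[OF T_linear] .

text \<open>Injectivity of the transitions upgrades equality at some upper bound to equality at
  every upper bound: both are compared at a bound above the two.\<close>

lemma rel_iff:
  assumes "k \<in> K" "i \<in> J" "j \<in> J" "l \<in> J" "x \<in> el (N i) k" "y \<in> el (N j) k" "below i l" "below j l"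
  shows "rel k i x j y \<longleftrightarrow> T i l k x = T j l k y"
proof
  assume "rel k i x j y"
  then obtain m where m: "m \<in> J" "below i m" "below j m" "T i m k x = T j m k y" by (auto simp: rel_def)
  obtain n where n: "n \<in> J" "below l n" "below m n" using directed assms(4) m(1) by blast
  have "T l n k (T i l k x) = T m n k (T i m k x)" "T l n k (T j l k y) = T m n k (T j m k y)"
    using T_comp assms m(1-3) n by simp_all
  then have "T l n k (T i l k x) = T l n k (T j l k y)" using m(4) by simp
  then show "T i l k x = T j l k y"
    by (rule inj_onD[OF T_inj[OF assms(4) n(1,2) assms(1)]]) (use T_el assms in auto)
next
  assume "T i l k x = T j l k y" then show "rel k i x j y" using assms by (auto simp: rel_def)
qed

lemma rel_trans:
  assumes "k \<in> K" "i \<in> J" "j \<in> J" "m \<in> J" "x \<in> el (N i) k" "y \<in> el (N j) k" "z \<in> el (N m) k"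
    "rel k i x j y" "rel k j y m z"
  shows "rel k i x m z"
proof -
  obtain l where l: "l \<in> J" "below i l" "below j l" using directed assms by blast
  obtain n where n: "n \<in> J" "below l n" "below m n" using directed assms l by blast
  have b: "below i n" "below j n" using below_trans l n by blast+
  show ?thesis
    using rel_iff[OF assms(1-3) n(1) assms(5,6) b] rel_iff[OF assms(1,3,4) n(1) assms(6,7) b(2) n(3)]
      rel_iff[OF assms(1,2,4) n(1) assms(5,7) b(1) n(3)] assms(8,9) by simp
qed

lemma rel_sym: "rel k i x j y \<Longrightarrow> rel k j y i x"
  unfolding rel_def by metis

lemma leg_eq_rel:
  assumes "k \<in> K" "i \<in> J" "j \<in> J" "x \<in> el (N i) k" "y \<in> el (N j) k"
  shows "leg i k x = leg j k y \<longleftrightarrow> rel k i x j y"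
proof
  have ex: "\<exists>p. case p of (l, z) \<Rightarrow> l \<in> J \<and> z \<in> el (N l) k \<and> rel k l z i x" if "i \<in> J" "x \<in> el (N i) k" for i x
    using that below_refl by (intro exI[of _ "(i, x)"]) (auto simp: rel_def)
  assume "leg i k x = leg j k y"
  then have e: "(SOME (l, z). l \<in> J \<and> z \<in> el (N l) k \<and> rel k l z i x) =
      (SOME (l, z). l \<in> J \<and> z \<in> el (N l) k \<and> rel k l z j y)" (is "?p = ?q")
    using pr_inj by (auto simp: leg_def dest: injD)
  obtain l z where lz: "?p = (l, z)" by fastforce
  have "l \<in> J \<and> z \<in> el (N l) k \<and> rel k l z i x" using someI_ex[OF ex[OF assms(2,4)]] unfolding lz by simp
  moreover have "rel k l z j y" using someI_ex[OF ex[OF assms(3,5)]] unfolding e[symmetric] lz by simp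
  ultimately show "rel k i x j y" using rel_trans[OF assms(1,2) _ assms(3,4) _ assms(5)] rel_sym by blast
next
  assume r: "rel k i x j y"
  have "rel k l z i x \<longleftrightarrow> rel k l z j y" if "l \<in> J" "z \<in> el (N l) k" for l z
    using rel_trans[OF assms(1) that(1) assms(2,3) that(2) assms(4,5) _ r]
      rel_trans[OF assms(1) that(1) assms(3,2) that(2) assms(5,4) _ rel_sym[OF r]] by blast
  then have "(\<lambda>(l, z). l \<in> J \<and> z \<in> el (N l) k \<and> rel k l z i x) = (\<lambda>(l, z). l \<in> J \<and> z \<in> el (N l) k \<and> rel k l z j y)"
    by (auto simp: fun_eq_iff)
  then show "leg i k x = leg j k y" by (simp add: leg_def)
qed

lemma leg_T:
  assumes "k \<in> K" "i \<in> J" "j \<in> J" "below i j" "x \<in> el (N i) k"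
  shows "leg j k (T i j k x) = leg i k x"
  using leg_eq_rel[OF assms(1,3,2) T_el[OF assms(2,3,4,1,5)] assms(5)] assms below_refl[OF assms(3)]
    T_comp[OF assms(2,3,3,4) below_refl[OF assms(3)] assms(1,5)]
  by (auto simp: rel_def)

lemma leg_inj: "k \<in> K \<Longrightarrow> i \<in> J \<Longrightarrow> inj_on (leg i k) (el (N i) k)"
proof (rule inj_onI)
  fix x y assume k: "k \<in> K" "i \<in> J" "x \<in> el (N i) k" "y \<in> el (N i) k" and e: "leg i k x = leg i k y"
  have "T i i k x = T i i k y"
    using e leg_eq_rel[OF k(1,2,2,3,4)] rel_iff[OF k(1,2,2,2,3,4)] below_refl[OF k(2)] by simp
  then show "x = y" by (rule inj_onD[OF T_inj[OF k(2,2) below_refl[OF k(2)] k(1)] _ k(3,4)])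
qed

text \<open>The operations are computed at any stage that contains the arguments.
  \<open>colim_mult\<close>, \<open>colim_act\<close> and \<open>colim_one\<close> show that the
  result does not depend on the stage, so the choices are harmless.\<close>

definition colim :: "('k, 'p, 'u) msm" where
  "colim = (\<lambda>k. \<lparr>carrier = (\<Union>i\<in>J. leg i k ` el (N i) k),
      mult = (\<lambda>a b. SOME c. \<exists>i\<in>J. \<exists>x\<in>el (N i) k. \<exists>y\<in>el (N i) k.
        a = leg i k x \<and> b = leg i k y \<and> c = leg i k (x \<otimes>\<^bsub>gr (N i) k\<^esub> y)),
      one = leg (SOME i. i \<in> J) k \<one>\<^bsub>gr (N (SOME i. i \<in> J)) k\<^esub>\<rparr>,
    \<lambda>p a. SOME c. \<exists>i\<in>J. \<exists>x\<in>el (N i) (src p). a = leg i (src p) x \<and> c = leg i (tgt p) (ac (N i) p x))"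

lemma common:
  assumes "k \<in> K" "i \<in> J" "j \<in> J" "x \<in> el (N i) k" "y \<in> el (N j) k"
  obtains l where "l \<in> J" "below i l" "below j l" "T i l k x \<in> el (N l) k" "T j l k y \<in> el (N l) k"
    "leg i k x = leg l k (T i l k x)" "leg j k y = leg l k (T j l k y)"
proof -
  obtain l where l: "l \<in> J" "below i l" "below j l" using directed assms by blast
  then show ?thesis using that[OF l] T_el leg_T assms by simp
qed

lemma colim_mult:
  assumes k: "k \<in> K" and i: "i \<in> J" and x: "x \<in> el (N i) k" and y: "y \<in> el (N i) k"
  shows "leg i k x \<otimes>\<^bsub>gr colim k\<^esub> leg i k y = leg i k (x \<otimes>\<^bsub>gr (N i) k\<^esub> y)"
proof -
  have "c = leg i k (x \<otimes>\<^bsub>gr (N i) k\<^esub> y)"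
    if j: "j \<in> J" "x' \<in> el (N j) k" "y' \<in> el (N j) k" "leg i k x = leg j k x'" "leg i k y = leg j k y'"
      "c = leg j k (x' \<otimes>\<^bsub>gr (N j) k\<^esub> y')" for c j x' y'
  proof -
    obtain l where l: "l \<in> J" "below i l" "below j l" using directed i j by blast
    have "T i l k x = T j l k x'" "T i l k y = T j l k y'"
      using leg_eq_rel[OF k i j(1) x j(2)] leg_eq_rel[OF k i j(1) y j(3)]
        rel_iff[OF k i j(1) l(1) x j(2) l(2,3)] rel_iff[OF k i j(1) l(1) y j(3) l(2,3)] j(4,5) by simp_all
    then have "T i l k (x \<otimes>\<^bsub>gr (N i) k\<^esub> y) = T j l k (x' \<otimes>\<^bsub>gr (N j) k\<^esub> y')"
      using linear_mult[OF T_linear[OF i l(1,2)] k x y] linear_mult[OF T_linear[OF j(1) l(1,3)] k j(2,3)] by simp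
    then show ?thesis
      using leg_T[OF k i l(1,2) el_mult[OF premod_N[OF i] k x y]]
        leg_T[OF k j(1) l(1,3) el_mult[OF premod_N[OF j(1)] k j(2,3)]] j(6) by simp
  qed
  then show ?thesis unfolding colim_def fst_conv monoid.select_convs
    by (intro some_equality) (use i x y in blast)+
qed

lemma colim_act:
  assumes p: "p \<in> Ops" and i: "i \<in> J" and x: "x \<in> el (N i) (src p)"
  shows "ac colim p (leg i (src p) x) = leg i (tgt p) (ac (N i) p x)"
proof -
  note k = src_in[OF p]
  have "c = leg i (tgt p) (ac (N i) p x)"
    if j: "j \<in> J" "x' \<in> el (N j) (src p)" "leg i (src p) x = leg j (src p) x'" "c = leg j (tgt p) (ac (N j) p x')" for c j x'
  proof -
    obtain l where l: "l \<in> J" "below i l" "below j l" using directed i j by blast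
    have "T i l (src p) x = T j l (src p) x'"
      using leg_eq_rel[OF k i j(1) x j(2)] rel_iff[OF k i j(1) l(1) x j(2) l(2,3)] j(3) by simp
    then have "T i l (tgt p) (ac (N i) p x) = T j l (tgt p) (ac (N j) p x')"
      using linear_act[OF T_linear[OF i l(1,2)] p x] linear_act[OF T_linear[OF j(1) l(1,3)] p j(2)] by simp
    then show ?thesis
      using leg_T[OF tgt_in[OF p] i l(1,2) el_act[OF premod_N[OF i] p x]]
        leg_T[OF tgt_in[OF p] j(1) l(1,3) el_act[OF premod_N[OF j(1)] p j(2)]] j(4) by simp
  qed
  then show ?thesis unfolding colim_def snd_conv
    by (intro some_equality) (use i x in blast)+
qed

lemma colim_one:
  assumes k: "k \<in> K" and i: "i \<in> J"
  shows "\<one>\<^bsub>gr colim k\<^esub> = leg i k \<one>\<^bsub>gr (N i) k\<^esub>"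
proof -
  let ?j = "SOME i. i \<in> J"
  have j: "?j \<in> J" using J_nonempty by (simp add: some_in_eq)
  note o = el_one[OF premod_N[OF i] k] el_one[OF premod_N[OF j] k]
  obtain l where l: "l \<in> J" "below i l" "below ?j l" using directed i j by blast
  have "T i l k \<one>\<^bsub>gr (N i) k\<^esub> = T ?j l k \<one>\<^bsub>gr (N ?j) k\<^esub>"
    using linear_one[OF T_linear[OF i l(1,2)] premod_N premod_N k] i
      linear_one[OF T_linear[OF j l(1,3)] premod_N premod_N k] j l by simp
  then show ?thesis using leg_T[OF k i l(1,2) o(1)] leg_T[OF k j l(1,3) o(2)] by (simp add: colim_def)
qed

lemma colim_el: "el colim k = (\<Union>i\<in>J. leg i k ` el (N i) k)"
  by (simp add: colim_def)

lemma colim_common: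
  assumes "k \<in> K" "a \<in> el colim k" "b \<in> el colim k" "c \<in> el colim k"
  obtains i x y z where "i \<in> J" "x \<in> el (N i) k" "y \<in> el (N i) k" "z \<in> el (N i) k"
    "a = leg i k x" "b = leg i k y" "c = leg i k z"
proof -
  obtain i x j y where ij: "i \<in> J" "x \<in> el (N i) k" "a = leg i k x" "j \<in> J" "y \<in> el (N j) k" "b = leg j k y"
    using assms(2,3) unfolding colim_el by blast
  obtain l where l: "l \<in> J" "T i l k x \<in> el (N l) k" "T j l k y \<in> el (N l) k"
    "a = leg l k (T i l k x)" "b = leg l k (T j l k y)"
    using common[OF assms(1) ij(1,4,2,5)] ij(3,6) by metis
  obtain m z where m: "m \<in> J" "z \<in> el (N m) k" "c = leg m k z" using assms(4) unfolding colim_el by blast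
  obtain n where n: "n \<in> J" "below l n" "below m n" using directed l(1) m(1) by blast
  show ?thesis
    using that[OF n(1) T_el[OF l(1) n(1,2) assms(1) l(2)] T_el[OF l(1) n(1,2) assms(1) l(3)] T_el[OF m(1) n(1,3) assms(1) m(2)]]
      leg_T[OF assms(1) l(1) n(1,2)] leg_T[OF assms(1) m(1) n(1,3)] l m by simp
qed

lemma premod_colim: "premod colim"
  unfolding premod_def
proof (intro conjI ballI)
  fix k assume k: "k \<in> K"
  have el: "leg i k x \<in> el colim k" if "i \<in> J" "x \<in> el (N i) k" for i x using that by (auto simp: colim_el)
  show "comm_group (gr colim k)"
  proof (rule comm_groupI)
    fix a b c assume "a \<in> el colim k" "b \<in> el colim k" "c \<in> el colim k"
    then obtain i x y z where i: "i \<in> J" "x \<in> el (N i) k" "y \<in> el (N i) k" "z \<in> el (N i) k"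
      and e: "a = leg i k x" "b = leg i k y" "c = leg i k z" by (rule colim_common[OF k])
    interpret comm_group "gr (N i) k" using premod_grp[OF premod_N[OF i(1)] k] .
    show "a \<otimes>\<^bsub>gr colim k\<^esub> b \<otimes>\<^bsub>gr colim k\<^esub> c = a \<otimes>\<^bsub>gr colim k\<^esub> (b \<otimes>\<^bsub>gr colim k\<^esub> c)"
      using i e by (simp add: colim_mult[OF k] m_assoc)
  next
    fix a b assume "a \<in> el colim k" "b \<in> el colim k"
    then obtain i x y where i: "i \<in> J" "x \<in> el (N i) k" "y \<in> el (N i) k"
      and e: "a = leg i k x" "b = leg i k y" using colim_common[OF k] by metis
    interpret comm_group "gr (N i) k" using premod_grp[OF premod_N[OF i(1)] k] .
    show "a \<otimes>\<^bsub>gr colim k\<^esub> b = b \<otimes>\<^bsub>gr colim k\<^esub> a" using i e by (simp add: colim_mult[OF k] m_comm)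
    show "a \<otimes>\<^bsub>gr colim k\<^esub> b \<in> el colim k" using i e el by (simp add: colim_mult[OF k])
  next
    obtain i where i: "i \<in> J" using J_nonempty by blast
    then show "\<one>\<^bsub>gr colim k\<^esub> \<in> el colim k" using el el_one[OF premod_N[OF i] k] by (simp add: colim_one[OF k i])
  next
    fix a assume "a \<in> el colim k"
    then obtain i x where i: "i \<in> J" "x \<in> el (N i) k" and e: "a = leg i k x" by (auto simp: colim_el)
    interpret comm_group "gr (N i) k" using premod_grp[OF premod_N[OF i(1)] k] .
    show "\<one>\<^bsub>gr colim k\<^esub> \<otimes>\<^bsub>gr colim k\<^esub> a = a" using i e by (simp add: colim_mult[OF k] colim_one[OF k i(1)])
    show "\<exists>b\<in>el colim k. b \<otimes>\<^bsub>gr colim k\<^esub> a = \<one>\<^bsub>gr colim k\<^esub>"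
      using i e el by (intro bexI[of _ "leg i k (inv\<^bsub>gr (N i) k\<^esub> x)"]) (simp_all add: colim_mult[OF k] colim_one[OF k i(1)])
  qed
next
  fix p assume p: "p \<in> Ops"
  show "ac colim p \<in> hom (gr colim (src p)) (gr colim (tgt p))"
  proof (rule homI)
    fix a assume "a \<in> el colim (src p)"
    then obtain i x where i: "i \<in> J" "x \<in> el (N i) (src p)" "a = leg i (src p) x" by (auto simp: colim_el)
    then show "ac colim p a \<in> el colim (tgt p)"
      using el_act[OF premod_N[OF i(1)] p i(2)] by (auto simp: colim_act[OF p] colim_el)
  next
    fix a b assume "a \<in> el colim (src p)" "b \<in> el colim (src p)"
    then obtain i x y where i: "i \<in> J" "x \<in> el (N i) (src p)" "y \<in> el (N i) (src p)"
      and e: "a = leg i (src p) x" "b = leg i (src p) y" using colim_common[OF src_in[OF p]] by metis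
    note m = premod_N[OF i(1)]
    show "ac colim p (a \<otimes>\<^bsub>gr colim (src p)\<^esub> b) = ac colim p a \<otimes>\<^bsub>gr colim (tgt p)\<^esub> ac colim p b"
      using i el_act[OF m p] el_mult[OF m src_in[OF p]] act_mult[OF m p]
      by (simp add: e colim_mult[OF src_in[OF p]] colim_mult[OF tgt_in[OF p]] colim_act[OF p])
  qed
qed

lemma linear_leg: "i \<in> J \<Longrightarrow> linear (N i) colim (leg i)"
  by (auto simp: linear_def hom_def colim_mult colim_act colim_el)

end

context big_module_category
begin

text \<open>One cocone with injective legs suffices to make the legs of every colimit cocone
  injective, since the former factor through the latter.\<close>

lemma filtered_mono_cocone:
  fixes I :: "('u, 'u) cat"
  assumes I: "category I" and fi: "filtered I" and D: "is_functor I C D"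
    and mono: "\<And>t. t \<in> Arr I \<Longrightarrow> is_mono C (FArr D t)"
  shows "\<exists>M d. is_cocone I C D M d \<and> (\<forall>i\<in>Obj I. \<forall>k\<in>K. inj_on (app (d i) k) (el (md (FObj D i)) k))"
proof -
  obtain pr :: "'u \<times> 'u \<Rightarrow> 'u" where pr: "inj pr" using inj_pairing[OF universe] by blast
  have HomI: "i \<in> Obj I" "j \<in> Obj I" "t \<in> Arr I" if "t \<in> Hom I i j" for t i j
    using that category.Dom_in[OF I] category.Cod_in[OF I] by (auto simp: Hom_iff)
  have Dt: "FArr D t \<in> Hom C (FObj D i) (FObj D j)" if "t \<in> Hom I i j" for t i j
    using D that by (auto simp: is_functor_def Hom_iff)
  have DO: "FObj D i \<in> Obj C" if "i \<in> Obj I" for i using D that by (simp add: is_functor_def)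
  have Dinj: "inj_on (app (FArr D t) k) (el (md (FObj D i)) k)" if "t \<in> Hom I i j" "k \<in> K" for t i j k
    using mono[OF HomI(3)[OF that(1)]] is_mono_iff[OF Dt[OF that(1)]] that(2) by blast
  have Dcomp: "app (FArr D (Comp I s t)) k x = app (FArr D s) k (app (FArr D t) k x)"
    if "t \<in> Hom I i j" "s \<in> Hom I j l" "k \<in> K" "x \<in> el (md (FObj D i)) k" for s t i j l k x
  proof -
    have "FArr D (Comp I s t) = Comp C (FArr D s) (FArr D t)"
      using D that(1,2) by (simp add: is_functor_def Hom_iff)
    then show ?thesis using app_Comp[OF Dt[OF that(1)] Dt[OF that(2)] that(3,4)] by simp
  qed
  \<comment> \<open>Filteredness supplies an arrow equalising the two parallel arrows after
    composition, and that arrow acts injectively.\<close>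
  have par: "app (FArr D s) k x = app (FArr D t) k x"
    if st: "s \<in> Hom I i j" "t \<in> Hom I i j" and k: "k \<in> K" and x: "x \<in> el (md (FObj D i)) k" for s t i j k x
  proof -
    obtain l r where r: "r \<in> Hom I j l" "Comp I r s = Comp I r t"
      using fi st unfolding filtered_def by blast
    have "app (FArr D r) k (app (FArr D s) k x) = app (FArr D r) k (app (FArr D t) k x)"
      using Dcomp[OF st(1) r(1) k x] Dcomp[OF st(2) r(1) k x] r(2) by simp
    then show ?thesis
      by (rule inj_onD[OF Dinj[OF r(1) k]]) (use app_el[OF Dt k x] st in auto)
  qed
  define below where "below i j \<longleftrightarrow> Hom I i j \<noteq> {}" for i j
  define T where "T i j = app (FArr D (SOME s. s \<in> Hom I i j))" for i j
  have some: "(SOME s. s \<in> Hom I i j) \<in> Hom I i j" if "below i j" for i j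
    using that by (simp add: below_def some_in_eq)
  have T: "app (FArr D s) k x = T i j k x" if "s \<in> Hom I i j" "k \<in> K" "x \<in> el (md (FObj D i)) k" for s i j k x
    unfolding T_def by (rule par[OF that(1) some that(2,3)]) (use that in \<open>auto simp: below_def\<close>)
  interpret S: directed_system K Ops src tgt "Obj I" below "\<lambda>i. md (FObj D i)" T pr
  proof
    show "Obj I \<noteq> {}" using fi by (simp add: filtered_def)
    show "\<exists>l\<in>Obj I. below i l \<and> below j l" if "i \<in> Obj I" "j \<in> Obj I" for i j
      using fi that by (simp add: filtered_def below_def)
    show "below i i" if "i \<in> Obj I" for i using category.Ident_in[OF I that] by (auto simp: below_def)
    show "below i l" if "below i j" "below j l" for i j l
      using that category.Comp_in[OF I] unfolding below_def by blast
    show "premod (md (FObj D i))" if "i \<in> Obj I" for i using md[OF DO[OF that]] .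
    show "linear (md (FObj D i)) (md (FObj D j)) (T i j)" if "below i j" for i j
      unfolding T_def using app_linear[OF Dt[OF some[OF that]]] .
    show "inj_on (T i j k) (el (md (FObj D i)) k)" if "below i j" "k \<in> K" for i j k
      unfolding T_def using Dinj[OF some[OF that(1)] that(2)] .
    show "T j l k (T i j k x) = T i l k x"
      if "below i j" "below j l" "k \<in> K" "x \<in> el (md (FObj D i)) k" for i j l k x
      using Dcomp[OF some[OF that(1)] some[OF that(2)] that(3,4)]
        T[OF category.Comp_in[OF I some[OF that(1)] some[OF that(2)]] that(3,4)]
      by (simp add: T_def)
  qed (rule pr)
  \<comment> \<open>Every element of the colimit lies in the image of a leg from some
    \<open>FObj D i\<close>, which is exactly the hypothesis of \<open>ob_cover\<close>.\<close>
  have "\<exists>Z\<in>Obj C. eqmod (md Z) S.colim"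
    by (rule ob_cover[OF S.premod_colim]) (use S.linear_leg DO in \<open>fastforce simp: S.colim_el\<close>)
  then obtain Z where Z: "Z \<in> Obj C" "eqmod (md Z) S.colim" by blast
  note l = linear_eqmod_right[OF Z(2) S.premod_colim S.linear_leg]
  define d where "d i = mk (FObj D i) Z (S.leg i)" for i
  have d: "d i \<in> Hom C (FObj D i) Z" "k \<in> K \<Longrightarrow> x \<in> el (md (FObj D i)) k \<Longrightarrow> app (d i) k x = S.leg i k x"
    if "i \<in> Obj I" for i k x using mk[OF DO[OF that] Z(1) l[OF that]] by (simp_all add: d_def)
  have "is_cocone I C D Z d" unfolding is_cocone_def
  proof (intro conjI ballI Z(1) d(1))
    fix t assume "t \<in> Arr I"
    then have t: "t \<in> Hom I (Dom I t) (Cod I t)" by (simp add: Hom_iff)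
    note o = HomI[OF t] and h = Dt[OF t]
    show "Comp C (d (Cod I t)) (FArr D t) = d (Dom I t)"
    proof (rule arr_ext[OF Comp_in[OF h d(1)[OF o(2)]] d(1)[OF o(1)]])
      fix k x assume k: "k \<in> K" and x: "x \<in> el (md (FObj D (Dom I t))) k"
      have "S.leg (Cod I t) k (T (Dom I t) (Cod I t) k x) = S.leg (Dom I t) k x"
        using S.leg_T[OF k o(1,2) _ x] t by (auto simp: below_def)
      then show "app (Comp C (d (Cod I t)) (FArr D t)) k x = app (d (Dom I t)) k x"
        using app_Comp[OF h d(1)[OF o(2)] k x] d(2)[OF o(2) k app_el[OF h k x]] d(2)[OF o(1) k x] T[OF t k x] by simp
    qed
  qed
  moreover have "inj_on (app (d i) k) (el (md (FObj D i)) k)" if "i \<in> Obj I" "k \<in> K" for i k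
    using S.leg_inj[OF that(2,1)] d(2)[OF that] by (simp add: inj_on_def)
  ultimately show ?thesis by blast
qed

lemma finitely_generated_of_fg:
  assumes X: "X \<in> Obj C" and fg: "fg_sub (md X) (el (md X))"
  shows "finitely_generated TYPE('u) C X"
  unfolding finitely_generated_def
proof (intro conjI allI impI X; elim conjE)
  fix I :: "('u, 'u) cat" and D L c
  assume I: "category I" and fi: "filtered I" and D: "is_functor I C D"
    and mono: "\<forall>t\<in>Arr I. is_mono C (FArr D t)" and col: "is_colimit I C D L c"
  have co: "is_cocone I C D L c" and
    univ: "\<And>M d. is_cocone I C D M d \<Longrightarrow> \<exists>!u. u \<in> Hom C L M \<and> (\<forall>i\<in>Obj I. Comp C u (c i) = d i)"
    using col by (auto simp: is_colimit_def)
  have L: "L \<in> Obj C" and c: "\<And>i. i \<in> Obj I \<Longrightarrow> c i \<in> Hom C (FObj D i) L"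
    and ct: "\<And>t. t \<in> Arr I \<Longrightarrow> Comp C (c (Cod I t)) (FArr D t) = c (Dom I t)"
    using co by (auto simp: is_cocone_def)
  have HomI: "i \<in> Obj I" "j \<in> Obj I" "t \<in> Arr I" "Dom I t = i" "Cod I t = j" if "t \<in> Hom I i j" for t i j
    using that category.Dom_in[OF I] category.Cod_in[OF I] by (auto simp: Hom_iff)
  have Dt: "FArr D t \<in> Hom C (FObj D i) (FObj D j)" if "t \<in> Hom I i j" for t i j
    using D that by (auto simp: is_functor_def Hom_iff)
  have DO: "FObj D i \<in> Obj C" if "i \<in> Obj I" for i using D that by (simp add: is_functor_def)
  have dir: "\<exists>l\<in>Obj I. Hom I i l \<noteq> {} \<and> Hom I j l \<noteq> {}" if "i \<in> Obj I" "j \<in> Obj I" for i j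
    using fi that by (simp add: filtered_def)
  have push: "app (c j) k (app (FArr D t) k x) = app (c i) k x"
    if "t \<in> Hom I i j" "k \<in> K" "x \<in> el (md (FObj D i)) k" for t i j k x
    using ct[OF HomI(3)[OF that(1)]] app_Comp[OF Dt[OF that(1)] c[OF HomI(2)[OF that(1)]] that(2,3)]
      HomI(4,5)[OF that(1)] by simp
  \<comment> \<open>The colimit leg composed with the mediating arrow to the cocone of
    \<open>filtered_mono_cocone\<close> is injective, so the leg is injective.\<close>
  have inj: "inj_on (app (c i) k) (el (md (FObj D i)) k)" if i: "i \<in> Obj I" and k: "k \<in> K" for i k
  proof -
    obtain M d where d: "is_cocone I C D M d" "\<forall>i\<in>Obj I. \<forall>k\<in>K. inj_on (app (d i) k) (el (md (FObj D i)) k)"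
      using filtered_mono_cocone[OF I fi D] mono by blast
    then obtain u where u: "u \<in> Hom C L M" "\<forall>i\<in>Obj I. Comp C u (c i) = d i" using univ by blast
    have "app (d i) k x = app u k (app (c i) k x)" if "x \<in> el (md (FObj D i)) k" for x
      using app_Comp[OF c[OF i] u(1) k that] u(2) i by simp
    then show ?thesis using d(2) i k by (metis (mono_tags, lifting) inj_on_def)
  qed
  define U where "U k = (\<Union>i\<in>Obj I. app (c i) k ` el (md (FObj D i)) k)" for k
  have mono_im: "app (c i) k ` el (md (FObj D i)) k \<subseteq> app (c j) k ` el (md (FObj D j)) k"
    if "t \<in> Hom I i j" "k \<in> K" for t i j k
    using push[OF that] app_el[OF Dt[OF that(1)] that(2)] by (metis image_eqI image_subsetI)
  have sub: "submodule (md L) (\<lambda>k. app (c i) k ` el (md (FObj D i)) k)" if "i \<in> Obj I" for i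
    using submodule_image[OF app_linear[OF c[OF that]]] md DO[OF that] L submodule_el by blast
  have U: "submodule (md L) U"
  proof (rule submoduleI[OF md[OF L]])
    show "x \<in> el (md L) k" if "k \<in> K" "x \<in> U k" for k x using that app_el[OF c] by (auto simp: U_def)
    show "\<one>\<^bsub>gr (md L) k\<^esub> \<in> U k" if "k \<in> K" for k
    proof -
      obtain i where i: "i \<in> Obj I" using fi by (auto simp: filtered_def)
      then show ?thesis using sub_one[OF sub[OF i] that] by (auto simp: U_def)
    qed
    show "x \<otimes>\<^bsub>gr (md L) k\<^esub> y \<in> U k" if k: "k \<in> K" and x: "x \<in> U k" and y: "y \<in> U k" for k x y
    proof -
      obtain i j where ij: "i \<in> Obj I" "x \<in> app (c i) k ` el (md (FObj D i)) k"
        "j \<in> Obj I" "y \<in> app (c j) k ` el (md (FObj D j)) k" using x y by (auto simp: U_def)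
      obtain l s t where l: "l \<in> Obj I" "s \<in> Hom I i l" "t \<in> Hom I j l" using dir[OF ij(1,3)] by blast
      have "x \<in> app (c l) k ` el (md (FObj D l)) k" "y \<in> app (c l) k ` el (md (FObj D l)) k"
        using mono_im[OF l(2) k] mono_im[OF l(3) k] ij by blast+
      then show ?thesis using sub_mult[OF sub[OF l(1)] k] l(1) unfolding U_def by blast
    qed
    show "inv\<^bsub>gr (md L) k\<^esub> x \<in> U k" if "k \<in> K" "x \<in> U k" for k x
      using that sub_inv[OF sub that(1)] unfolding U_def by blast
    show "ac (md L) p x \<in> U (tgt p)" if "p \<in> Ops" "x \<in> U (src p)" for p x
      using that sub_act[OF sub that(1)] unfolding U_def by blast
  qed
  \<comment> \<open>The legs corestrict to the submodule \<open>U\<close> swept out by their images.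
    Mediating to it and including back is the identity of \<open>L\<close> by uniqueness, so
    \<open>U\<close> is all of \<open>L\<close>.\<close>
  have cover: "\<exists>i\<in>Obj I. y \<in> app (c i) k ` el (md (FObj D i)) k" if k: "k \<in> K" and y: "y \<in> el (md L) k" for k y
  proof -
    note S = sub_ob(1)[OF L U] and Sel = sub_ob_el[OF L U] and j = incl[OF L U]
    have lin: "linear (md (FObj D i)) (md (sub_ob L U)) (app (c i))" if i: "i \<in> Obj I" for i
      by (rule linear_into_sub_ob[OF L U md[OF DO[OF i]] app_linear[OF c[OF i]]]) (use i in \<open>auto simp: U_def\<close>)
    define d where "d i = mk (FObj D i) (sub_ob L U) (app (c i))" for i
    have d: "d i \<in> Hom C (FObj D i) (sub_ob L U)"
      "k \<in> K \<Longrightarrow> x \<in> el (md (FObj D i)) k \<Longrightarrow> app (d i) k x = app (c i) k x" if "i \<in> Obj I" for i k x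
      using mk[OF DO[OF that] S lin[OF that]] by (simp_all add: d_def)
    have "is_cocone I C D (sub_ob L U) d" unfolding is_cocone_def
    proof (intro conjI ballI S d(1))
      fix t assume "t \<in> Arr I"
      then have t: "t \<in> Hom I (Dom I t) (Cod I t)" by (simp add: Hom_iff)
      note o = HomI[OF t] and h = Dt[OF t]
      show "Comp C (d (Cod I t)) (FArr D t) = d (Dom I t)"
        by (rule arr_ext[OF Comp_in[OF h d(1)[OF o(2)]] d(1)[OF o(1)]])
          (simp add: app_Comp[OF h d(1)[OF o(2)]] d(2)[OF o(2)] d(2)[OF o(1)] app_el[OF h] push[OF t])
    qed
    then obtain u where u: "u \<in> Hom C L (sub_ob L U)" "\<And>i. i \<in> Obj I \<Longrightarrow> Comp C u (c i) = d i"
      using univ by blast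
    note v = Comp_in[OF u(1) j(1)]
    have "Comp C (Comp C (incl L U) u) (c i) = c i" if i: "i \<in> Obj I" for i
    proof (rule arr_ext[OF Comp_in[OF c[OF i] v] c[OF i]])
      fix k x assume k: "k \<in> K" and x: "x \<in> el (md (FObj D i)) k"
      have "app u k (app (c i) k x) = app (c i) k x"
        using app_Comp[OF c[OF i] u(1) k x] u(2)[OF i] d(2)[OF i k x] by simp
      moreover have "app (c i) k x \<in> U k" using i x by (auto simp: U_def)
      ultimately show "app (Comp C (Comp C (incl L U) u) (c i)) k x = app (c i) k x"
        using app_Comp[OF c[OF i] v k x] app_Comp[OF u(1) j(1) k app_el[OF c[OF i] k x]] j(2)[OF k] by simp
    qed
    moreover have "Comp C (Ident C L) (c i) = c i" if i: "i \<in> Obj I" for i using Ident_left[OF c[OF i]] .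
    ultimately have "Comp C (incl L U) u = Ident C L"
      using univ[OF co] v Ident_in[OF L] by blast
    moreover have uy: "app u k y \<in> U k" using app_el[OF u(1) k y] Sel[OF k] by simp
    ultimately have "y = app u k y"
      using app_Comp[OF u(1) j(1) k y] j(2)[OF k uy] app_Ident[OF L k y] by simp
    then show ?thesis using uy unfolding U_def by auto
  qed
  obtain E where E: "finite E" "E \<subseteq> Sigma K (el (md X))" "\<forall>k\<in>K. el (md X) k \<subseteq> span (md X) E k"
    using fg by (auto simp: fg_sub_def)
  \<comment> \<open>Finitely many generators are sent into the image of one common leg. The preimage
    of that image under \<open>f\<close> is a submodule containing the generators, so all of
    \<open>f\<close> factors through the stage.\<close>
  have fact: "\<exists>i\<in>Obj I. \<exists>u\<in>Hom C X (FObj D i). f = Comp C (c i) u" if f: "f \<in> Hom C X L" for f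
  proof -
    have "\<exists>i\<in>Obj I. \<forall>(k, x)\<in>E. app f k x \<in> app (c i) k ` el (md (FObj D i)) k" using E(1,2)
    proof (induction E)
      case empty
      then show ?case using fi by (auto simp: filtered_def)
    next
      case (insert e E)
      then obtain i where i: "i \<in> Obj I" "\<forall>(k, x)\<in>E. app f k x \<in> app (c i) k ` el (md (FObj D i)) k" by auto
      obtain k x where e: "e = (k, x)" "k \<in> K" "x \<in> el (md X) k" using insert.prems by auto
      obtain j where j: "j \<in> Obj I" "app f k x \<in> app (c j) k ` el (md (FObj D j)) k"
        using cover[OF e(2) app_el[OF f e(2,3)]] by blast
      obtain l s t where l: "l \<in> Obj I" "s \<in> Hom I i l" "t \<in> Hom I j l" using dir[OF i(1) j(1)] by blast
      have "app f k' x' \<in> app (c l) k' ` el (md (FObj D l)) k'" if "(k', x') \<in> E" for k' x'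
      proof -
        have "k' \<in> K" using that insert.prems by auto
        moreover have "app f k' x' \<in> app (c i) k' ` el (md (FObj D i)) k'" using i(2) that by auto
        ultimately show ?thesis using mono_im[OF l(2)] by blast
      qed
      moreover have "app f k x \<in> app (c l) k ` el (md (FObj D l)) k" using mono_im[OF l(3) e(2)] j(2) by blast
      ultimately show ?case using l(1) e(1) by (intro bexI[of _ l]) auto
    qed
    then obtain i where i: "i \<in> Obj I" "\<And>k x. (k, x) \<in> E \<Longrightarrow> app f k x \<in> app (c i) k ` el (md (FObj D i)) k" by blast
    let ?P = "preim (md X) (app f) (\<lambda>k. app (c i) k ` el (md (FObj D i)) k)"
    have P: "submodule (md X) ?P" by (rule submodule_preim[OF app_linear[OF f] md[OF X] md[OF L] sub[OF i(1)]])
    have "E \<subseteq> Sigma K ?P" using E(2) i(2) by (auto simp: preim_def)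
    then have "el (md X) k \<subseteq> ?P k" if "k \<in> K" for k using E(3) that span_least[OF P] by blast
    then have "\<exists>!u. u \<in> Hom C X (FObj D i) \<and> Comp C (c i) u = f"
      by (intro lift_mono[OF c[OF i(1)] f inj[OF i(1)]]) (auto simp: preim_def)
    then show ?thesis using i(1) by blast
  qed
  let ?H = "comp_functor (hom_functor C X) D" and ?c = "\<lambda>i. FArr (hom_functor C X) (c i)"
  have HO: "FObj ?H i = Hom C X (FObj D i)" for i by (simp add: comp_functor_def hom_functor_def)
  have HA: "FArr ?H t = \<lparr>Src = Hom C X (FObj D i), Tgt = Hom C X (FObj D j),
      App = (\<lambda>h\<in>Hom C X (FObj D i). Comp C (FArr D t) h)\<rparr>" if "t \<in> Hom I i j" for t i j
    using Dt[OF that] by (simp add: comp_functor_def hom_functor_def Hom_iff)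
  have Hc: "?c i = \<lparr>Src = Hom C X (FObj D i), Tgt = Hom C X L,
      App = (\<lambda>h\<in>Hom C X (FObj D i). Comp C (c i) h)\<rparr>" if "i \<in> Obj I" for i
    using c[OF that] by (simp add: hom_functor_def Hom_iff)
  have HL: "FObj (hom_functor C X) L = Hom C X L" by (simp add: hom_functor_def)
  have cc: "Comp C (c j) (Comp C (FArr D t) h) = Comp C (c i) h" if "t \<in> Hom I i j" "h \<in> Hom C X (FObj D i)" for t i j h
    using Comp_assoc[OF that(2) Dt[OF that(1)] c[OF HomI(2)[OF that(1)]]] ct[OF HomI(3)[OF that(1)]] HomI(4,5)[OF that(1)] by simp
  have cinj: "u = v" if i: "i \<in> Obj I" and uv: "u \<in> Hom C X (FObj D i)" "v \<in> Hom C X (FObj D i)"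
    and e: "Comp C (c i) u = Comp C (c i) v" for i u v
  proof -
    have "is_mono C (c i)" using is_mono_iff[OF c[OF i]] inj[OF i] by blast
    moreover have "Dom C (c i) = FObj D i" using c[OF i] by (simp add: Hom_iff)
    ultimately show ?thesis using uv e unfolding is_mono_def by metis
  qed
  have cocone: "is_cocone I set_category ?H (Hom C X L) ?c" unfolding is_cocone_def
  proof (intro conjI ballI)
    show "?c i \<in> Hom set_category (FObj ?H i) (Hom C X L)" if "i \<in> Obj I" for i
      using Comp_in[OF _ c[OF that]] by (auto simp: Hom_set_category Hc[OF that] HO)
    show "Comp set_category (?c (Cod I t)) (FArr ?H t) = ?c (Dom I t)" if t: "t \<in> Arr I" for t
    proof -
      have t': "t \<in> Hom I (Dom I t) (Cod I t)" using t by (simp add: Hom_iff)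
      have "compose (Hom C X (FObj D (Dom I t))) (\<lambda>h\<in>Hom C X (FObj D (Cod I t)). Comp C (c (Cod I t)) h)
          (\<lambda>h\<in>Hom C X (FObj D (Dom I t)). Comp C (FArr D t) h) =
          (\<lambda>h\<in>Hom C X (FObj D (Dom I t)). Comp C (c (Dom I t)) h)"
        by (rule ext) (simp add: compose_def cc[OF t'] Comp_in[OF _ Dt[OF t']])
      then show ?thesis by (simp add: Hc[OF HomI(1)[OF t']] Hc[OF HomI(2)[OF t']] HA[OF t'])
    qed
  qed simp
  show "is_colimit I set_category ?H (FObj (hom_functor C X) L) ?c"
    unfolding is_colimit_def HL
  proof (intro conjI allI impI cocone)
    fix M d assume "is_cocone I set_category ?H M d"
    then have d: "\<And>i. i \<in> Obj I \<Longrightarrow> d i \<in> Hom set_category (Hom C X (FObj D i)) M"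
      and dt: "\<And>t. t \<in> Arr I \<Longrightarrow> Comp set_category (d (Cod I t)) (FArr ?H t) = d (Dom I t)"
      by (auto simp: is_cocone_def HO)
    have d': "Src (d i) = Hom C X (FObj D i)" "Tgt (d i) = M" "App (d i) \<in> Hom C X (FObj D i) \<rightarrow>\<^sub>E M" if "i \<in> Obj I" for i
      using d[OF that] by (auto simp: Hom_set_category)
    have pushd: "App (d j) (Comp C (FArr D t) h) = App (d i) h" if t: "t \<in> Hom I i j" and h: "h \<in> Hom C X (FObj D i)" for t i j h
    proof -
      have e: "Comp set_category (d j) (FArr ?H t) = d i" using dt[OF HomI(3)[OF t]] HomI(4,5)[OF t] by simp
      show ?thesis using fun_cong[OF arg_cong[OF e, of App], of h] h by (simp add: HA[OF t] compose_def)
    qed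
    have wd: "App (d i) u = App (d j) v"
      if ij: "i \<in> Obj I" "j \<in> Obj I" and uv: "u \<in> Hom C X (FObj D i)" "v \<in> Hom C X (FObj D j)"
        and e: "Comp C (c i) u = Comp C (c j) v" for i j u v
    proof -
      obtain l s t where l: "l \<in> Obj I" "s \<in> Hom I i l" "t \<in> Hom I j l" using dir[OF ij] by blast
      have "Comp C (FArr D s) u = Comp C (FArr D t) v"
        using cinj[OF l(1) Comp_in[OF uv(1) Dt[OF l(2)]] Comp_in[OF uv(2) Dt[OF l(3)]]]
          cc[OF l(2) uv(1)] cc[OF l(3) uv(2)] e by simp
      then show ?thesis using pushd[OF l(2) uv(1)] pushd[OF l(3) uv(2)] by simp
    qed
    define w where "w f = (SOME z. \<exists>i\<in>Obj I. \<exists>u\<in>Hom C X (FObj D i). f = Comp C (c i) u \<and> z = App (d i) u)" for f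
    have w: "w (Comp C (c i) u) = App (d i) u" if i: "i \<in> Obj I" and u: "u \<in> Hom C X (FObj D i)" for i u
      unfolding w_def
    proof (rule some_equality)
      show "\<exists>j\<in>Obj I. \<exists>v\<in>Hom C X (FObj D j). Comp C (c i) u = Comp C (c j) v \<and> App (d i) u = App (d j) v"
        using i u by blast
    qed (use wd[OF i _ u] in metis)
    let ?w = "\<lparr>Src = Hom C X L, Tgt = M, App = (\<lambda>f\<in>Hom C X L. w f)\<rparr>"
    show "\<exists>!u. u \<in> Hom set_category (Hom C X L) M \<and> (\<forall>i\<in>Obj I. Comp set_category u (?c i) = d i)"
    proof (rule ex1I[of _ ?w])
      have "w f \<in> M" if "f \<in> Hom C X L" for f
        using fact[OF that] w PiE_mem[OF d'(3)] by auto
      moreover have "Comp set_category ?w (?c i) = d i" if i: "i \<in> Obj I" for i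
      proof -
        have "compose (Hom C X (FObj D i)) (\<lambda>f\<in>Hom C X L. w f) (\<lambda>h\<in>Hom C X (FObj D i). Comp C (c i) h) = App (d i)"
        proof (rule ext)
          fix h
          show "compose (Hom C X (FObj D i)) (\<lambda>f\<in>Hom C X L. w f) (\<lambda>h\<in>Hom C X (FObj D i). Comp C (c i) h) h = App (d i) h"
            using w[OF i, of h] Comp_in[OF _ c[OF i], of h X] PiE_arb[OF d'(3)[OF i], of h] by (simp add: compose_def)
        qed
        then show ?thesis using d'(1,2)[OF i] by (simp add: Hc[OF i])
      qed
      ultimately show "?w \<in> Hom set_category (Hom C X L) M \<and> (\<forall>i\<in>Obj I. Comp set_category ?w (?c i) = d i)"
        by (auto simp: Hom_set_category)
      fix u assume u: "u \<in> Hom set_category (Hom C X L) M \<and> (\<forall>i\<in>Obj I. Comp set_category u (?c i) = d i)"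
      then have u': "Src u = Hom C X L" "Tgt u = M" "App u \<in> Hom C X L \<rightarrow>\<^sub>E M" by (auto simp: Hom_set_category)
      have "App u f = (\<lambda>f\<in>Hom C X L. w f) f" for f
      proof (cases "f \<in> Hom C X L")
        case True
        then obtain i v where i: "i \<in> Obj I" and v: "v \<in> Hom C X (FObj D i)" and f: "f = Comp C (c i) v" using fact by blast
        have e: "Comp set_category u (?c i) = d i" using u i by blast
        have "App u f = App (d i) v"
          using fun_cong[OF arg_cong[OF e, of App], of v] v f True by (simp add: Hc[OF i] compose_def)
        then show ?thesis using w[OF i v] True f by simp
      next
        case False
        then show ?thesis using PiE_arb[OF u'(3)] by simp
      qed
      then show "u = ?w" using u'(1,2) by (simp add: fun_eq_iff)
    qed
  qed
qed

lemma finitely_generated_iff: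
  "finitely_generated TYPE('u) C X \<longleftrightarrow> X \<in> Obj C \<and> fg_sub (md X) (el (md X))"
  using fg_of_finitely_generated finitely_generated_of_fg by (auto simp: finitely_generated_def)

lemma noeth_sub_of_noetherian:
  assumes "noetherian TYPE('u) C X" shows "noeth_sub (md X) (el (md X))"
  unfolding noeth_sub_def
proof (intro allI impI)
  fix W assume W: "submodule (md X) W"
  have X: "X \<in> Obj C" using assms by (simp add: noetherian_def)
  note i = incl[OF X W] and S = sub_ob_el[OF X W]
  have "is_mono C (incl X W)" using is_mono_iff[OF i(1)] i(2) S by (auto simp: inj_on_def)
  then have "finitely_generated TYPE('u) C (sub_ob X W)"
    using assms i(1) unfolding noetherian_def Hom_iff by metis
  then have "fg_sub (md (sub_ob X W)) (el (md (sub_ob X W)))" by (rule fg_of_finitely_generated)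
  then obtain E where E: "finite E" "E \<subseteq> Sigma K (el (md (sub_ob X W)))"
      "\<forall>k\<in>K. el (md (sub_ob X W)) k \<subseteq> span (md (sub_ob X W)) E k"
    by (auto simp: fg_sub_def)
  have im: "image_elts (app (incl X W)) E = E"
    using E(2) i(2) S unfolding image_elts_def by force
  have "w \<in> span (md X) E k" if "k \<in> K" "w \<in> W k" for k w
  proof -
    have "w \<in> span (md (sub_ob X W)) E k" using E(3) that S[OF that(1)] by blast
    from span_linear[OF app_linear[OF i(1)] md[OF sub_ob(1)[OF X W]] md[OF X] E(2) this] show ?thesis
      using im i(2)[OF that] by simp
  qed
  moreover have "E \<subseteq> Sigma K W" using E(2) S by auto
  ultimately show "fg_sub (md X) W" unfolding fg_sub_def
    by (intro exI[of _ E] conjI E(1) ballI subsetI) blast+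
qed

text \<open>The elements with noetherian span form a submodule \<open>?U\<close>. If the projection
  modulo \<open>?U\<close> were nonzero, a noetherian generator \<open>Y\<close> would have an arrow
  into \<open>X\<close> surviving it; but the image of \<open>Y\<close> is noetherian and so lies in
  \<open>?U\<close>.\<close>

lemma locally_noetherian_span:
  assumes ln: "locally_noetherian TYPE('u) C" and X: "X \<in> Obj C" and k: "k \<in> K" and x: "x \<in> el (md X) k"
  shows "noeth_sub (md X) (span (md X) {(k, x)})"
proof -
  obtain G where G: "generating_set C G" "\<forall>Y\<in>G. noetherian TYPE('u) C Y"
    using ln by (auto simp: locally_noetherian_def)
  let ?U = "\<lambda>k. {x \<in> el (md X) k. noeth_sub (md X) (span (md X) {(k, x)})}"
  have U: "submodule (md X) ?U" by (rule noeth_sub_span_closed[OF md[OF X]])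
  note p = proj[OF X U] and Q = quot_ob(1)[OF X U]
  note t = trivial_arrow[OF X Q]
  have "proj X ?U = trivial_arrow X (quot_ob X ?U)"
  proof (rule ccontr)
    assume "proj X ?U \<noteq> trivial_arrow X (quot_ob X ?U)"
    then obtain Y h where Y: "Y \<in> G" "h \<in> Hom C Y X" "Comp C (proj X ?U) h \<noteq> Comp C (trivial_arrow X (quot_ob X ?U)) h"
      using G(1) p(1) t(1) unfolding generating_set_def by blast
    have YO: "Y \<in> Obj C" using Hom_Obj[OF Y(2)] by blast
    have n: "noeth_sub (md X) (\<lambda>k. app h k ` el (md Y) k)"
      by (rule noeth_sub_image[OF md[OF YO] md[OF X] app_linear[OF Y(2)] noeth_sub_of_noetherian]) (use G(2) Y(1) in blast)
    have s: "submodule (md X) (\<lambda>k. app h k ` el (md Y) k)"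
      by (rule submodule_image[OF app_linear[OF Y(2)] md[OF YO] md[OF X] submodule_el[OF md[OF YO]]])
    have "app h k y \<in> ?U k" if ky: "k \<in> K" "y \<in> el (md Y) k" for k y
    proof -
      have "noeth_sub (md X) (span (md X) {(k, app h k y)})"
        by (rule noeth_sub_mono[OF n]) (rule span_least[OF s], use ky in auto)
      then show ?thesis using app_el[OF Y(2) ky] by simp
    qed
    then have "app (proj X ?U) k (app h k y) = app (trivial_arrow X (quot_ob X ?U)) k (app h k y)"
      if "k \<in> K" "y \<in> el (md Y) k" for k y
      using p(3)[OF that(1) app_el[OF Y(2) that]] t(2)[OF that(1) app_el[OF Y(2) that]] that by simp
    then have "Comp C (proj X ?U) h = Comp C (trivial_arrow X (quot_ob X ?U)) h"
      using app_Comp[OF Y(2) p(1)] app_Comp[OF Y(2) t(1)]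
      by (intro arr_ext[OF Comp_in[OF Y(2) p(1)] Comp_in[OF Y(2) t(1)]]) simp
    then show False using Y(3) by blast
  qed
  then have "x \<in> ?U k" using p(3)[OF k x] t(2)[OF k x] by simp
  then show ?thesis by simp
qed

end

section \<open>Modules and FI-modules\<close>

lemma category_Ab: "category Ab"
proof
  fix f g h :: "('a monoid, 'a \<Rightarrow> 'a) arrow" and a b c d
  assume f: "f \<in> Hom Ab a b"
  then have f': "Src f = a" "Tgt f = b" "App f \<in> hom a b" "App f \<in> extensional (carrier a)" "comm_group a" "comm_group b"
    by (auto simp: Hom_def Ab_def)
  show "Comp Ab (Ident Ab b) f = f" "Comp Ab f (Ident Ab a) = f"
    using f' by (auto simp: Ab_def compose_def fun_eq_iff extensional_def hom_def intro!: arrow.equality)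
  assume "g \<in> Hom Ab b c"
  then have g': "Src g = b" "Tgt g = c" "App g \<in> hom b c" "App g \<in> extensional (carrier b)" "comm_group b" "comm_group c"
    by (auto simp: Hom_def Ab_def)
  show "Comp Ab g f \<in> Hom Ab a c"
    using f' g' by (simp add: Hom_def Ab_def) (simp add: compose_def hom_def Pi_iff comm_group.axioms(2)[THEN group.is_monoid, THEN monoid.m_closed])
  assume "h \<in> Hom Ab c d"
  then show "Comp Ab h (Comp Ab g f) = Comp Ab (Comp Ab h g) f"
    using f' g' by (auto simp: Hom_def Ab_def compose_def hom_def fun_eq_iff)
next
  fix a :: "'a monoid" assume "a \<in> Obj Ab"
  then interpret comm_group a by (simp add: Ab_def)
  show "Ident Ab a \<in> Hom Ab a a" using comm_group_axioms by (auto simp: Hom_def Ab_def hom_def)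
qed (auto simp: Ab_def)

lemma Hom_Ab: "f \<in> Hom Ab G H \<longleftrightarrow> Src f = G \<and> Tgt f = H \<and> comm_group G \<and> comm_group H \<and>
    App f \<in> hom G H \<and> App f \<in> extensional (carrier G)"
  by (auto simp: Hom_def Ab_def)

lemma Ab_simps [simp]:
  "Obj Ab = {G. comm_group G}" "Dom Ab = Src" "Cod Ab = Tgt"
  "App (Comp Ab g f) = compose (carrier (Src f)) (App g) (App f)"
  "App (Ident Ab G) = (\<lambda>x\<in>carrier G. x)"
  "App (HAdd Ab f g) = (\<lambda>x\<in>carrier (Src f). App f x \<otimes>\<^bsub>Tgt f\<^esub> App g x)"
  by (simp_all add: Ab_def)

lemma functor_category_simps [simp]:
  "Obj (functor_category C D) = {F. is_functor C D F}"
  "Dom (functor_category C D) = Src" "Cod (functor_category C D) = Tgt"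
  "App (Comp (functor_category C D) u t) = (\<lambda>a\<in>Obj C. Comp D (App u a) (App t a))"
  "App (Ident (functor_category C D) F) = (\<lambda>a\<in>Obj C. Ident D (FObj F a))"
  by (simp_all add: functor_category_def)

lemma Hom_functor_category:
  "t \<in> Hom (functor_category C D) F G \<longleftrightarrow> Src t = F \<and> Tgt t = G \<and> is_functor C D F \<and> is_functor C D G \<and>
    App t \<in> extensional (Obj C) \<and> (\<forall>a\<in>Obj C. App t a \<in> Hom D (FObj F a) (FObj G a)) \<and>
    (\<forall>f\<in>Arr C. Comp D (App t (Cod C f)) (FArr F f) = Comp D (FArr G f) (App t (Dom C f)))"
  by (auto simp: Hom_def functor_category_def)

lemma category_functor_category:
  assumes "category C" "category D" shows "category (functor_category C D)"
proof -
  interpret C: category C by fact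
  interpret D: category D by fact
  have FH: "FArr F x \<in> Hom D (FObj F (Dom C x)) (FObj F (Cod C x))" if "is_functor C D F" "x \<in> Arr C" for F x
    using that by (simp add: is_functor_def)
  have FO: "FObj F a \<in> Obj D" if "is_functor C D F" "a \<in> Obj C" for F a using that by (simp add: is_functor_def)
  show ?thesis
  proof
    fix f F G assume f: "f \<in> Hom (functor_category C D) F G"
    note f' = f[unfolded Hom_functor_category]
    have fa: "App f a \<in> Hom D (FObj F a) (FObj G a)" if "a \<in> Obj C" for a using f' that by blast
    have ex: "App f a = undefined" if "a \<notin> Obj C" for a using f' that by (simp add: extensional_def)
    show "Comp (functor_category C D) (Ident (functor_category C D) G) f = f"
      using f' D.Ident_left[OF fa] ex by (auto simp: functor_category_def fun_eq_iff intro!: arrow.equality)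
    show "Comp (functor_category C D) f (Ident (functor_category C D) F) = f"
      using f' D.Ident_right[OF fa] ex by (auto simp: functor_category_def fun_eq_iff intro!: arrow.equality)
    fix g H assume g: "g \<in> Hom (functor_category C D) G H"
    note g' = g[unfolded Hom_functor_category]
    have ga: "App g a \<in> Hom D (FObj G a) (FObj H a)" if "a \<in> Obj C" for a using g' that by blast
    have "Comp D (Comp D (App g (Cod C x)) (App f (Cod C x))) (FArr F x) =
        Comp D (FArr H x) (Comp D (App g (Dom C x)) (App f (Dom C x)))" if x: "x \<in> Arr C" for x
    proof -
      have o: "Dom C x \<in> Obj C" "Cod C x \<in> Obj C" using C.Dom_in C.Cod_in x by blast+
      have "Comp D (Comp D (App g (Cod C x)) (App f (Cod C x))) (FArr F x) =
          Comp D (App g (Cod C x)) (Comp D (App f (Cod C x)) (FArr F x))"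
        using D.Comp_assoc[OF FH fa[OF o(2)] ga[OF o(2)]] f' x by simp
      also have "\<dots> = Comp D (App g (Cod C x)) (Comp D (FArr G x) (App f (Dom C x)))" using f' x by simp
      also have "\<dots> = Comp D (Comp D (App g (Cod C x)) (FArr G x)) (App f (Dom C x))"
        using D.Comp_assoc[OF fa[OF o(1)] FH ga[OF o(2)]] f' x by simp
      also have "\<dots> = Comp D (Comp D (FArr H x) (App g (Dom C x))) (App f (Dom C x))" using g' x by simp
      also have "\<dots> = Comp D (FArr H x) (Comp D (App g (Dom C x)) (App f (Dom C x)))"
        using D.Comp_assoc[OF fa[OF o(1)] ga[OF o(1)] FH] g' x by simp
      finally show ?thesis .
    qed
    then show "Comp (functor_category C D) g f \<in> Hom (functor_category C D) F H"
      using f' g' D.Comp_in[OF fa ga] C.Dom_in C.Cod_in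
      unfolding Hom_functor_category by (simp add: functor_category_def)
    fix h L assume h: "h \<in> Hom (functor_category C D) H L"
    have ha: "App h a \<in> Hom D (FObj H a) (FObj L a)" if "a \<in> Obj C" for a
      using h[unfolded Hom_functor_category] that by blast
    show "Comp (functor_category C D) h (Comp (functor_category C D) g f) =
        Comp (functor_category C D) (Comp (functor_category C D) h g) f"
      using D.Comp_assoc[OF fa ga ha] by (simp add: functor_category_def fun_eq_iff)
  next
    fix F assume "F \<in> Obj (functor_category C D)"
    then have F: "is_functor C D F" by simp
    show "Ident (functor_category C D) F \<in> Hom (functor_category C D) F F"
      unfolding Hom_functor_category using F D.Ident_in[OF FO[OF F]] D.Ident_left[OF FH[OF F]] D.Ident_right[OF FH[OF F]]
        C.Dom_in C.Cod_in by (simp add: functor_category_def)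
  qed (auto simp: functor_category_def)
qed

lemma full_subcategory_simps [simp]:
  "Obj (full_subcategory C A) = Obj C \<inter> A" "Dom (full_subcategory C A) = Dom C" "Cod (full_subcategory C A) = Cod C"
  "Ident (full_subcategory C A) = Ident C" "Comp (full_subcategory C A) = Comp C"
  by (simp_all add: full_subcategory_def)

lemma Hom_full_subcategory:
  "f \<in> Hom (full_subcategory C A) a b \<longleftrightarrow> f \<in> Hom C a b \<and> a \<in> A \<and> b \<in> A"
  by (auto simp: Hom_def full_subcategory_def)

lemma category_full_subcategory: assumes "category C" shows "category (full_subcategory C A)"
proof -
  interpret category C by fact
  show ?thesis
    by unfold_locales
      (use Dom_in Cod_in Ident_in Ident_left Ident_right Comp_assoc Comp_in in
        \<open>auto simp: Hom_full_subcategory, auto simp: full_subcategory_def\<close>)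
qed

lemma opposite_simps [simp]:
  "Obj (opposite R) = Obj R" "Arr (opposite R) = Arr R" "Dom (opposite R) = Cod R" "Cod (opposite R) = Dom R"
  "Ident (opposite R) = Ident R" "Comp (opposite R) g f = Comp R f g" "HAdd (opposite R) = HAdd R"
  by (simp_all add: opposite_def)

lemma Hom_opposite [simp]: "Hom (opposite R) a b = Hom R b a"
  by (auto simp: Hom_def)

lemma category_opposite: assumes "category (R :: ('o, 'm) preadd)" shows "category (opposite R)"
proof -
  interpret category R by fact
  show ?thesis
    by unfold_locales (use Dom_in Cod_in Ident_in Ident_left Ident_right Comp_assoc Comp_in in auto)
qed

lemma FI_simps [simp]:
  "Obj FI = {S. finite S}" "Dom FI = Src" "Cod FI = Tgt"
  "Comp FI g f = \<lparr>Src = Src f, Tgt = Tgt g, App = compose (Src f) (App g) (App f)\<rparr>"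
  "Ident FI S = \<lparr>Src = S, Tgt = S, App = (\<lambda>x\<in>S. x)\<rparr>"
  by (simp_all add: FI_def)

lemma Arr_FI: "f \<in> Arr FI \<longleftrightarrow> finite (Src f) \<and> finite (Tgt f) \<and> App f \<in> Src f \<rightarrow>\<^sub>E Tgt f \<and> inj_on (App f) (Src f)"
  by (simp add: FI_def)

lemma category_FI: "category FI"
proof
  fix f a b assume f: "f \<in> Hom FI a b"
  then have f': "Src f = a" "Tgt f = b" "finite a" "finite b" "App f \<in> a \<rightarrow>\<^sub>E b" "inj_on (App f) a"
    by (auto simp: Hom_def Arr_FI)
  show "Comp FI (Ident FI b) f = f" "Comp FI f (Ident FI a) = f"
    using f' by (auto simp: compose_def fun_eq_iff PiE_iff extensional_def intro!: arrow.equality)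
  fix g c assume g: "g \<in> Hom FI b c"
  then have g': "Src g = b" "Tgt g = c" "finite c" "App g \<in> b \<rightarrow>\<^sub>E c" "inj_on (App g) b"
    by (auto simp: Hom_def Arr_FI)
  show "Comp FI g f \<in> Hom FI a c"
    using f' g' by (auto simp: Hom_def Arr_FI compose_def inj_on_def PiE_iff)
  fix h d assume "h \<in> Hom FI c d"
  then show "Comp FI h (Comp FI g f) = Comp FI (Comp FI h g) f"
    using f' g' by (auto simp: Hom_def compose_def fun_eq_iff PiE_iff)
qed (auto simp: Hom_def Arr_FI)

locale ring_category = preadditive_category R for R :: "('u, 'u) preadd" +
  assumes universe: "infinite (UNIV :: 'u set)"
begin

abbreviation FK :: "(nat set \<times> 'u) set" where "FK \<equiv> {S. finite S} \<times> Obj R"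

text \<open>Two kinds of operations act on the sorts \<open>(S, r)\<close>:
  \<open>Inl (f, r)\<close> pushes along an injection \<open>f\<close> at the object
  \<open>r\<close>, and \<open>Inr (S, a)\<close> is the right action of an arrow \<open>a\<close>
  of \<open>R\<close> at the set \<open>S\<close>. The latter starts at \<open>Cod R a\<close>,
  since right modules are contravariant.\<close>

abbreviation FOps :: "(FI_arrow \<times> 'u + nat set \<times> 'u) set" where
  "FOps \<equiv> (Arr FI \<times> Obj R) <+> ({S. finite S} \<times> Arr R)"

definition Fsrc :: "FI_arrow \<times> 'u + nat set \<times> 'u \<Rightarrow> nat set \<times> 'u" where
  "Fsrc p = (case p of Inl (f, r) \<Rightarrow> (Src f, r) | Inr (S, a) \<Rightarrow> (S, Cod R a))"

definition Ftgt :: "FI_arrow \<times> 'u + nat set \<times> 'u \<Rightarrow> nat set \<times> 'u" where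
  "Ftgt p = (case p of Inl (f, r) \<Rightarrow> (Tgt f, r) | Inr (S, a) \<Rightarrow> (S, Dom R a))"

lemma Fsrc_simps [simp]: "Fsrc (Inl (f, r)) = (Src f, r)" "Fsrc (Inr (S, a)) = (S, Cod R a)"
  "Ftgt (Inl (f, r)) = (Tgt f, r)" "Ftgt (Inr (S, a)) = (S, Dom R a)"
  by (simp_all add: Fsrc_def Ftgt_def)

lemma in_FOps [simp]: "Inl (f, r) \<in> FOps \<longleftrightarrow> f \<in> Arr FI \<and> r \<in> Obj R"
  "Inr (S, a) \<in> FOps \<longleftrightarrow> finite S \<and> a \<in> Arr R"
  by auto

lemma FOps_cases:
  assumes "p \<in> FOps"
  obtains f r where "p = Inl (f, r)" "f \<in> Arr FI" "r \<in> Obj R"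
  | S a where "p = Inr (S, a)" "finite S" "a \<in> Arr R"
  using assms by auto

definition rmd :: "'u rmod \<Rightarrow> ('u, 'u, 'u) msm" where
  "rmd M = (FObj M, \<lambda>a. App (FArr M a))"

definition rapp :: "'u rmod_arrow \<Rightarrow> 'u \<Rightarrow> 'u \<Rightarrow> 'u" where
  "rapp t r = App (App t r)"

definition fmd :: "'u FI_module \<Rightarrow> (nat set \<times> 'u, FI_arrow \<times> 'u + nat set \<times> 'u, 'u) msm" where
  "fmd V = (\<lambda>(S, r). FObj (FObj V S) r,
    \<lambda>p. case p of Inl (f, r) \<Rightarrow> rapp (FArr V f) r | Inr (S, a) \<Rightarrow> App (FArr (FObj V S) a))"

definition fapp :: "'u FI_module_arrow \<Rightarrow> nat set \<times> 'u \<Rightarrow> 'u \<Rightarrow> 'u" where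
  "fapp t = (\<lambda>(S, r). rapp (App t S) r)"

lemma md_simps [simp]:
  "gr (rmd M) r = FObj M r" "ac (rmd M) a = App (FArr M a)"
  "gr (fmd V) (S, r) = FObj (FObj V S) r" "ac (fmd V) (Inl (f, r)) = rapp (FArr V f) r"
  "ac (fmd V) (Inr (S, a)) = App (FArr (FObj V S) a)" "fapp t (S, r) = rapp (App t S) r"
  by (simp_all add: rmd_def fmd_def fapp_def)

definition part :: "(nat set \<times> 'u, FI_arrow \<times> 'u + nat set \<times> 'u, 'u) msm \<Rightarrow> nat set \<Rightarrow> ('u, 'u, 'u) msm" where
  "part N S = (\<lambda>r. gr N (S, r), \<lambda>a. ac N (Inr (S, a)))"

lemma part_simps [simp]: "gr (part N S) r = gr N (S, r)" "ac (part N S) a = ac N (Inr (S, a))"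
  by (simp_all add: part_def)

lemma part_fmd: "part (fmd V) S = rmd (FObj V S)"
  by (simp add: part_def rmd_def)

sublocale RO: sorted_ops "Obj R" "Arr R" "Cod R" "Dom R"
  by unfold_locales (simp_all add: Dom_in Cod_in)

sublocale FO: sorted_ops FK FOps Fsrc Ftgt
  by unfold_locales (auto simp: Arr_FI Dom_in Cod_in elim!: FOps_cases)

definition mod_rel :: "('u, 'u, 'u) msm \<Rightarrow> bool" where
  "mod_rel N \<longleftrightarrow> (\<forall>r\<in>Obj R. \<forall>x\<in>el N r. ac N (Ident R r) x = x) \<and>
    (\<forall>f\<in>Arr R. \<forall>g\<in>Arr R. Cod R f = Dom R g \<longrightarrow> (\<forall>x\<in>el N (Cod R g). ac N (Comp R g f) x = ac N f (ac N g x))) \<and>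
    (\<forall>a b. \<forall>f\<in>Hom R a b. \<forall>g\<in>Hom R a b. \<forall>x\<in>el N b. ac N (HAdd R f g) x = ac N f x \<otimes>\<^bsub>gr N a\<^esub> ac N g x)"

text \<open>The clauses are: a right module in each degree, functoriality of the pushes, and, in the
  last clause, naturality, which makes each push an arrow of \<open>Mod R\<close>. Each equation has
  one element variable.\<close>

definition fi_rel :: "(nat set \<times> 'u, FI_arrow \<times> 'u + nat set \<times> 'u, 'u) msm \<Rightarrow> bool" where
  "fi_rel N \<longleftrightarrow> (\<forall>S. finite S \<longrightarrow> mod_rel (part N S)) \<and>
    (\<forall>S r. finite S \<longrightarrow> r \<in> Obj R \<longrightarrow> (\<forall>x\<in>el N (S, r). ac N (Inl (Ident FI S, r)) x = x)) \<and>
    (\<forall>f\<in>Arr FI. \<forall>g\<in>Arr FI. Tgt f = Src g \<longrightarrow> (\<forall>r\<in>Obj R. \<forall>x\<in>el N (Src f, r).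
      ac N (Inl (Comp FI g f, r)) x = ac N (Inl (g, r)) (ac N (Inl (f, r)) x))) \<and>
    (\<forall>f\<in>Arr FI. \<forall>a\<in>Arr R. \<forall>x\<in>el N (Src f, Cod R a).
      ac N (Inr (Tgt f, a)) (ac N (Inl (f, Cod R a)) x) = ac N (Inl (f, Dom R a)) (ac N (Inr (Src f, a)) x))"

lemma HAdd_in: "f \<in> Hom R a b \<Longrightarrow> g \<in> Hom R a b \<Longrightarrow> HAdd R f g \<in> Hom R a b"
proof -
  assume fg: "f \<in> Hom R a b" "g \<in> Hom R a b"
  then have "a \<in> Obj R" "b \<in> Obj R" using Dom_in Cod_in by (auto simp: Hom_def)
  then interpret comm_group "hom_group R a b" by (rule hom_group_comm)
  show ?thesis using m_closed[of f g] fg by (simp add: hom_group_def)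
qed

lemma Ident_Arr: "r \<in> Obj R \<Longrightarrow> Ident R r \<in> Arr R \<and> Dom R (Ident R r) = r \<and> Cod R (Ident R r) = r"
  using Ident_in by (auto simp: Hom_def)

lemma Comp_Arr: "f \<in> Arr R \<Longrightarrow> g \<in> Arr R \<Longrightarrow> Cod R f = Dom R g \<Longrightarrow>
    Comp R g f \<in> Arr R \<and> Dom R (Comp R g f) = Dom R f \<and> Cod R (Comp R g f) = Cod R g"
  using Comp_in[of f "Dom R f" "Cod R f" g "Cod R g"] by (auto simp: Hom_def)

lemma premod_part: "FO.premod N \<Longrightarrow> finite S \<Longrightarrow> RO.premod (part N S)"
  unfolding RO.premod_def
  using FO.premod_grp[of N "(S, _)"] FO.premod_hom[of N "Inr (S, _)"] by simp

lemma linear_part: "FO.linear M N \<phi> \<Longrightarrow> finite S \<Longrightarrow> RO.linear (part M S) (part N S) (\<lambda>r. \<phi> (S, r))"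
  unfolding RO.linear_def
  using FO.linear_hom[of M N \<phi> "(S, _)"] FO.linear_act[of M N \<phi> "Inr (S, _)"] by simp

text \<open>Every equation concerns a single element and its images under operations, so it may be
  checked in a module that hits this element. Different elements may be hit from different modules;
  this is what directed colimits require.\<close>

lemma mod_rel_cover:
  assumes N: "RO.premod N" and cover: "\<And>r y. r \<in> Obj R \<Longrightarrow> y \<in> el N r \<Longrightarrow>
      \<exists>M \<phi>. RO.premod M \<and> mod_rel M \<and> RO.linear M N \<phi> \<and> y \<in> \<phi> r ` el M r"
  shows "mod_rel N"
  unfolding mod_rel_def
proof (intro conjI ballI allI impI)
  fix r y assume r: "r \<in> Obj R" and y: "y \<in> el N r"
  obtain M \<phi> x where M: "mod_rel M" "RO.linear M N \<phi>" "x \<in> el M r" "y = \<phi> r x" using cover[OF r y] by blast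
  then show "ac N (Ident R r) y = y"
    using RO.linear_act[OF M(2), of "Ident R r" x] Ident_Arr[OF r] r by (simp add: mod_rel_def)
next
  fix f g y assume fg: "f \<in> Arr R" "g \<in> Arr R" "Cod R f = Dom R g" and y: "y \<in> el N (Cod R g)"
  obtain M \<phi> x where M: "mod_rel M" "RO.linear M N \<phi>" "x \<in> el M (Cod R g)" "y = \<phi> (Cod R g) x" "RO.premod M"
    using cover[OF Cod_in[OF fg(2)] y] by blast
  have "ac N (Comp R g f) y = \<phi> (Dom R f) (ac M (Comp R g f) x)"
    using RO.linear_act[OF M(2), of "Comp R g f" x] Comp_Arr[OF fg] M(3,4) by simp
  also have "\<dots> = \<phi> (Dom R f) (ac M f (ac M g x))" using M(1,3) fg by (simp add: mod_rel_def)
  also have "\<dots> = ac N f (ac N g y)"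
    using RO.linear_act[OF M(2) fg(1), of "ac M g x"] RO.linear_act[OF M(2) fg(2) M(3)] RO.el_act[OF M(5) fg(2) M(3)] fg(3) M(4)
    by simp
  finally show "ac N (Comp R g f) y = ac N f (ac N g y)" .
next
  fix a b f g y assume f: "f \<in> Hom R a b" and g: "g \<in> Hom R a b" and y: "y \<in> el N b"
  have ob: "a \<in> Obj R" "b \<in> Obj R" using f Dom_in Cod_in by (auto simp: Hom_def)
  obtain M \<phi> x where M: "mod_rel M" "RO.linear M N \<phi>" "x \<in> el M b" "y = \<phi> b x" "RO.premod M"
    using cover[OF ob(2) y] by blast
  have *: "ac N h y = \<phi> a (ac M h x)" "ac M h x \<in> el M a" if "h \<in> Hom R a b" for h
    using RO.linear_act[OF M(2), of h x] RO.el_act[OF M(5), of h x] that M(3,4) by (auto simp: Hom_def)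
  show "ac N (HAdd R f g) y = ac N f y \<otimes>\<^bsub>gr N a\<^esub> ac N g y"
    using *(1)[OF HAdd_in[OF f g]] *[OF f] *[OF g] RO.linear_mult[OF M(2) ob(1)] M(1,3) f g
    by (simp add: mod_rel_def)
qed

text \<open>Equations hold in the target and are reflected by an injective family of maps.\<close>

lemma mod_rel_sub:
  assumes N: "RO.premod N" and M: "mod_rel M" and \<phi>: "RO.linear N M \<phi>"
    and inj: "\<And>r. r \<in> Obj R \<Longrightarrow> inj_on (\<phi> r) (el N r)"
  shows "mod_rel N"
  unfolding mod_rel_def
proof (intro conjI ballI allI impI)
  fix r y assume r: "r \<in> Obj R" and y: "y \<in> el N r"
  note \<phi>y = RO.linear_el[OF \<phi> r y]
  show "ac N (Ident R r) y = y"
  proof (rule inj_onD[OF inj[OF r] _ _ y])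
    have "ac M (Ident R r) (\<phi> r y) = \<phi> r y" using M r \<phi>y unfolding mod_rel_def by blast
    then show "\<phi> r (ac N (Ident R r) y) = \<phi> r y"
      using RO.linear_act[OF \<phi>, of "Ident R r" y] Ident_Arr[OF r] y by simp
    show "ac N (Ident R r) y \<in> el N r"
      using RO.el_act[OF N, of "Ident R r" y] Ident_Arr[OF r] y by simp
  qed
next
  fix f g y assume fg: "f \<in> Arr R" "g \<in> Arr R" "Cod R f = Dom R g" and y: "y \<in> el N (Cod R g)"
  note c = Comp_Arr[OF fg]
  note e = RO.el_act[OF N fg(2) y] RO.el_act[OF N, of "Comp R g f" y]
  have "\<phi> (Dom R f) (ac N (Comp R g f) y) = ac M (Comp R g f) (\<phi> (Cod R g) y)"
    using RO.linear_act[OF \<phi>, of "Comp R g f" y] c y by simp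
  also have "\<dots> = ac M f (ac M g (\<phi> (Cod R g) y))"
    using M fg RO.linear_el[OF \<phi> Cod_in[OF fg(2)] y] by (simp add: mod_rel_def)
  also have "\<dots> = \<phi> (Dom R f) (ac N f (ac N g y))"
    using RO.linear_act[OF \<phi> fg(1), of "ac N g y"] RO.linear_act[OF \<phi> fg(2) y] e fg(3) by simp
  finally show "ac N (Comp R g f) y = ac N f (ac N g y)"
    by (rule inj_onD[OF inj[OF Dom_in[OF fg(1)]]]) (use e c y fg RO.el_act[OF N fg(1)] in auto)
next
  fix a b f g y assume f: "f \<in> Hom R a b" and g: "g \<in> Hom R a b" and y: "y \<in> el N b"
  have ob: "a \<in> Obj R" "b \<in> Obj R" using f Dom_in Cod_in by (auto simp: Hom_def)
  have *: "\<phi> a (ac N h y) = ac M h (\<phi> b y)" "ac N h y \<in> el N a" if "h \<in> Hom R a b" for h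
    using RO.linear_act[OF \<phi>, of h y] RO.el_act[OF N, of h y] that y by (auto simp: Hom_def)
  have "\<phi> a (ac N (HAdd R f g) y) = \<phi> a (ac N f y \<otimes>\<^bsub>gr N a\<^esub> ac N g y)"
    using *(1)[OF HAdd_in[OF f g]] *[OF f] *[OF g] RO.linear_mult[OF \<phi> ob(1)] M RO.linear_el[OF \<phi> ob(2) y] f g
    by (simp add: mod_rel_def)
  then show "ac N (HAdd R f g) y = ac N f y \<otimes>\<^bsub>gr N a\<^esub> ac N g y"
    by (rule inj_onD[OF inj[OF ob(1)]]) (use *[OF HAdd_in[OF f g]] *[OF f] *[OF g] RO.el_mult[OF N ob(1)] in auto)
qed

lemma Ident_FI_Arr: "finite S \<Longrightarrow> Ident FI S \<in> Arr FI"
  by (simp add: Arr_FI inj_on_def)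

lemma Comp_FI_Arr: "f \<in> Arr FI \<Longrightarrow> g \<in> Arr FI \<Longrightarrow> Tgt f = Src g \<Longrightarrow> Comp FI g f \<in> Arr FI"
  using category.Comp_in[OF category_FI, of f "Src f" "Tgt f" g "Tgt g"] by (auto simp: Hom_def)

lemma linear_push: "FO.linear M N \<phi> \<Longrightarrow> f \<in> Arr FI \<Longrightarrow> r \<in> Obj R \<Longrightarrow> x \<in> el M (Src f, r) \<Longrightarrow>
    \<phi> (Tgt f, r) (ac M (Inl (f, r)) x) = ac N (Inl (f, r)) (\<phi> (Src f, r) x)"
  using FO.linear_act[of M N \<phi> "Inl (f, r)" x] by simp

lemma linear_ract: "FO.linear M N \<phi> \<Longrightarrow> finite S \<Longrightarrow> a \<in> Arr R \<Longrightarrow> x \<in> el M (S, Cod R a) \<Longrightarrow>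
    \<phi> (S, Dom R a) (ac M (Inr (S, a)) x) = ac N (Inr (S, a)) (\<phi> (S, Cod R a) x)"
  using FO.linear_act[of M N \<phi> "Inr (S, a)" x] by simp

lemma push_el: "FO.premod M \<Longrightarrow> f \<in> Arr FI \<Longrightarrow> r \<in> Obj R \<Longrightarrow> x \<in> el M (Src f, r) \<Longrightarrow> ac M (Inl (f, r)) x \<in> el M (Tgt f, r)"
  using FO.el_act[of M "Inl (f, r)" x] by simp

lemma ract_el: "FO.premod M \<Longrightarrow> finite S \<Longrightarrow> a \<in> Arr R \<Longrightarrow> x \<in> el M (S, Cod R a) \<Longrightarrow> ac M (Inr (S, a)) x \<in> el M (S, Dom R a)"
  using FO.el_act[of M "Inr (S, a)" x] by simp

lemma fi_rel_cover:
  assumes N: "FO.premod N" and cover: "\<And>k y. k \<in> FK \<Longrightarrow> y \<in> el N k \<Longrightarrow>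
      \<exists>M \<phi>. FO.premod M \<and> fi_rel M \<and> FO.linear M N \<phi> \<and> y \<in> \<phi> k ` el M k"
  shows "fi_rel N"
  unfolding fi_rel_def
proof (intro conjI ballI allI impI)
  fix S :: "nat set" assume S: "finite S"
  show "mod_rel (part N S)"
  proof (rule mod_rel_cover[OF premod_part[OF N S]])
    fix r y assume "r \<in> Obj R" "y \<in> el (part N S) r"
    then obtain M \<phi> where "FO.premod M" "fi_rel M" "FO.linear M N \<phi>" "y \<in> \<phi> (S, r) ` el M (S, r)"
      using cover[of "(S, r)" y] S by auto
    then show "\<exists>M \<phi>. RO.premod M \<and> mod_rel M \<and> RO.linear M (part N S) \<phi> \<and> y \<in> \<phi> r ` el M r"
      using premod_part[OF _ S] linear_part[OF _ S] S
      by (intro exI[of _ "part M S"] exI[of _ "\<lambda>r. \<phi> (S, r)"]) (simp add: fi_rel_def)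
  qed
next
  fix S :: "nat set" and r y assume S: "finite S" and r: "r \<in> Obj R" and y: "y \<in> el N (S, r)"
  obtain M \<phi> x where M: "fi_rel M" "FO.linear M N \<phi>" "x \<in> el M (S, r)" "y = \<phi> (S, r) x"
    using cover[of "(S, r)" y] S r y by blast
  have "ac M (Inl (Ident FI S, r)) x = x" using M(1,3) S r unfolding fi_rel_def by blast
  then show "ac N (Inl (Ident FI S, r)) y = y"
    using linear_push[OF M(2) Ident_FI_Arr[OF S] r, of x] M(3,4) by simp
next
  fix f g r y assume fg: "f \<in> Arr FI" "g \<in> Arr FI" "Tgt f = Src g" and r: "r \<in> Obj R" and y: "y \<in> el N (Src f, r)"
  have "(Src f, r) \<in> FK" using fg r by (simp add: Arr_FI)
  then obtain M \<phi> x where M: "fi_rel M" "FO.linear M N \<phi>" "x \<in> el M (Src f, r)" "y = \<phi> (Src f, r) x" "FO.premod M"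
    using cover y by blast
  have "ac M (Inl (Comp FI g f, r)) x = ac M (Inl (g, r)) (ac M (Inl (f, r)) x)"
    using M(1,3) fg r unfolding fi_rel_def by blast
  then show "ac N (Inl (Comp FI g f, r)) y = ac N (Inl (g, r)) (ac N (Inl (f, r)) y)"
    using linear_push[OF M(2) Comp_FI_Arr[OF fg] r, of x] linear_push[OF M(2) fg(1) r M(3)]
      linear_push[OF M(2) fg(2) r, of "ac M (Inl (f, r)) x"] push_el[OF M(5) fg(1) r M(3)] M(3,4) fg(3) by simp
next
  fix f a y assume f: "f \<in> Arr FI" and a: "a \<in> Arr R" and y: "y \<in> el N (Src f, Cod R a)"
  have fin: "finite (Src f)" "finite (Tgt f)" using f by (auto simp: Arr_FI)
  have ob: "Dom R a \<in> Obj R" "Cod R a \<in> Obj R" using a Dom_in Cod_in by auto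
  obtain M \<phi> x where M: "fi_rel M" "FO.linear M N \<phi>" "x \<in> el M (Src f, Cod R a)" "y = \<phi> (Src f, Cod R a) x" "FO.premod M"
    using cover[of "(Src f, Cod R a)" y] y fin ob by blast
  have "ac M (Inr (Tgt f, a)) (ac M (Inl (f, Cod R a)) x) = ac M (Inl (f, Dom R a)) (ac M (Inr (Src f, a)) x)"
    using M(1,3) f a unfolding fi_rel_def by blast
  then show "ac N (Inr (Tgt f, a)) (ac N (Inl (f, Cod R a)) y) = ac N (Inl (f, Dom R a)) (ac N (Inr (Src f, a)) y)"
    using linear_push[OF M(2) f ob(2) M(3)] linear_ract[OF M(2) fin(1) a M(3)]
      linear_ract[OF M(2) fin(2) a push_el[OF M(5) f ob(2) M(3)]]
      linear_push[OF M(2) f ob(1) ract_el[OF M(5) fin(1) a M(3)]] M(4) by simp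
qed

lemma fi_rel_sub:
  assumes N: "FO.premod N" and M: "fi_rel M" and \<phi>: "FO.linear N M \<phi>"
    and inj: "\<And>k. k \<in> FK \<Longrightarrow> inj_on (\<phi> k) (el N k)"
  shows "fi_rel N"
  unfolding fi_rel_def
proof (intro conjI ballI allI impI)
  fix S :: "nat set" assume S: "finite S"
  show "mod_rel (part N S)"
    by (rule mod_rel_sub[OF premod_part[OF N S] _ linear_part[OF \<phi> S]]) (use M S inj in \<open>auto simp: fi_rel_def\<close>)
next
  fix S :: "nat set" and r y assume S: "finite S" and r: "r \<in> Obj R" and y: "y \<in> el N (S, r)"
  have k: "(S, r) \<in> FK" using S r by simp
  have "ac M (Inl (Ident FI S, r)) (\<phi> (S, r) y) = \<phi> (S, r) y"
    using M FO.linear_el[OF \<phi> k y] S r unfolding fi_rel_def by blast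
  then have "\<phi> (S, r) (ac N (Inl (Ident FI S, r)) y) = \<phi> (S, r) y"
    using linear_push[OF \<phi> Ident_FI_Arr[OF S] r, of y] y by simp
  then show "ac N (Inl (Ident FI S, r)) y = y"
    by (rule inj_onD[OF inj[OF k]]) (use push_el[OF N Ident_FI_Arr[OF S] r, of y] y in auto)
next
  fix f g r y assume fg: "f \<in> Arr FI" "g \<in> Arr FI" "Tgt f = Src g" and r: "r \<in> Obj R" and y: "y \<in> el N (Src f, r)"
  have k: "(Src f, r) \<in> FK" "(Tgt g, r) \<in> FK" using fg r by (simp_all add: Arr_FI)
  have "ac M (Inl (Comp FI g f, r)) (\<phi> (Src f, r) y) = ac M (Inl (g, r)) (ac M (Inl (f, r)) (\<phi> (Src f, r) y))"
    using M FO.linear_el[OF \<phi> k(1) y] fg r unfolding fi_rel_def by blast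
  then have "\<phi> (Tgt g, r) (ac N (Inl (Comp FI g f, r)) y) = \<phi> (Tgt g, r) (ac N (Inl (g, r)) (ac N (Inl (f, r)) y))"
    using linear_push[OF \<phi> Comp_FI_Arr[OF fg] r, of y] linear_push[OF \<phi> fg(1) r y]
      linear_push[OF \<phi> fg(2) r, of "ac N (Inl (f, r)) y"] push_el[OF N fg(1) r y] y fg(3) by simp
  then show "ac N (Inl (Comp FI g f, r)) y = ac N (Inl (g, r)) (ac N (Inl (f, r)) y)"
    by (rule inj_onD[OF inj[OF k(2)]])
      (use push_el[OF N Comp_FI_Arr[OF fg] r, of y] push_el[OF N fg(2) r] push_el[OF N fg(1) r y] fg(3) y in auto)
next
  fix f a y assume f: "f \<in> Arr FI" and a: "a \<in> Arr R" and y: "y \<in> el N (Src f, Cod R a)"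
  have fin: "finite (Src f)" "finite (Tgt f)" using f by (auto simp: Arr_FI)
  have ob: "Dom R a \<in> Obj R" "Cod R a \<in> Obj R" using a Dom_in Cod_in by auto
  have k: "(Src f, Cod R a) \<in> FK" "(Tgt f, Dom R a) \<in> FK" using fin ob by auto
  note e = push_el[OF N f ob(2) y] ract_el[OF N fin(1) a y]
  have "ac M (Inr (Tgt f, a)) (ac M (Inl (f, Cod R a)) (\<phi> (Src f, Cod R a) y)) =
      ac M (Inl (f, Dom R a)) (ac M (Inr (Src f, a)) (\<phi> (Src f, Cod R a) y))"
    using M FO.linear_el[OF \<phi> k(1) y] f a unfolding fi_rel_def by blast
  then have "\<phi> (Tgt f, Dom R a) (ac N (Inr (Tgt f, a)) (ac N (Inl (f, Cod R a)) y)) =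
      \<phi> (Tgt f, Dom R a) (ac N (Inl (f, Dom R a)) (ac N (Inr (Src f, a)) y))"
    using linear_push[OF \<phi> f ob(2) y] linear_ract[OF \<phi> fin(1) a y]
      linear_ract[OF \<phi> fin(2) a e(1)] linear_push[OF \<phi> f ob(1) e(2)] by simp
  then show "ac N (Inr (Tgt f, a)) (ac N (Inl (f, Cod R a)) y) = ac N (Inl (f, Dom R a)) (ac N (Inr (Src f, a)) y)"
    by (rule inj_onD[OF inj[OF k(2)]]) (use ract_el[OF N fin(2) a e(1)] push_el[OF N f ob(1) e(2)] in auto)
qed

end

section \<open>\<open>Mod R\<close> and \<open>FI_Mod R\<close> as categories of many-sorted
  modules\<close>

context ring_category
begin

text \<open>The operations are restricted to the carriers because arrows of \<open>Ab\<close> have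
  to be extensional. Thus \<open>rmd (mod_of N)\<close> agrees with \<open>N\<close> in the sense of
  \<open>eqmod\<close> but need not be equal to it.\<close>

definition mod_of :: "('u, 'u, 'u) msm \<Rightarrow> 'u rmod" where
  "mod_of N = \<lparr>FObj = gr N, FArr = (\<lambda>a. \<lparr>Src = gr N (Cod R a), Tgt = gr N (Dom R a),
    App = restrict (ac N a) (el N (Cod R a))\<rparr>)\<rparr>"

definition mod_arr :: "'u rmod \<Rightarrow> 'u rmod \<Rightarrow> ('u \<Rightarrow> 'u \<Rightarrow> 'u) \<Rightarrow> 'u rmod_arrow" where
  "mod_arr M N \<phi> = \<lparr>Src = M, Tgt = N,
    App = (\<lambda>r\<in>Obj R. \<lparr>Src = FObj M r, Tgt = FObj N r, App = restrict (\<phi> r) (carrier (FObj M r))\<rparr>)\<rparr>"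

lemma category_Mod: "category (Mod R)"
  unfolding Mod_def
  by (intro category_full_subcategory category_functor_category category_opposite category_Ab category_axioms)

lemma Obj_Mod: "M \<in> Obj (Mod R) \<longleftrightarrow> additive_functor (opposite R) Ab M"
  by (auto simp: Mod_def additive_functor_def)

lemma Hom_Mod: "t \<in> Hom (Mod R) M N \<longleftrightarrow> M \<in> Obj (Mod R) \<and> N \<in> Obj (Mod R) \<and> Src t = M \<and> Tgt t = N \<and>
    App t \<in> extensional (Obj R) \<and> (\<forall>a\<in>Obj R. App t a \<in> Hom Ab (FObj M a) (FObj N a)) \<and>
    (\<forall>f\<in>Arr R. Comp Ab (App t (Dom R f)) (FArr M f) = Comp Ab (FArr N f) (App t (Cod R f)))"
  unfolding Obj_Mod by (auto simp: Mod_def Hom_full_subcategory Hom_functor_category additive_functor_def)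

lemma Mod_simps [simp]: "Ident (Mod R) = Ident (functor_category (opposite R) Ab)"
  "Comp (Mod R) = Comp (functor_category (opposite R) Ab)" "Dom (Mod R) = Src" "Cod (Mod R) = Tgt"
  by (simp_all add: Mod_def)

lemma Mod_ObjD:
  assumes "M \<in> Obj (Mod R)"
  shows "r \<in> Obj R \<Longrightarrow> comm_group (FObj M r)"
    and "a \<in> Arr R \<Longrightarrow> FArr M a \<in> Hom Ab (FObj M (Cod R a)) (FObj M (Dom R a))"
    and "r \<in> Obj R \<Longrightarrow> FArr M (Ident R r) = Ident Ab (FObj M r)"
    and "f \<in> Arr R \<Longrightarrow> g \<in> Arr R \<Longrightarrow> Cod R f = Dom R g \<Longrightarrow> FArr M (Comp R g f) = Comp Ab (FArr M f) (FArr M g)"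
    and "f \<in> Hom R b c \<Longrightarrow> g \<in> Hom R b c \<Longrightarrow> FArr M (HAdd R f g) = HAdd Ab (FArr M f) (FArr M g)"
  using assms by (auto simp: Obj_Mod additive_functor_def is_functor_def)

lemma rmd_Mod: assumes "M \<in> Obj (Mod R)" shows "RO.premod (rmd M)" "mod_rel (rmd M)"
proof -
  note M = Mod_ObjD[OF assms]
  have A: "Src (FArr M a) = FObj M (Cod R a)" "Tgt (FArr M a) = FObj M (Dom R a)"
    "App (FArr M a) \<in> hom (FObj M (Cod R a)) (FObj M (Dom R a))" if "a \<in> Arr R" for a
    using M(2)[OF that] by (auto simp: Hom_Ab)
  show "RO.premod (rmd M)" unfolding RO.premod_def using M(1) A(3) by simp
  show "mod_rel (rmd M)" unfolding mod_rel_def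
  proof (intro conjI ballI allI impI)
    fix r x assume "r \<in> Obj R" "x \<in> el (rmd M) r"
    then show "ac (rmd M) (Ident R r) x = x" using M(3) by simp
  next
    fix f g x assume "f \<in> Arr R" "g \<in> Arr R" "Cod R f = Dom R g" "x \<in> el (rmd M) (Cod R g)"
    then show "ac (rmd M) (Comp R g f) x = ac (rmd M) f (ac (rmd M) g x)"
      using M(4) A by (simp add: compose_def)
  next
    fix a b f g x assume fg: "f \<in> Hom R a b" "g \<in> Hom R a b" "x \<in> el (rmd M) b"
    then show "ac (rmd M) (HAdd R f g) x = ac (rmd M) f x \<otimes>\<^bsub>gr (rmd M) a\<^esub> ac (rmd M) g x"
      using M(5)[OF fg(1,2)] A[of f] by (auto simp: Hom_def)
  qed
qed

lemma mod_of_simps [simp]: "FObj (mod_of N) = gr N"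
  "App (FArr (mod_of N) a) = restrict (ac N a) (el N (Cod R a))"
  by (simp_all add: mod_of_def)

lemma mod_of_eqmod: "RO.eqmod (rmd (mod_of N)) N"
  by (simp add: RO.eqmod_def)

lemma mod_of_Obj:
  assumes N: "RO.premod N" "mod_rel N" shows "mod_of N \<in> Obj (Mod R)"
  unfolding Obj_Mod additive_functor_def is_functor_def
proof (intro conjI ballI allI impI)
  note g = RO.premod_grp[OF N(1)] and e = RO.el_act[OF N(1)]
  show "FObj (mod_of N) a \<in> Obj Ab" if "a \<in> Obj (opposite R)" for a using g that by simp
  have H: "FArr (mod_of N) f \<in> Hom Ab (gr N (Cod R f)) (gr N (Dom R f))" if "f \<in> Arr R" for f
    using g Dom_in Cod_in that RO.premod_hom[OF N(1) that] RO.el_mult[OF N(1)]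
    by (auto simp: Hom_Ab mod_of_def hom_def)
  then show "FArr (mod_of N) f \<in> Hom Ab (FObj (mod_of N) (Dom (opposite R) f)) (FObj (mod_of N) (Cod (opposite R) f))"
    if "f \<in> Arr (opposite R)" for f using that by simp
  show "FArr (mod_of N) (Ident (opposite R) a) = Ident Ab (FObj (mod_of N) a)" if "a \<in> Obj (opposite R)" for a
    using that N(2) Ident_Arr[of a] by (auto simp: mod_of_def Ab_def mod_rel_def fun_eq_iff)
  show "FArr (mod_of N) (Comp (opposite R) g f) = Comp Ab (FArr (mod_of N) g) (FArr (mod_of N) f)"
    if "f \<in> Arr (opposite R)" "g \<in> Arr (opposite R)" "Cod (opposite R) f = Dom (opposite R) g" for f g
    using that N(2) Comp_Arr[of g f] e[of f] by (auto simp: mod_of_def Ab_def mod_rel_def compose_def fun_eq_iff)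
  show "FArr (mod_of N) (HAdd (opposite R) f g) = HAdd Ab (FArr (mod_of N) f) (FArr (mod_of N) g)"
    if "f \<in> Hom (opposite R) a b" "g \<in> Hom (opposite R) a b" for a b f g
    using that N(2) HAdd_in[of f b a g] unfolding Hom_opposite
    by (auto simp: mod_of_def Ab_def mod_rel_def Hom_iff fun_eq_iff)
qed

lemma Hom_Ab_simps:
  assumes "t \<in> Hom (Mod R) M N" "r \<in> Obj R"
  shows "Src (App t r) = FObj M r" "Tgt (App t r) = FObj N r" "App (App t r) \<in> hom (FObj M r) (FObj N r)"
    "App (App t r) \<in> extensional (carrier (FObj M r))"
  using assms by (auto simp: Hom_Mod Hom_Ab)

lemma rapp_linear: assumes "t \<in> Hom (Mod R) M N" shows "RO.linear (rmd M) (rmd N) (rapp t)"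
  unfolding RO.linear_def
proof (intro conjI ballI)
  show "rapp t r \<in> hom (gr (rmd M) r) (gr (rmd N) r)" if "r \<in> Obj R" for r
    using Hom_Ab_simps[OF assms that] by (simp add: rapp_def)
  fix a x assume a: "a \<in> Arr R" and x: "x \<in> el (rmd M) (Cod R a)"
  have M: "M \<in> Obj (Mod R)" and e: "Comp Ab (App t (Dom R a)) (FArr M a) = Comp Ab (FArr N a) (App t (Cod R a))"
    using assms a by (auto simp: Hom_Mod)
  have "Src (FArr M a) = FObj M (Cod R a)" using Mod_ObjD(2)[OF M a] by (simp add: Hom_Ab)
  then show "rapp t (Dom R a) (ac (rmd M) a x) = ac (rmd N) a (rapp t (Cod R a) x)"
    using fun_cong[OF arg_cong[OF e, of App], of x] x Hom_Ab_simps[OF assms Cod_in[OF a]]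
    by (simp add: rapp_def compose_def)
qed

lemma mod_arr:
  assumes M: "M \<in> Obj (Mod R)" and N: "N \<in> Obj (Mod R)" and l: "RO.linear (rmd M) (rmd N) \<phi>"
  shows "mod_arr M N \<phi> \<in> Hom (Mod R) M N"
    and "r \<in> Obj R \<Longrightarrow> x \<in> el (rmd M) r \<Longrightarrow> rapp (mod_arr M N \<phi>) r x = \<phi> r x"
proof -
  have hom: "\<phi> r \<in> hom (FObj M r) (FObj N r)" if "r \<in> Obj R" for r using RO.linear_hom[OF l that] by simp
  have "Comp Ab (App (mod_arr M N \<phi>) (Dom R a)) (FArr M a) = Comp Ab (FArr N a) (App (mod_arr M N \<phi>) (Cod R a))"
    if a: "a \<in> Arr R" for a
  proof -
    note m = Mod_ObjD(2)[OF M a, unfolded Hom_Ab] Mod_ObjD(2)[OF N a, unfolded Hom_Ab]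
    have "App (FArr M a) x \<in> carrier (FObj M (Dom R a))" if "x \<in> carrier (FObj M (Cod R a))" for x
      using m(1) that by (auto simp: hom_def)
    then show ?thesis using m a Dom_in Cod_in RO.linear_act[OF l a] hom
      by (auto simp: Ab_def mod_arr_def compose_def fun_eq_iff)
  qed
  moreover have "App (mod_arr M N \<phi>) r \<in> Hom Ab (FObj M r) (FObj N r)" if "r \<in> Obj R" for r
    using hom[OF that] Mod_ObjD(1)[OF M that] Mod_ObjD(1)[OF N that] RO.el_mult[OF rmd_Mod(1)[OF M] that]
    by (auto simp: mod_arr_def Hom_Ab hom_def that)
  ultimately show "mod_arr M N \<phi> \<in> Hom (Mod R) M N" using M N unfolding Hom_Mod by (auto simp: mod_arr_def)
  show "r \<in> Obj R \<Longrightarrow> x \<in> el (rmd M) r \<Longrightarrow> rapp (mod_arr M N \<phi>) r x = \<phi> r x"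
    by (simp add: rapp_def mod_arr_def)
qed

lemma Mod_ext:
  assumes "f \<in> Hom (Mod R) M N" "g \<in> Hom (Mod R) M N"
    "\<And>r x. r \<in> Obj R \<Longrightarrow> x \<in> el (rmd M) r \<Longrightarrow> rapp f r x = rapp g r x"
  shows "f = g"
proof -
  have "App f r = App g r" for r
  proof (cases "r \<in> Obj R")
    case True
    note * = Hom_Ab_simps[OF assms(1) True] Hom_Ab_simps[OF assms(2) True]
    have "App (App f r) = App (App g r)"
      using *(4,8) assms(3)[OF True] by (intro extensionalityI) (auto simp: rapp_def)
    then show ?thesis using * by (simp add: arrow.equality)
  next
    case False
    then show ?thesis using assms(1,2) by (auto simp: Hom_Mod extensional_def)
  qed
  then show ?thesis using assms(1,2) by (auto simp: Hom_Mod intro!: arrow.equality)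
qed

lemma mod_rel_cover_Mod:
  assumes N: "RO.premod N" and cover: "\<And>r y. r \<in> Obj R \<Longrightarrow> y \<in> el N r \<Longrightarrow>
      \<exists>M\<in>Obj (Mod R). \<exists>\<phi>. RO.linear (rmd M) N \<phi> \<and> y \<in> \<phi> r ` el (rmd M) r"
  shows "mod_rel N"
proof (rule mod_rel_cover[OF N])
  fix r y assume "r \<in> Obj R" "y \<in> el N r"
  then obtain M \<phi> where "M \<in> Obj (Mod R)" "RO.linear (rmd M) N \<phi> \<and> y \<in> \<phi> r ` el (rmd M) r" using cover by blast
  then show "\<exists>M \<phi>. RO.premod M \<and> mod_rel M \<and> RO.linear M N \<phi> \<and> y \<in> \<phi> r ` el M r" using rmd_Mod[of M] by blast
qed

text \<open>Provides the nonemptiness of the object sets, from which zero objects are then cut out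
  as trivial submodules.\<close>

lemma trivial_premod:
  "\<exists>N. RO.premod N \<and> mod_rel N" "\<exists>N. FO.premod N \<and> fi_rel N"
proof -
  let ?G = "\<lparr>carrier = {undefined :: 'u}, mult = (\<lambda>x y. undefined), one = undefined\<rparr>"
  have G: "comm_group ?G" by (rule comm_groupI) auto
  have "RO.premod (\<lambda>k. ?G, \<lambda>p x. undefined)" "mod_rel (\<lambda>k. ?G, \<lambda>p x. undefined)"
    using G by (simp_all add: RO.premod_def mod_rel_def hom_def)
  then show "\<exists>N. RO.premod N \<and> mod_rel N" by blast
  have "FO.premod (\<lambda>k. ?G, \<lambda>p x. undefined)" "fi_rel (\<lambda>k. ?G, \<lambda>p x. undefined)"
    using G by (simp_all add: FO.premod_def mod_rel_def fi_rel_def part_def hom_def)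
  then show "\<exists>N. FO.premod N \<and> fi_rel N" by blast
qed

lemma Obj_Mod_nonempty: "Obj (Mod R) \<noteq> {}"
  using trivial_premod(1) mod_of_Obj by blast

sublocale RM: big_module_category "Obj R" "Arr R" "Cod R" "Dom R" "Mod R" rmd rapp
proof unfold_locales
  note C = category_Mod
  show "Dom (Mod R) f \<in> Obj (Mod R)" if "f \<in> Arr (Mod R)" for f using category.Dom_in[OF C that] .
  show "Cod (Mod R) f \<in> Obj (Mod R)" if "f \<in> Arr (Mod R)" for f using category.Cod_in[OF C that] .
  show "Ident (Mod R) a \<in> Hom (Mod R) a a" if "a \<in> Obj (Mod R)" for a using category.Ident_in[OF C that] .
  show "Comp (Mod R) g f \<in> Hom (Mod R) a c" if "f \<in> Hom (Mod R) a b" "g \<in> Hom (Mod R) b c" for a b c f g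
    using category.Comp_in[OF C that] .
  show "Comp (Mod R) (Ident (Mod R) b) f = f" "Comp (Mod R) f (Ident (Mod R) a) = f" if "f \<in> Hom (Mod R) a b" for a b f
    using category.Ident_left[OF C that] category.Ident_right[OF C that] .
  show "Comp (Mod R) h (Comp (Mod R) g f) = Comp (Mod R) (Comp (Mod R) h g) f"
    if "f \<in> Hom (Mod R) a b" "g \<in> Hom (Mod R) b c" "h \<in> Hom (Mod R) c d" for a b c d f g h
    using category.Comp_assoc[OF C that] .
  show "RO.premod (rmd X)" if "X \<in> Obj (Mod R)" for X using rmd_Mod(1)[OF that] .
  show "RO.linear (rmd X) (rmd Y) (rapp f)" if "f \<in> Hom (Mod R) X Y" for X Y f using rapp_linear[OF that] .
  show "rapp (Ident (Mod R) X) k x = x" if "X \<in> Obj (Mod R)" "k \<in> Obj R" "x \<in> el (rmd X) k" for X k x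
    using that by (simp add: rapp_def)
  show "rapp (Comp (Mod R) g f) k x = rapp g k (rapp f k x)"
    if "f \<in> Hom (Mod R) X Y" "g \<in> Hom (Mod R) Y Z" "k \<in> Obj R" "x \<in> el (rmd X) k" for X Y Z f g k x
    using that Hom_Ab_simps[OF that(1,3)] by (simp add: rapp_def compose_def)
  show "f = g" if "f \<in> Hom (Mod R) X Y" "g \<in> Hom (Mod R) X Y"
    "\<And>k x. k \<in> Obj R \<Longrightarrow> x \<in> el (rmd X) k \<Longrightarrow> rapp f k x = rapp g k x" for X Y f g
    using Mod_ext[OF that] .
  show "\<exists>f\<in>Hom (Mod R) X Y. \<forall>k\<in>Obj R. \<forall>x\<in>el (rmd X) k. rapp f k x = \<phi> k x"
    if "X \<in> Obj (Mod R)" "Y \<in> Obj (Mod R)" "RO.linear (rmd X) (rmd Y) \<phi>" for X Y \<phi>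
    using mod_arr[OF that] by blast
  show "Obj (Mod R) \<noteq> {}" by (rule Obj_Mod_nonempty)
  show "\<exists>Z\<in>Obj (Mod R). RO.eqmod (rmd Z) M"
    if "RO.premod M" "X \<in> Obj (Mod R)" "RO.linear M (rmd X) \<phi>" "\<And>k. k \<in> Obj R \<Longrightarrow> inj_on (\<phi> k) (el M k)" for M X \<phi>
    using mod_of_Obj[OF that(1) mod_rel_sub[OF that(1) rmd_Mod(2)[OF that(2)] that(3,4)]] mod_of_eqmod by blast
  show "\<exists>Z\<in>Obj (Mod R). RO.eqmod (rmd Z) M"
    if "RO.premod M" "X \<in> Obj (Mod R)" "RO.linear (rmd X) M \<phi>"
      "\<And>k. k \<in> Obj R \<Longrightarrow> el M k \<subseteq> \<phi> k ` el (rmd X) k" for M X \<phi>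
    using mod_of_Obj[OF that(1) mod_rel_cover_Mod[OF that(1)]] mod_of_eqmod that(2-4) by blast
  show "\<exists>Z\<in>Obj (Mod R). RO.eqmod (rmd Z) M"
    if "RO.premod M" "\<And>k y. k \<in> Obj R \<Longrightarrow> y \<in> el M k \<Longrightarrow>
      \<exists>X\<in>Obj (Mod R). \<exists>\<phi>. RO.linear (rmd X) M \<phi> \<and> y \<in> \<phi> k ` el (rmd X) k" for M
    using mod_of_Obj[OF that(1) mod_rel_cover_Mod[OF that]] mod_of_eqmod by blast
  show "infinite (UNIV :: 'u set)" by (rule universe)
  show "\<exists>e :: 'u \<times> 'u \<Rightarrow> 'u. inj_on e (Obj R \<times> UNIV)"
    using inj_pairing[OF universe] inj_on_subset by blast
qed

lemma category_FI_Mod: "category (FI_Mod R)"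
  unfolding FI_Mod_def by (intro category_functor_category category_FI category_Mod)

lemma FI_Mod_simps [simp]: "Obj (FI_Mod R) = {V. is_functor FI (Mod R) V}" "Dom (FI_Mod R) = Src" "Cod (FI_Mod R) = Tgt"
  "App (Comp (FI_Mod R) u t) = (\<lambda>a\<in>Obj FI. Comp (Mod R) (App u a) (App t a))"
  "App (Ident (FI_Mod R) F) = (\<lambda>a\<in>Obj FI. Ident (Mod R) (FObj F a))"
  by (simp_all add: FI_Mod_def)

lemma Hom_FI_Mod:
  "t \<in> Hom (FI_Mod R) V W \<longleftrightarrow> Src t = V \<and> Tgt t = W \<and> is_functor FI (Mod R) V \<and> is_functor FI (Mod R) W \<and>
    App t \<in> extensional {S. finite S} \<and> (\<forall>S. finite S \<longrightarrow> App t S \<in> Hom (Mod R) (FObj V S) (FObj W S)) \<and>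
    (\<forall>f\<in>Arr FI. Comp (Mod R) (App t (Tgt f)) (FArr V f) = Comp (Mod R) (FArr W f) (App t (Src f)))"
  unfolding FI_Mod_def Hom_functor_category by simp

lemma FI_ObjD:
  assumes "is_functor FI (Mod R) V"
  shows "finite S \<Longrightarrow> FObj V S \<in> Obj (Mod R)"
    and "f \<in> Arr FI \<Longrightarrow> FArr V f \<in> Hom (Mod R) (FObj V (Src f)) (FObj V (Tgt f))"
    and "finite S \<Longrightarrow> FArr V (Ident FI S) = Ident (Mod R) (FObj V S)"
    and "f \<in> Arr FI \<Longrightarrow> g \<in> Arr FI \<Longrightarrow> Tgt f = Src g \<Longrightarrow> FArr V (Comp FI g f) = Comp (Mod R) (FArr V g) (FArr V f)"
  using assms by (auto simp: is_functor_def simp del: Mod_simps)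

lemma fmd_FI_Mod: assumes "is_functor FI (Mod R) V" shows "FO.premod (fmd V)" "fi_rel (fmd V)"
proof -
  note V = FI_ObjD[OF assms]
  have l: "RO.linear (rmd (FObj V (Src f))) (rmd (FObj V (Tgt f))) (rapp (FArr V f))" if "f \<in> Arr FI" for f
    using RM.app_linear[OF V(2)[OF that]] .
  show "FO.premod (fmd V)" unfolding FO.premod_def
  proof (intro conjI ballI)
    show "comm_group (gr (fmd V) k)" if "k \<in> FK" for k
      using that Mod_ObjD(1)[OF V(1)] by auto
    fix p assume "p \<in> FOps"
    then show "ac (fmd V) p \<in> hom (gr (fmd V) (Fsrc p)) (gr (fmd V) (Ftgt p))"
      by (cases rule: FOps_cases) (use RO.linear_hom[OF l] RO.premod_hom[OF RM.md[OF V(1)]] in auto)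
  qed
  show "fi_rel (fmd V)" unfolding fi_rel_def
  proof (intro conjI ballI allI impI)
    show "mod_rel (part (fmd V) S)" if "finite S" for S using rmd_Mod(2)[OF V(1)[OF that]] by (simp add: part_fmd)
    show "ac (fmd V) (Inl (Ident FI S, r)) x = x" if "finite S" "r \<in> Obj R" "x \<in> el (fmd V) (S, r)" for S r x
      using that RM.app_Ident[OF V(1)[OF that(1)], of r x] V(3)[OF that(1)] by simp
    show "ac (fmd V) (Inl (Comp FI g f, r)) x = ac (fmd V) (Inl (g, r)) (ac (fmd V) (Inl (f, r)) x)"
      if "f \<in> Arr FI" "g \<in> Arr FI" "Tgt f = Src g" "r \<in> Obj R" "x \<in> el (fmd V) (Src f, r)" for f g r x
      using that RM.app_Comp[OF V(2)[OF that(1)] V(2)[OF that(2), folded that(3)], of r x] V(4)[OF that(1-3)] by simp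
    show "ac (fmd V) (Inr (Tgt f, a)) (ac (fmd V) (Inl (f, Cod R a)) x) =
        ac (fmd V) (Inl (f, Dom R a)) (ac (fmd V) (Inr (Src f, a)) x)"
      if "f \<in> Arr FI" "a \<in> Arr R" "x \<in> el (fmd V) (Src f, Cod R a)" for f a x
      using that RO.linear_act[OF l[OF that(1)] that(2), of x] by simp
  qed
qed

lemma fapp_linear: assumes "t \<in> Hom (FI_Mod R) V W" shows "FO.linear (fmd V) (fmd W) (fapp t)"
proof -
  note t = assms[unfolded Hom_FI_Mod]
  have tS: "App t S \<in> Hom (Mod R) (FObj V S) (FObj W S)" if "finite S" for S using t that by blast
  have V: "is_functor FI (Mod R) V" and W: "is_functor FI (Mod R) W" using t by auto
  show ?thesis unfolding FO.linear_def
  proof (intro conjI ballI)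
    show "fapp t k \<in> hom (gr (fmd V) k) (gr (fmd W) k)" if "k \<in> FK" for k
      using that RO.linear_hom[OF RM.app_linear[OF tS]] by auto
    fix p x assume p: "p \<in> FOps" and x: "x \<in> el (fmd V) (Fsrc p)"
    from p show "fapp t (Ftgt p) (ac (fmd V) p x) = ac (fmd W) p (fapp t (Fsrc p) x)"
    proof (cases rule: FOps_cases)
      case (1 f r)
      have fin: "finite (Src f)" "finite (Tgt f)" using 1(2) by (auto simp: Arr_FI)
      have "Comp (Mod R) (App t (Tgt f)) (FArr V f) = Comp (Mod R) (FArr W f) (App t (Src f))" using t 1(2) by blast
      then show ?thesis
        using RM.app_Comp[OF FI_ObjD(2)[OF V 1(2)] tS[OF fin(2)] 1(3)] RM.app_Comp[OF tS[OF fin(1)] FI_ObjD(2)[OF W 1(2)] 1(3)]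
          x 1(1) by (simp del: Mod_simps)
    next
      case (2 S a)
      then show ?thesis using RO.linear_act[OF RM.app_linear[OF tS[OF 2(2)]] 2(3)] x by simp
    qed
  qed
qed

definition fi_arr :: "'u FI_module \<Rightarrow> 'u FI_module \<Rightarrow> (nat set \<times> 'u \<Rightarrow> 'u \<Rightarrow> 'u) \<Rightarrow> 'u FI_module_arrow" where
  "fi_arr V W \<phi> = \<lparr>Src = V, Tgt = W, App = (\<lambda>S\<in>Obj FI. mod_arr (FObj V S) (FObj W S) (\<lambda>r. \<phi> (S, r)))\<rparr>"

lemma fi_arr:
  assumes V: "is_functor FI (Mod R) V" and W: "is_functor FI (Mod R) W" and l: "FO.linear (fmd V) (fmd W) \<phi>"
  shows "fi_arr V W \<phi> \<in> Hom (FI_Mod R) V W"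
    and "k \<in> FK \<Longrightarrow> x \<in> el (fmd V) k \<Longrightarrow> fapp (fi_arr V W \<phi>) k x = \<phi> k x"
proof -
  have lS: "RO.linear (rmd (FObj V S)) (rmd (FObj W S)) (\<lambda>r. \<phi> (S, r))" if "finite S" for S
    using linear_part[OF l that] by (simp add: part_fmd)
  note m = mod_arr[OF FI_ObjD(1)[OF V] FI_ObjD(1)[OF W] lS]
  have "Comp (Mod R) (mod_arr (FObj V (Tgt f)) (FObj W (Tgt f)) (\<lambda>r. \<phi> (Tgt f, r))) (FArr V f) =
      Comp (Mod R) (FArr W f) (mod_arr (FObj V (Src f)) (FObj W (Src f)) (\<lambda>r. \<phi> (Src f, r)))" if f: "f \<in> Arr FI" for f
  proof -
    have fin: "finite (Src f)" "finite (Tgt f)" using f by (auto simp: Arr_FI)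
    note a = FI_ObjD(2)[OF V f] m(1)[OF fin(2) fin(2) fin(2)] and b = m(1)[OF fin(1) fin(1) fin(1)] FI_ObjD(2)[OF W f]
    show ?thesis
    proof (rule RM.arr_ext[OF RM.Comp_in[OF a] RM.Comp_in[OF b]])
      fix r x assume r: "r \<in> Obj R" and x: "x \<in> el (rmd (FObj V (Src f))) r"
      have "\<phi> (Tgt f, r) (rapp (FArr V f) r x) = rapp (FArr W f) r (\<phi> (Src f, r) x)"
        using linear_push[OF l f r, of x] x by simp
      then show "rapp (Comp (Mod R) (mod_arr (FObj V (Tgt f)) (FObj W (Tgt f)) (\<lambda>r. \<phi> (Tgt f, r))) (FArr V f)) r x =
          rapp (Comp (Mod R) (FArr W f) (mod_arr (FObj V (Src f)) (FObj W (Src f)) (\<lambda>r. \<phi> (Src f, r)))) r x"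
        unfolding RM.app_Comp[OF a r x] RM.app_Comp[OF b r x]
        using m(2)[OF fin(1) fin(1) fin(1) r x] m(2)[OF fin(2) fin(2) fin(2) r RM.app_el[OF a(1) r x]] by simp
    qed
  qed
  then show "fi_arr V W \<phi> \<in> Hom (FI_Mod R) V W"
    using V W m(1) unfolding Hom_FI_Mod by (auto simp: fi_arr_def Arr_FI simp del: Mod_simps)
  show "k \<in> FK \<Longrightarrow> x \<in> el (fmd V) k \<Longrightarrow> fapp (fi_arr V W \<phi>) k x = \<phi> k x"
    using m(2) by (cases k) (simp add: fi_arr_def)
qed

definition fi_of :: "(nat set \<times> 'u, FI_arrow \<times> 'u + nat set \<times> 'u, 'u) msm \<Rightarrow> 'u FI_module" where
  "fi_of N = \<lparr>FObj = (\<lambda>S. mod_of (part N S)),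
    FArr = (\<lambda>f. mod_arr (mod_of (part N (Src f))) (mod_of (part N (Tgt f))) (\<lambda>r. ac N (Inl (f, r))))\<rparr>"

lemma fi_of:
  assumes N: "FO.premod N" "fi_rel N"
  shows "is_functor FI (Mod R) (fi_of N)" "FO.eqmod (fmd (fi_of N)) N"
proof -
  have O: "mod_of (part N S) \<in> Obj (Mod R)" if "finite S" for S
    using mod_of_Obj[OF premod_part[OF N(1) that]] N(2) that by (simp add: fi_rel_def)
  have l: "RO.linear (rmd (mod_of (part N (Src f)))) (rmd (mod_of (part N (Tgt f)))) (\<lambda>r. ac N (Inl (f, r)))"
    if f: "f \<in> Arr FI" for f
    unfolding RO.linear_def
  proof (intro conjI ballI)
    have fin: "finite (Src f)" "finite (Tgt f)" using f by (auto simp: Arr_FI)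
    show "ac N (Inl (f, r)) \<in> hom (gr (rmd (mod_of (part N (Src f)))) r) (gr (rmd (mod_of (part N (Tgt f)))) r)"
      if "r \<in> Obj R" for r
      using FO.premod_hom[OF N(1), of "Inl (f, r)"] f that by simp
    fix a x assume a: "a \<in> Arr R" and x: "x \<in> el (rmd (mod_of (part N (Src f)))) (Cod R a)"
    have "ac N (Inr (Tgt f, a)) (ac N (Inl (f, Cod R a)) x) = ac N (Inl (f, Dom R a)) (ac N (Inr (Src f, a)) x)"
      using N(2) f a x by (simp add: fi_rel_def)
    then show "ac N (Inl (f, Dom R a)) (ac (rmd (mod_of (part N (Src f)))) a x) =
        ac (rmd (mod_of (part N (Tgt f)))) a (ac N (Inl (f, Cod R a)) x)"
      using x push_el[OF N(1) f Cod_in[OF a], of x] by simp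
  qed
  have fin: "finite (Src f)" "finite (Tgt f)" if "f \<in> Arr FI" for f using that by (auto simp: Arr_FI)
  note m = mod_arr[OF O[OF fin(1)] O[OF fin(2)] l]
  show "is_functor FI (Mod R) (fi_of N)"
    unfolding is_functor_def
  proof (intro conjI ballI impI)
    show "FObj (fi_of N) S \<in> Obj (Mod R)" if "S \<in> Obj FI" for S using O that by (simp add: fi_of_def)
    show "FArr (fi_of N) f \<in> Hom (Mod R) (FObj (fi_of N) (Dom FI f)) (FObj (fi_of N) (Cod FI f))" if "f \<in> Arr FI" for f
      using m(1)[OF that that that] by (simp add: fi_of_def)
    show "FArr (fi_of N) (Ident FI S) = Ident (Mod R) (FObj (fi_of N) S)" if "S \<in> Obj FI" for S
    proof -
      have S: "finite S" using that by simp
      note i = Ident_FI_Arr[OF S]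
      have "mod_arr (mod_of (part N S)) (mod_of (part N S)) (\<lambda>r. ac N (Inl (Ident FI S, r))) = Ident (Mod R) (mod_of (part N S))"
      proof (rule RM.arr_ext[OF _ RM.Ident_in[OF O[OF S]]])
        show "mod_arr (mod_of (part N S)) (mod_of (part N S)) (\<lambda>r. ac N (Inl (Ident FI S, r))) \<in>
            Hom (Mod R) (mod_of (part N S)) (mod_of (part N S))" using m(1)[OF i i i] by simp
        fix r x assume r: "r \<in> Obj R" and x: "x \<in> el (rmd (mod_of (part N S))) r"
        show "rapp (mod_arr (mod_of (part N S)) (mod_of (part N S)) (\<lambda>r. ac N (Inl (Ident FI S, r)))) r x =
            rapp (Ident (Mod R) (mod_of (part N S))) r x"
          using RM.app_Ident[OF O[OF S] r x] m(2)[OF i i i r, of x] N(2) S r x by (simp add: fi_rel_def del: Mod_simps)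
      qed
      then show ?thesis by (simp add: fi_of_def)
    qed
    show "FArr (fi_of N) (Comp FI g f) = Comp (Mod R) (FArr (fi_of N) g) (FArr (fi_of N) f)"
      if f: "f \<in> Arr FI" and g: "g \<in> Arr FI" and fg: "Cod FI f = Dom FI g" for f g
    proof -
      have fg': "Tgt f = Src g" using fg by simp
      note c = Comp_FI_Arr[OF f g fg']
      note h = m(1)[OF f f f] m(1)[OF g g g, folded fg']
      have "mod_arr (mod_of (part N (Src f))) (mod_of (part N (Tgt g))) (\<lambda>r. ac N (Inl (Comp FI g f, r))) =
        Comp (Mod R) (mod_arr (mod_of (part N (Src g))) (mod_of (part N (Tgt g))) (\<lambda>r. ac N (Inl (g, r))))
          (mod_arr (mod_of (part N (Src f))) (mod_of (part N (Tgt f))) (\<lambda>r. ac N (Inl (f, r))))" (is "?l = ?r")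
      proof (rule RM.arr_ext)
        show "?l \<in> Hom (Mod R) (mod_of (part N (Src f))) (mod_of (part N (Tgt g)))" using m(1)[OF c c c] by simp
        show "?r \<in> Hom (Mod R) (mod_of (part N (Src f))) (mod_of (part N (Tgt g)))"
          using RM.Comp_in[OF h] by (simp add: fg' del: Mod_simps)
        fix r x assume r: "r \<in> Obj R" and x: "x \<in> el (rmd (mod_of (part N (Src f)))) r"
        have "ac N (Inl (f, r)) x \<in> el (rmd (mod_of (part N (Src g)))) r"
          using push_el[OF N(1) f r, of x] x fg' by simp
        then have "rapp ?r r x = ac N (Inl (g, r)) (ac N (Inl (f, r)) x)"
          using RM.app_Comp[OF h r x] m(2)[OF f f f r x] m(2)[OF g g g r] fg' by (simp del: Mod_simps)
        moreover have "rapp ?l r x = ac N (Inl (Comp FI g f, r)) x" using m(2)[OF c c c r, of x] x by simp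
        moreover have "ac N (Inl (Comp FI g f, r)) x = ac N (Inl (g, r)) (ac N (Inl (f, r)) x)"
          using N(2) f g fg' r x unfolding fi_rel_def by simp
        ultimately show "rapp ?l r x = rapp ?r r x" by simp
      qed
      then show ?thesis by (simp add: fi_of_def del: Mod_simps)
    qed
  qed
  show "FO.eqmod (fmd (fi_of N)) N"
    unfolding FO.eqmod_def
  proof (intro conjI ballI)
    show "gr (fmd (fi_of N)) k = gr N k" if "k \<in> FK" for k using that by (cases k) (simp add: fi_of_def)
    fix p x assume p: "p \<in> FOps" and x: "x \<in> el N (Fsrc p)"
    from p show "ac (fmd (fi_of N)) p x = ac N p x"
    proof (cases rule: FOps_cases)
      case (1 f r)
      then show ?thesis using m(2)[OF 1(2) 1(2) 1(2) 1(3), of x] x by (simp add: fi_of_def)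
    next
      case (2 S a)
      then show ?thesis using x by (simp add: fi_of_def)
    qed
  qed
qed

lemma FI_Mod_ext:
  assumes "f \<in> Hom (FI_Mod R) V W" "g \<in> Hom (FI_Mod R) V W"
    "\<And>k x. k \<in> FK \<Longrightarrow> x \<in> el (fmd V) k \<Longrightarrow> fapp f k x = fapp g k x"
  shows "f = g"
proof -
  have "App f S = App g S" for S
  proof (cases "finite S")
    case True
    show ?thesis
      by (rule RM.arr_ext[of _ "FObj V S" "FObj W S"])
        (use assms(1,2)[unfolded Hom_FI_Mod] True assms(3)[of "(S, _)"] in auto)
  next
    case False
    then show ?thesis using assms(1,2) by (auto simp: Hom_FI_Mod extensional_def)
  qed
  then show ?thesis using assms(1,2) by (auto simp: Hom_FI_Mod intro!: arrow.equality)
qed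

lemma fi_rel_cover_FI:
  assumes N: "FO.premod N" and cover: "\<And>k y. k \<in> FK \<Longrightarrow> y \<in> el N k \<Longrightarrow>
      \<exists>M\<in>Obj (FI_Mod R). \<exists>\<phi>. FO.linear (fmd M) N \<phi> \<and> y \<in> \<phi> k ` el (fmd M) k"
  shows "fi_rel N"
proof (rule fi_rel_cover[OF N])
  fix k y assume "k \<in> FK" "y \<in> el N k"
  then obtain V \<phi> where "V \<in> Obj (FI_Mod R)" "FO.linear (fmd V) N \<phi> \<and> y \<in> \<phi> k ` el (fmd V) k" using cover by blast
  then show "\<exists>M \<phi>. FO.premod M \<and> fi_rel M \<and> FO.linear M N \<phi> \<and> y \<in> \<phi> k ` el M k" using fmd_FI_Mod[of V] by (intro exI[of _ "fmd V"] exI[of _ \<phi>]) simp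
qed

text \<open>\<open>set_encode\<close> is injective on finite sets of naturals, and an infinite type
  contains a copy of \<open>nat\<close>; the remaining components are paired inside
  \<open>'u\<close>.\<close>

lemma element_coding: "\<exists>e :: (nat set \<times> 'u) \<times> 'u \<Rightarrow> 'u. inj_on e (FK \<times> UNIV)"
proof -
  obtain pr :: "'u \<times> 'u \<Rightarrow> 'u" where pr: "inj pr" using inj_pairing[OF universe] by blast
  obtain nn :: "nat \<Rightarrow> 'u" where nn: "inj nn" using infinite_countable_subset[OF universe] by blast
  have "inj_on (\<lambda>((S, r), x). pr (nn (set_encode S), pr (r, x))) (FK \<times> UNIV)"
    by (rule inj_onI) (auto simp: inj_eq[OF pr] inj_eq[OF nn] set_encode_eq)
  then show ?thesis by blast
qed

lemma FI_Mod_ob: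
  assumes "FO.premod M" "fi_rel M" shows "\<exists>Z\<in>Obj (FI_Mod R). FO.eqmod (fmd Z) M"
  using fi_of[OF assms] by auto

sublocale FM: big_module_category FK FOps Fsrc Ftgt "FI_Mod R" fmd fapp
proof unfold_locales
  note C = category_FI_Mod
  show "Dom (FI_Mod R) f \<in> Obj (FI_Mod R)" if "f \<in> Arr (FI_Mod R)" for f using category.Dom_in[OF C that] .
  show "Cod (FI_Mod R) f \<in> Obj (FI_Mod R)" if "f \<in> Arr (FI_Mod R)" for f using category.Cod_in[OF C that] .
  show "Ident (FI_Mod R) a \<in> Hom (FI_Mod R) a a" if "a \<in> Obj (FI_Mod R)" for a using category.Ident_in[OF C that] .
  show "Comp (FI_Mod R) g f \<in> Hom (FI_Mod R) a c" if "f \<in> Hom (FI_Mod R) a b" "g \<in> Hom (FI_Mod R) b c" for a b c f g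
    using category.Comp_in[OF C that] .
  show "Comp (FI_Mod R) (Ident (FI_Mod R) b) f = f" "Comp (FI_Mod R) f (Ident (FI_Mod R) a) = f" if "f \<in> Hom (FI_Mod R) a b" for a b f
    using category.Ident_left[OF C that] category.Ident_right[OF C that] .
  show "Comp (FI_Mod R) h (Comp (FI_Mod R) g f) = Comp (FI_Mod R) (Comp (FI_Mod R) h g) f"
    if "f \<in> Hom (FI_Mod R) a b" "g \<in> Hom (FI_Mod R) b c" "h \<in> Hom (FI_Mod R) c d" for a b c d f g h
    using category.Comp_assoc[OF C that] .
  show "FO.premod (fmd X)" if "X \<in> Obj (FI_Mod R)" for X using fmd_FI_Mod(1) that by simp
  show "FO.linear (fmd X) (fmd Y) (fapp f)" if "f \<in> Hom (FI_Mod R) X Y" for X Y f using fapp_linear[OF that] .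
  show "fapp (Ident (FI_Mod R) X) k x = x" if "X \<in> Obj (FI_Mod R)" "k \<in> FK" "x \<in> el (fmd X) k" for X k x
    using that RM.app_Ident[OF FI_ObjD(1)] by (cases k) (simp del: Mod_simps)
  show "fapp (Comp (FI_Mod R) g f) k x = fapp g k (fapp f k x)"
    if "f \<in> Hom (FI_Mod R) X Y" "g \<in> Hom (FI_Mod R) Y Z" "k \<in> FK" "x \<in> el (fmd X) k" for X Y Z f g k x
  proof -
    obtain S r where kS: "k = (S, r)" by (cases k)
    then have k: "k = (S, r)" "finite S" "r \<in> Obj R" using that(3) by auto
    have "App f S \<in> Hom (Mod R) (FObj X S) (FObj Y S)" "App g S \<in> Hom (Mod R) (FObj Y S) (FObj Z S)"
      using that(1,2) k(2) by (auto simp: Hom_FI_Mod)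
    from RM.app_Comp[OF this k(3)] show ?thesis using that(4) k by (simp del: Mod_simps)
  qed
  show "f = g" if "f \<in> Hom (FI_Mod R) X Y" "g \<in> Hom (FI_Mod R) X Y"
    "\<And>k x. k \<in> FK \<Longrightarrow> x \<in> el (fmd X) k \<Longrightarrow> fapp f k x = fapp g k x" for X Y f g
    using FI_Mod_ext[OF that] .
  show "\<exists>f\<in>Hom (FI_Mod R) X Y. \<forall>k\<in>FK. \<forall>x\<in>el (fmd X) k. fapp f k x = \<phi> k x"
    if "X \<in> Obj (FI_Mod R)" "Y \<in> Obj (FI_Mod R)" "FO.linear (fmd X) (fmd Y) \<phi>" for X Y \<phi>
    using fi_arr[of X Y \<phi>] that by (intro bexI[of _ "fi_arr X Y \<phi>"]) auto
  show "Obj (FI_Mod R) \<noteq> {}" using trivial_premod(2) FI_Mod_ob by blast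
  show "\<exists>Z\<in>Obj (FI_Mod R). FO.eqmod (fmd Z) M"
    if "FO.premod M" "X \<in> Obj (FI_Mod R)" "FO.linear M (fmd X) \<phi>" "\<And>k. k \<in> FK \<Longrightarrow> inj_on (\<phi> k) (el M k)" for M X \<phi>
    using FI_Mod_ob[OF that(1) fi_rel_sub[OF that(1) _ that(3,4)]] fmd_FI_Mod(2)[of X] that(2) by simp
  show "\<exists>Z\<in>Obj (FI_Mod R). FO.eqmod (fmd Z) M"
    if "FO.premod M" "X \<in> Obj (FI_Mod R)" "FO.linear (fmd X) M \<phi>"
      "\<And>k. k \<in> FK \<Longrightarrow> el M k \<subseteq> \<phi> k ` el (fmd X) k" for M X \<phi>
    using FI_Mod_ob[OF that(1) fi_rel_cover_FI[OF that(1)]] that(2-4) by blast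
  show "\<exists>Z\<in>Obj (FI_Mod R). FO.eqmod (fmd Z) M"
    if "FO.premod M" "\<And>k y. k \<in> FK \<Longrightarrow> y \<in> el M k \<Longrightarrow>
      \<exists>X\<in>Obj (FI_Mod R). \<exists>\<phi>. FO.linear (fmd X) M \<phi> \<and> y \<in> \<phi> k ` el (fmd X) k" for M
    using FI_Mod_ob[OF that(1) fi_rel_cover_FI[OF that]] .
  show "infinite (UNIV :: 'u set)" by (rule universe)
  show "\<exists>e :: (nat set \<times> 'u) \<times> 'u \<Rightarrow> 'u. inj_on e (FK \<times> UNIV)" by (rule element_coding)
qed

end

section \<open>Noetherianity of FI-modules\<close>

lemma nat_incseq_subseq:
  fixes v :: "nat \<Rightarrow> nat"
  shows "\<exists>\<phi> :: nat \<Rightarrow> nat. strict_mono \<phi> \<and> (\<forall>i j. i \<le> j \<longrightarrow> v (\<phi> i) \<le> v (\<phi> j))"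
proof -
  \<comment> \<open>Indices whose value is minimal among all later values. They occur beyond every
    bound, since each tail attains its minimum, and along them the values cannot decrease.\<close>
  let ?min = "\<lambda>n. \<forall>m\<ge>n. v n \<le> v m"
  have ex: "\<exists>n\<ge>k. ?min n" for k
  proof -
    obtain n where "n \<ge> k" "\<And>m. m \<ge> k \<Longrightarrow> v n \<le> v m"
      using ex_has_least_nat[of "\<lambda>n. n \<ge> k" k v] by auto
    then show ?thesis by (meson le_trans)
  qed
  have "\<exists>\<phi>. \<forall>i. ?min (\<phi> i) \<and> \<phi> i < \<phi> (Suc i)"
  proof (rule dependent_nat_choice)
    show "\<exists>n. ?min n" using ex by blast
    show "\<exists>m. ?min m \<and> n < m" for n using ex[of "Suc n"] by (auto simp: Suc_le_eq)
  qed
  then obtain \<phi> where \<phi>: "\<And>i. ?min (\<phi> i)" "\<And>i. \<phi> i < \<phi> (Suc i)" by blast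
  have sm: "strict_mono \<phi>" by (rule strict_monoI) (rule lift_Suc_mono_less[of \<phi>, OF \<phi>(2)])
  have "v (\<phi> i) \<le> v (\<phi> j)" if "i \<le> j" for i j
    using \<phi>(1)[of i] that sm by (simp add: strict_mono_less_eq)
  then show ?thesis using sm by blast
qed

text \<open>One coordinate at a time: passing to a further subsequence keeps the earlier coordinates
  nondecreasing.\<close>

lemma dickson:
  fixes v :: "'p \<Rightarrow> nat \<Rightarrow> nat"
  assumes "finite P"
  shows "\<exists>\<phi> :: nat \<Rightarrow> nat. strict_mono \<phi> \<and> (\<forall>p\<in>P. \<forall>i j. i \<le> j \<longrightarrow> v p (\<phi> i) \<le> v p (\<phi> j))"
  using assms
proof induction
  case empty show ?case by (rule exI[of _ id]) (simp add: strict_mono_def)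
next
  case (insert q P)
  then obtain \<phi> :: "nat \<Rightarrow> nat" where \<phi>: "strict_mono \<phi>" "\<forall>p\<in>P. \<forall>i j. i \<le> j \<longrightarrow> v p (\<phi> i) \<le> v p (\<phi> j)"
    by (elim exE conjE)
  from nat_incseq_subseq[of "\<lambda>n. v q (\<phi> n)"] obtain \<chi> :: "nat \<Rightarrow> nat"
    where \<chi>: "strict_mono \<chi>" "\<forall>i j. i \<le> j \<longrightarrow> v q (\<phi> (\<chi> i)) \<le> v q (\<phi> (\<chi> j))"
    by (elim exE conjE)
  have "strict_mono (\<lambda>i. \<phi> (\<chi> i))" using \<phi>(1) \<chi>(1) by (simp add: strict_mono_def)
  moreover have "\<chi> i \<le> \<chi> j" if "i \<le> j" for i j using that \<chi>(1) by (simp add: strict_mono_less_eq)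
  ultimately show ?case using \<phi>(2) \<chi>(2) by (intro exI[of _ "\<lambda>i. \<phi> (\<chi> i)"]) auto
qed

text \<open>If no finite set worked, elements could be chosen one after another so that no earlier
  one is \<open>good\<close> for a later one, contradicting the assumption on sequences. The case
  \<open>p \<in> F\<close> is listed separately since \<open>good\<close> is not assumed
  reflexive.\<close>

lemma finite_basis:
  assumes "\<And>s :: nat \<Rightarrow> 'a. (\<And>i. s i \<in> P) \<Longrightarrow> \<exists>i j. i < j \<and> good (s i) (s j)"
  shows "\<exists>F. finite F \<and> F \<subseteq> P \<and> (\<forall>p\<in>P. p \<in> F \<or> (\<exists>q\<in>F. good q p))"
proof (rule ccontr)
  assume "\<not> ?thesis"
  then have bad: "finite F \<Longrightarrow> F \<subseteq> P \<Longrightarrow> \<exists>p\<in>P. p \<notin> F \<and> (\<forall>q\<in>F. \<not> good q p)" for F by metis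
  have "\<exists>s. \<forall>n :: nat. s n \<in> P \<and> (\<forall>i<n. \<not> good (s i) (s n))"
  proof (rule dependent_wellorder_choice)
    fix s :: "nat \<Rightarrow> 'a" and n assume "\<And>m. m < n \<Longrightarrow> s m \<in> P \<and> (\<forall>i<m. \<not> good (s i) (s m))"
    then have "s ` {..<n} \<subseteq> P" by auto
    from bad[OF _ this] show "\<exists>r. r \<in> P \<and> (\<forall>i<n. \<not> good (s i) r)" by auto
  qed simp
  then show False using assms by (metis (full_types))
qed

text \<open>\<open>h\<close> moves \<open>k\<close> up by the largest displacement
  \<open>G i - F i\<close> among the points \<open>F i\<close> below or at \<open>k\<close>. This
  displacement grows with \<open>k\<close>, so \<open>h\<close> is strictly increasing; by
  \<open>gap\<close>, the maximum at \<open>F i\<close> is the displacement of \<open>i\<close>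
  itself.\<close>

lemma strict_mono_extension:
  fixes F G :: "nat \<Rightarrow> nat"
  assumes le: "\<And>i. i \<le> d \<Longrightarrow> F i \<le> G i"
    and gap: "\<And>i j. i \<le> d \<Longrightarrow> j \<le> d \<Longrightarrow> F i \<le> F j \<Longrightarrow> G i - F i \<le> G j - F j"
  shows "\<exists>h. strict_mono h \<and> (\<forall>i\<le>d. h (F i) = G i)"
proof -
  define D where "D k = insert 0 ((\<lambda>i. G i - F i) ` {i. i \<le> d \<and> F i \<le> k})" for k
  have fin: "finite (D k)" for k by (simp add: D_def)
  define h where "h k = k + Max (D k)" for k
  have "strict_mono h"
  proof (rule strict_monoI)
    fix k l :: nat assume "k < l"
    then have "D k \<subseteq> D l" by (auto simp: D_def)
    then have "Max (D k) \<le> Max (D l)" by (intro Max_mono fin) (auto simp: D_def)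
    then show "h k < h l" using \<open>k < l\<close> by (simp add: h_def)
  qed
  moreover have "h (F i) = G i" if "i \<le> d" for i
  proof -
    have "Max (D (F i)) = G i - F i"
      using gap that by (intro Max_eqI fin) (auto simp: D_def)
    then show ?thesis using le[OF that] by (simp add: h_def)
  qed
  ultimately show ?thesis by blast
qed

text \<open>The order on lists compares lengths first, so for equal lengths it is lexicographic. The
  first place where the lists differ is unchanged by \<open>h\<close>.\<close>

lemma map_strict_mono_less:
  fixes xs ys :: "nat list"
  assumes "strict_mono h" "xs < ys" "length xs = length ys" shows "map h xs < map h ys"
proof -
  obtain us a as b bs where "xs = us @ a # as" "ys = us @ b # bs" "a < b" "length as = length bs"
    using assms(2,3) by (auto simp: list_less_def lenlex_conv lex_conv)
  then have "map h xs = map h us @ h a # map h as" "map h ys = map h us @ h b # map h bs" "h a < h b"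
    using assms(1) by (simp_all add: strict_mono_less)
  then have "\<exists>ws u us v vs. map h xs = ws @ u # us \<and> map h ys = ws @ v # vs \<and> (u, v) \<in> {(u, v). u < v}"
    by blast
  then have "(map h xs, map h ys) \<in> lex {(u, v). u < v}" using assms(3) by (simp add: lex_conv)
  then show ?thesis using assms(3) by (simp add: list_less_def lenlex_conv)
qed

section \<open>Injections written as lists\<close>

definition emb :: "nat \<Rightarrow> nat list \<Rightarrow> FI_arrow" where
  "emb n xs = \<lparr>Src = {..<length xs}, Tgt = {..<n}, App = (\<lambda>i\<in>{..<length xs}. xs ! i)\<rparr>"

definition stretch :: "nat \<Rightarrow> nat \<Rightarrow> (nat \<Rightarrow> nat) \<Rightarrow> FI_arrow" where
  "stretch n m h = \<lparr>Src = {..<n}, Tgt = {..<m}, App = restrict h {..<n}\<rparr>"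

lemma emb_simps [simp]: "Src (emb n xs) = {..<length xs}" "Tgt (emb n xs) = {..<n}"
  "Src (stretch n m h) = {..<n}" "Tgt (stretch n m h) = {..<m}"
  by (simp_all add: emb_def stretch_def)

lemma emb_Arr: "distinct xs \<Longrightarrow> set xs \<subseteq> {..<n} \<Longrightarrow> emb n xs \<in> Arr FI"
  by (force simp: Arr_FI emb_def inj_on_def nth_eq_iff_index_eq)

lemma stretch_Arr: "strict_mono h \<Longrightarrow> h n = m \<Longrightarrow> stretch n m h \<in> Arr FI"
  by (auto simp: Arr_FI stretch_def inj_on_def strict_mono_eq strict_mono_less)

lemma stretch_emb: "set xs \<subseteq> {..<n} \<Longrightarrow> Comp FI (stretch n m h) (emb n xs) = emb m (map h xs)"
  by (auto simp: emb_def stretch_def compose_def fun_eq_iff subset_iff)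

text \<open>Moves elements from an arbitrary finite set to an initial segment and back, so that
  injections may be written as lists.\<close>

lemma bij_arrow:
  assumes "finite S"
  obtains f g where "f \<in> Arr FI" "Src f = S" "Tgt f = {..<card S}" "g \<in> Arr FI" "Src g = {..<card S}" "Tgt g = S"
    "Comp FI g f = Ident FI S"
proof -
  let ?T = "{..<card S}"
  obtain h where h: "bij_betw h S ?T" using finite_same_card_bij[OF assms, of ?T] by auto
  let ?f = "\<lparr>Src = S, Tgt = ?T, App = restrict h S\<rparr>" and ?g = "\<lparr>Src = ?T, Tgt = S, App = restrict (inv_into S h) ?T\<rparr>"
  note b = bij_betw_inv_into[OF h] bij_betw_inv_into_left[OF h] bij_betw_inv_into_right[OF h]
  have hm: "h x \<in> ?T" if "x \<in> S" for x using h that by (auto simp: bij_betw_def)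
  have gm: "inv_into S h y \<in> S" if "y \<in> ?T" for y using b(1) that by (auto simp: bij_betw_def)
  have "?f \<in> Arr FI" "?g \<in> Arr FI"
    using assms hm gm bij_betw_imp_inj_on[OF h] bij_betw_imp_inj_on[OF b(1)] by (auto simp: Arr_FI)
  moreover have "Comp FI ?g ?f = Ident FI S"
    using b(2) hm by (auto simp: compose_def fun_eq_iff)
  ultimately show ?thesis using that[of ?f ?g] by simp
qed

text \<open>The converse of \<open>span_linear\<close>: the images of the span form a submodule that
  contains the images of the generators.\<close>

lemma (in sorted_ops) span_image_elts:
  assumes "linear M N \<phi>" "premod M" "premod N" "E \<subseteq> Sigma K (el M)" "y \<in> span N (image_elts \<phi> E) k"
  shows "\<exists>x\<in>span M E k. y = \<phi> k x"
proof -
  have "submodule N (\<lambda>k. \<phi> k ` span M E k)"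
    by (rule submodule_image[OF assms(1-3) submodule_span[OF assms(2,4)]])
  moreover have "image_elts \<phi> E \<subseteq> Sigma K (\<lambda>k. \<phi> k ` span M E k)"
    using assms(4) by (auto simp: image_elts_def intro!: span_gen)
  ultimately have "y \<in> \<phi> k ` span M E k" by (rule span_least[OF _ _ assms(5)])
  then show ?thesis by blast
qed

section \<open>Leading coefficients in FI-modules over a locally noetherian base\<close>

locale fi_module = ring_category R for R :: "('u, 'u) preadd" +
  fixes M :: "(nat set \<times> 'u, FI_arrow \<times> 'u + nat set \<times> 'u, 'u) msm"
  assumes premod: "FO.premod M" and rel: "fi_rel M"
    and locally_noeth: "\<And>S r x. finite S \<Longrightarrow> r \<in> Obj R \<Longrightarrow> x \<in> el M (S, r) \<Longrightarrow>
      RO.noeth_sub (part M S) (RO.span (part M S) {(r, x)})"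
begin

abbreviation push :: "FI_arrow \<Rightarrow> 'u \<Rightarrow> 'u \<Rightarrow> 'u" where "push f r \<equiv> ac M (Inl (f, r))"

lemma linear_push_part: assumes f: "f \<in> Arr FI" shows "RO.linear (part M (Src f)) (part M (Tgt f)) (push f)"
  unfolding RO.linear_def
proof (intro conjI ballI)
  show "push f r \<in> hom (gr (part M (Src f)) r) (gr (part M (Tgt f)) r)" if "r \<in> Obj R" for r
    using FO.premod_hom[OF premod, of "Inl (f, r)"] f that by simp
  show "push f (Dom R a) (ac (part M (Src f)) a x) = ac (part M (Tgt f)) a (push f (Cod R a) x)"
    if "a \<in> Arr R" "x \<in> el (part M (Src f)) (Cod R a)" for a x
    using rel f that by (simp add: fi_rel_def)
qed

lemma push_comp: "f \<in> Arr FI \<Longrightarrow> g \<in> Arr FI \<Longrightarrow> Tgt f = Src g \<Longrightarrow> r \<in> Obj R \<Longrightarrow> x \<in> el M (Src f, r) \<Longrightarrow>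
    push g r (push f r x) = push (Comp FI g f) r x"
  using rel unfolding fi_rel_def by metis

lemma push_Ident: "finite S \<Longrightarrow> r \<in> Obj R \<Longrightarrow> x \<in> el M (S, r) \<Longrightarrow> push (Ident FI S) r x = x"
  using rel unfolding fi_rel_def by metis

lemma sub_push: "FO.submodule M U \<Longrightarrow> f \<in> Arr FI \<Longrightarrow> r \<in> Obj R \<Longrightarrow> x \<in> U (Src f, r) \<Longrightarrow> push f r x \<in> U (Tgt f, r)"
  using FO.sub_act[of M U "Inl (f, r)" x] by simp

lemma submodule_slice: "FO.submodule M U \<Longrightarrow> finite S \<Longrightarrow> RO.submodule (part M S) (\<lambda>r. U (S, r))"
  unfolding RO.submodule_def using FO.submodule_grp[of M U "(S, _)"] FO.sub_act[of M U "Inr (S, _)"] by simp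

lemma premod_slice: "finite S \<Longrightarrow> RO.premod (part M S)"
  using premod_part[OF premod] .

end

text \<open>The submodule generated by \<open>A\<close> and one element \<open>x\<close> of degree \<open>d\<close> is filtered by the ordered
  set of injections of \<open>{..<d}\<close> into \<open>{..<n}\<close>, written as lists; \<open>lead W n f\<close> collects the leading
  coefficients at \<open>f\<close> of the elements of \<open>W\<close>.\<close>

locale fi_module_extension = fi_module R M for R :: "('u, 'u) preadd" and M +
  fixes A d r0 x
  assumes A: "FO.submodule M A" and r0: "r0 \<in> Obj R" and x: "x \<in> el M ({..<d}, r0)"
begin

abbreviation P :: "nat \<Rightarrow> ('u, 'u, 'u) msm" where "P n \<equiv> part M {..<n}"

definition valid :: "nat \<Rightarrow> nat list set" where
  "valid n = {f. distinct f \<and> length f = d \<and> set f \<subseteq> {..<n}}"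

definition term_at :: "nat \<Rightarrow> nat list \<Rightarrow> 'u" where "term_at n f = push (emb n f) r0 x"

text \<open>Its span \<open>B n \<Gamma>\<close> is the degree \<open>n\<close> part of
  \<open>A\<close> plus the right modules generated by the translates of \<open>x\<close> along the
  lists in \<open>\<Gamma>\<close>.\<close>

definition base :: "nat \<Rightarrow> nat list set \<Rightarrow> ('u \<times> 'u) set" where
  "base n \<Gamma> = Sigma (Obj R) (\<lambda>r. A ({..<n}, r)) \<union> (\<lambda>f. (r0, term_at n f)) ` \<Gamma>"

definition B :: "nat \<Rightarrow> nat list set \<Rightarrow> 'u \<Rightarrow> 'u set" where "B n \<Gamma> = RO.span (P n) (base n \<Gamma>)"

definition X :: "'u \<Rightarrow> 'u set" where "X = RO.span (P d) {(r0, x)}"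

definition lead :: "(nat set \<times> 'u \<Rightarrow> 'u set) \<Rightarrow> nat \<Rightarrow> nat list \<Rightarrow> 'u \<Rightarrow> 'u set" where
  "lead W n f r = X r \<inter> RO.preim (P d) (push (emb n f))
    (RO.set_sum (P n) (\<lambda>r. W ({..<n}, r)) (B n {g \<in> valid n. g < f})) r"

lemma validD: "f \<in> valid n \<Longrightarrow> emb n f \<in> Arr FI" "f \<in> valid n \<Longrightarrow> length f = d"
  by (auto simp: valid_def intro: emb_Arr)

lemma linear_emb: "f \<in> valid n \<Longrightarrow> RO.linear (P d) (P n) (push (emb n f))"
  using linear_push_part[OF validD(1)] validD(2) by fastforce

lemma finite_valid: "finite (valid n)"
  by (rule finite_subset[OF _ finite_lists_length_eq[of "{..<n}" d]]) (auto simp: valid_def)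

lemma term_at_el: "f \<in> valid n \<Longrightarrow> term_at n f \<in> el M ({..<n}, r0)"
  using push_el[OF premod validD(1) r0, of f n x] validD(2) x by (simp add: term_at_def)

lemma base_el: "\<Gamma> \<subseteq> valid n \<Longrightarrow> base n \<Gamma> \<subseteq> Sigma (Obj R) (el (P n))"
  using term_at_el r0 FO.sub_el[OF A] by (auto simp: base_def)

lemma submodule_B: "\<Gamma> \<subseteq> valid n \<Longrightarrow> RO.submodule (P n) (B n \<Gamma>)"
  unfolding B_def by (rule RO.submodule_span[OF premod_slice base_el]) auto

lemma X_el: "{(r0, x)} \<subseteq> Sigma (Obj R) (el (P d))"
  using r0 x by simp

lemma submodule_X: "RO.submodule (P d) X"
  unfolding X_def by (rule RO.submodule_span[OF premod_slice X_el]) simp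

lemma submodule_lead:
  assumes "FO.submodule M W" "f \<in> valid n" shows "RO.submodule (P d) (lead W n f)"
  unfolding lead_def
  by (intro RO.submodule_Int RO.submodule_preim[OF linear_emb[OF assms(2)]] RO.submodule_set_sum premod_slice
      submodule_X submodule_slice submodule_B assms) auto

text \<open>A strictly increasing \<open>h\<close> preserves the order of lists, so pushing along it
  sends translates below \<open>f\<close> to translates below \<open>g\<close>. A congruence
  witnessing that \<open>y\<close> is a leading coefficient at \<open>f\<close> is thereby carried
  to one at \<open>g\<close>; the coefficient \<open>y\<close> itself is unchanged.\<close>

lemma lead_stretch:
  assumes W: "FO.submodule M W" and f: "f \<in> valid n" and g: "g \<in> valid m" and r: "r \<in> Obj R"
    and h: "strict_mono h" "h n = m" "map h f = g"
  shows "lead W n f r \<subseteq> lead W m g r"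
proof
  fix y assume y: "y \<in> lead W n f r"
  then have yX: "y \<in> X r" "y \<in> el (P d) r" by (auto simp: lead_def RO.preim_def)
  obtain w b where w: "w \<in> W ({..<n}, r)" and b: "b \<in> B n {g \<in> valid n. g < f} r"
    and e: "push (emb n f) r y = w \<otimes>\<^bsub>gr (P n) r\<^esub> b"
    using y by (auto simp: lead_def RO.preim_def RO.set_sum_def)
  let ?h = "stretch n m h"
  have hA: "?h \<in> Arr FI" using stretch_Arr h by blast
  note l = linear_push_part[OF hA, unfolded emb_simps]
  have comp: "Comp FI ?h (emb n f') = emb m (map h f')" if "f' \<in> valid n" for f'
    using stretch_emb[of f' n m h] that by (simp add: valid_def del: FI_simps)
  have hv: "map h f' \<in> valid m" if "f' \<in> valid n" for f'
    using that h by (auto simp: valid_def distinct_map strict_mono_less strict_mono_eq inj_on_def)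
  have be: "base n {g \<in> valid n. g < f} \<subseteq> Sigma (Obj R) (el (P n))" by (rule base_el) auto
  have "image_elts (push ?h) (base n {g \<in> valid n. g < f}) \<subseteq> base m {g' \<in> valid m. g' < g}"
  proof -
    have "push ?h r a \<in> A ({..<m}, r)" if "r \<in> Obj R" "a \<in> A ({..<n}, r)" for r a
      using sub_push[OF A hA that(1)] that(2) by simp
    moreover have "push ?h r0 (term_at n f') = term_at m (map h f') \<and> map h f' \<in> valid m \<and> map h f' < g"
      if f': "f' \<in> valid n" "f' < f" for f'
      using push_comp[OF validD(1)[OF f'(1)] hA _ r0, of x] comp[OF f'(1)] hv[OF f'(1)] x validD(2)[OF f'(1)]
        map_strict_mono_less[OF h(1) f'(2)] validD(2)[OF f] h(3) by (simp add: term_at_def del: FI_simps)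
    ultimately show ?thesis unfolding base_def image_elts_def by fastforce
  qed
  then have "push ?h r b \<in> B m {g' \<in> valid m. g' < g} r"
    unfolding B_def by (rule RO.span_mono[OF _ RO.span_linear[OF l premod_slice[OF finite_lessThan]
            premod_slice[OF finite_lessThan] be b[unfolded B_def]]])
  moreover have "push ?h r w \<in> W ({..<m}, r)" using sub_push[OF W hA r] w by simp
  moreover have "push (emb m g) r y = push ?h r w \<otimes>\<^bsub>gr (P m) r\<^esub> push ?h r b"
  proof -
    have "b \<in> el (P n) r" by (rule RO.sub_el[OF submodule_B r b]) auto
    moreover have "w \<in> el (P n) r" using FO.sub_el[OF W _ w] r by simp
    ultimately have "push ?h r (push (emb n f) r y) = push ?h r w \<otimes>\<^bsub>gr (P m) r\<^esub> push ?h r b"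
      using RO.linear_mult[OF l r] e by simp
    then show ?thesis
      using push_comp[OF validD(1)[OF f] hA _ r, of y] comp[OF f] h(3) validD(2)[OF f] yX(2) by (simp del: FI_simps)
  qed
  ultimately show "y \<in> lead W m g r"
    using yX by (auto simp: lead_def RO.preim_def RO.set_sum_def)
qed

text \<open>Division with remainder, by induction on the set \<open>\<Gamma>\<close> of lists that
  may occur in \<open>w\<close>: the largest list is removed by subtracting an element of
  \<open>W'\<close> with the same leading term. Downward closure of \<open>\<Gamma>\<close> ensures
  that the lists below the largest one are exactly those that remain.\<close>

lemma reduction:
  assumes W: "FO.submodule M W" and W': "FO.submodule M W'" "\<And>k. k \<in> FK \<Longrightarrow> W' k \<subseteq> W k"
    and lead: "\<And>f r. f \<in> valid n \<Longrightarrow> r \<in> Obj R \<Longrightarrow> lead W n f r \<subseteq> lead W' n f r"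
    and "finite \<Gamma>" "\<Gamma> \<subseteq> valid n" "\<And>f g. f \<in> \<Gamma> \<Longrightarrow> g \<in> valid n \<Longrightarrow> g < f \<Longrightarrow> g \<in> \<Gamma>"
    and "r \<in> Obj R" "w \<in> W ({..<n}, r)" "w \<in> B n \<Gamma> r"
  shows "w \<in> FO.set_sum M W' A ({..<n}, r)"
  using assms(5-10)
proof (induction \<Gamma> arbitrary: w rule: finite_linorder_max_induct)
  case empty
  have "w \<in> A ({..<n}, r)"
    by (rule RO.span_least[OF submodule_slice[OF A finite_lessThan] _ empty.prems(5)[unfolded B_def]]) (auto simp: base_def)
  then show ?case using FO.set_sum_right[OF premod W'(1) A] empty.prems(3) by simp
next
  case (insert f \<Gamma>)
  have r: "r \<in> Obj R" and w: "w \<in> W ({..<n}, r)" and f: "f \<in> valid n" and \<Gamma>: "\<Gamma> \<subseteq> valid n" using insert.prems by auto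
  have dc: "g \<in> \<Gamma>" if "f' \<in> \<Gamma>" "g \<in> valid n" "g < f'" for f' g
    using insert.prems(2)[of f' g] that insert.hyps(2) by auto
  have below: "{g \<in> valid n. g < f} = \<Gamma>"
    using insert.prems(2)[of f] insert.hyps(2) \<Gamma> by auto
  interpret G: comm_group "gr (P n) r" using RO.premod_grp[OF premod_slice r] by simp
  have BS: "RO.submodule (P n) (B n \<Gamma>)" by (rule submodule_B[OF \<Gamma>])
  have eE: "{(r0, term_at n f)} = image_elts (push (emb n f)) {(r0, x)}" by (simp add: image_elts_def term_at_def)
  have "w \<in> RO.set_sum (P n) (RO.span (P n) (base n \<Gamma>)) (RO.span (P n) {(r0, term_at n f)}) r"
    by (rule RO.span_Un[OF premod_slice]) (use base_el[OF \<Gamma>] insert.prems(5) term_at_el[OF f] r0 in \<open>auto simp: B_def base_def\<close>)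
  then obtain b c where b: "b \<in> B n \<Gamma> r" and c: "c \<in> RO.span (P n) {(r0, term_at n f)} r"
    and wbc: "w = b \<otimes>\<^bsub>gr (P n) r\<^esub> c" by (auto simp: RO.set_sum_def B_def)
  obtain y where y: "y \<in> X r" "c = push (emb n f) r y"
    using RO.span_image_elts[OF linear_emb[OF f] premod_slice premod_slice X_el c[unfolded eE]] by (auto simp: X_def)
  have el: "b \<in> el (P n) r" "w \<in> el (P n) r" "y \<in> el (P d) r"
    using RO.sub_el[OF BS r b] FO.sub_el[OF W _ w] r RO.sub_el[OF submodule_X r y(1)] by simp_all
  have cel: "c \<in> el (P n) r" using RO.linear_el[OF linear_emb[OF f] r el(3)] y(2) by simp
  \<comment> \<open>In additive notation, \<open>f y = w - b\<close> with \<open>w\<close> in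
    \<open>W\<close> and \<open>b\<close> in the part below \<open>f\<close>, which shows that
    \<open>y\<close> is a leading coefficient of \<open>W\<close> at \<open>f\<close>.\<close>
  have "c = w \<otimes>\<^bsub>gr (P n) r\<^esub> inv\<^bsub>gr (P n) r\<^esub> b"
    using el(1) cel unfolding wbc by (metis G.inv_solve_right' G.m_closed G.m_comm)
  then have "y \<in> lead W n f r"
    unfolding lead_def RO.preim_def RO.set_sum_def below
    by (intro IntI CollectI conjI exI[of _ w] exI[of _ "inv\<^bsub>gr (P n) r\<^esub> b"])
      (use y el(3) w RO.sub_inv[OF BS r b] in simp_all)
  then have "y \<in> lead W' n f r" using lead[OF f r] by blast
  then obtain w' b' where w': "w' \<in> W' ({..<n}, r)" and b': "b' \<in> B n \<Gamma> r" and cw: "c = w' \<otimes>\<^bsub>gr (P n) r\<^esub> b'"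
    unfolding lead_def RO.preim_def RO.set_sum_def below y(2) by blast
  have k: "({..<n}, r) \<in> FK" using r by simp
  have w'W: "w' \<in> W ({..<n}, r)" using W'(2)[OF k] w' by blast
  have el': "w' \<in> el (P n) r" "b' \<in> el (P n) r" using FO.sub_el[OF W'(1) k w'] RO.sub_el[OF BS r b'] by simp_all
  \<comment> \<open>Additively, \<open>w - w' = b + b'\<close> has no term at \<open>f\<close> any
    more, and it still lies in \<open>W\<close> because \<open>W'\<close> is contained in
    \<open>W\<close>. The induction hypothesis applies to it.\<close>
  have wb: "w = (b \<otimes>\<^bsub>gr (P n) r\<^esub> b') \<otimes>\<^bsub>gr (P n) r\<^esub> w'"
    unfolding wbc cw using el(1) el' by (simp add: G.m_ac del: part_simps)
  then have "w \<otimes>\<^bsub>gr (P n) r\<^esub> inv\<^bsub>gr (P n) r\<^esub> w' = b \<otimes>\<^bsub>gr (P n) r\<^esub> b'"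
    using el(1) el' by (metis G.inv_solve_right' G.m_closed)
  moreover have "w \<otimes>\<^bsub>gr (P n) r\<^esub> inv\<^bsub>gr (P n) r\<^esub> w' \<in> W ({..<n}, r)"
    using RO.sub_mult[OF submodule_slice[OF W finite_lessThan] r w RO.sub_inv[OF submodule_slice[OF W finite_lessThan] r w'W]] .
  moreover have "b \<otimes>\<^bsub>gr (P n) r\<^esub> b' \<in> B n \<Gamma> r" using RO.sub_mult[OF BS r b b'] .
  ultimately have "b \<otimes>\<^bsub>gr (P n) r\<^esub> b' \<in> FO.set_sum M W' A ({..<n}, r)"
    using insert.IH[OF \<Gamma> dc r] by simp
  then show ?case
    using FO.sub_mult[OF FO.submodule_set_sum[OF premod W'(1) A] k] FO.set_sum_left[OF premod W'(1) A k w'] wb by simp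
qed

lemma cover:
  assumes "y \<in> FO.span M (Sigma FK A \<union> {(({..<d}, r0), x)}) ({..<n}, r)" "r \<in> Obj R"
  shows "y \<in> B n (valid n) r"
proof -
  \<comment> \<open>The condition ranges over all injections into all initial segments, which makes
    it stable under pushing along any arrow. It holds for the elements of \<open>A\<close> and for
    \<open>x\<close>, hence on the whole span; the identity of \<open>{..<n}\<close> then gives the
    claim.\<close>
  define U where "U = (\<lambda>(S, r). {y \<in> el M (S, r). \<forall>n b. b \<in> Arr FI \<and> Src b = S \<and> Tgt b = {..<n} \<longrightarrow>
    push b r y \<in> B n (valid n) r})"
  have BS: "RO.submodule (P n) (B n (valid n))" for n by (rule submodule_B) simp
  have U: "FO.submodule M U"
  proof (rule FO.submoduleI[OF premod])
    fix k y assume k: "k \<in> FK" and y: "y \<in> U k"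
    obtain S r where kS: "k = (S, r)" by fastforce
    then have S: "finite S" "r \<in> Obj R" using k by auto
    show yk: "y \<in> el M k" using y kS by (simp add: U_def)
    have l: "RO.linear (part M S) (P n) (push b)" if "b \<in> Arr FI" "Src b = S" "Tgt b = {..<n}" for b n
      using linear_push_part[OF that(1)] that(2,3) by simp
    note p = premod_slice[OF S(1)] premod_slice[OF finite_lessThan]
    show "inv\<^bsub>gr M k\<^esub> y \<in> U k"
      using y yk S RO.linear_inv[OF l p S(2), of _ _ y] RO.sub_inv[OF BS S(2)] FO.el_inv[OF premod k yk]
      by (simp add: U_def kS)
    fix z assume z: "z \<in> U k"
    have zk: "z \<in> el M k" using z kS by (simp add: U_def)
    show "y \<otimes>\<^bsub>gr M k\<^esub> z \<in> U k"
      using y z yk zk S RO.linear_mult[OF l S(2), of _ _ y z] RO.sub_mult[OF BS S(2)] FO.el_mult[OF premod k yk zk]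
      by (simp add: U_def kS)
  next
    fix k assume k: "k \<in> FK"
    obtain S r where kS: "k = (S, r)" by fastforce
    then have S: "finite S" "r \<in> Obj R" using k by auto
    have l: "RO.linear (part M S) (P n) (push b)" if "b \<in> Arr FI" "Src b = S" "Tgt b = {..<n}" for b n
      using linear_push_part[OF that(1)] that(2,3) by simp
    note p = premod_slice[OF S(1)] premod_slice[OF finite_lessThan]
    show "\<one>\<^bsub>gr M k\<^esub> \<in> U k"
      using S RO.linear_one[OF l p S(2)] RO.sub_one[OF BS S(2)] FO.el_one[OF premod k] by (simp add: U_def kS)
  next
    fix p y assume p: "p \<in> FOps" and y: "y \<in> U (Fsrc p)"
    from p show "ac M p y \<in> U (Ftgt p)"
    proof (cases rule: FOps_cases)
      case (1 f r)
      have yel: "y \<in> el M (Src f, r)" using y 1(1) by (simp add: U_def)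
      have "push b r (push f r y) \<in> B n (valid n) r" if b: "b \<in> Arr FI" "Src b = Tgt f" "Tgt b = {..<n}" for b n
      proof -
        have "Comp FI b f \<in> Arr FI" using Comp_FI_Arr[OF 1(2) b(1)] b(2) by simp
        then have "push (Comp FI b f) r y \<in> B n (valid n) r" using y 1(1) b by (simp add: U_def)
        then show ?thesis using push_comp[OF 1(2) b(1) _ 1(3) yel] b(2) by simp
      qed
      then show ?thesis using push_el[OF premod 1(2,3) yel] 1(1) by (simp add: U_def)
    next
      case (2 S a)
      have yel: "y \<in> el M (S, Cod R a)" using y 2(1) by (simp add: U_def)
      have "push b (Dom R a) (ac M (Inr (S, a)) y) \<in> B n (valid n) (Dom R a)"
        if b: "b \<in> Arr FI" "Src b = S" "Tgt b = {..<n}" for b n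
        using RO.linear_act[OF linear_push_part[OF b(1)] 2(3), of y] RO.sub_act[OF BS 2(3)] y b yel 2(1)
        by (simp add: U_def)
      then show ?thesis using ract_el[OF premod 2(2,3) yel] 2(1) by (simp add: U_def)
    qed
  qed
  have "Sigma FK A \<union> {(({..<d}, r0), x)} \<subseteq> Sigma FK U"
  proof -
    have "push b r a \<in> B n (valid n) r"
      if "finite S" "r \<in> Obj R" "a \<in> A (S, r)" "b \<in> Arr FI" "Src b = S" "Tgt b = {..<n}" for S r a b n
    proof -
      have "push b r a \<in> A ({..<n}, r)" using sub_push[OF A that(4,2), of a] that by simp
      then show ?thesis unfolding B_def using that(2) by (intro RO.span_gen) (auto simp: base_def)
    qed
    moreover have "push b r0 x \<in> B n (valid n) r0" if b: "b \<in> Arr FI" "Src b = {..<d}" "Tgt b = {..<n}" for b n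
    proof -
      let ?f = "map (App b) [0..<d]"
      have inj: "inj_on (App b) {..<d}" and ran: "App b \<in> {..<d} \<rightarrow>\<^sub>E {..<n}" using b by (auto simp: Arr_FI)
      have "emb n ?f = b" using b ran
        by (intro arrow.equality) (auto simp: emb_def fun_eq_iff PiE_iff extensional_def)
      moreover have "?f \<in> valid n" using inj ran by (auto simp: valid_def distinct_map atLeast0LessThan)
      ultimately have "(r0, push b r0 x) \<in> base n (valid n)" by (force simp: base_def term_at_def)
      then show ?thesis unfolding B_def using r0 by (intro RO.span_gen)
    qed
    ultimately show ?thesis using FO.sub_el[OF A] r0 x by (auto simp: U_def)
  qed
  then have "y \<in> U ({..<n}, r)" using FO.span_least[OF U _ assms(1)] by blast
  moreover have "Ident FI {..<n} \<in> Arr FI" by (rule Ident_FI_Arr) simp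
  ultimately have "push (Ident FI {..<n}) r y \<in> B n (valid n) r" "y \<in> el M ({..<n}, r)" by (auto simp: U_def)
  then show ?thesis using push_Ident[OF finite_lessThan assms(2)] by simp
qed

lemma wqo_lead:
  assumes W: "FO.submodule M W" and s: "\<And>i :: nat. snd (s i) \<in> valid (fst (s i))"
  shows "\<exists>i j. i < j \<and> (\<exists>h. strict_mono h \<and> h (fst (s i)) = fst (s j) \<and> map h (snd (s i)) = snd (s j)) \<and>
    (\<forall>r\<in>Obj R. lead W (fst (s i)) (snd (s i)) r = lead W (fst (s j)) (snd (s j)) r)"
proof -
  \<comment> \<open>The target size \<open>n\<close> is appended as entry number \<open>d\<close>,
    so that the map \<open>h\<close> obtained below also takes one size to the other.\<close>
  define F where "F k i = (snd (s k) @ [fst (s k)]) ! i" for k i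
  have len: "length (snd (s k)) = d" for k using validD(2)[OF s] .
  \<comment> \<open>Dickson's lemma is applied to the entries and to all their pairwise differences.
    The \<open>+ 1\<close> makes an equality of entries visible: it gives the value 1, which forces
    the later difference to be nonnegative, whereas a negative difference is truncated to 0.\<close>
  define v where "v p k = (case p of Inl i \<Rightarrow> F k i | Inr (i, j) \<Rightarrow> nat (int (F k j) - int (F k i) + 1))" for p k
  have "finite ({..d} <+> ({..d} \<times> {..d}))" by simp
  from dickson[OF this, of v] obtain \<phi> :: "nat \<Rightarrow> nat" where \<phi>: "strict_mono \<phi>"
    and "\<forall>p\<in>{..d} <+> ({..d} \<times> {..d}). \<forall>i j. i \<le> j \<longrightarrow> v p (\<phi> i) \<le> v p (\<phi> j)" by (elim exE conjE)
  then have vm: "v p (\<phi> i) \<le> v p (\<phi> j)" if "p \<in> {..d} <+> ({..d} \<times> {..d})" "i \<le> j" for p i j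
    using that by simp
  have h: "\<exists>h. strict_mono h \<and> h (fst (s (\<phi> i))) = fst (s (\<phi> j)) \<and> map h (snd (s (\<phi> i))) = snd (s (\<phi> j))"
    if ij: "i \<le> j" for i j
  proof -
    have le: "F (\<phi> i) a \<le> F (\<phi> j) a" if "a \<le> d" for a
      using vm[of "Inl a" i j] that ij by (auto simp: v_def)
    have "\<exists>h. strict_mono h \<and> (\<forall>a\<le>d. h (F (\<phi> i) a) = F (\<phi> j) a)"
    proof (rule strict_mono_extension[OF le])
      fix a b assume ab: "a \<le> d" "b \<le> d" "F (\<phi> i) a \<le> F (\<phi> i) b"
      then show "F (\<phi> j) a - F (\<phi> i) a \<le> F (\<phi> j) b - F (\<phi> i) b"
        using vm[OF InrI[of "(a, b)"] ij] le[OF ab(1)] le[OF ab(2)] by (simp add: v_def)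
    qed
    then obtain h where h: "strict_mono h" "\<And>a. a \<le> d \<Longrightarrow> h (F (\<phi> i) a) = F (\<phi> j) a" by blast
    have "h (fst (s (\<phi> i))) = fst (s (\<phi> j))" using h(2)[of d] len by (simp add: F_def nth_append)
    moreover have "map h (snd (s (\<phi> i))) = snd (s (\<phi> j))"
    proof (rule nth_equalityI)
      show "length (map h (snd (s (\<phi> i)))) = length (snd (s (\<phi> j)))" using len by simp
      show "map h (snd (s (\<phi> i))) ! a = snd (s (\<phi> j)) ! a" if "a < length (map h (snd (s (\<phi> i))))" for a
        using h(2)[of a] that len by (simp add: F_def nth_append)
    qed
    ultimately show ?thesis using h(1) by blast
  qed
  \<comment> \<open>By \<open>lead_stretch\<close> these submodules ascend along the subsequence
    inside the noetherian module \<open>X\<close>, so they stabilise. Two consecutive indices past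
    that point satisfy both requirements.\<close>
  define Ls where "Ls i = lead W (fst (s (\<phi> i))) (snd (s (\<phi> i)))" for i
  have "\<exists>N. \<forall>i\<ge>N. \<forall>r\<in>Obj R. Ls i r = Ls N r"
  proof (rule RO.noeth_chain_stable[where U = Ls and X = X and M = "P d"])
    show "RO.noeth_sub (P d) X" unfolding X_def by (rule locally_noeth) (use r0 x in auto)
    show "RO.submodule (P d) (Ls i)" for i unfolding Ls_def by (rule submodule_lead[OF W s])
    show "Ls i r \<subseteq> X r" for i r by (auto simp: Ls_def lead_def)
    show "Ls i r \<subseteq> Ls j r" if "i \<le> j" "r \<in> Obj R" for i j r
      unfolding Ls_def using h[OF that(1)] lead_stretch[OF W s s that(2)] by blast
    show "RO.premod (P d)" by (rule premod_slice) simp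
  qed
  then obtain N where N: "\<And>i r. i \<ge> N \<Longrightarrow> r \<in> Obj R \<Longrightarrow> Ls i r = Ls N r" by blast
  have "\<phi> N < \<phi> (Suc N)" using \<phi> by (simp add: strict_mono_less)
  moreover have "\<forall>r\<in>Obj R. Ls N r = Ls (Suc N) r" using N[of "Suc N"] by simp
  ultimately show ?thesis using h[of N "Suc N"] unfolding Ls_def by (intro exI[of _ "\<phi> N"] exI[of _ "\<phi> (Suc N)"]) simp
qed

lemma relative_generators:
  assumes W: "FO.submodule M W" and WX: "\<And>k. k \<in> FK \<Longrightarrow> W k \<subseteq> FO.span M (Sigma FK A \<union> {(({..<d}, r0), x)}) k"
  shows "\<exists>E. finite E \<and> E \<subseteq> Sigma FK W \<and> (\<forall>k\<in>FK. W k \<subseteq> FO.set_sum M (FO.span M E) A k)"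
proof -
  let ?P = "{(n, f). f \<in> valid n}"
  \<comment> \<open>Divisibility of lists alone would only give an inclusion of leading
    coefficients; requiring equality of the two modules lets the generators at \<open>q\<close>
    serve at \<open>p\<close> as well.\<close>
  let ?good = "\<lambda>q p. (\<exists>h. strict_mono h \<and> h (fst q) = fst p \<and> map h (snd q) = snd p) \<and>
    (\<forall>r\<in>Obj R. lead W (fst q) (snd q) r = lead W (fst p) (snd p) r)"
  have "\<exists>F. finite F \<and> F \<subseteq> ?P \<and> (\<forall>p\<in>?P. p \<in> F \<or> (\<exists>q\<in>F. ?good q p))"
  proof (rule finite_basis)
    fix s :: "nat \<Rightarrow> nat \<times> nat list" assume "\<And>i. s i \<in> ?P"
    then have "snd (s i) \<in> valid (fst (s i))" for i by (simp add: case_prod_beta)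
    from wqo_lead[OF W this] show "\<exists>i j. i < j \<and> ?good (s i) (s j)" .
  qed
  then obtain F where F: "finite F" "F \<subseteq> ?P" "\<forall>p\<in>?P. p \<in> F \<or> (\<exists>q\<in>F. ?good q p)" by (elim exE conjE)
  have noX: "RO.noeth_sub (P d) X" unfolding X_def by (rule locally_noeth) (use r0 x in auto)
  have "RO.fg_sub (P d) (lead W n f)" if "f \<in> valid n" for n f
    using noX submodule_lead[OF W that] by (auto simp: RO.noeth_sub_def lead_def)
  then have "\<exists>E. finite E \<and> E \<subseteq> Sigma (Obj R) (lead W n f) \<and> (\<forall>r\<in>Obj R. lead W n f r \<subseteq> RO.span (P d) E r)"
    if "f \<in> valid n" for n f using that by (simp add: RO.fg_sub_def)
  note ex = someI_ex[OF this]
  define G where "G n f = (SOME E. finite E \<and> E \<subseteq> Sigma (Obj R) (lead W n f) \<and>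
    (\<forall>r\<in>Obj R. lead W n f r \<subseteq> RO.span (P d) E r))" for n f
  have G: "finite (G n f) \<and> G n f \<subseteq> Sigma (Obj R) (lead W n f) \<and>
    (\<forall>r\<in>Obj R. lead W n f r \<subseteq> RO.span (P d) (G n f) r)" if "f \<in> valid n" for n f
    unfolding G_def by (rule ex[OF that])
  have "\<exists>w. w \<in> W ({..<n}, r) \<and> (\<exists>b\<in>B n {g \<in> valid n. g < f} r. push (emb n f) r y = w \<otimes>\<^bsub>gr (P n) r\<^esub> b)"
    if "y \<in> lead W n f r" for n f r y
    using that by (auto simp: lead_def RO.preim_def RO.set_sum_def)
  note exl = someI_ex[OF this]
  define lift where "lift n f r y = (SOME w. w \<in> W ({..<n}, r) \<and>
    (\<exists>b\<in>B n {g \<in> valid n. g < f} r. push (emb n f) r y = w \<otimes>\<^bsub>gr (P n) r\<^esub> b))" for n f r y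
  have lift: "lift n f r y \<in> W ({..<n}, r) \<and>
    (\<exists>b\<in>B n {g \<in> valid n. g < f} r. push (emb n f) r y = lift n f r y \<otimes>\<^bsub>gr (P n) r\<^esub> b)"
    if "y \<in> lead W n f r" for n f r y
    unfolding lift_def by (rule exl[OF that])
  \<comment> \<open>One element of \<open>W\<close> is lifted from each of the finitely many
    generators of the leading modules at the finitely many basic positions.\<close>
  define E where "E = (\<Union>(n, f)\<in>F. (\<lambda>(r, y). (({..<n}, r), lift n f r y)) ` G n f)"
  have Efin: "finite E" unfolding E_def using F(1,2) G by auto
  have EW: "E \<subseteq> Sigma FK W"
  proof
    fix z assume "z \<in> E"
    then obtain n f r y where z: "(n, f) \<in> F" "(r, y) \<in> G n f" "z = (({..<n}, r), lift n f r y)" by (auto simp: E_def)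
    then have "r \<in> Obj R" "y \<in> lead W n f r" using G[of f n] F(2) by auto
    then show "z \<in> Sigma FK W" using lift z(3) by auto
  qed
  have Eel: "E \<subseteq> Sigma FK (el M)" using EW FO.sub_el[OF W] by blast
  define W' where "W' = FO.span M E"
  have W': "FO.submodule M W'" unfolding W'_def by (rule FO.submodule_span[OF premod Eel])
  have W'W: "W' k \<subseteq> W k" for k unfolding W'_def using FO.span_least[OF W EW] by blast
  have leadF: "lead W n f r \<subseteq> lead W' n f r" if nf: "(n, f) \<in> F" and r: "r \<in> Obj R" for n f r
  proof -
    have f: "f \<in> valid n" using nf F(2) by auto
    note g = G[OF f]
    have "G n f \<subseteq> Sigma (Obj R) (lead W' n f)"
    proof
      fix z assume z: "z \<in> G n f"
      then obtain r y where ry: "z = (r, y)" "r \<in> Obj R" "y \<in> lead W n f r" using g by auto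
      have "(({..<n}, r), lift n f r y) \<in> E" using nf z ry by (force simp: E_def)
      then have "lift n f r y \<in> W' ({..<n}, r)" unfolding W'_def using ry(2) by (intro FO.span_gen) auto
      then have "y \<in> lead W' n f r"
        using lift[OF ry(3)] ry(3) unfolding lead_def RO.preim_def RO.set_sum_def by blast
      then show "z \<in> Sigma (Obj R) (lead W' n f)" using ry by simp
    qed
    then show ?thesis using g r RO.span_least[OF submodule_lead[OF W' f]] by blast
  qed
  \<comment> \<open>At a position outside \<open>F\<close>, the leading module of \<open>W\<close>
    equals the one at a basic position dividing it, which \<open>W'\<close> attains;
    \<open>lead_stretch\<close> for \<open>W'\<close> brings it to the given position.\<close>
  have leads: "lead W n f r \<subseteq> lead W' n f r" if f: "f \<in> valid n" and r: "r \<in> Obj R" for n f r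
  proof -
    consider "(n, f) \<in> F" | q where "q \<in> F" "?good q (n, f)" using bspec[OF F(3), of "(n, f)"] f by auto
    then show ?thesis
    proof cases
      case 1 then show ?thesis using leadF r by blast
    next
      case 2
      obtain m g where q: "q = (m, g)" by fastforce
      have g: "g \<in> valid m" using 2(1) q F(2) by auto
      have "lead W n f r = lead W m g r" using 2(2) r q by simp
      also have "\<dots> \<subseteq> lead W' m g r" using leadF 2(1) q r by blast
      also have "\<dots> \<subseteq> lead W' n f r" using lead_stretch[OF W' g f r] 2(2) q by auto
      finally show ?thesis .
    qed
  qed
  note SS = FO.submodule_set_sum[OF premod W' A]
  have "w \<in> FO.set_sum M W' A k" if k: "k \<in> FK" and w: "w \<in> W k" for k w
  proof -
    obtain S r where kS: "k = (S, r)" "finite S" "r \<in> Obj R" using k by auto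
    define n where "n = card S"
    obtain f g where fg: "f \<in> Arr FI" "Src f = S" "Tgt f = {..<n}" "g \<in> Arr FI" "Src g = {..<n}" "Tgt g = S"
      "Comp FI g f = Ident FI S"
      by (rule bij_arrow[OF kS(2), folded n_def])
    have fw: "push f r w \<in> W ({..<n}, r)" using sub_push[OF W fg(1) kS(3), of w] w fg kS by simp
    have "push f r w \<in> FO.set_sum M W' A ({..<n}, r)"
    proof (rule reduction[OF W W' W'W leads finite_valid subset_refl _ kS(3) fw])
      show "push f r w \<in> B n (valid n) r" by (rule cover) (use WX[of "({..<n}, r)"] fw kS(3) in auto)
    qed auto
    from sub_push[OF SS fg(4) kS(3)] this have "push g r (push f r w) \<in> FO.set_sum M W' A (S, r)" using fg by simp
    moreover have "push g r (push f r w) = w"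
    proof -
      have wel: "w \<in> el M (S, r)" using FO.sub_el[OF W k w] kS(1) by simp
      then show ?thesis using push_comp[OF fg(1,4) _ kS(3), of w] push_Ident[OF kS(2,3) wel] fg by (simp del: FI_simps)
    qed
    ultimately show ?thesis using kS(1) by simp
  qed
  then show ?thesis using Efin EW unfolding W'_def by blast
qed

end

section \<open>Finitely generated FI-modules are noetherian\<close>

context fi_module
begin

text \<open>Generators are added one at a time. The span of the earlier ones is the submodule
  \<open>A\<close> of the extension locale; relative generators modulo \<open>A\<close> and
  noetherianity of \<open>A\<close> combine by \<open>fg_sub_relative\<close>.\<close>

lemma noeth_span:
  assumes "finite E" "E \<subseteq> Sigma FK (el M)" shows "FO.noeth_sub M (FO.span M E)"
  using assms
proof (induction E)
  case empty
  have "FO.fg_sub M W" if "\<forall>k\<in>FK. W k \<subseteq> FO.span M {} k" for W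
    using that unfolding FO.fg_sub_def by (intro exI[of _ "{}"]) simp
  then show ?case by (simp add: FO.noeth_sub_def)
next
  case (insert e E)
  obtain S r y where e: "e = ((S, r), y)" "finite S" "r \<in> Obj R" "y \<in> el M (S, r)" using insert.prems by auto
  define d where "d = card S"
  obtain f g where fg: "f \<in> Arr FI" "Src f = S" "Tgt f = {..<d}" "g \<in> Arr FI" "Src g = {..<d}" "Tgt g = S"
    "Comp FI g f = Ident FI S"
    by (rule bij_arrow[OF e(2), folded d_def])
  \<comment> \<open>The new generator is moved to an initial segment by a bijection, and
    \<open>gx\<close> moves it back, so it may be replaced by \<open>x\<close> in the span.\<close>
  define x where "x = push f r y"
  have x: "x \<in> el M ({..<d}, r)" using push_el[OF premod fg(1) e(3), of y] e(4) fg by (simp add: x_def)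
  have gx: "push g r x = y"
    using push_comp[OF fg(1,4) _ e(3), of y] push_Ident[OF e(2-4)] fg e(4) by (simp add: x_def del: FI_simps)
  have E: "E \<subseteq> Sigma FK (el M)" using insert.prems by simp
  let ?A = "FO.span M E"
  have A: "FO.submodule M ?A" by (rule FO.submodule_span[OF premod E])
  interpret fi_module_extension R M ?A d r x
    by unfold_locales (use A e(3) x in auto)
  let ?G = "Sigma FK ?A \<union> {(({..<d}, r), x)}"
  have G: "?G \<subseteq> Sigma FK (el M)" using FO.sub_el[OF A] e(3) x by auto
  have GS: "FO.submodule M (FO.span M ?G)" by (rule FO.submodule_span[OF premod G])
  have "insert e E \<subseteq> Sigma FK (FO.span M ?G)"
  proof -
    have "x \<in> FO.span M ?G ({..<d}, r)" using e(3) by (intro FO.span_gen) auto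
    then have "y \<in> FO.span M ?G (S, r)" using sub_push[OF GS fg(4) e(3), of x] fg gx by simp
    moreover have "z \<in> FO.span M ?G k" if "(k, z) \<in> E" for k z
    proof -
      have k: "k \<in> FK" using E that by auto
      then have "z \<in> ?A k" using that by (intro FO.span_gen)
      then show ?thesis using k by (intro FO.span_gen) auto
    qed
    ultimately show ?thesis using e E by auto
  qed
  then have sub: "FO.span M (insert e E) k \<subseteq> FO.span M ?G k" for k using FO.span_least[OF GS] by blast
  show ?case unfolding FO.noeth_sub_def
  proof (intro allI impI)
    fix W assume W: "FO.submodule M W" "\<forall>k\<in>FK. W k \<subseteq> FO.span M (insert e E) k"
    obtain F where F: "finite F" "F \<subseteq> Sigma FK W" "\<forall>k\<in>FK. W k \<subseteq> FO.set_sum M (FO.span M F) ?A k"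
      using relative_generators[OF W(1)] W(2) sub by blast
    show "FO.fg_sub M W"
      by (rule FO.fg_sub_relative[OF premod A insert.IH[OF E] W(1) F(1,2)]) (use F(3) in blast)
  qed
qed

lemma fg_noeth: assumes "FO.fg_sub M (el M)" shows "FO.noeth_sub M (el M)"
proof -
  obtain E where "finite E" "E \<subseteq> Sigma FK (el M)" "\<forall>k\<in>FK. el M k \<subseteq> FO.span M E k"
    using assms by (auto simp: FO.fg_sub_def)
  then show ?thesis using noeth_span[of E] by (blast intro: FO.noeth_sub_mono)
qed

end

context ring_category
begin

lemma fi_module_fmd:
  assumes "locally_noetherian TYPE('u) (Mod R)" "is_functor FI (Mod R) V"
  shows "fi_module R (fmd V)"
proof
  show "FO.premod (fmd V)" "fi_rel (fmd V)" using fmd_FI_Mod[OF assms(2)] by auto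
  show "RO.noeth_sub (part (fmd V) S) (RO.span (part (fmd V) S) {(r, x)})"
    if "finite S" "r \<in> Obj R" "x \<in> el (fmd V) (S, r)" for S r x
    using RM.locally_noetherian_span[OF assms(1) FI_ObjD(1)[OF assms(2) that(1)] that(2)] that(3)
    by (simp add: part_fmd)
qed

end

section \<open>Shifts\<close>

lemma FI_arrow_eqI:
  assumes "f \<in> Arr FI" "g \<in> Arr FI" "Src f = Src g" "Tgt f = Tgt g" "\<And>x. x \<in> Src g \<Longrightarrow> App f x = App g x"
  shows "f = g"
proof -
  have "App f x = App g x" for x
    using assms by (cases "x \<in> Src g") (auto simp: Arr_FI PiE_iff extensional_def)
  then show ?thesis using assms(3,4) by (intro arrow.equality) auto
qed

lemma FI_App: "f \<in> Arr FI \<Longrightarrow> x \<in> Src f \<Longrightarrow> App f x \<in> Tgt f"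
  by (auto simp: Arr_FI)

lemma FI_inverse:
  assumes "f \<in> Arr FI" "App f ` Src f = Tgt f"
  obtains g where "g \<in> Arr FI" "Src g = Tgt f" "Tgt g = Src f" "Comp FI f g = Ident FI (Tgt f)"
proof -
  have inj: "inj_on (App f) (Src f)" and fin: "finite (Src f)" "finite (Tgt f)" using assms(1) by (auto simp: Arr_FI)
  let ?g = "\<lparr>Src = Tgt f, Tgt = Src f, App = (\<lambda>y\<in>Tgt f. inv_into (Src f) (App f) y)\<rparr>"
  have "inv_into (Src f) (App f) y \<in> Src f \<and> App f (inv_into (Src f) (App f) y) = y" if "y \<in> Tgt f" for y
    using that assms(2) by (auto simp: inv_into_into f_inv_into_f)
  note i = this
  have "inj_on (inv_into (Src f) (App f)) (Tgt f)" using inj_on_inv_into[of "Tgt f" "App f" "Src f"] assms(2) by simp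
  then have "?g \<in> Arr FI" using fin i by (auto simp: Arr_FI inj_on_def)
  moreover have "Comp FI f ?g = Ident FI (Tgt f)" using i by (auto simp: compose_def fun_eq_iff)
  ultimately show ?thesis using that[of ?g] by simp
qed

lemma finite_FI_Hom: assumes "finite S" "finite T" shows "finite {f \<in> Arr FI. Src f = S \<and> Tgt f = T}"
proof (rule finite_imageD[of App])
  have "App ` {f \<in> Arr FI. Src f = S \<and> Tgt f = T} \<subseteq> S \<rightarrow>\<^sub>E T" by (auto simp: Arr_FI)
  then show "finite (App ` {f \<in> Arr FI. Src f = S \<and> Tgt f = T})"
    by (rule finite_subset) (simp add: finite_PiE assms)
  show "inj_on App {f \<in> Arr FI. Src f = S \<and> Tgt f = T}" by (auto simp: inj_on_def intro: arrow.equality)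
qed

abbreviation old :: "nat \<Rightarrow> nat" where "old x \<equiv> sum_encode (Inl x)"
abbreviation new :: "nat \<Rightarrow> nat" where "new j \<equiv> sum_encode (Inr j)"

lemma old_new [simp]: "old x = old y \<longleftrightarrow> x = y" "new i = new j \<longleftrightarrow> i = j" "old x \<noteq> new j" "new j \<noteq> old x"
  by (simp_all add: sum_encode_eq)

lemma pad_iff [simp]: "old x \<in> pad a S \<longleftrightarrow> x \<in> S" "new j \<in> pad a S \<longleftrightarrow> 1 \<le> j \<and> j \<le> a"
  by (auto simp: pad_def image_iff)

lemma pad_cases:
  assumes "y \<in> pad a S"
  obtains x where "x \<in> S" "y = old x" | j where "1 \<le> j" "j \<le> a" "y = new j"
  using assms by (auto simp: pad_def)

lemma finite_pad [simp]: "finite S \<Longrightarrow> finite (pad a S)"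
  by (simp add: pad_def)

lemma pad_arrow_simps [simp]: "Src (pad_arrow a f) = pad a (Src f)" "Tgt (pad_arrow a f) = pad a (Tgt f)"
  "x \<in> Src f \<Longrightarrow> App (pad_arrow a f) (old x) = old (App f x)"
  "1 \<le> j \<Longrightarrow> j \<le> a \<Longrightarrow> App (pad_arrow a f) (new j) = new j"
  by (simp_all add: pad_arrow_def)

lemma into_pad_simps [simp]: "Src (into_pad a S) = S" "Tgt (into_pad a S) = pad a S"
  "x \<in> S \<Longrightarrow> App (into_pad a S) x = old x"
  by (simp_all add: into_pad_def)

lemma pad_inclusion_simps [simp]: "Src (pad_inclusion a b S) = pad a S" "Tgt (pad_inclusion a b S) = pad b S"
  "x \<in> pad a S \<Longrightarrow> App (pad_inclusion a b S) x = x"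
  by (simp_all add: pad_inclusion_def)

lemma into_pad_Arr: "finite S \<Longrightarrow> into_pad a S \<in> Arr FI"
  by (auto simp: Arr_FI into_pad_def inj_on_def)

lemma pad_inclusion_Arr: "finite S \<Longrightarrow> a \<le> b \<Longrightarrow> pad_inclusion a b S \<in> Arr FI"
  by (auto simp: Arr_FI pad_inclusion_def inj_on_def elim!: pad_cases)

lemma pad_arrow_Arr: assumes "f \<in> Arr FI" shows "pad_arrow a f \<in> Arr FI"
proof -
  have f: "finite (Src f)" "finite (Tgt f)" "inj_on (App f) (Src f)" using assms by (auto simp: Arr_FI)
  have "App (pad_arrow a f) y \<in> pad a (Tgt f)" if "y \<in> pad a (Src f)" for y
    using that FI_App[OF assms] by (cases rule: pad_cases) auto
  moreover have "y = z" if "y \<in> pad a (Src f)" "z \<in> pad a (Src f)" "App (pad_arrow a f) y = App (pad_arrow a f) z" for y z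
    using that f(3) by (auto elim!: pad_cases dest: inj_onD)
  moreover have "App (pad_arrow a f) \<in> extensional (pad a (Src f))" by (simp add: pad_arrow_def)
  ultimately show ?thesis using f(1,2) by (auto simp: Arr_FI PiE_iff inj_on_def)
qed

lemma Comp_FI_simps: "Src (Comp FI g f) = Src f" "Tgt (Comp FI g f) = Tgt g"
  "x \<in> Src f \<Longrightarrow> App (Comp FI g f) x = App g (App f x)"
  by (simp_all add: compose_def)

lemma pad_arrow_Comp:
  assumes "f \<in> Arr FI" "g \<in> Arr FI" "Tgt f = Src g"
  shows "pad_arrow a (Comp FI g f) = Comp FI (pad_arrow a g) (pad_arrow a f)"
proof (rule FI_arrow_eqI)
  have c: "Comp FI g f \<in> Arr FI" using category.Comp_in[OF category_FI, of f "Src f" "Tgt f" g "Tgt g"] assms by (simp add: Hom_def)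
  show "pad_arrow a (Comp FI g f) \<in> Arr FI" by (rule pad_arrow_Arr[OF c])
  show "Comp FI (pad_arrow a g) (pad_arrow a f) \<in> Arr FI"
    using category.Comp_in[OF category_FI, of "pad_arrow a f" "pad a (Src f)" "pad a (Tgt f)" "pad_arrow a g" "pad a (Tgt g)"]
      pad_arrow_Arr assms by (simp add: Hom_def)
  fix y assume "y \<in> Src (Comp FI (pad_arrow a g) (pad_arrow a f))"
  then have y: "y \<in> pad a (Src f)" by simp
  then show "App (pad_arrow a (Comp FI g f)) y = App (Comp FI (pad_arrow a g) (pad_arrow a f)) y"
    using FI_App[OF assms(1)] assms(3)
    by (cases rule: pad_cases) (simp_all add: Comp_FI_simps del: FI_simps)
qed (simp_all add: Comp_FI_simps)

lemma Ident_FI_in: "finite S \<Longrightarrow> Ident FI S \<in> Arr FI"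
  by (simp add: Arr_FI inj_on_def)

lemma pad_arrow_Ident: "finite S \<Longrightarrow> pad_arrow a (Ident FI S) = Ident FI (pad a S)"
  by (rule FI_arrow_eqI[OF pad_arrow_Arr[OF Ident_FI_in] Ident_FI_in]) (auto elim!: pad_cases)

lemma pad_functor: "is_functor FI FI (pad_functor a)"
  unfolding is_functor_def
proof (intro conjI ballI impI)
  fix f g assume "f \<in> Arr FI" "g \<in> Arr FI" "Cod FI f = Dom FI g"
  then show "FArr (pad_functor a) (Comp FI g f) = Comp FI (FArr (pad_functor a) g) (FArr (pad_functor a) f)"
    using pad_arrow_Comp[of f g a] by (simp add: pad_functor_def del: FI_simps(4))
next
  fix S assume "S \<in> Obj FI"
  then show "FArr (pad_functor a) (Ident FI S) = Ident FI (FObj (pad_functor a) S)"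
    using pad_arrow_Ident[of S a] by (simp add: pad_functor_def)
qed (auto simp: pad_functor_def Hom_def pad_arrow_Arr)

lemma is_functor_comp:
  assumes "category C" "is_functor C D F" "is_functor D E G" shows "is_functor C E (comp_functor G F)"
  unfolding is_functor_def
proof (intro conjI ballI impI)
  fix f assume f: "f \<in> Arr C"
  then have "FArr F f \<in> Hom D (FObj F (Dom C f)) (FObj F (Cod C f))" using assms(2) by (simp add: is_functor_def)
  then show "FArr (comp_functor G F) f \<in> Hom E (FObj (comp_functor G F) (Dom C f)) (FObj (comp_functor G F) (Cod C f))"
    using assms(3) by (auto simp: is_functor_def comp_functor_def Hom_def)
  fix g assume g: "g \<in> Arr C" "Cod C f = Dom C g"
  then have "FArr F g \<in> Hom D (FObj F (Dom C g)) (FObj F (Cod C g))" using assms(2) by (simp add: is_functor_def)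
  then show "FArr (comp_functor G F) (Comp C g f) = Comp E (FArr (comp_functor G F) g) (FArr (comp_functor G F) f)"
    using f g assms(2,3) \<open>FArr F f \<in> _\<close> by (auto simp: is_functor_def comp_functor_def Hom_def)
qed (use assms in \<open>auto simp: is_functor_def comp_functor_def\<close>)

lemma into_pad_natural:
  assumes "f \<in> Arr FI"
  shows "Comp FI (into_pad a (Tgt f)) f = Comp FI (pad_arrow a f) (into_pad a (Src f))"
proof -
  have "finite (Src f)" "finite (Tgt f)" using assms by (auto simp: Arr_FI)
  then show ?thesis
    using category.Comp_in[OF category_FI, of f "Src f" "Tgt f" "into_pad a (Tgt f)" "pad a (Tgt f)"]
      category.Comp_in[OF category_FI, of "into_pad a (Src f)" "Src f" "pad a (Src f)" "pad_arrow a f" "pad a (Tgt f)"]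
      into_pad_Arr pad_arrow_Arr[OF assms] assms FI_App[OF assms]
    by (intro FI_arrow_eqI) (simp_all add: Hom_def Comp_FI_simps del: FI_simps(4))
qed

lemma pad_inclusion_into:
  assumes "finite S" "a \<le> b" shows "Comp FI (pad_inclusion a b S) (into_pad a S) = into_pad b S"
  using category.Comp_in[OF category_FI, of "into_pad a S" S "pad a S" "pad_inclusion a b S" "pad b S"]
    into_pad_Arr pad_inclusion_Arr assms
  by (intro FI_arrow_eqI) (simp_all add: Hom_def Comp_FI_simps del: FI_simps(4))

text \<open>Here \<open>a\<close> is the number of points of \<open>Tgt f\<close> missed by
  \<open>f\<close>: these go to the new points, and the image of \<open>f\<close> is sent back to
  the old ones.\<close>

lemma extend_to_into_pad:
  assumes f: "f \<in> Arr FI"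
  obtains a g where "g \<in> Arr FI" "Src g = Tgt f" "Tgt g = pad a (Src f)" "Comp FI g f = into_pad a (Src f)"
proof -
  have fin: "finite (Src f)" "finite (Tgt f)" and inj: "inj_on (App f) (Src f)" using f by (auto simp: Arr_FI)
  define a where "a = card (Tgt f - App f ` Src f)"
  obtain h where h: "bij_betw h (Tgt f - App f ` Src f) {1..a}"
    using finite_same_card_bij[of "Tgt f - App f ` Src f" "{1..a}"] fin unfolding a_def by fastforce
  define G where "G y = (if y \<in> App f ` Src f then old (inv_into (Src f) (App f) y) else new (h y))" for y
  let ?g = "\<lparr>Src = Tgt f, Tgt = pad a (Src f), App = restrict G (Tgt f)\<rparr>"
  have hm: "h y \<in> {1..a}" if "y \<in> Tgt f" "y \<notin> App f ` Src f" for y using h that by (auto simp: bij_betw_def)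
  have "G y \<in> pad a (Src f)" if "y \<in> Tgt f" for y
    using that hm[OF that] by (auto simp: G_def inv_into_into)
  moreover have "inj_on G (Tgt f)"
  proof (rule inj_onI)
    fix y z assume yz: "y \<in> Tgt f" "z \<in> Tgt f" "G y = G z"
    show "y = z"
    proof (cases "y \<in> App f ` Src f")
      case True
      then show ?thesis using yz(3) by (auto simp: G_def inj inv_into_f_f split: if_splits)
    next
      case False
      then have "z \<notin> App f ` Src f" "h y = h z" using yz(3) by (auto simp: G_def split: if_splits)
      then show ?thesis using yz(1,2) False bij_betw_imp_inj_on[OF h] by (auto dest: inj_onD)
    qed
  qed
  ultimately have g: "?g \<in> Arr FI" using fin by (auto simp: Arr_FI inj_on_def)
  have "Comp FI ?g f \<in> Arr FI" using category.Comp_in[OF category_FI, of f "Src f" "Tgt f" ?g "pad a (Src f)"] f g by (simp add: Hom_def)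
  then have "Comp FI ?g f = into_pad a (Src f)"
    by (rule FI_arrow_eqI[OF _ into_pad_Arr[OF fin(1)]])
      (use FI_App[OF f] in \<open>simp_all add: Comp_FI_simps G_def inv_into_f_f[OF inj] del: FI_simps(4)\<close>)
  then show ?thesis using that[OF g] by simp
qed

text \<open>The cardinality bound leaves at least \<open>a\<close> points of \<open>Tgt f\<close>
  outside the image, enough to receive the new points injectively.\<close>

lemma factor_through_into_pad:
  assumes f: "f \<in> Arr FI" and card: "card (Src f) + a \<le> card (Tgt f)"
  obtains g where "g \<in> Arr FI" "Src g = pad a (Src f)" "Tgt g = Tgt f" "Comp FI g (into_pad a (Src f)) = f"
proof -
  have fin: "finite (Src f)" "finite (Tgt f)" and inj: "inj_on (App f) (Src f)" using f by (auto simp: Arr_FI)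
  have "card (App f ` Src f) = card (Src f)" using inj by (rule card_image)
  moreover have "App f ` Src f \<subseteq> Tgt f" using FI_App[OF f] by blast
  ultimately have "card {1..a} \<le> card (Tgt f - App f ` Src f)"
    using card card_Diff_subset[of "App f ` Src f" "Tgt f"] fin by simp
  then obtain h where h: "inj_on h {1..a}" "h ` {1..a} \<subseteq> Tgt f - App f ` Src f"
    using card_le_inj[of "{1..a}" "Tgt f - App f ` Src f"] fin by auto
  define G where "G y = (case sum_decode y of Inl x \<Rightarrow> App f x | Inr j \<Rightarrow> h j)" for y
  let ?g = "\<lparr>Src = pad a (Src f), Tgt = Tgt f, App = restrict G (pad a (Src f))\<rparr>"
  have G: "G (old x) = App f x" "G (new j) = h j" for x j by (simp_all add: G_def)
  have "h j \<in> Tgt f - App f ` Src f" if "1 \<le> j" "j \<le> a" for j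
    using h(2) that by (meson atLeastAtMost_iff image_subset_iff)
  then have hm: "h j \<in> Tgt f" "h j \<notin> App f ` Src f" if "1 \<le> j" "j \<le> a" for j using that by auto
  have "G y \<in> Tgt f" if "y \<in> pad a (Src f)" for y
    using that by (cases rule: pad_cases) (use G hm FI_App[OF f] in auto)
  moreover have "inj_on G (pad a (Src f))"
  proof (rule inj_onI)
    fix y z assume y: "y \<in> pad a (Src f)" and z: "z \<in> pad a (Src f)" and e: "G y = G z"
    have hne: "h j \<noteq> App f x" if "1 \<le> j" "j \<le> a" "x \<in> Src f" for x j using hm(2)[OF that(1,2)] that(3) by blast
    have hi: "i = j" if "h i = h j" "1 \<le> i" "i \<le> a" "1 \<le> j" "j \<le> a" for i j
      using inj_onD[OF h(1) that(1)] that by simp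
    from y z show "y = z"
      by (elim pad_cases) (use e G in \<open>auto intro: hi inj_onD[OF inj] simp: hne hne[symmetric]\<close>)
  qed
  ultimately have g: "?g \<in> Arr FI" using fin by (auto simp: Arr_FI inj_on_def)
  have "Comp FI ?g (into_pad a (Src f)) \<in> Arr FI"
    using category.Comp_in[OF category_FI, of "into_pad a (Src f)" "Src f" "pad a (Src f)" ?g "Tgt f"] into_pad_Arr[OF fin(1)] g
    by (simp add: Hom_def)
  then have "Comp FI ?g (into_pad a (Src f)) = f"
    by (rule FI_arrow_eqI[OF _ f]) (simp_all add: Comp_FI_simps G del: FI_simps(4))
  then show ?thesis using that[OF g] by simp
qed

text \<open>The outer new points keep their numbers \<open>1..d\<close>; the inner ones are moved
  past them by adding \<open>d\<close>. This is a bijection, natural in \<open>S\<close>.\<close>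

definition regroup :: "nat \<Rightarrow> nat \<Rightarrow> nat set \<Rightarrow> FI_arrow" where
  "regroup d e S = \<lparr>Src = pad d (pad e S), Tgt = pad (d + e) S, App = (\<lambda>y\<in>pad d (pad e S).
    case sum_decode y of Inl z \<Rightarrow> (case sum_decode z of Inl x \<Rightarrow> old x | Inr j \<Rightarrow> new (d + j)) | Inr j \<Rightarrow> new j)\<rparr>"

lemma regroup_simps [simp]: "Src (regroup d e S) = pad d (pad e S)" "Tgt (regroup d e S) = pad (d + e) S"
  "x \<in> S \<Longrightarrow> App (regroup d e S) (old (old x)) = old x"
  "1 \<le> j \<Longrightarrow> j \<le> e \<Longrightarrow> App (regroup d e S) (old (new j)) = new (d + j)"
  "1 \<le> j \<Longrightarrow> j \<le> d \<Longrightarrow> App (regroup d e S) (new j) = new j"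
  by (simp_all add: regroup_def)

lemma regroup_Arr: assumes "finite S" shows "regroup d e S \<in> Arr FI"
proof -
  have "App (regroup d e S) y \<in> pad (d + e) S" if "y \<in> pad d (pad e S)" for y
    using that by (auto elim!: pad_cases)
  moreover have "y = z" if "y \<in> pad d (pad e S)" "z \<in> pad d (pad e S)" "App (regroup d e S) y = App (regroup d e S) z" for y z
    using that by (auto elim!: pad_cases)
  moreover have "App (regroup d e S) \<in> extensional (pad d (pad e S))" by (simp add: regroup_def)
  ultimately show ?thesis using assms by (auto simp: Arr_FI PiE_iff inj_on_def)
qed

lemma regroup_surj: "App (regroup d e S) ` Src (regroup d e S) = Tgt (regroup d e S)"
proof
  show "App (regroup d e S) ` Src (regroup d e S) \<subseteq> Tgt (regroup d e S)" by (auto elim!: pad_cases)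
  show "Tgt (regroup d e S) \<subseteq> App (regroup d e S) ` Src (regroup d e S)"
  proof
    fix y assume "y \<in> Tgt (regroup d e S)"
    then have "y \<in> pad (d + e) S" by simp
    then show "y \<in> App (regroup d e S) ` Src (regroup d e S)"
    proof (cases rule: pad_cases)
      case (1 x) then show ?thesis by (intro image_eqI[of _ _ "old (old x)"]) auto
    next
      case (2 j)
      show ?thesis
      proof (cases "j \<le> d")
        case True then show ?thesis using 2 by (intro image_eqI[of _ _ "new j"]) auto
      next
        case False then show ?thesis using 2 by (intro image_eqI[of _ _ "old (new (j - d))"]) auto
      qed
    qed
  qed
qed

lemma Comp_FI_in: "f \<in> Arr FI \<Longrightarrow> g \<in> Arr FI \<Longrightarrow> Tgt f = Src g \<Longrightarrow> Comp FI g f \<in> Arr FI"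
  using category.Comp_in[OF category_FI, of f "Src f" "Tgt f" g "Tgt g"] by (simp add: Hom_def)

lemma regroup_natural:
  assumes h: "h \<in> Arr FI"
  shows "Comp FI (regroup d e (Tgt h)) (pad_arrow d (pad_arrow e h)) = Comp FI (pad_arrow (d + e) h) (regroup d e (Src h))"
proof (rule FI_arrow_eqI)
  have fin: "finite (Src h)" "finite (Tgt h)" using h by (auto simp: Arr_FI)
  show "Comp FI (regroup d e (Tgt h)) (pad_arrow d (pad_arrow e h)) \<in> Arr FI"
    by (rule Comp_FI_in) (simp_all add: pad_arrow_Arr h regroup_Arr fin)
  show "Comp FI (pad_arrow (d + e) h) (regroup d e (Src h)) \<in> Arr FI"
    by (rule Comp_FI_in) (simp_all add: pad_arrow_Arr h regroup_Arr fin)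
  fix y assume "y \<in> Src (Comp FI (pad_arrow (d + e) h) (regroup d e (Src h)))"
  then have "y \<in> pad d (pad e (Src h))" by simp
  then show "App (Comp FI (regroup d e (Tgt h)) (pad_arrow d (pad_arrow e h))) y =
      App (Comp FI (pad_arrow (d + e) h) (regroup d e (Src h))) y"
    using FI_App[OF h] by (auto elim!: pad_cases simp: Comp_FI_simps simp del: FI_simps(4))
qed (simp_all add: Comp_FI_simps)

text \<open>\<open>S'\<close> is the part of the source that \<open>c\<close> sends to old points.
  All information about new points is put into \<open>g\<close>, whose target depends only on
  \<open>S'\<close>; since \<open>S'\<close> is a subset of the source, only finitely many pairs
  \<open>(S', g)\<close> occur for a given source.\<close>

lemma factor_pad:
  assumes c: "c \<in> Arr FI" "Tgt c = pad e T" "finite T"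
  obtains S' g h where "S' \<subseteq> Src c" "g \<in> Arr FI" "Src g = Src c" "Tgt g = pad e S'"
    "h \<in> Arr FI" "Src h = S'" "Tgt h = T" "Comp FI (pad_arrow e h) g = c"
proof -
  have fin: "finite (Src c)" and inj: "inj_on (App c) (Src c)" using c(1) by (auto simp: Arr_FI)
  define S' where "S' = {s \<in> Src c. \<exists>x. App c s = old x}"
  define H where "H s = (THE x. App c s = old x)" for s
  have H: "App c s = old (H s)" if "s \<in> S'" for s using that by (auto simp: S'_def H_def)
  have cT: "App c s \<in> pad e T" if "s \<in> Src c" for s using FI_App[OF c(1) that] c(2) by simp
  have S'c: "S' \<subseteq> Src c" by (auto simp: S'_def)
  have HT: "H s \<in> T" if "s \<in> S'" for s using cT[of s] H[OF that] S'c that by auto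
  let ?h = "\<lparr>Src = S', Tgt = T, App = restrict H S'\<rparr>"
  have "inj_on H S'" using inj H S'c by (auto simp: inj_on_def subset_iff)
  then have h: "?h \<in> Arr FI" using fin S'c c(3) HT by (auto simp: Arr_FI finite_subset inj_on_def)
  define G where "G s = (if s \<in> S' then old s else App c s)" for s
  let ?g = "\<lparr>Src = Src c, Tgt = pad e S', App = restrict G (Src c)\<rparr>"
  have N: "\<exists>j. 1 \<le> j \<and> j \<le> e \<and> App c s = new j" if "s \<in> Src c" "s \<notin> S'" for s
    using cT[OF that(1)] that by (cases rule: pad_cases) (auto simp: S'_def)
  have "G s \<in> pad e S'" if "s \<in> Src c" for s using N[OF that] by (auto simp: G_def)
  moreover have "inj_on G (Src c)"
  proof (rule inj_onI)
    fix s t assume st: "s \<in> Src c" "t \<in> Src c" and e: "G s = G t"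
    show "s = t" using e N[OF st(1)] N[OF st(2)] inj_onD[OF inj _ st] by (auto simp: G_def split: if_splits)
  qed
  ultimately have g: "?g \<in> Arr FI" using fin S'c by (auto simp: Arr_FI inj_on_def finite_subset)
  have "Comp FI (pad_arrow e ?h) ?g \<in> Arr FI" by (rule Comp_FI_in[OF g pad_arrow_Arr[OF h]]) simp
  then have "Comp FI (pad_arrow e ?h) ?g = c"
  proof (rule FI_arrow_eqI[OF _ c(1)])
    fix s assume s: "s \<in> Src c"
    show "App (Comp FI (pad_arrow e ?h) ?g) s = App c s"
    proof (cases "s \<in> S'")
      case True then show ?thesis using s H by (simp add: Comp_FI_simps G_def del: FI_simps(4))
    next
      case False
      then obtain j where "1 \<le> j" "j \<le> e" "App c s = new j" using N[OF s] by blast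
      then show ?thesis using False s by (simp add: Comp_FI_simps G_def del: FI_simps(4))
    qed
  qed (simp_all add: c(2))
  then show ?thesis using that[OF S'c g _ _ h] by simp
qed

section \<open>Finite generation along injections, surjections and extensions\<close>

context sorted_ops
begin

lemma fg_subI:
  "finite E \<Longrightarrow> E \<subseteq> Sigma K U \<Longrightarrow> (\<And>k x. k \<in> K \<Longrightarrow> x \<in> U k \<Longrightarrow> x \<in> span M E k) \<Longrightarrow> fg_sub M U"
  unfolding fg_sub_def by (intro exI[of _ E]) auto

text \<open>The image is finitely generated as a submodule of a noetherian module, and its
  generators have unique preimages. Injectivity turns a relation between images into one in
  \<open>M\<close>.\<close>

lemma fg_of_injective:
  assumes l: "linear M N \<phi>" and M: "premod M" and N: "premod N" and inj: "\<And>k. k \<in> K \<Longrightarrow> inj_on (\<phi> k) (el M k)"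
    and no: "noeth_sub N (el N)"
  shows "fg_sub M (el M)"
proof -
  have "submodule N (\<lambda>k. \<phi> k ` el M k)" by (rule submodule_image[OF l M N submodule_el[OF M]])
  then have "fg_sub N (\<lambda>k. \<phi> k ` el M k)" using no linear_el[OF l] unfolding noeth_sub_def by blast
  then obtain E where E: "finite E" "E \<subseteq> Sigma K (\<lambda>k. \<phi> k ` el M k)" "\<forall>k\<in>K. \<phi> k ` el M k \<subseteq> span N E k"
    by (auto simp: fg_sub_def)
  define G where "G = image_elts (\<lambda>k. inv_into (el M k) (\<phi> k)) E"
  have G: "finite G" "G \<subseteq> Sigma K (el M)" using E by (auto simp: G_def image_elts_def inv_into_into)
  have "\<phi> k (inv_into (el M k) (\<phi> k) y) = y" if "(k, y) \<in> E" for k y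
    using E(2) that by (auto simp: f_inv_into_f)
  then have "image_elts \<phi> G = E" unfolding G_def image_elts_def image_image by force
  then have "x \<in> span M G k" if k: "k \<in> K" and x: "x \<in> el M k" for k x
  proof -
    have "\<phi> k x \<in> span N (image_elts \<phi> G) k" using E(3) k x \<open>image_elts \<phi> G = E\<close> by blast
    then obtain y where y: "y \<in> span M G k" "\<phi> k x = \<phi> k y" using span_image_elts[OF l M N G(2)] by blast
    then have "x = y" using inj_onD[OF inj[OF k]] spanD[OF y(1) M G(2)] x by blast
    then show ?thesis using y(1) by simp
  qed
  then show ?thesis by (rule fg_subI[OF G])
qed

lemma fg_of_surjective:
  assumes l: "linear M N \<phi>" and M: "premod M" and N: "premod N" and surj: "\<And>k. k \<in> K \<Longrightarrow> el N k \<subseteq> \<phi> k ` el M k"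
    and fg: "fg_sub M (el M)"
  shows "fg_sub N (el N)"
proof -
  obtain E where E: "finite E" "E \<subseteq> Sigma K (el M)" "\<forall>k\<in>K. el M k \<subseteq> span M E k" using fg by (auto simp: fg_sub_def)
  have "y \<in> span N (image_elts \<phi> E) k" if k: "k \<in> K" and y: "y \<in> el N k" for k y
  proof -
    obtain x where "x \<in> el M k" "y = \<phi> k x" using surj[OF k] y by blast
    then show ?thesis using span_linear[OF l M N E(2), of x k] E(3) k by blast
  qed
  moreover have "image_elts \<phi> E \<subseteq> Sigma K (el N)" by (rule image_elts_subset[OF E(2)]) (rule linear_el[OF l])
  ultimately show ?thesis by (intro fg_subI[OF finite_image_elts[OF E(1)]])
qed

lemma fg_extension:
  assumes f: "linear L M f" and g: "linear M N g" and L: "premod L" and M: "premod M" and N: "premod N"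
    and surj: "\<And>k. k \<in> K \<Longrightarrow> el N k \<subseteq> g k ` el M k"
    and ex: "\<And>k x. k \<in> K \<Longrightarrow> x \<in> el M k \<Longrightarrow> g k x = \<one>\<^bsub>gr N k\<^esub> \<Longrightarrow> x \<in> f k ` el L k"
    and fgL: "fg_sub L (el L)" and fgN: "fg_sub N (el N)"
  shows "fg_sub M (el M)"
proof -
  obtain E where E: "finite E" "E \<subseteq> Sigma K (el L)" "\<forall>k\<in>K. el L k \<subseteq> span L E k" using fgL by (auto simp: fg_sub_def)
  obtain G where G: "finite G" "G \<subseteq> Sigma K (el N)" "\<forall>k\<in>K. el N k \<subseteq> span N G k" using fgN by (auto simp: fg_sub_def)
  define G' where "G' = image_elts (\<lambda>k. inv_into (el M k) (g k)) G"
  have i: "inv_into (el M k) (g k) y \<in> el M k" "g k (inv_into (el M k) (g k) y) = y" if "(k, y) \<in> G" for k y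
    using that G(2) surj[of k] by (auto simp: subset_iff inv_into_into f_inv_into_f)
  have G': "finite G'" "G' \<subseteq> Sigma K (el M)" using G(1,2) i(1) by (auto simp: G'_def image_elts_def)
  have gG': "image_elts g G' = G" unfolding G'_def image_elts_def image_image using i(2) by force
  let ?H = "image_elts f E \<union> G'"
  have fE: "image_elts f E \<subseteq> Sigma K (el M)" by (rule image_elts_subset[OF E(2)]) (rule linear_el[OF f])
  then have H: "finite ?H" "?H \<subseteq> Sigma K (el M)" using finite_image_elts[OF E(1)] G' by auto
  have S: "submodule M (span M ?H)" by (rule submodule_span[OF M H(2)])
  have "x \<in> span M ?H k" if k: "k \<in> K" and x: "x \<in> el M k" for k x
  proof -
    interpret comm_group "gr M k" using premod_grp[OF M k] .
    interpret N: comm_group "gr N k" using premod_grp[OF N k] .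
    have "g k x \<in> span N (image_elts g G') k" using G(3) k linear_el[OF g k x] gG' by auto
    then obtain y where y: "y \<in> span M G' k" "g k x = g k y" using span_image_elts[OF g M N G'(2)] by blast
    have yel: "y \<in> el M k" using spanD[OF y(1) M G'(2)] by blast
    have "g k (x \<otimes>\<^bsub>gr M k\<^esub> inv\<^bsub>gr M k\<^esub> y) = \<one>\<^bsub>gr N k\<^esub>"
      using linear_mult[OF g k x] linear_inv[OF g M N k yel] yel y(2) linear_el[OF g k yel] by simp
    then obtain z where z: "z \<in> el L k" "x \<otimes>\<^bsub>gr M k\<^esub> inv\<^bsub>gr M k\<^esub> y = f k z" using ex[OF k] x yel by blast
    have "f k z \<in> span M (image_elts f E) k" using span_linear[OF f L M E(2)] E(3) k z(1) by blast
    then have fz: "f k z \<in> span M ?H k" by (rule span_mono[rotated]) simp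
    have "y \<in> span M ?H k" by (rule span_mono[OF _ y(1)]) simp
    moreover have "x = f k z \<otimes>\<^bsub>gr M k\<^esub> y"
      using z(2)[symmetric] x yel by (simp add: m_assoc)
    ultimately show ?thesis using sub_mult[OF S k fz] by simp
  qed
  then show ?thesis by (rule fg_subI[OF H])
qed

end

section \<open>Further shifts preserve finite generation\<close>

context ring_category
begin

lemma shift_functor: "is_functor FI (Mod R) V \<Longrightarrow> is_functor FI (Mod R) (shift d V)"
  unfolding shift_def by (rule is_functor_comp[OF category_FI pad_functor])

lemma shift_simps [simp]: "FObj (shift d V) S = FObj V (pad d S)" "FArr (shift d V) f = FArr V (pad_arrow d f)"
  by (simp_all add: shift_def comp_functor_def pad_functor_def)

lemma linear_shift:
  assumes l: "FO.linear (fmd V) (fmd W) \<phi>"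
  shows "FO.linear (fmd (shift d V)) (fmd (shift d W)) (\<lambda>(S, r). \<phi> (pad d S, r))"
  unfolding FO.linear_def
proof (intro conjI ballI)
  show "(case k of (S, r) \<Rightarrow> \<phi> (pad d S, r)) \<in> hom (gr (fmd (shift d V)) k) (gr (fmd (shift d W)) k)" if k: "k \<in> FK" for k
    using k FO.linear_hom[OF l, of "(pad d (fst k), snd k)"] by (cases k) simp
  fix p x assume p: "p \<in> FOps" and x: "x \<in> el (fmd (shift d V)) (Fsrc p)"
  from p show "(case Ftgt p of (S, r) \<Rightarrow> \<phi> (pad d S, r)) (ac (fmd (shift d V)) p x) =
      ac (fmd (shift d W)) p ((case Fsrc p of (S, r) \<Rightarrow> \<phi> (pad d S, r)) x)"
  proof (cases rule: FOps_cases)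
    case (1 f r) then show ?thesis using linear_push[OF l pad_arrow_Arr[of f d], of r x] x by simp
  next
    case (2 S a) then show ?thesis using linear_ract[OF l, of "pad d S" a x] x by simp
  qed
qed

text \<open>Up to \<open>regroup\<close>, the shift by \<open>d + e\<close> is the shift by
  \<open>e\<close> of the shift by \<open>d\<close>. The elements that a generator in degree
  \<open>S\<close> contributes in degree \<open>T\<close> come from injections of \<open>S\<close>
  into \<open>pad e T\<close>; by \<open>factor_pad\<close> these are pushed forward from finitely
  many elements in degrees \<open>S'\<close> contained in \<open>S\<close>.\<close>

lemma fg_shift_mono:
  assumes V: "is_functor FI (Mod R) V" and fg: "FO.fg_sub (fmd (shift d V)) (el (fmd (shift d V)))"
  shows "FO.fg_sub (fmd (shift (d + e) V)) (el (fmd (shift (d + e) V)))"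
proof -
  let ?M = "fmd (shift d V)" and ?N = "fmd (shift (d + e) V)"
  note MV = fmd_FI_Mod[OF V] and M = fmd_FI_Mod(1)[OF shift_functor[OF V], of d]
    and N = fmd_FI_Mod(1)[OF shift_functor[OF V], of "d + e"]
  obtain E where E: "finite E" "E \<subseteq> Sigma FK (el ?M)" "\<forall>k\<in>FK. el ?M k \<subseteq> FO.span ?M E k" using fg by (auto simp: FO.fg_sub_def)
  let ?push = "\<lambda>f r. ac (fmd V) (Inl (f, r))"
  have pc: "?push g r (?push f r x) = ?push (Comp FI g f) r x"
    if "f \<in> Arr FI" "g \<in> Arr FI" "Tgt f = Src g" "r \<in> Obj R" "x \<in> el (fmd V) (Src f, r)" for f g r x
    using MV(2) that unfolding fi_rel_def by metis
  have nt: "ac (fmd V) (Inr (Tgt f, a)) (?push f (Cod R a) x) = ?push f (Dom R a) (ac (fmd V) (Inr (Src f, a)) x)"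
    if "f \<in> Arr FI" "a \<in> Arr R" "x \<in> el (fmd V) (Src f, Cod R a)" for f a x
    using MV(2) that unfolding fi_rel_def by blast
  let ?Homs = "\<lambda>S S'. {g \<in> Arr FI. Src g = S \<and> Tgt g = pad e S'}"
  \<comment> \<open>The finitely many basic elements: for each generator, all subsets
    \<open>S'\<close> of its degree and all injections into \<open>pad e S'\<close>. Finiteness uses
    that both range over finite sets.\<close>
  define E' where "E' = (\<Union>((S, r), x)\<in>E. \<Union>S'\<in>Pow S. \<Union>g\<in>?Homs S S'.
    {((S', r), ?push (Comp FI (regroup d e S') (pad_arrow d g)) r x)})"
  have Eb: "finite S \<and> r \<in> Obj R \<and> x \<in> el (fmd V) (pad d S, r)" if "((S, r), x) \<in> E" for S r x using that E(2) by auto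
  have E'fin: "finite E'"
    unfolding E'_def
  proof (intro finite_UN_I[OF E(1)])
    fix z assume z: "z \<in> E"
    obtain S r x where zz: "z = ((S, r), x)" by (metis surj_pair)
    have S: "finite S" using Eb z zz by blast
    have "finite (\<Union>S'\<in>Pow S. \<Union>g\<in>?Homs S S'. {((S', r), ?push (Comp FI (regroup d e S') (pad_arrow d g)) r x)})"
      using S by (intro finite_UN_I finite_FI_Hom finite_pad) (auto intro: finite_subset)
    then show "finite (case z of (a, b) \<Rightarrow> (case a of (S, r) \<Rightarrow> \<lambda>x. \<Union>S'\<in>Pow S. \<Union>g\<in>?Homs S S'.
      {((S', r), ?push (Comp FI (regroup d e S') (pad_arrow d g)) r x)}) b)" by (simp add: zz)
  qed
  have rc: "Comp FI (regroup d e T) (pad_arrow d g) \<in> Arr FI" "Src (Comp FI (regroup d e T) (pad_arrow d g)) = pad d (Src g)"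
    "Tgt (Comp FI (regroup d e T) (pad_arrow d g)) = pad (d + e) T"
    if "g \<in> Arr FI" "Tgt g = pad e T" "finite T" for g T
    using that by (auto intro!: Comp_FI_in pad_arrow_Arr regroup_Arr simp del: FI_simps(4) simp: Comp_FI_simps)
  have E'el: "E' \<subseteq> Sigma FK (el ?N)"
  proof
    fix z assume "z \<in> E'"
    then obtain S r x S' g where z: "((S, r), x) \<in> E" "S' \<subseteq> S" "g \<in> Arr FI" "Src g = S" "Tgt g = pad e S'"
      "z = ((S', r), ?push (Comp FI (regroup d e S') (pad_arrow d g)) r x)" by (auto simp: E'_def)
    have "finite S'" using Eb[OF z(1)] z(2) finite_subset by blast
    then show "z \<in> Sigma FK (el ?N)"
      using push_el[OF MV(1) rc(1)[OF z(3,5)], of r x] rc(2,3)[OF z(3,5)] Eb[OF z(1)] z(4,6) by (simp del: FI_simps(4))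
  qed
  have NS: "FO.submodule ?N (FO.span ?N E')" by (rule FO.submodule_span[OF N E'el])
  have NSr: "RO.submodule (part ?N T) (\<lambda>r. FO.span ?N E' (T, r))" if "finite T" for T
    unfolding RO.submodule_def using FO.submodule_grp[OF NS, of "(T, _)"] FO.sub_act[OF NS, of "Inr (T, _)"] that
    by simp
  \<comment> \<open>Transfer from degree \<open>S\<close> of the shift by \<open>d\<close> to degree
    \<open>T\<close> of the shift by \<open>d + e\<close>, along \<open>c\<close> from
    \<open>S\<close> to \<open>pad e T\<close>.\<close>
  define tr where "tr T c r = ?push (Comp FI (regroup d e T) (pad_arrow d c)) r" for T c r
  \<comment> \<open>Quantifying over all \<open>T\<close> and \<open>c\<close> makes the condition
    stable under pushing, since transferring after a push along \<open>f\<close> is transferring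
    along \<open>Comp FI c f\<close>.\<close>
  define U where "U = (\<lambda>(S, r). {z \<in> el ?M (S, r). \<forall>T c. finite T \<and> c \<in> Arr FI \<and> Src c = S \<and> Tgt c = pad e T \<longrightarrow>
    tr T c r z \<in> FO.span ?N E' (T, r)})"
  have trl: "RO.linear (part ?M S) (part ?N T) (tr T c)" if c: "finite T" "c \<in> Arr FI" "Src c = S" "Tgt c = pad e T" for S T c
    unfolding tr_def RO.linear_def
  proof (intro conjI ballI)
    note r = rc[OF c(2,4,1)]
    show "?push (Comp FI (regroup d e T) (pad_arrow d c)) s \<in> hom (gr (part ?M S) s) (gr (part ?N T) s)" if "s \<in> Obj R" for s
      using FO.premod_hom[OF MV(1), of "Inl (Comp FI (regroup d e T) (pad_arrow d c), s)"] r c(3) that by (simp del: FI_simps(4))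
    show "?push (Comp FI (regroup d e T) (pad_arrow d c)) (Dom R a) (ac (part ?M S) a x) =
        ac (part ?N T) a (?push (Comp FI (regroup d e T) (pad_arrow d c)) (Cod R a) x)"
      if "a \<in> Arr R" "x \<in> el (part ?M S) (Cod R a)" for a x
    proof -
      let ?q = "Comp FI (regroup d e T) (pad_arrow d c)"
      have "ac (fmd V) (Inr (Tgt ?q, a)) (?push ?q (Cod R a) x) = ?push ?q (Dom R a) (ac (fmd V) (Inr (Src ?q, a)) x)"
        using nt[OF r(1) that(1), of x] r that(2) c(3) by (simp del: FI_simps(4))
      then show ?thesis using r c(3) by (simp del: FI_simps(4))
    qed
  qed
  have U: "FO.submodule ?M U"
  proof (rule FO.submoduleI[OF M])
    fix k y assume k: "k \<in> FK" and y: "y \<in> U k"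
    obtain S r where kS: "k = (S, r)" by fastforce
    then have S: "finite S" "r \<in> Obj R" using k by auto
    show yk: "y \<in> el ?M k" using y kS by (simp add: U_def)
    note p = premod_part[OF M S(1)] premod_part[OF N]
    show "inv\<^bsub>gr ?M k\<^esub> y \<in> U k"
      using y yk S RO.linear_inv[OF trl p S(2), of _ _ y] RO.sub_inv[OF NSr] FO.el_inv[OF M k yk]
      by (simp add: U_def kS)
    fix z assume z: "z \<in> U k"
    have zk: "z \<in> el ?M k" using z kS by (simp add: U_def)
    show "y \<otimes>\<^bsub>gr ?M k\<^esub> z \<in> U k"
      using y z yk zk S RO.linear_mult[OF trl S(2), of _ _ _ y z] RO.sub_mult[OF NSr] FO.el_mult[OF M k yk zk]
      by (simp add: U_def kS)
  next
    fix k assume k: "k \<in> FK"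
    obtain S r where kS: "k = (S, r)" by fastforce
    then have S: "finite S" "r \<in> Obj R" using k by auto
    note p = premod_part[OF M S(1)] premod_part[OF N]
    show "\<one>\<^bsub>gr ?M k\<^esub> \<in> U k"
      using S RO.linear_one[OF trl p S(2)] RO.sub_one[OF NSr] FO.el_one[OF M k] by (simp add: U_def kS)
  next
    fix p y assume p: "p \<in> FOps" and y: "y \<in> U (Fsrc p)"
    from p show "ac ?M p y \<in> U (Ftgt p)"
    proof (cases rule: FOps_cases)
      case (1 f r)
      have yel: "y \<in> el ?M (Src f, r)" using y 1(1) by (simp add: U_def)
      have "tr T c r (ac ?M (Inl (f, r)) y) \<in> FO.span ?N E' (T, r)"
        if c: "finite T" "c \<in> Arr FI" "Src c = Tgt f" "Tgt c = pad e T" for c T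
      proof -
        have cf: "Comp FI c f \<in> Arr FI" by (rule Comp_FI_in[OF 1(2) c(2) c(3)[symmetric]])
        have "tr T c r (ac ?M (Inl (f, r)) y) = ?push (Comp FI (Comp FI (regroup d e T) (pad_arrow d c)) (pad_arrow d f)) r y"
          unfolding tr_def using pc[OF pad_arrow_Arr[OF 1(2), of d] rc(1)[OF c(2,4,1)] _ 1(3), of y] rc(2)[OF c(2,4,1)] c(3) yel
          by (simp del: FI_simps(4))
        also have "Comp FI (Comp FI (regroup d e T) (pad_arrow d c)) (pad_arrow d f) =
            Comp FI (regroup d e T) (pad_arrow d (Comp FI c f))"
          using category.Comp_assoc[OF category_FI, of "pad_arrow d f" "pad d (Src f)" "pad d (Src c)" "pad_arrow d c" "pad d (pad e T)"
              "regroup d e T" "pad (d + e) T"] pad_arrow_Comp[OF 1(2) c(2) c(3)[symmetric]] pad_arrow_Arr[OF 1(2)]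
            pad_arrow_Arr[OF c(2)] regroup_Arr[OF c(1)] c by (simp add: Hom_def del: FI_simps(4))
        finally have "tr T c r (ac ?M (Inl (f, r)) y) = tr T (Comp FI c f) r y" by (simp only: tr_def)
        moreover have "tr T (Comp FI c f) r y \<in> FO.span ?N E' (T, r)"
          using y 1(1) cf c by (simp add: U_def Comp_FI_simps del: FI_simps(4))
        ultimately show ?thesis by simp
      qed
      then show ?thesis using push_el[OF M 1(2,3) yel] 1(1) by (simp add: U_def)
    next
      case (2 S a)
      have yel: "y \<in> el ?M (S, Cod R a)" using y 2(1) by (simp add: U_def)
      have "tr T c (Dom R a) (ac ?M (Inr (S, a)) y) \<in> FO.span ?N E' (T, Dom R a)"
        if c: "finite T" "c \<in> Arr FI" "Src c = S" "Tgt c = pad e T" for c T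
      proof -
        have "tr T c (Cod R a) y \<in> FO.span ?N E' (T, Cod R a)" using y c 2(1) by (simp add: U_def)
        from FO.sub_act[OF NS, of "Inr (T, a)"] this
        have "ac ?N (Inr (T, a)) (tr T c (Cod R a) y) \<in> FO.span ?N E' (T, Dom R a)" using c(1) 2(3) by simp
        moreover have "tr T c (Dom R a) (ac (part ?M S) a y) = ac (part ?N T) a (tr T c (Cod R a) y)"
          by (rule RO.linear_act[OF trl[OF c] 2(3)]) (use yel in simp)
        ultimately show ?thesis by simp
      qed
      then show ?thesis using ract_el[OF M 2(2,3) yel] 2(1) by (simp add: U_def)
    qed
  qed
  have "E \<subseteq> Sigma FK U"
  proof
    fix z assume z: "z \<in> E"
    obtain S r x where zz: "z = ((S, r), x)" by (metis surj_pair)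
    note b = Eb[OF z[unfolded zz]]
    have "tr T c r x \<in> FO.span ?N E' (T, r)"
      if c: "finite T" "c \<in> Arr FI" "Src c = S" "Tgt c = pad e T" for T c
    proof -
      obtain S' g h where f: "S' \<subseteq> Src c" "g \<in> Arr FI" "Src g = Src c" "Tgt g = pad e S'"
        "h \<in> Arr FI" "Src h = S'" "Tgt h = T" "Comp FI (pad_arrow e h) g = c" by (rule factor_pad[OF c(2,4,1)])
      have S': "finite S'" using f(5,6) by (auto simp: Arr_FI)
      note q = rc[OF f(2,4) S']
      let ?x = "?push (Comp FI (regroup d e S') (pad_arrow d g)) r x"
      have "((S', r), ?x) \<in> (\<Union>S'\<in>Pow S. \<Union>g\<in>?Homs S S'.
          {((S', r), ?push (Comp FI (regroup d e S') (pad_arrow d g)) r x)})"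
        by (rule UN_I[of S'], use f(1) c(3) in simp, rule UN_I[of g], use f(2-4) c(3) in simp, rule singletonI)
      then have "((S', r), ?x) \<in> E'"
        unfolding E'_def by (intro UN_I[OF z]) (simp only: zz prod.case)
      then have xE: "?x \<in> FO.span ?N E' (S', r)" using S' b by (intro FO.span_gen) auto
      have "ac ?N (Inl (h, r)) ?x \<in> FO.span ?N E' (T, r)"
        using FO.sub_act[OF NS, of "Inl (h, r)" ?x] xE f(5-7) b by (simp del: FI_simps(4))
      moreover have "ac ?N (Inl (h, r)) ?x = ?push (Comp FI (pad_arrow (d + e) h) (Comp FI (regroup d e S') (pad_arrow d g))) r x"
        using pc[OF q(1) pad_arrow_Arr[OF f(5), of "d + e"] _ conjunct1[OF conjunct2[OF b]], of x] q(2,3) f(3,6) c(3) b by (simp del: FI_simps(4))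
      moreover have "Comp FI (pad_arrow (d + e) h) (Comp FI (regroup d e S') (pad_arrow d g)) =
          Comp FI (regroup d e T) (pad_arrow d c)"
      proof -
        have H: "pad_arrow d g \<in> Hom FI (pad d S) (pad d (pad e S'))" "regroup d e S' \<in> Hom FI (pad d (pad e S')) (pad (d + e) S')"
          "pad_arrow (d + e) h \<in> Hom FI (pad (d + e) S') (pad (d + e) T)" "regroup d e T \<in> Hom FI (pad d (pad e T)) (pad (d + e) T)"
          "pad_arrow d (pad_arrow e h) \<in> Hom FI (pad d (pad e S')) (pad d (pad e T))"
          using f c S' by (simp_all add: Hom_def pad_arrow_Arr regroup_Arr)
        have "Comp FI (pad_arrow (d + e) h) (Comp FI (regroup d e S') (pad_arrow d g)) =
            Comp FI (Comp FI (pad_arrow (d + e) h) (regroup d e S')) (pad_arrow d g)"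
          by (rule category.Comp_assoc[OF category_FI H(1-3)])
        also have "\<dots> = Comp FI (Comp FI (regroup d e T) (pad_arrow d (pad_arrow e h))) (pad_arrow d g)"
          using regroup_natural[OF f(5), of d e] f(6,7) by simp
        also have "\<dots> = Comp FI (regroup d e T) (Comp FI (pad_arrow d (pad_arrow e h)) (pad_arrow d g))"
          by (rule category.Comp_assoc[OF category_FI H(1,5,4), symmetric])
        also have "\<dots> = Comp FI (regroup d e T) (pad_arrow d c)"
          using pad_arrow_Comp[OF f(2) pad_arrow_Arr[OF f(5)], of e d] f(4,6,8) by simp
        finally show ?thesis .
      qed
      ultimately show ?thesis by (simp only: tr_def)
    qed
    then show "z \<in> Sigma FK U" using b by (auto simp: U_def zz)
  qed
  then have EU: "el ?M k \<subseteq> U k" if "k \<in> FK" for k using E(3) that FO.span_least[OF U] by blast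
  have "y \<in> FO.span ?N E' k" if k: "k \<in> FK" and y: "y \<in> el ?N k" for k y
  proof -
    obtain T r where kT: "k = (T, r)" by fastforce
    then have T: "finite T" "r \<in> Obj R" using k by auto
    obtain g where g: "g \<in> Arr FI" "Src g = pad (d + e) T" "Tgt g = pad d (pad e T)"
      "Comp FI (regroup d e T) g = Ident FI (pad (d + e) T)"
      using FI_inverse[OF regroup_Arr[OF T(1)] regroup_surj] by (metis regroup_simps(1,2))
    \<comment> \<open>Undoing the regrouping places \<open>y\<close> in degree
      \<open>pad e T\<close> of the shift by \<open>d\<close>. Transfer along the identity of
      \<open>pad e T\<close> is the push along \<open>regroup\<close>, which returns
      \<open>y\<close>.\<close>
    let ?z = "?push g r y"
    have yel: "y \<in> el (fmd V) (pad (d + e) T, r)" using y kT by simp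
    have zel: "?z \<in> el ?M (pad e T, r)" using push_el[OF MV(1) g(1) T(2), of y] yel g by simp
    then have "?z \<in> U (pad e T, r)" using EU[of "(pad e T, r)"] T by auto
    then have "tr T (Ident FI (pad e T)) r ?z \<in> FO.span ?N E' (T, r)"
      using T Ident_FI_Arr[of "pad e T"] by (simp add: U_def)
    moreover have "Comp FI (regroup d e T) (pad_arrow d (Ident FI (pad e T))) = regroup d e T"
      using pad_arrow_Ident[of "pad e T" d] category.Ident_right[OF category_FI, of "regroup d e T" "pad d (pad e T)" "pad (d + e) T"]
        regroup_Arr[OF T(1)] T by (simp add: Hom_def del: FI_simps(4,5))
    moreover have "?push (regroup d e T) r ?z = y"
    proof -
      have "?push (regroup d e T) r ?z = ?push (Comp FI (regroup d e T) g) r y"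
        using pc[OF g(1) regroup_Arr[OF T(1)] _ T(2), of d e y] g(2,3) yel by simp
      also have "\<dots> = y" unfolding g(4) using MV(2) T yel unfolding fi_rel_def by (metis finite_pad)
      finally show ?thesis .
    qed
    ultimately show ?thesis by (simp only: tr_def kT)
  qed
  then show ?thesis by (rule FO.fg_subI[OF E'fin E'el])
qed

end

section \<open>The Serre property of \<open>FI_sfg R\<close>\<close>

locale noetherian_ring_category = ring_category R for R :: "('u, 'u) preadd" +
  assumes locally_noeth: "locally_noetherian TYPE('u) (Mod R)"
begin

definition fg_shift :: "nat \<Rightarrow> 'u FI_module \<Rightarrow> bool" where
  "fg_shift d V \<longleftrightarrow> FO.fg_sub (fmd (shift d V)) (el (fmd (shift d V)))"

lemma FI_sfg_iff: "V \<in> FI_sfg R \<longleftrightarrow> is_functor FI (Mod R) V \<and> (\<exists>d. fg_shift d V)"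
  using shift_functor by (auto simp: FI_sfg_def FM.finitely_generated_iff fg_shift_def)

lemma fapp_shift:
  assumes "f \<in> Hom (FI_Mod R) V W"
  shows "FO.linear (fmd (shift d V)) (fmd (shift d W)) (\<lambda>(S, r). fapp f (pad d S, r))"
  using linear_shift[OF fapp_linear[OF assms]] .

lemma fg_shift_noeth:
  assumes "is_functor FI (Mod R) V" "fg_shift d V"
  shows "FO.noeth_sub (fmd (shift d V)) (el (fmd (shift d V)))"
proof -
  interpret fi_module R "fmd (shift d V)" by (rule fi_module_fmd[OF locally_noeth shift_functor[OF assms(1)]])
  show ?thesis using fg_noeth assms(2) by (simp add: fg_shift_def)
qed

text \<open>Shifting merely reindexes sorts, so it preserves injectivity, surjectivity and
  exactness. Noetherianity of the shifted module enters only for subobjects; for extensions a common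
  shift is needed.\<close>

lemma serre_FI_sfg: "serre_subcategory (FI_Mod R) (FI_sfg R)"
  unfolding serre_subcategory_def
proof (intro conjI allI impI)
  show "FI_sfg R \<subseteq> Obj (FI_Mod R)" by (auto simp: FI_sfg_def)
  obtain Z where Z: "zero_object (FI_Mod R) Z" "\<forall>k\<in>FK. el (fmd Z) k = {\<one>\<^bsub>gr (fmd Z) k\<^esub>}"
    using FM.zero_object_ex by blast
  have ZV: "is_functor FI (Mod R) Z" using Z(1) by (simp add: zero_object_def)
  have "el (fmd (shift 0 Z)) k \<subseteq> FO.span (fmd (shift 0 Z)) {} k" if k: "k \<in> FK" for k
  proof -
    obtain S r where kS: "k = (S, r)" "finite S" "r \<in> Obj R" using k by auto
    have "el (fmd (shift 0 Z)) k = {\<one>\<^bsub>gr (fmd (shift 0 Z)) k\<^esub>}" using Z(2) kS by auto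
    moreover have "\<one>\<^bsub>gr (fmd (shift 0 Z)) k\<^esub> \<in> FO.span (fmd (shift 0 Z)) {} k"
      by (simp add: FO.span_def FO.spn.one k)
    ultimately show ?thesis by simp
  qed
  then have "fg_shift 0 Z" unfolding fg_shift_def FO.fg_sub_def by (intro exI[of _ "{}"]) simp
  then show "FI_sfg R \<noteq> {}" using ZV FI_sfg_iff by blast
next
  fix f g assume a: "short_exact (FI_Mod R) f g \<and> Dom (FI_Mod R) f \<in> FI_sfg R \<and> Cod (FI_Mod R) g \<in> FI_sfg R"
  obtain X Y Z where f: "f \<in> Hom (FI_Mod R) X Y" and g: "g \<in> Hom (FI_Mod R) Y Z"
    and surj: "\<And>k. k \<in> FK \<Longrightarrow> fapp g k ` el (fmd Y) k = el (fmd Z) k"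
    and ex: "\<And>k y. k \<in> FK \<Longrightarrow> y \<in> el (fmd Y) k \<Longrightarrow> fapp g k y = \<one>\<^bsub>gr (fmd Z) k\<^esub> \<longleftrightarrow> y \<in> fapp f k ` el (fmd X) k"
    using FM.short_exactD[OF conjunct1[OF a]] by metis
  have e: "Dom (FI_Mod R) f = X" "Cod (FI_Mod R) f = Y" "Cod (FI_Mod R) g = Z" using f g by (auto simp: Hom_iff)
  have F: "is_functor FI (Mod R) X" "is_functor FI (Mod R) Y" "is_functor FI (Mod R) Z"
    using FM.Hom_Obj[OF f] FM.Hom_Obj[OF g] by auto
  \<comment> \<open>The two ends come with different shifts; \<open>fg_shift_mono\<close> raises
    both to \<open>c + d\<close>.\<close>
  obtain c d where "fg_shift c X" "fg_shift d Z" using a e by (auto simp: FI_sfg_iff)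
  then have "fg_shift (c + d) X" "fg_shift (c + d) Z"
    using fg_shift_mono[OF F(1), of c d] fg_shift_mono[OF F(3), of d c] by (simp_all add: fg_shift_def add.commute)
  moreover have "el (fmd (shift (c + d) Z)) k \<subseteq> (\<lambda>(S, r). fapp g (pad (c + d) S, r)) k ` el (fmd (shift (c + d) Y)) k" if "k \<in> FK" for k
    using that surj[of "(pad (c + d) (fst k), snd k)"] by (cases k) auto
  moreover have "x \<in> (\<lambda>(S, r). fapp f (pad (c + d) S, r)) k ` el (fmd (shift (c + d) X)) k"
    if "k \<in> FK" "x \<in> el (fmd (shift (c + d) Y)) k"
      "(\<lambda>(S, r). fapp g (pad (c + d) S, r)) k x = \<one>\<^bsub>gr (fmd (shift (c + d) Z)) k\<^esub>" for k x
    using that ex[of "(pad (c + d) (fst k), snd k)" x] by (cases k) auto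
  ultimately have "fg_shift (c + d) Y"
    unfolding fg_shift_def
    by (intro FO.fg_extension[OF fapp_shift[OF f] fapp_shift[OF g]] fmd_FI_Mod shift_functor F) auto
  then show "Cod (FI_Mod R) f \<in> FI_sfg R" using F(2) e(2) by (auto simp: FI_sfg_iff)
next
  fix g assume a: "is_epi (FI_Mod R) g \<and> Dom (FI_Mod R) g \<in> FI_sfg R"
  define X Y where XY: "X = Dom (FI_Mod R) g" "Y = Cod (FI_Mod R) g"
  have g: "g \<in> Hom (FI_Mod R) X Y" using a by (auto simp: is_epi_def Hom_iff XY)
  have F: "is_functor FI (Mod R) X" "is_functor FI (Mod R) Y" using FM.Hom_Obj[OF g] by auto
  have surj: "fapp g k ` el (fmd X) k = el (fmd Y) k" if "k \<in> FK" for k using a FM.is_epi_iff[OF g] that by blast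
  obtain d where d: "fg_shift d X" using a by (auto simp: FI_sfg_iff XY)
  have "el (fmd (shift d Y)) k \<subseteq> (\<lambda>(S, r). fapp g (pad d S, r)) k ` el (fmd (shift d X)) k" if "k \<in> FK" for k
    using that surj[of "(pad d (fst k), snd k)"] by (cases k) auto
  then have "fg_shift d Y"
    using FO.fg_of_surjective[OF fapp_shift[OF g] fmd_FI_Mod(1)[OF shift_functor[OF F(1)]] fmd_FI_Mod(1)[OF shift_functor[OF F(2)]]] d
    unfolding fg_shift_def by blast
  then show "Cod (FI_Mod R) g \<in> FI_sfg R" using F XY by (auto simp: FI_sfg_iff)
next
  fix f assume a: "is_mono (FI_Mod R) f \<and> Cod (FI_Mod R) f \<in> FI_sfg R"
  define X Y where XY: "X = Dom (FI_Mod R) f" "Y = Cod (FI_Mod R) f"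
  have f: "f \<in> Hom (FI_Mod R) X Y" using a by (auto simp: is_mono_def Hom_iff XY)
  have F: "is_functor FI (Mod R) X" "is_functor FI (Mod R) Y" using FM.Hom_Obj[OF f] by auto
  have inj: "inj_on (fapp f k) (el (fmd X) k)" if "k \<in> FK" for k using a FM.is_mono_iff[OF f] that by blast
  obtain d where d: "fg_shift d Y" using a by (auto simp: FI_sfg_iff XY)
  have "inj_on ((\<lambda>(S, r). fapp f (pad d S, r)) k) (el (fmd (shift d X)) k)" if "k \<in> FK" for k
    using that inj[of "(pad d (fst k), snd k)"] by (cases k) auto
  then have "fg_shift d X"
    unfolding fg_shift_def
    using FO.fg_of_injective[OF fapp_shift[OF f] fmd_FI_Mod(1)[OF shift_functor[OF F(1)]]
        fmd_FI_Mod(1)[OF shift_functor[OF F(2)]] _ fg_shift_noeth[OF F(2) d]] by blast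
  then show "Dom (FI_Mod R) f \<in> FI_sfg R" using F XY by (auto simp: FI_sfg_iff)
qed

end

section \<open>The torsion class of FI-modules with finitely generated shift\<close>

text \<open>Closure under subobjects and quotients puts the objects provided by
  \<open>ob_sub\<close> and \<open>ob_quot\<close> back into \<open>A\<close>: the given linear map
  becomes a mono into, or an epi from, an object of \<open>A\<close>.\<close>

lemma (in module_category) module_category_serre:
  assumes "serre_subcategory C A"
  shows "module_category K Ops src tgt (full_subcategory C A) md app"
proof -
  note s = assms[unfolded serre_subcategory_def]
  note A = s[THEN conjunct1] s[THEN conjunct2, THEN conjunct1]
    s[THEN conjunct2, THEN conjunct2, THEN conjunct2, THEN conjunct1, rule_format, OF conjI]
    s[THEN conjunct2, THEN conjunct2, THEN conjunct2, THEN conjunct2, rule_format, OF conjI]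
  interpret D: category "full_subcategory C A" by (rule category_full_subcategory) unfold_locales
  show ?thesis
  proof unfold_locales
    show "premod (md X)" if "X \<in> Obj (full_subcategory C A)" for X using md that by simp
    show "linear (md X) (md Y) (app f)" if "f \<in> Hom (full_subcategory C A) X Y" for f X Y
      using app_linear that by (simp add: Hom_full_subcategory)
    show "app (Ident (full_subcategory C A) X) k x = x"
      if "X \<in> Obj (full_subcategory C A)" "k \<in> K" "x \<in> el (md X) k" for X k x using app_Ident that by simp
    show "app (Comp (full_subcategory C A) g f) k x = app g k (app f k x)"
      if "f \<in> Hom (full_subcategory C A) X Y" "g \<in> Hom (full_subcategory C A) Y Z" "k \<in> K" "x \<in> el (md X) k"
      for f g X Y Z k x using app_Comp[of f X Y g Z k x] that by (simp add: Hom_full_subcategory)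
    show "f = g" if "f \<in> Hom (full_subcategory C A) X Y" "g \<in> Hom (full_subcategory C A) X Y"
      "\<And>k x. k \<in> K \<Longrightarrow> x \<in> el (md X) k \<Longrightarrow> app f k x = app g k x" for f g X Y
      using arr_ext[of f X Y g] that by (simp add: Hom_full_subcategory)
    show "\<exists>f\<in>Hom (full_subcategory C A) X Y. \<forall>k\<in>K. \<forall>x\<in>el (md X) k. app f k x = \<phi> k x"
      if "X \<in> Obj (full_subcategory C A)" "Y \<in> Obj (full_subcategory C A)" "linear (md X) (md Y) \<phi>" for X Y \<phi>
    proof -
      have "f \<in> Hom (full_subcategory C A) X Y" if "f \<in> Hom C X Y" for f
        using that \<open>X \<in> _\<close> \<open>Y \<in> _\<close> by (simp add: Hom_full_subcategory)
      then show ?thesis using arr_ex[of X Y \<phi>] that by auto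
    qed
    show "Obj (full_subcategory C A) \<noteq> {}" using A(1,2) by auto
    show "\<exists>Z\<in>Obj (full_subcategory C A). eqmod (md Z) M"
      if M: "premod M" and X: "X \<in> Obj (full_subcategory C A)" and l: "linear M (md X) \<phi>"
        and inj: "\<And>k. k \<in> K \<Longrightarrow> inj_on (\<phi> k) (el M k)" for M X \<phi>
    proof -
      have X': "X \<in> Obj C" "X \<in> A" using X by auto
      obtain Z where Z: "Z \<in> Obj C" "eqmod (md Z) M" using ob_sub[OF M X'(1) l inj] by blast
      note m = mk[OF Z(1) X'(1) linear_eqmod_left[OF Z(2) M l]]
      have "el (md Z) k = el M k" if "k \<in> K" for k using Z(2) that by (simp add: eqmod_def)
      then have "is_mono C (mk Z X \<phi>)" unfolding is_mono_iff[OF m(1)] using m(2) inj by (simp add: inj_on_def)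
      then have "Z \<in> A" using A(4)[of "mk Z X \<phi>"] m(1) X'(2) by (simp add: Hom_iff)
      then show ?thesis using Z by auto
    qed
    show "\<exists>Z\<in>Obj (full_subcategory C A). eqmod (md Z) M"
      if M: "premod M" and X: "X \<in> Obj (full_subcategory C A)" and l: "linear (md X) M \<phi>"
        and surj: "\<And>k. k \<in> K \<Longrightarrow> el M k \<subseteq> \<phi> k ` el (md X) k" for M X \<phi>
    proof -
      have X': "X \<in> Obj C" "X \<in> A" using X by auto
      obtain Z where Z: "Z \<in> Obj C" "eqmod (md Z) M" using ob_quot[OF M X'(1) l surj] by blast
      note m = mk[OF X'(1) Z(1) linear_eqmod_right[OF Z(2) M l]]
      have "el (md Z) k = el M k" if "k \<in> K" for k using Z(2) that by (simp add: eqmod_def)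
      then have "app (mk X Z \<phi>) k ` el (md X) k = el (md Z) k" if "k \<in> K" for k
        using m(2) surj linear_el[OF l] that by force
      then have "is_epi C (mk X Z \<phi>)" unfolding is_epi_iff[OF m(1)] by blast
      then have "Z \<in> A" using A(3)[of "mk X Z \<phi>"] m(1) X'(2) by (simp add: Hom_iff)
      then show ?thesis using Z by auto
    qed
  qed
qed

lemma category_nat_category: "category nat_category"
  by unfold_locales (auto simp: nat_category_def Hom_def)

lemma Hom_nat_category: "Hom nat_category a b = (if a \<le> b then {(a, b)} else {})"
  by (auto simp: Hom_def nat_category_def)

lemma nat_category_simps [simp]: "Obj nat_category = UNIV" "Arr nat_category = {(a, b). a \<le> b}"
  "Dom nat_category = fst" "Cod nat_category = snd" "Ident nat_category a = (a, a)"
  "Comp nat_category g f = (fst f, snd g)"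
  by (simp_all add: nat_category_def)

section \<open>Elements of FI-modules that become torsion after a shift\<close>

locale FI_torsion = noetherian_ring_category R + RT: module_torsion "Obj R" "Arr R" "Cod R" "Dom R" "Mod R" rmd rapp T F
  for R :: "('u, 'u) preadd" and T F
begin

abbreviation push :: "'u FI_module \<Rightarrow> FI_arrow \<Rightarrow> 'u \<Rightarrow> 'u \<Rightarrow> 'u" where "push V f \<equiv> rapp (FArr V f)"

definition FI_tor :: "'u FI_module \<Rightarrow> nat set \<times> 'u \<Rightarrow> 'u set" where
  "FI_tor V = (\<lambda>(S, r). {x \<in> el (fmd V) (S, r). \<exists>a. push V (into_pad a S) r x \<in> RT.tor (FObj V (pad a S)) r})"

lemma FArr_in:
  assumes "is_functor FI (Mod R) V" "f \<in> Arr FI"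
  shows "FArr V f \<in> Hom (Mod R) (FObj V (Src f)) (FObj V (Tgt f))" "FObj V (Src f) \<in> Obj (Mod R)" "FObj V (Tgt f) \<in> Obj (Mod R)"
  using FI_ObjD(2)[OF assms] RM.Hom_Obj by blast+

lemma push_el': "is_functor FI (Mod R) V \<Longrightarrow> f \<in> Arr FI \<Longrightarrow> r \<in> Obj R \<Longrightarrow> x \<in> el (fmd V) (Src f, r) \<Longrightarrow>
    push V f r x \<in> el (fmd V) (Tgt f, r)"
  using RM.app_el[OF FArr_in(1)] by simp

lemma push_comp: "is_functor FI (Mod R) V \<Longrightarrow> f \<in> Arr FI \<Longrightarrow> g \<in> Arr FI \<Longrightarrow> Tgt f = Src g \<Longrightarrow> r \<in> Obj R \<Longrightarrow>
    x \<in> el (fmd V) (Src f, r) \<Longrightarrow> push V g r (push V f r x) = push V (Comp FI g f) r x"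
  using fmd_FI_Mod(2)[of V] unfolding fi_rel_def by (metis md_simps(4))

lemma push_Ident: "is_functor FI (Mod R) V \<Longrightarrow> finite S \<Longrightarrow> r \<in> Obj R \<Longrightarrow> x \<in> el (fmd V) (S, r) \<Longrightarrow>
    push V (Ident FI S) r x = x"
  using fmd_FI_Mod(2)[of V] unfolding fi_rel_def by (metis md_simps(4))

lemma push_tor: "is_functor FI (Mod R) V \<Longrightarrow> f \<in> Arr FI \<Longrightarrow> r \<in> Obj R \<Longrightarrow> x \<in> RT.tor (FObj V (Src f)) r \<Longrightarrow>
    push V f r x \<in> RT.tor (FObj V (Tgt f)) r"
  using RT.tor_app[OF FArr_in(1)] by blast

text \<open>Becoming torsion along any injection is enough, since every injection extends to a
  standard inclusion \<open>into_pad\<close> and torsion elements stay torsion under arrows.\<close>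

lemma FI_torI:
  assumes V: "is_functor FI (Mod R) V" and f: "f \<in> Arr FI" and r: "r \<in> Obj R"
    and x: "x \<in> el (fmd V) (Src f, r)" and t: "push V f r x \<in> RT.tor (FObj V (Tgt f)) r"
  shows "x \<in> FI_tor V (Src f, r)"
proof -
  obtain a g where g: "g \<in> Arr FI" "Src g = Tgt f" "Tgt g = pad a (Src f)" "Comp FI g f = into_pad a (Src f)"
    by (rule extend_to_into_pad[OF f])
  have "push V g r (push V f r x) \<in> RT.tor (FObj V (pad a (Src f))) r" using push_tor[OF V g(1) r] t g by simp
  then show ?thesis using push_comp[OF V f g(1) g(2)[symmetric] r x] x g(4) by (auto simp: FI_tor_def)
qed

lemma FI_tor_mono:
  assumes V: "is_functor FI (Mod R) V" and S: "finite S" and r: "r \<in> Obj R" and x: "x \<in> el (fmd V) (S, r)"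
    and t: "push V (into_pad a S) r x \<in> RT.tor (FObj V (pad a S)) r" and ab: "a \<le> b"
  shows "push V (into_pad b S) r x \<in> RT.tor (FObj V (pad b S)) r"
  using push_tor[OF V pad_inclusion_Arr[OF S ab] r, of "push V (into_pad a S) r x"] t
    push_comp[OF V into_pad_Arr[OF S] pad_inclusion_Arr[OF S ab] _ r, of a x] x pad_inclusion_into[OF S ab]
  by (simp del: FI_simps)

text \<open>The submodule of \<open>V S\<close> underlying the pullback with index \<open>a\<close>
  in the colimit formula.\<close>

definition level :: "'u FI_module \<Rightarrow> nat set \<Rightarrow> nat \<Rightarrow> 'u \<Rightarrow> 'u set" where
  "level V S a = RO.preim (rmd (FObj V S)) (push V (into_pad a S)) (RT.tor (FObj V (pad a S)))"

lemma level_iff: "x \<in> level V S a r \<longleftrightarrow> x \<in> el (fmd V) (S, r) \<and> push V (into_pad a S) r x \<in> RT.tor (FObj V (pad a S)) r"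
  by (simp add: level_def RO.preim_def)

lemma into_pad_Hom:
  assumes "is_functor FI (Mod R) V" "finite S"
  shows "FArr V (into_pad a S) \<in> Hom (Mod R) (FObj V S) (FObj V (pad a S))"
  using FArr_in(1)[OF assms(1) into_pad_Arr[OF assms(2)]] by simp

lemma submodule_level:
  assumes V: "is_functor FI (Mod R) V" and S: "finite S"
  shows "RO.submodule (rmd (FObj V S)) (level V S a)"
  unfolding level_def
  by (rule RO.submodule_preim[OF RM.app_linear[OF into_pad_Hom[OF V S]] RM.md[OF FI_ObjD(1)[OF V S]]
        RM.md[OF FI_ObjD(1)[OF V finite_pad[OF S]]] RT.submodule_tor[OF FI_ObjD(1)[OF V finite_pad[OF S]]]])

lemma level_mono: "is_functor FI (Mod R) V \<Longrightarrow> finite S \<Longrightarrow> r \<in> Obj R \<Longrightarrow> a \<le> b \<Longrightarrow> level V S a r \<subseteq> level V S b r"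
  using FI_tor_mono by (auto simp: level_iff)

lemma FI_tor_level: "FI_tor V (S, r) = (\<Union>a. level V S a r)"
  by (auto simp: FI_tor_def level_iff)

text \<open>In a fixed degree this is an increasing union of submodules. A push along
  \<open>f\<close> keeps the level \<open>a\<close>, because \<open>into_pad\<close> is natural and
  \<open>pad_arrow a f\<close> preserves torsion.\<close>

lemma submodule_FI_tor:
  assumes V: "is_functor FI (Mod R) V"
  shows "FO.submodule (fmd V) (FI_tor V)"
proof (rule FO.submoduleI[OF fmd_FI_Mod(1)[OF V]])
  fix k assume k: "k \<in> FK"
  obtain S r where kS: "k = (S, r)" by fastforce
  then have S: "finite S" "r \<in> Obj R" using k by auto
  note L = submodule_level[OF V S(1)]
  show "\<one>\<^bsub>gr (fmd V) k\<^esub> \<in> FI_tor V k" using RO.sub_one[OF L S(2)] by (auto simp: kS FI_tor_level)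
  fix x assume x: "x \<in> FI_tor V k"
  show "x \<in> el (fmd V) k" using x by (auto simp: kS FI_tor_def)
  show "inv\<^bsub>gr (fmd V) k\<^esub> x \<in> FI_tor V k" using x RO.sub_inv[OF L S(2)] by (auto simp: kS FI_tor_level)
  fix y assume y: "y \<in> FI_tor V k"
  obtain a b where ab: "x \<in> level V S a r" "y \<in> level V S b r" using x y by (auto simp: kS FI_tor_level)
  then have "x \<in> level V S (max a b) r" "y \<in> level V S (max a b) r"
    using level_mono[OF V S, of a "max a b"] level_mono[OF V S, of b "max a b"] by auto
  from RO.sub_mult[OF L S(2) this] show "x \<otimes>\<^bsub>gr (fmd V) k\<^esub> y \<in> FI_tor V k" by (auto simp: kS FI_tor_level)
next
  fix p x assume p: "p \<in> FOps" and x: "x \<in> FI_tor V (Fsrc p)"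
  from p show "ac (fmd V) p x \<in> FI_tor V (Ftgt p)"
  proof (cases rule: FOps_cases)
    case (1 f r)
    have fin: "finite (Src f)" "finite (Tgt f)" using 1(2) by (auto simp: Arr_FI)
    obtain a where a: "x \<in> el (fmd V) (Src f, r)" "push V (into_pad a (Src f)) r x \<in> RT.tor (FObj V (pad a (Src f))) r"
      using x 1(1) by (auto simp: FI_tor_def)
    have "push V (pad_arrow a f) r (push V (into_pad a (Src f)) r x) \<in> RT.tor (FObj V (pad a (Tgt f))) r"
      using push_tor[OF V pad_arrow_Arr[OF 1(2)] 1(3)] a(2) by simp
    then have "push V (into_pad a (Tgt f)) r (push V f r x) \<in> RT.tor (FObj V (pad a (Tgt f))) r"
      using push_comp[OF V into_pad_Arr[OF fin(1)] pad_arrow_Arr[OF 1(2)] _ 1(3), of a a x]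
        push_comp[OF V 1(2) into_pad_Arr[OF fin(2)] _ 1(3) a(1), of a] into_pad_natural[OF 1(2), of a] a(1)
      by (simp del: FI_simps)
    then show ?thesis using push_el'[OF V 1(2,3) a(1)] 1(1) by (auto simp: FI_tor_def)
  next
    case (2 S b)
    obtain a where "x \<in> level V S a (Cod R b)" using x 2(1) by (auto simp: FI_tor_level)
    then show ?thesis using RO.sub_act[OF submodule_level[OF V 2(2)] 2(3)] 2(1) by (auto simp: FI_tor_level)
  qed
qed

lemma FI_Hom_App: "f \<in> Hom (FI_Mod R) V W \<Longrightarrow> finite S \<Longrightarrow> App f S \<in> Hom (Mod R) (FObj V S) (FObj W S)"
  by (simp add: Hom_FI_Mod)

lemma fapp_push:
  assumes "f \<in> Hom (FI_Mod R) V W" "g \<in> Arr FI" "r \<in> Obj R" "x \<in> el (fmd V) (Src g, r)"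
  shows "fapp f (Tgt g, r) (push V g r x) = push W g r (fapp f (Src g, r) x)"
  using linear_push[OF fapp_linear[OF assms(1)] assms(2-4)] by simp

lemma FI_tor_app:
  assumes f: "f \<in> Hom (FI_Mod R) V W" and k: "k \<in> FK" and x: "x \<in> FI_tor V k"
  shows "fapp f k x \<in> FI_tor W k"
proof -
  obtain S r where kS: "k = (S, r)" "finite S" "r \<in> Obj R" using k by auto
  obtain a where a: "x \<in> el (fmd V) (S, r)" "push V (into_pad a S) r x \<in> RT.tor (FObj V (pad a S)) r"
    using x kS by (auto simp: FI_tor_def)
  have "rapp (App f (pad a S)) r (push V (into_pad a S) r x) \<in> RT.tor (FObj W (pad a S)) r"
    by (rule RT.tor_app[OF FI_Hom_App[OF f] kS(3) a(2)]) (simp add: kS)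
  then show ?thesis
    using fapp_push[OF f into_pad_Arr[OF kS(2)] kS(3), of x a] FM.app_el[OF f, of "(S, r)" x] a(1) kS
    by (auto simp: FI_tor_def)
qed

text \<open>Heredity of the torsion theory on modules is applied in the single degree
  \<open>pad a S\<close>, where the component of \<open>f\<close> is again injective.\<close>

lemma FI_tor_preimage:
  assumes f: "f \<in> Hom (FI_Mod R) V W" and inj: "\<And>k. k \<in> FK \<Longrightarrow> inj_on (fapp f k) (el (fmd V) k)"
    and k: "k \<in> FK" and x: "x \<in> el (fmd V) k" "fapp f k x \<in> FI_tor W k"
  shows "x \<in> FI_tor V k"
proof -
  obtain S r where kS: "k = (S, r)" "finite S" "r \<in> Obj R" using k by auto
  have V: "is_functor FI (Mod R) V" using FM.Hom_Obj[OF f] by simp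
  obtain a where a: "push W (into_pad a S) r (fapp f (S, r) x) \<in> RT.tor (FObj W (pad a S)) r"
    using x kS by (auto simp: FI_tor_def)
  have e: "rapp (App f (pad a S)) r (push V (into_pad a S) r x) = push W (into_pad a S) r (fapp f (S, r) x)"
    using fapp_push[OF f into_pad_Arr[OF kS(2)] kS(3), of x a] x(1) kS(1) by simp
  have p: "push V (into_pad a S) r x \<in> el (rmd (FObj V (pad a S))) r"
    using push_el'[OF V into_pad_Arr[OF kS(2)] kS(3), of x a] x(1) kS(1) by simp
  have "push V (into_pad a S) r x \<in> RT.tor (FObj V (pad a S)) r"
  proof (rule RT.tor_preimage[OF FI_Hom_App[OF f] _ kS(3) p])
    show "inj_on (rapp (App f (pad a S)) r) (el (rmd (FObj V (pad a S))) r)" if "r \<in> Obj R" for r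
      using inj[of "(pad a S, r)"] that kS(2) by simp
  qed (use a e kS in simp_all)
  then show ?thesis using x(1) kS(1) by (auto simp: FI_tor_def)
qed

text \<open>Torsion in all large degrees makes every element torsion once its degree is embedded in
  a large set. Conversely, finitely many generators have a common bound \<open>N\<close> on degree
  size plus level, and every injection into \<open>{1..n}\<close> with \<open>n \<ge> N\<close>
  factors through their padding.\<close>

lemma T_bar_iff:
  assumes V: "is_functor FI (Mod R) V" and fg: "FO.fg_sub (fmd V) (el (fmd V))"
  shows "(\<exists>N. \<forall>n\<ge>N. FObj V {1..n} \<in> T) \<longleftrightarrow> (\<forall>k\<in>FK. el (fmd V) k \<subseteq> FI_tor V k)"
proof
  assume "\<exists>N. \<forall>n\<ge>N. FObj V {1..n} \<in> T"
  then obtain N where N: "\<And>n. n \<ge> N \<Longrightarrow> FObj V {1..n} \<in> T" by blast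
  show "\<forall>k\<in>FK. el (fmd V) k \<subseteq> FI_tor V k"
  proof (intro ballI subsetI)
    fix k x assume k: "k \<in> FK" and x: "x \<in> el (fmd V) k"
    obtain S r where kS: "k = (S, r)" "finite S" "r \<in> Obj R" using k by auto
    \<comment> \<open>Large enough both for \<open>V\<close> to be torsion there and for
      \<open>S\<close> to embed into \<open>{1..n}\<close>.\<close>
    define n where "n = max N (card S)"
    obtain h where h: "inj_on h S" "h ` S \<subseteq> {1..n}" using card_le_inj[OF kS(2), of "{1..n}"] by (auto simp: n_def)
    let ?f = "\<lparr>Src = S, Tgt = {1..n}, App = restrict h S\<rparr>"
    have f: "?f \<in> Arr FI" using h kS(2) by (auto simp: Arr_FI inj_on_def)
    have "FObj V {1..n} \<in> T" by (rule N) (simp add: n_def)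
    then have "el (rmd (FObj V {1..n})) r \<subseteq> RT.tor (FObj V {1..n}) r"
      using RT.T_iff[OF FI_ObjD(1)[OF V]] kS(3) by blast
    moreover have "push V ?f r x \<in> el (rmd (FObj V {1..n})) r" using push_el'[OF V f kS(3), of x] x kS(1) by simp
    ultimately show "x \<in> FI_tor V k" using FI_torI[OF V f kS(3), of x] x kS(1) by auto
  qed
next
  assume r: "\<forall>k\<in>FK. el (fmd V) k \<subseteq> FI_tor V k"
  obtain E where E: "finite E" "E \<subseteq> Sigma FK (el (fmd V))" "\<forall>k\<in>FK. el (fmd V) k \<subseteq> FO.span (fmd V) E k"
    using fg by (auto simp: FO.fg_sub_def)
  have "\<exists>N. \<forall>z\<in>E. \<exists>S r x a. z = ((S, r), x) \<and> card S + a \<le> N \<and> x \<in> level V S a r" using E(1,2)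
  proof (induction E)
    case (insert z E)
    then obtain N where N: "\<forall>z\<in>E. \<exists>S r x a. z = ((S, r), x) \<and> card S + a \<le> N \<and> x \<in> level V S a r" by auto
    obtain S q x where z: "z = ((S, q), x)" by (metis surj_pair)
    have "(S, q) \<in> FK" "x \<in> el (fmd V) (S, q)" using insert.prems z by auto
    then have "x \<in> FI_tor V (S, q)" using r by blast
    then obtain a where a: "x \<in> level V S a q" by (auto simp: FI_tor_level)
    show ?case
    proof (intro exI[of _ "max N (card S + a)"] ballI)
      fix y assume "y \<in> insert z E"
      then have "y = z \<or> y \<in> E" by simp
      then show "\<exists>S' r x b. y = ((S', r), x) \<and> card S' + b \<le> max N (card S + a) \<and> x \<in> level V S' b r"
      proof
        assume "y = z"
        then show ?thesis using z a by (intro exI[of _ S] exI[of _ q] exI[of _ x] exI[of _ a]) simp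
      next
        assume "y \<in> E"
        then obtain S' q' x' b where "y = ((S', q'), x')" "card S' + b \<le> N" "x' \<in> level V S' b q'" using N by blast
        then show ?thesis by (intro exI[of _ S'] exI[of _ q'] exI[of _ x'] exI[of _ b]) simp
      qed
    qed
  qed simp
  then obtain N where N: "\<And>z. z \<in> E \<Longrightarrow> \<exists>S r x a. z = ((S, r), x) \<and> card S + a \<le> N \<and> x \<in> level V S a r" by blast
  show "\<exists>N. \<forall>n\<ge>N. FObj V {1..n} \<in> T"
  proof (intro exI[of _ N] allI impI)
    fix n assume n: "n \<ge> N"
    \<comment> \<open>The elements all of whose pushes to \<open>{1..n}\<close> are torsion. They
      form a submodule that contains the generators, hence everything; the identity of
      \<open>{1..n}\<close> then shows that \<open>V\<close> is torsion in this degree.\<close>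
    define U where "U = (\<lambda>(S, r). {x \<in> el (fmd V) (S, r). \<forall>f. f \<in> Arr FI \<and> Src f = S \<and> Tgt f = {1..n} \<longrightarrow>
      push V f r x \<in> RT.tor (FObj V {1..n}) r})"
    have TS: "RO.submodule (rmd (FObj V {1..n})) (RT.tor (FObj V {1..n}))"
      by (rule RT.submodule_tor[OF FI_ObjD(1)[OF V]]) simp
    note md = RM.md[OF FI_ObjD(1)[OF V]]
    have l: "RO.linear (rmd (FObj V S)) (rmd (FObj V {1..n})) (push V f)"
      if "f \<in> Arr FI" "Src f = S" "Tgt f = {1..n}" for f S
      using RM.app_linear[OF FArr_in(1)[OF V that(1)]] that(2,3) by simp
    have U: "FO.submodule (fmd V) U"
    proof (rule FO.submoduleI[OF fmd_FI_Mod(1)[OF V]])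
      fix k x assume k: "k \<in> FK" and x: "x \<in> U k"
      obtain S r where kS: "k = (S, r)" "finite S" "r \<in> Obj R" using k by auto
      show xel: "x \<in> el (fmd V) k" using x by (simp add: U_def kS)
      show "inv\<^bsub>gr (fmd V) k\<^esub> x \<in> U k"
        using x xel kS RO.linear_inv[OF l md[OF kS(2)] md[of "{1..n}"] kS(3), of _ x] RO.sub_inv[OF TS kS(3)]
          RO.el_inv[OF md[OF kS(2)] kS(3), of x] by (simp add: U_def)
      fix y assume y: "y \<in> U k"
      have yel: "y \<in> el (fmd V) k" using y by (simp add: U_def kS)
      show "x \<otimes>\<^bsub>gr (fmd V) k\<^esub> y \<in> U k"
        using x y xel yel kS RO.linear_mult[OF l kS(3), of _ S x y] RO.sub_mult[OF TS kS(3)]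
          RO.el_mult[OF md[OF kS(2)] kS(3), of x y] by (simp add: U_def)
    next
      fix k assume k: "k \<in> FK"
      obtain S r where kS: "k = (S, r)" "finite S" "r \<in> Obj R" using k by auto
      show "\<one>\<^bsub>gr (fmd V) k\<^esub> \<in> U k"
        using kS RO.linear_one[OF l md[OF kS(2)] md[of "{1..n}"] kS(3)] RO.sub_one[OF TS kS(3)]
          RO.el_one[OF md[OF kS(2)] kS(3)] by (simp add: U_def)
    next
      fix p x assume p: "p \<in> FOps" and x: "x \<in> U (Fsrc p)"
      from p show "ac (fmd V) p x \<in> U (Ftgt p)"
      proof (cases rule: FOps_cases)
        case (1 f r)
        have xel: "x \<in> el (fmd V) (Src f, r)" using x 1(1) by (simp add: U_def)
        have "push V g r (push V f r x) \<in> RT.tor (FObj V {1..n}) r"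
          if g: "g \<in> Arr FI" "Src g = Tgt f" "Tgt g = {1..n}" for g
          unfolding push_comp[OF V 1(2) g(1) g(2)[symmetric] 1(3) xel]
          using x 1(1) Comp_FI_in[OF 1(2) g(1) g(2)[symmetric]] g(3) by (simp add: U_def)
        then show ?thesis using push_el'[OF V 1(2,3) xel] 1(1) by (simp add: U_def)
      next
        case (2 S b)
        have xel: "x \<in> el (fmd V) (S, Cod R b)" using x 2(1) by (simp add: U_def)
        have "push V f (Dom R b) (ac (rmd (FObj V S)) b x) \<in> RT.tor (FObj V {1..n}) (Dom R b)"
          if f: "f \<in> Arr FI" "Src f = S" "Tgt f = {1..n}" for f
          using RO.linear_act[OF l[OF f] 2(3), of x] RO.sub_act[OF TS 2(3)] x xel f 2(1) by (simp add: U_def)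
        then show ?thesis using ract_el[OF fmd_FI_Mod(1)[OF V] 2(2,3) xel] 2(1) by (simp add: U_def)
      qed
    qed
    have "E \<subseteq> Sigma FK U"
    proof
      fix z assume z: "z \<in> E"
      obtain S r x a where a: "z = ((S, r), x)" "card S + a \<le> N" "x \<in> level V S a r" using N[OF z] by blast
      have S: "finite S" "r \<in> Obj R" "x \<in> el (fmd V) (S, r)" using E(2) z a(1) by auto
      have "push V f r x \<in> RT.tor (FObj V {1..n}) r" if f: "f \<in> Arr FI" "Src f = S" "Tgt f = {1..n}" for f
      proof -
        obtain g where g: "g \<in> Arr FI" "Src g = pad a (Src f)" "Tgt g = Tgt f" "Comp FI g (into_pad a (Src f)) = f"
          using factor_through_into_pad[OF f(1), of a] f(2,3) a(2) n by auto
        have "push V g r (push V (into_pad a S) r x) \<in> RT.tor (FObj V {1..n}) r"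
          using push_tor[OF V g(1) S(2), of "push V (into_pad a S) r x"] a(3) g f by (simp add: level_iff)
        then show ?thesis
          using push_comp[OF V into_pad_Arr[OF S(1)] g(1) _ S(2), of a x] g f S(3) by (simp del: FI_simps)
      qed
      then show "z \<in> Sigma FK U" using S a(1) by (simp add: U_def)
    qed
    then have all: "el (fmd V) k \<subseteq> U k" if "k \<in> FK" for k using E(3) that FO.span_least[OF U] by blast
    have "x \<in> RT.tor (FObj V {1..n}) r" if r: "r \<in> Obj R" and x: "x \<in> el (rmd (FObj V {1..n})) r" for r x
    proof -
      have "x \<in> U ({1..n}, r)" using all[of "({1..n}, r)"] r x by auto
      then have "push V (Ident FI {1..n}) r x \<in> RT.tor (FObj V {1..n}) r"
        using Ident_FI_in[of "{1..n}"] by (simp add: U_def)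
      then show ?thesis using push_Ident[OF V _ r, of "{1..n}" x] x by (simp del: FI_simps)
    qed
    then show "FObj V {1..n} \<in> T" using RT.T_iff[OF FI_ObjD(1)[OF V]] by auto
  qed
qed

text \<open>The condition on all finitely generated subobjects is tested on those generated by one
  element, to which \<open>T_bar_iff\<close> applies. In the other direction, elements of a
  subobject inherit membership by \<open>FI_tor_preimage\<close>.\<close>

lemma T_bar_sfg_iff: "V \<in> T_bar_sfg R T \<longleftrightarrow> V \<in> FI_sfg R \<and> (\<forall>k\<in>FK. el (fmd V) k \<subseteq> FI_tor V k)"
proof
  assume V: "V \<in> T_bar_sfg R T"
  then have sfg: "V \<in> FI_sfg R" by (simp add: T_bar_sfg_def)
  then have VO: "V \<in> Obj (FI_Mod R)" using FI_sfg_iff by simp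
  have "x \<in> FI_tor V k" if k: "k \<in> FK" and x: "x \<in> el (fmd V) k" for k x
  proof -
    let ?U = "FO.span (fmd V) {(k, x)}"
    have e: "{(k, x)} \<subseteq> Sigma FK (el (fmd V))" using k x by simp
    have U: "FO.submodule (fmd V) ?U" by (rule FO.submodule_span[OF FM.md[OF VO] e])
    note Z = FM.sub_ob[OF VO U] and Zel = FM.sub_ob_el[OF VO U] and i = FM.incl[OF VO U]
    let ?Z = "FM.sub_ob V ?U"
    have inj: "inj_on (fapp (FM.incl V ?U) k) (el (fmd ?Z) k)" if "k \<in> FK" for k
      using i(2)[OF that] Zel[OF that] by (simp add: inj_on_def)
    then have mono: "is_mono (FI_Mod R) (FM.incl V ?U)" using FM.is_mono_iff[OF i(1)] by blast
    have x': "x \<in> ?U k" using k by (intro FO.span_gen) auto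
    define E where "E = {(k, x)}"
    have "FO.fg_sub (fmd ?Z) (el (fmd ?Z))"
    proof (rule FO.fg_subI)
      show "finite E" "E \<subseteq> Sigma FK (el (fmd ?Z))" using k x' Zel by (auto simp: E_def)
      fix j y assume j: "j \<in> FK" and y: "y \<in> el (fmd ?Z) j"
      have Es: "E \<subseteq> Sigma FK (el (fmd ?Z))" using k x' Zel by (auto simp: E_def)
      have im: "image_elts (fapp (FM.incl V ?U)) E = {(k, x)}" using i(2)[OF k x'] by (simp add: image_elts_def E_def)
      have yU: "y \<in> ?U j" using y Zel[OF j] by simp
      obtain z where z: "z \<in> FO.span (fmd ?Z) E j" "y = fapp (FM.incl V ?U) j z"
        using FO.span_image_elts[OF FM.app_linear[OF i(1)] FM.md[OF Z(1)] FM.md[OF VO] Es, of y j] yU im by auto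
      have "z \<in> el (fmd ?Z) j" using FO.spanD[OF z(1) FM.md[OF Z(1)] Es] by blast
      then show "y \<in> FO.span (fmd ?Z) E j" using z i(2)[OF j] Zel[OF j] by simp
    qed
    then have fg: "FO.fg_sub (fmd ?Z) (el (fmd ?Z))" "finitely_generated TYPE('u) (FI_Mod R) ?Z"
      using FM.finitely_generated_iff Z(1) by auto
    have "Cod (FI_Mod R) (FM.incl V ?U) = V" "Dom (FI_Mod R) (FM.incl V ?U) = ?Z" using i(1) by (auto simp: Hom_iff)
    then have "?Z \<in> T_bar R T" using V mono fg(2) unfolding T_bar_sfg_def by force
    then have "\<exists>N. \<forall>n\<ge>N. FObj ?Z {1..n} \<in> T" by (simp add: T_bar_def)
    moreover have "is_functor FI (Mod R) ?Z" using Z(1) by simp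
    ultimately have "el (fmd ?Z) k \<subseteq> FI_tor ?Z k" using T_bar_iff[OF _ fg(1)] k by blast
    then have "x \<in> FI_tor ?Z k" using x' Zel[OF k] by blast
    then show ?thesis using FI_tor_app[OF i(1) k] i(2)[OF k x'] by metis
  qed
  then show "V \<in> FI_sfg R \<and> (\<forall>k\<in>FK. el (fmd V) k \<subseteq> FI_tor V k)" using sfg by blast
next
  assume V: "V \<in> FI_sfg R \<and> (\<forall>k\<in>FK. el (fmd V) k \<subseteq> FI_tor V k)"
  show "V \<in> T_bar_sfg R T" unfolding T_bar_sfg_def
  proof (intro CollectI conjI allI impI)
    show "V \<in> FI_sfg R" using V by blast
    fix f assume a: "is_mono (FI_Mod R) f \<and> Cod (FI_Mod R) f = V \<and> finitely_generated TYPE('u) (FI_Mod R) (Dom (FI_Mod R) f)"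
    define W where "W = Dom (FI_Mod R) f"
    have f: "f \<in> Hom (FI_Mod R) W V" using a by (auto simp: is_mono_def Hom_iff W_def)
    have W: "is_functor FI (Mod R) W" "FO.fg_sub (fmd W) (el (fmd W))"
      using a FM.finitely_generated_iff by (auto simp: W_def)
    have inj: "inj_on (fapp f k) (el (fmd W) k)" if "k \<in> FK" for k using a FM.is_mono_iff[OF f] that by blast
    have "x \<in> FI_tor W k" if "k \<in> FK" "x \<in> el (fmd W) k" for k x
      using FI_tor_preimage[OF f inj that] FM.app_el[OF f that] V that(1) by blast
    then have "\<exists>N. \<forall>n\<ge>N. FObj W {1..n} \<in> T" using T_bar_iff[OF W] by blast
    then show "Dom (FI_Mod R) f \<in> T_bar R T" using a by (simp add: T_bar_def W_def)
  qed
qed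

text \<open>The level at which an element of the kernel becomes torsion varies with the element, so
  torsion of the quotient cannot be lifted directly. Restricting to the module generated by one
  element bounds the levels, after which \<open>tor_transfer\<close> lifts torsion from
  \<open>W\<close> to \<open>V\<close>.\<close>

lemma FI_tor_quotient:
  assumes g: "g \<in> Hom (FI_Mod R) V W" and surj: "\<And>k. k \<in> FK \<Longrightarrow> fapp g k ` el (fmd V) k = el (fmd W) k"
    and ker: "\<And>k x. k \<in> FK \<Longrightarrow> x \<in> el (fmd V) k \<Longrightarrow> fapp g k x = \<one>\<^bsub>gr (fmd W) k\<^esub> \<longleftrightarrow> x \<in> FI_tor V k"
    and k: "k \<in> FK" and y: "y \<in> FI_tor W k"
  shows "y = \<one>\<^bsub>gr (fmd W) k\<^esub>"
proof -
  have V: "is_functor FI (Mod R) V" and W: "is_functor FI (Mod R) W" using FM.Hom_Obj[OF g] by auto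
  obtain S r where kS: "k = (S, r)" "finite S" "r \<in> Obj R" using k by auto
  obtain a where a: "y \<in> el (fmd W) (S, r)" "push W (into_pad a S) r y \<in> RT.tor (FObj W (pad a S)) r"
    using y kS by (auto simp: FI_tor_def)
  obtain x where x: "x \<in> el (fmd V) (S, r)" "y = fapp g (S, r) x" using surj[OF k] a(1) kS(1) by blast
  \<comment> \<open>After the first padding, the image of \<open>x1\<close> in \<open>W\<close> is
    torsion already, and the rest of the argument takes place among modules, starting from the
    single degree \<open>S1\<close>.\<close>
  define S1 where "S1 = pad a S"
  have S1: "finite S1" using kS by (simp add: S1_def)
  define x1 where "x1 = push V (into_pad a S) r x"
  have x1: "x1 \<in> el (rmd (FObj V S1)) r" using push_el'[OF V into_pad_Arr[OF kS(2)] kS(3), of x a] x(1) by (simp add: x1_def S1_def)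
  have gx1: "fapp g (S1, r) x1 \<in> RT.tor (FObj W S1) r"
    using fapp_push[OF g into_pad_Arr[OF kS(2)] kS(3), of x a] x a(2) by (simp add: x1_def S1_def)
  have O1: "FObj V S1 \<in> Obj (Mod R)" by (rule FI_ObjD(1)[OF V S1])
  note md1 = RM.md[OF O1]
  let ?U = "RO.span (rmd (FObj V S1)) {(r, x1)}"
  have Ue: "{(r, x1)} \<subseteq> Sigma (Obj R) (el (rmd (FObj V S1)))" using kS x1 by simp
  have U: "RO.submodule (rmd (FObj V S1)) ?U" by (rule RO.submodule_span[OF md1 Ue])
  have no: "RO.noeth_sub (rmd (FObj V S1)) ?U" by (rule RM.locally_noetherian_span[OF locally_noeth O1 kS(3) x1])
  have tS: "RO.submodule (rmd (FObj V S1)) (\<lambda>r. FI_tor V (S1, r))"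
    unfolding RO.submodule_def
    using FO.submodule_grp[OF submodule_FI_tor[OF V], of "(S1, _)"] FO.sub_act[OF submodule_FI_tor[OF V], of "Inr (S1, _)"] S1
    by simp
  have "RO.fg_sub (rmd (FObj V S1)) (\<lambda>r. ?U r \<inter> FI_tor V (S1, r))"
    using no RO.submodule_Int[OF md1 U tS] by (auto simp: RO.noeth_sub_def)
  then obtain E where E: "finite E" "E \<subseteq> Sigma (Obj R) (\<lambda>r. ?U r \<inter> FI_tor V (S1, r))"
    "\<forall>s\<in>Obj R. ?U s \<inter> FI_tor V (S1, s) \<subseteq> RO.span (rmd (FObj V S1)) E s" by (auto simp: RO.fg_sub_def)
  have "\<exists>b. E \<subseteq> Sigma (Obj R) (level V S1 b)" using E(1,2)
  proof (induction E)
    case (insert z E)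
    then obtain b where b: "E \<subseteq> Sigma (Obj R) (level V S1 b)" by auto
    obtain s u where z: "z = (s, u)" "s \<in> Obj R" "u \<in> FI_tor V (S1, s)" using insert.prems by auto
    then obtain c where c: "u \<in> level V S1 c s" by (auto simp: FI_tor_level)
    have "level V S1 b q \<subseteq> level V S1 (max b c) q" "level V S1 c q \<subseteq> level V S1 (max b c) q" if "q \<in> Obj R" for q
      using level_mono[OF V S1 that] by simp_all
    then show ?case using b c z(1,2) by (intro exI[of _ "max b c"]) blast
  qed simp
  then obtain b where b: "E \<subseteq> Sigma (Obj R) (level V S1 b)" by blast
  \<comment> \<open>The finitely many generators \<open>E\<close> of the intersection lie in one
    level \<open>b\<close>; levels are submodules, so the whole intersection does.\<close>
  have Ub: "u \<in> level V S1 b s" if "s \<in> Obj R" "u \<in> ?U s" "u \<in> FI_tor V (S1, s)" for s u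
    using E(3) that RO.span_least[OF submodule_level[OF V S1] b] by blast
  note X0 = RM.sub_ob[OF O1 U] and X0el = RM.sub_ob_el[OF O1 U] and i = RM.incl[OF O1 U]
  let ?i = "RM.incl (FObj V S1) ?U"
  note q = RM.Comp_in[OF i(1) FI_Hom_App[OF g S1]] and f = RM.Comp_in[OF i(1) into_pad_Hom[OF V S1, of b]]
  have qe: "rapp (Comp (Mod R) (App g S1) ?i) s u = fapp g (S1, s) u" if "s \<in> Obj R" "u \<in> ?U s" for s u
    using RM.app_Comp[OF i(1) FI_Hom_App[OF g S1] that(1), of u] X0el[OF that(1)] i(2)[OF that] that(2) by (simp del: Mod_simps)
  have fe: "rapp (Comp (Mod R) (FArr V (into_pad b S1)) ?i) s u = push V (into_pad b S1) s u" if "s \<in> Obj R" "u \<in> ?U s" for s u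
    using RM.app_Comp[OF i(1) into_pad_Hom[OF V S1, of b] that(1), of u] X0el[OF that(1)] i(2)[OF that] that(2) by (simp del: Mod_simps)
  have qt: "fapp g (S1, s) u \<in> RT.tor (FObj W S1) s" if "s \<in> Obj R" "u \<in> ?U s" for s u
  proof -
    have "RO.submodule (rmd (FObj V S1)) (RO.preim (rmd (FObj V S1)) (rapp (App g S1)) (RT.tor (FObj W S1)))"
      by (rule RO.submodule_preim[OF RM.app_linear[OF FI_Hom_App[OF g S1]] md1 RM.md[OF FI_ObjD(1)[OF W S1]]
            RT.submodule_tor[OF FI_ObjD(1)[OF W S1]]])
    moreover have "{(r, x1)} \<subseteq> Sigma (Obj R) (RO.preim (rmd (FObj V S1)) (rapp (App g S1)) (RT.tor (FObj W S1)))"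
      using gx1 x1 kS(3) by (simp add: RO.preim_def)
    ultimately have "u \<in> RO.preim (rmd (FObj V S1)) (rapp (App g S1)) (RT.tor (FObj W S1)) s"
      by (rule RO.span_least[OF _ _ that(2)])
    then show ?thesis by (simp add: RO.preim_def)
  qed
  have x1U: "x1 \<in> ?U r" using kS(3) by (intro RO.span_gen) auto
  \<comment> \<open>Here \<open>q\<close> is the restriction of \<open>g\<close> to
    \<open>?U\<close>, with torsion image, and \<open>f\<close> is the push to
    \<open>pad b S1\<close>. The kernel of \<open>q\<close> consists of elements of
    \<open>FI_tor V\<close>, which \<open>f\<close> makes torsion by the choice of
    \<open>b\<close>.\<close>
  have "rapp (Comp (Mod R) (FArr V (into_pad b S1)) ?i) r x1 \<in> RT.tor (FObj V (pad b S1)) r"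
  proof (rule RT.tor_transfer[OF q f _ _ kS(3)])
    fix s u assume s: "s \<in> Obj R" and "u \<in> el (rmd (RM.sub_ob (FObj V S1) ?U)) s"
    then have u: "u \<in> ?U s" using X0el[OF s] by simp
    show "rapp (Comp (Mod R) (App g S1) ?i) s u \<in> RT.tor (FObj W S1) s" unfolding qe[OF s u] by (rule qt[OF s u])
    assume "rapp (Comp (Mod R) (App g S1) ?i) s u = \<one>\<^bsub>gr (rmd (FObj W S1)) s\<^esub>"
    then have "u \<in> FI_tor V (S1, s)"
      using ker[of "(S1, s)" u] qe[OF s u] s S1 RO.sub_el[OF U s u] by simp
    then show "rapp (Comp (Mod R) (FArr V (into_pad b S1)) ?i) s u \<in> RT.tor (FObj V (pad b S1)) s"
      unfolding fe[OF s u] using Ub[OF s u] by (simp add: level_iff)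
  qed (use X0el[OF kS(3)] x1U in simp)
  then have "push V (into_pad b S1) r x1 \<in> RT.tor (FObj V (pad b S1)) r" using fe[OF kS(3) x1U] by simp
  moreover have "push V (into_pad b S1) r x1 = push V (Comp FI (into_pad b S1) (into_pad a S)) r x"
    unfolding x1_def by (rule push_comp[OF V into_pad_Arr[OF kS(2)] into_pad_Arr[OF S1] _ kS(3)]) (use x(1) in \<open>simp_all add: S1_def\<close>)
  ultimately have "x \<in> FI_tor V (S, r)"
    using FI_torI[OF V Comp_FI_in[OF into_pad_Arr[OF kS(2), of a] into_pad_Arr[OF S1, of b]] kS(3), of x] x(1)
    by (simp add: S1_def Comp_FI_simps del: FI_simps(4))
  then show ?thesis using ker[OF k, of x] x kS(1) by simp
qed

section \<open>The torsion theory on \<open>FI_sfg R\<close>\<close>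

abbreviation sfg :: "('u FI_module, 'u FI_module_arrow) cat" where "sfg \<equiv> full_subcategory (FI_Mod R) (FI_sfg R)"

definition T_free :: "'u FI_module set" where
  "T_free = {V \<in> FI_sfg R. \<forall>k\<in>FK. FI_tor V k \<subseteq> {\<one>\<^bsub>gr (fmd V) k\<^esub>}}"

sublocale D: module_category FK FOps Fsrc Ftgt sfg fmd fapp
  by (rule FM.module_category_serre[OF serre_FI_sfg])

lemma Hom_sfg: "f \<in> Hom sfg V W \<Longrightarrow> f \<in> Hom (FI_Mod R) V W" "f \<in> Hom sfg V W \<Longrightarrow> V \<in> FI_sfg R \<and> W \<in> FI_sfg R"
  by (auto simp: Hom_full_subcategory)

lemma Obj_sfg: "V \<in> Obj sfg \<longleftrightarrow> V \<in> FI_sfg R"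
  by (auto simp: FI_sfg_def)

text \<open>The subobject is torsion because its inclusion reflects \<open>FI_tor\<close>, and the
  quotient is torsion free by \<open>FI_tor_quotient\<close>.\<close>

lemma FI_tor_sub_ob:
  assumes V: "V \<in> FI_sfg R"
  shows "D.sub_ob V (FI_tor V) \<in> T_bar_sfg R T" "D.quot_ob V (FI_tor V) \<in> T_free"
proof -
  have VO: "V \<in> Obj sfg" using V Obj_sfg by blast
  have VF: "is_functor FI (Mod R) V" using V FI_sfg_iff by blast
  note U = submodule_FI_tor[OF VF]
  note i = D.incl[OF VO U] and Zel = D.sub_ob_el[OF VO U] and p = D.proj[OF VO U]
  have inj: "inj_on (fapp (D.incl V (FI_tor V)) k) (el (fmd (D.sub_ob V (FI_tor V))) k)" if "k \<in> FK" for k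
    using i(2)[OF that] Zel[OF that] by (simp add: inj_on_def)
  have "x \<in> FI_tor (D.sub_ob V (FI_tor V)) k" if k: "k \<in> FK" and x: "x \<in> el (fmd (D.sub_ob V (FI_tor V))) k" for k x
    by (rule FI_tor_preimage[OF Hom_sfg(1)[OF i(1)] inj k x]) (use i(2)[OF k] Zel[OF k] x in simp_all)
  then show "D.sub_ob V (FI_tor V) \<in> T_bar_sfg R T"
    using T_bar_sfg_iff Hom_sfg(2)[OF i(1)] by blast
  have "y = \<one>\<^bsub>gr (fmd (D.quot_ob V (FI_tor V))) k\<^esub>" if "k \<in> FK" "y \<in> FI_tor (D.quot_ob V (FI_tor V)) k" for k y
    by (rule FI_tor_quotient[OF Hom_sfg(1)[OF p(1)] p(2,3) that])
  then show "D.quot_ob V (FI_tor V) \<in> T_free" using Hom_sfg(2)[OF p(1)] by (auto simp: T_free_def)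
qed

lemma torsion_theory_sfg: "torsion_theory sfg (T_bar_sfg R T) T_free"
  unfolding torsion_theory_def
proof (intro conjI ballI)
  show "T_bar_sfg R T \<subseteq> Obj sfg" "T_free \<subseteq> Obj sfg"
    using Obj_sfg by (auto simp: T_bar_sfg_def T_free_def)
  show "replete sfg (T_bar_sfg R T)" unfolding replete_def
  proof (intro allI impI)
    fix V W assume a: "V \<in> T_bar_sfg R T \<and> isomorphic sfg V W"
    obtain f where f: "f \<in> Hom sfg V W" and b: "\<And>k. k \<in> FK \<Longrightarrow> bij_betw (fapp f k) (el (fmd V) k) (el (fmd W) k)"
      using D.isomorphicD conjunct2[OF a] by metis
    have "y \<in> FI_tor W k" if k: "k \<in> FK" and y: "y \<in> el (fmd W) k" for k y
    proof -
      obtain x where x: "x \<in> el (fmd V) k" "y = fapp f k x" using b[OF k] y unfolding bij_betw_def by blast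
      then have "x \<in> FI_tor V k" using a T_bar_sfg_iff k by blast
      then show ?thesis using FI_tor_app[OF Hom_sfg(1)[OF f] k] x(2) by blast
    qed
    then show "W \<in> T_bar_sfg R T" using T_bar_sfg_iff Hom_sfg(2)[OF f] by blast
  qed
  show "replete sfg T_free" unfolding replete_def
  proof (intro allI impI)
    fix V W assume a: "V \<in> T_free \<and> isomorphic sfg V W"
    obtain f where f: "f \<in> Hom sfg V W" and b: "\<And>k. k \<in> FK \<Longrightarrow> bij_betw (fapp f k) (el (fmd V) k) (el (fmd W) k)"
      using D.isomorphicD conjunct2[OF a] by metis
    have inj: "inj_on (fapp f k) (el (fmd V) k)" if "k \<in> FK" for k using b[OF that] by (simp add: bij_betw_def)
    have W: "is_functor FI (Mod R) W" using FM.Hom_Obj[OF Hom_sfg(1)[OF f]] by simp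
    have "y = \<one>\<^bsub>gr (fmd W) k\<^esub>" if k: "k \<in> FK" and y: "y \<in> FI_tor W k" for k y
    proof -
      have "y \<in> el (fmd W) k" using FO.sub_el[OF submodule_FI_tor[OF W] k y] .
      then obtain x where x: "x \<in> el (fmd V) k" "y = fapp f k x" using b[OF k] unfolding bij_betw_def by blast
      then have "x \<in> FI_tor V k" using FI_tor_preimage[OF Hom_sfg(1)[OF f] inj k x(1)] y by simp
      then have "x = \<one>\<^bsub>gr (fmd V) k\<^esub>" using a k unfolding T_free_def by blast
      then show ?thesis using x(2) D.app_one[OF f k] by simp
    qed
    then show "W \<in> T_free" using Hom_sfg(2)[OF f] by (auto simp: T_free_def)
  qed
  show "zero_arrow sfg f" if V: "V \<in> T_bar_sfg R T" and W: "W \<in> T_free" and f: "f \<in> Hom sfg V W" for V W f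
    unfolding D.zero_arrow_iff[OF f]
  proof (intro ballI)
    fix k x assume k: "k \<in> FK" and x: "x \<in> el (fmd V) k"
    have "x \<in> FI_tor V k" using V T_bar_sfg_iff k x by blast
    then have "fapp f k x \<in> FI_tor W k" by (rule FI_tor_app[OF Hom_sfg(1)[OF f] k])
    then show "fapp f k x = \<one>\<^bsub>gr (fmd W) k\<^esub>" using W k unfolding T_free_def by blast
  qed
  show "\<exists>t g. short_exact sfg t g \<and> Cod sfg t = V \<and> Dom sfg t \<in> T_bar_sfg R T \<and> Cod sfg g \<in> T_free"
    if VO: "V \<in> Obj sfg" for V
  proof -
    have V: "V \<in> FI_sfg R" using VO Obj_sfg by blast
    have U: "FO.submodule (fmd V) (FI_tor V)" using submodule_FI_tor V FI_sfg_iff by blast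
    have "Cod sfg (D.incl V (FI_tor V)) = V" "Dom sfg (D.incl V (FI_tor V)) = D.sub_ob V (FI_tor V)"
      "Cod sfg (D.proj V (FI_tor V)) = D.quot_ob V (FI_tor V)"
      using D.incl(1)[OF VO U] D.proj(1)[OF VO U] unfolding Hom_iff by auto
    then show ?thesis
      using D.short_exact_sub[OF VO U] FI_tor_sub_ob[OF V]
      by (intro exI[of _ "D.incl V (FI_tor V)"] exI[of _ "D.proj V (FI_tor V)"]) simp
  qed
qed

lemma hereditary_sfg: "hereditary_torsion_theory sfg (T_bar_sfg R T) T_free"
  unfolding hereditary_torsion_theory_def closed_under_subobjects_def
proof (intro conjI allI impI torsion_theory_sfg)
  fix f assume a: "is_mono sfg f \<and> Cod sfg f \<in> T_bar_sfg R T"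
  define V W where VW: "V = Dom sfg f" "W = Cod sfg f"
  have f: "f \<in> Hom sfg V W" using a unfolding is_mono_def VW by (simp only: Hom_iff)
  have inj: "inj_on (fapp f k) (el (fmd V) k)" if "k \<in> FK" for k using a D.is_mono_iff[OF f] that by blast
  have "x \<in> FI_tor V k" if "k \<in> FK" "x \<in> el (fmd V) k" for k x
    using FI_tor_preimage[OF Hom_sfg(1)[OF f] inj that] D.app_el[OF f that] a T_bar_sfg_iff that(1) VW by blast
  then show "Dom sfg f \<in> T_bar_sfg R T" using T_bar_sfg_iff Hom_sfg(2)[OF f] VW by blast
qed

section \<open>The torsion subobject as a colimit of pullbacks\<close>

sublocale DT: module_torsion FK FOps Fsrc Ftgt sfg fmd fapp "T_bar_sfg R T" T_free
  by unfold_locales (rule hereditary_sfg)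

text \<open>Both the given \<open>i\<close> and the constructed inclusion of \<open>FI_tor V\<close>
  have the trace \<open>DT.tor V\<close> as image, whatever torsion-free classes their sequences
  use.\<close>

lemma torsion_subobject_image:
  assumes V: "V \<in> FI_sfg R" and i: "torsion_subobject sfg (T_bar_sfg R T) V i"
  shows "i \<in> Hom (FI_Mod R) (Src i) V" "\<And>k. k \<in> FK \<Longrightarrow> inj_on (fapp i k) (el (fmd (Src i)) k)"
    "\<And>k. k \<in> FK \<Longrightarrow> fapp i k ` el (fmd (Src i)) k = FI_tor V k"
proof -
  have VO: "V \<in> Obj sfg" using V Obj_sfg by blast
  have U: "FO.submodule (fmd V) (FI_tor V)" using submodule_FI_tor V FI_sfg_iff by blast
  obtain F' g where s: "torsion_theory sfg (T_bar_sfg R T) F'" "short_exact sfg i g" "Cod sfg i = V"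
    "Dom sfg i \<in> T_bar_sfg R T" "Cod sfg g \<in> F'" using i by (auto simp: torsion_subobject_def)
  obtain X Y Z where iH: "i \<in> Hom sfg X Y" and inj: "\<And>k. k \<in> FK \<Longrightarrow> inj_on (fapp i k) (el (fmd X) k)"
    using D.short_exactD[OF s(2)] by metis
  have e: "X = Src i" "Y = V" using iH s(3) by (auto simp: Hom_iff)
  show "i \<in> Hom (FI_Mod R) (Src i) V" using Hom_sfg(1)[OF iH] e by simp
  show "inj_on (fapp i k) (el (fmd (Src i)) k)" if "k \<in> FK" for k using inj[OF that] e by simp
  show "fapp i k ` el (fmd (Src i)) k = FI_tor V k" if k: "k \<in> FK" for k
  proof -
    have "DT.tor V k = fapp i k ` el (fmd (Src i)) k"
      using DT.tor_eq_image[OF s(2-5,1) k] by simp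
    moreover have "DT.tor V k = fapp (D.incl V (FI_tor V)) k ` el (fmd (D.sub_ob V (FI_tor V))) k"
    proof -
      have d: "Cod sfg (D.incl V (FI_tor V)) = V" "Dom sfg (D.incl V (FI_tor V)) = D.sub_ob V (FI_tor V)"
        "Cod sfg (D.proj V (FI_tor V)) = D.quot_ob V (FI_tor V)"
        using D.incl(1)[OF VO U] D.proj(1)[OF VO U] unfolding Hom_iff by auto
      show ?thesis
        using DT.tor_eq_image[OF D.short_exact_sub[OF VO U] d(1) _ _ torsion_theory_sfg k, unfolded d] FI_tor_sub_ob[OF V] by blast
    qed
    moreover have "fapp (D.incl V (FI_tor V)) k ` el (fmd (D.sub_ob V (FI_tor V))) k = FI_tor V k"
      using D.incl(2)[OF VO U k] D.sub_ob_el[OF VO U k] by simp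
    ultimately show ?thesis by simp
  qed
qed

text \<open>Since \<open>t\<close> is injective, the pullback can be realised as an actual submodule
  of \<open>X\<close>; the second projection is the unique lift of \<open>f\<close> on it through
  \<open>t\<close>.\<close>

lemma pullback_along_mono:
  assumes f: "f \<in> Hom (Mod R) X Y" and t: "t \<in> Hom (Mod R) Z Y"
    and inj: "\<And>r. r \<in> Obj R \<Longrightarrow> inj_on (rapp t r) (el (rmd Z) r)"
    and P: "RO.submodule (rmd X) P" "\<And>r. r \<in> Obj R \<Longrightarrow> P r = {x \<in> el (rmd X) r. rapp f r x \<in> rapp t r ` el (rmd Z) r}"
  shows "\<exists>q. q \<in> Hom (Mod R) (RM.sub_ob X P) Z \<and> is_pullback (Mod R) f t (RM.incl X P) q"
proof -
  have XO: "X \<in> Obj (Mod R)" using RM.Hom_Obj[OF f] by blast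
  let ?p = "RM.incl X P"
  note p = RM.incl[OF XO P(1)] and el = RM.sub_ob_el[OF XO P(1)]
  note fp = RM.Comp_in[OF p(1) f]
  have pe: "rapp (Comp (Mod R) f ?p) r x = rapp f r x" if "r \<in> Obj R" "x \<in> P r" for r x
    using RM.app_Comp[OF p(1) f that(1), of x] el[OF that(1)] p(2)[OF that] that(2) by simp
  have pinj: "inj_on (rapp ?p r) (el (rmd (RM.sub_ob X P)) r)" if "r \<in> Obj R" for r
    using p(2)[OF that] el[OF that] by (simp add: inj_on_def)
  have "\<exists>!q. q \<in> Hom (Mod R) (RM.sub_ob X P) Z \<and> Comp (Mod R) t q = Comp (Mod R) f ?p"
    by (rule RM.lift_mono[OF t fp inj]) (use el pe P(2) in auto)
  then obtain q where q: "q \<in> Hom (Mod R) (RM.sub_ob X P) Z" "Comp (Mod R) t q = Comp (Mod R) f ?p" by blast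
  have d: "Dom (Mod R) f = X" "Cod (Mod R) f = Y" "Dom (Mod R) t = Z" "Cod (Mod R) t = Y" "Dom (Mod R) ?p = RM.sub_ob X P"
    "f \<in> Arr (Mod R)" "t \<in> Arr (Mod R)"
    using f t p(1) by (auto simp: Hom_iff simp del: Mod_simps)
  have tm: "is_mono (Mod R) t" using RM.is_mono_iff[OF t] inj by blast
  have "\<exists>!u. u \<in> Hom (Mod R) a (RM.sub_ob X P) \<and> Comp (Mod R) ?p u = x \<and> Comp (Mod R) q u = y"
    if x: "x \<in> Hom (Mod R) a X" and y: "y \<in> Hom (Mod R) a Z" and e: "Comp (Mod R) f x = Comp (Mod R) t y" for a x y
  proof -
    have "rapp x r w \<in> P r" if "r \<in> Obj R" "w \<in> el (rmd a) r" for r w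
    proof -
      have "rapp f r (rapp x r w) = rapp t r (rapp y r w)"
        using RM.app_Comp[OF x f that] RM.app_Comp[OF y t that] e by (simp del: Mod_simps)
      then show ?thesis using P(2)[OF that(1)] RM.app_el[OF x that] RM.app_el[OF y that] by blast
    qed
    then have "\<exists>!u. u \<in> Hom (Mod R) a (RM.sub_ob X P) \<and> Comp (Mod R) ?p u = x"
      by (intro RM.lift_mono[OF p(1) x pinj]) (use p(2) el in force)+
    then obtain u where u: "u \<in> Hom (Mod R) a (RM.sub_ob X P)" "Comp (Mod R) ?p u = x"
      and uniq: "\<And>v. v \<in> Hom (Mod R) a (RM.sub_ob X P) \<Longrightarrow> Comp (Mod R) ?p v = x \<Longrightarrow> v = u" by blast
    have "Comp (Mod R) t (Comp (Mod R) q u) = Comp (Mod R) t y"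
      using RM.Comp_assoc[OF u(1) q(1) t] RM.Comp_assoc[OF u(1) p(1) f] q(2) u(2) e by simp
    then have "Comp (Mod R) q u = y"
      using tm RM.Comp_in[OF u(1) q(1)] y d unfolding is_mono_def by metis
    then show ?thesis using u uniq by blast
  qed
  then show ?thesis using q p(1) d unfolding is_pullback_def by (intro exI[of _ q]) (simp del: Mod_simps)
qed

lemma torsion_colimit:
  assumes V: "V \<in> FI_sfg R" and i: "torsion_subobject sfg (T_bar_sfg R T) V i" and S: "finite S"
  shows "is_torsion_colimit R T V S (App i S)"
proof -
  note im = torsion_subobject_image[OF V i]
  have VF: "is_functor FI (Mod R) V" using V FI_sfg_iff by blast
  define X where "X = FObj V S"
  define L where "L = FObj (Src i) S"
  define k where "k = App i S"
  have kH: "k \<in> Hom (Mod R) L X" unfolding k_def L_def X_def by (rule FI_Hom_App[OF im(1) S])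
  have XO: "X \<in> Obj (Mod R)" and LO: "L \<in> Obj (Mod R)" using RM.Hom_Obj[OF kH] by auto
  have kinj: "inj_on (rapp k r) (el (rmd L) r)" if "r \<in> Obj R" for r
    using im(2)[of "(S, r)"] that S by (simp add: k_def L_def)
  have kim: "rapp k r ` el (rmd L) r = (\<Union>a. level V S a r)" if "r \<in> Obj R" for r
    using im(3)[of "(S, r)"] that S by (simp add: k_def L_def FI_tor_level)
  have Lv: "RO.submodule (rmd X) (level V S a)" for a unfolding X_def by (rule submodule_level[OF VF S])
  let ?f = "\<lambda>a. FArr V (into_pad a S)"
  have fH: "?f a \<in> Hom (Mod R) X (FObj V (pad a S))" for a unfolding X_def by (rule into_pad_Hom[OF VF S])
  have "\<exists>t g. short_exact (Mod R) t g \<and> Cod (Mod R) t = FObj V (pad a S) \<and> Dom (Mod R) t \<in> T \<and> Cod (Mod R) g \<in> F" for a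
    using RT.torsion FI_ObjD(1)[OF VF, of "pad a S"] S unfolding torsion_theory_def by simp
  then obtain t g where tg: "\<And>a. short_exact (Mod R) (t a) (g a)" "\<And>a. Cod (Mod R) (t a) = FObj V (pad a S)"
    "\<And>a. Dom (Mod R) (t a) \<in> T" "\<And>a. Cod (Mod R) (g a) \<in> F" by metis
  define Z where "Z a = Dom (Mod R) (t a)" for a
  have tH: "t a \<in> Hom (Mod R) (Z a) (FObj V (pad a S))" for a
    using tg(1,2)[of a] unfolding short_exact_def is_kernel_def Hom_iff Z_def by blast
  have tinj: "inj_on (rapp (t a) r) (el (rmd (Z a)) r)" if "r \<in> Obj R" for a r
  proof -
    have ker: "is_kernel (Mod R) (t a) (g a)" using tg(1) by (simp add: short_exact_def)
    then have "g a \<in> Hom (Mod R) (FObj V (pad a S)) (Cod (Mod R) (g a))"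
      using tg(2)[of a] unfolding is_kernel_def Hom_iff by metis
    from RM.is_kernelD(1)[OF ker tH this that] show ?thesis .
  qed
  have tim: "RT.tor (FObj V (pad a S)) r = rapp (t a) r ` el (rmd (Z a)) r" if "r \<in> Obj R" for a r
    using RT.tor_eq_image[OF tg(1-4) RT.torsion that] by (simp add: Z_def)
  \<comment> \<open>The pullbacks are chosen as the submodules \<open>level V S a\<close> of the
    same module \<open>V S\<close>, so that the transition arrows act as the identity on
    elements.\<close>
  let ?P = "\<lambda>a. RM.sub_ob X (level V S a)" and ?p = "\<lambda>a. RM.incl X (level V S a)"
  note PO = RM.sub_ob(1)[OF XO Lv] and Pel = RM.sub_ob_el[OF XO Lv] and p = RM.incl[OF XO Lv]
  have "\<exists>q. q \<in> Hom (Mod R) (?P a) (Z a) \<and> is_pullback (Mod R) (?f a) (t a) (?p a) q" for a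
    by (rule pullback_along_mono[OF fH tH tinj Lv]) (use tim in \<open>auto simp: level_iff X_def\<close>)
  then obtain q where q: "\<And>a. q a \<in> Hom (Mod R) (?P a) (Z a)" "\<And>a. is_pullback (Mod R) (?f a) (t a) (?p a) (q a)" by metis
  define tr where "tr a b = RM.mk (?P a) (?P b) (\<lambda>r x. x)" for a b
  have tr: "tr a b \<in> Hom (Mod R) (?P a) (?P b)" "r \<in> Obj R \<Longrightarrow> x \<in> level V S a r \<Longrightarrow> rapp (tr a b) r x = x"
    if "a \<le> b" for a b r x
  proof -
    have "RO.linear (rmd (?P a)) (rmd X) (\<lambda>r x. x)"
    proof (rule RO.linear_cong[OF RM.app_linear[OF p(1)] RM.md[OF PO]])
      show "x = rapp (?p a) r x" if r: "r \<in> Obj R" and x: "x \<in> el (rmd (?P a)) r" for r x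
        using p(2)[OF r, of x a] x Pel[OF r] by simp
    qed
    then have "RO.linear (rmd (?P a)) (rmd (?P b)) (\<lambda>r x. x)"
      by (rule RM.linear_into_sub_ob[OF XO Lv RM.md[OF PO]]) (use level_mono[OF VF S _ that] Pel in auto)
    note m = RM.mk[OF PO PO this, folded tr_def]
    show "tr a b \<in> Hom (Mod R) (?P a) (?P b)" by (rule m)
    show "r \<in> Obj R \<Longrightarrow> x \<in> level V S a r \<Longrightarrow> rapp (tr a b) r x = x" using m(2) Pel by simp
  qed
  define PF where "PF = \<lparr>FObj = ?P, FArr = (\<lambda>(a, b). tr a b)\<rparr>"
  have PF: "is_functor nat_category (Mod R) PF"
    unfolding is_functor_def
  proof (intro conjI ballI impI)
    show "FObj PF a \<in> Obj (Mod R)" for a using PO by (simp add: PF_def)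
    show "FArr PF e \<in> Hom (Mod R) (FObj PF (Dom nat_category e)) (FObj PF (Cod nat_category e))" if "e \<in> Arr nat_category" for e
      using that tr(1) by (auto simp: PF_def)
    show "FArr PF (Ident nat_category a) = Ident (Mod R) (FObj PF a)" for a
      unfolding PF_def
      by (simp del: Mod_simps, rule RM.arr_ext[OF tr(1) RM.Ident_in[OF PO]])
        (use tr(2)[of a a] RM.app_Ident[OF PO] Pel in \<open>auto simp del: Mod_simps\<close>)
    show "FArr PF (Comp nat_category e' e) = Comp (Mod R) (FArr PF e') (FArr PF e)"
      if ee: "e \<in> Arr nat_category" "e' \<in> Arr nat_category" "Cod nat_category e = Dom nat_category e'" for e e'
    proof -
      obtain a b c where e: "e = (a, b)" "e' = (b, c)" "a \<le> b" "b \<le> c" using ee by (cases e; cases e') auto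
      have "tr a c = Comp (Mod R) (tr b c) (tr a b)"
      proof (rule RM.arr_ext[OF tr(1) RM.Comp_in[OF tr(1) tr(1)]])
        fix r x assume r: "r \<in> Obj R" and x: "x \<in> el (rmd (?P a)) r"
        then have xa: "x \<in> level V S a r" using Pel by simp
        then have "x \<in> level V S b r" using level_mono[OF VF S r e(3)] by blast
        then show "rapp (tr a c) r x = rapp (Comp (Mod R) (tr b c) (tr a b)) r x"
          using RM.app_Comp[OF tr(1)[OF e(3)] tr(1)[OF e(4)] r x] tr(2)[OF e(3) r xa] tr(2)[OF e(4) r] tr(2)[OF _ r xa, of c] e(3,4)
          by simp
      qed (use e in auto)
      then show ?thesis by (simp add: PF_def e del: Mod_simps)
    qed
  qed
  have ptr: "Comp (Mod R) (?p b) (tr a b) = ?p a" if ab: "a \<le> b" for a b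
  proof (rule RM.arr_ext[OF RM.Comp_in[OF tr(1)[OF ab] p(1)] p(1)])
    fix r x assume r: "r \<in> Obj R" and x: "x \<in> el (rmd (?P a)) r"
    then have xa: "x \<in> level V S a r" using Pel by simp
    then have "x \<in> level V S b r" using level_mono[OF VF S r ab] by blast
    then show "rapp (Comp (Mod R) (?p b) (tr a b)) r x = rapp (?p a) r x"
      using RM.app_Comp[OF tr(1)[OF ab] p(1) r x] tr(2)[OF ab r xa] p(2)[OF r xa] p(2)[OF r] by simp
  qed
  have sq: "Comp (Mod R) (?f a) (?p a) = Comp (Mod R) (t a) (q a)" for a
    using q(2)[of a] unfolding is_pullback_def by blast
  \<comment> \<open>Both sides are the restriction of the map induced by \<open>into_pad b S\<close>
    to the pullback at \<open>a\<close>, because \<open>into_pad b S\<close> is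
    \<open>into_pad a S\<close> followed by \<open>pad_inclusion a b S\<close>.\<close>
  have ttr: "Comp (Mod R) (t b) (Comp (Mod R) (q b) (tr a b)) =
      Comp (Mod R) (FArr V (pad_inclusion a b S)) (Comp (Mod R) (t a) (q a))" if ab: "a \<le> b" for a b
  proof -
    have inc: "FArr V (pad_inclusion a b S) \<in> Hom (Mod R) (FObj V (pad a S)) (FObj V (pad b S))"
      using FArr_in(1)[OF VF pad_inclusion_Arr[OF S ab]] by simp
    have "Comp (Mod R) (t b) (Comp (Mod R) (q b) (tr a b)) = Comp (Mod R) (Comp (Mod R) (?f b) (?p b)) (tr a b)"
      unfolding sq by (rule RM.Comp_assoc[OF tr(1)[OF ab] q(1) tH])
    also have "\<dots> = Comp (Mod R) (?f b) (?p a)"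
      using RM.Comp_assoc[OF tr(1)[OF ab] p(1) fH] ptr[OF ab] by simp
    also have "?f b = Comp (Mod R) (FArr V (pad_inclusion a b S)) (?f a)"
      using FI_ObjD(4)[OF VF into_pad_Arr[OF S, of a] pad_inclusion_Arr[OF S ab]] pad_inclusion_into[OF S ab]
      by (simp del: Mod_simps FI_simps)
    also have "Comp (Mod R) \<dots> (?p a) = Comp (Mod R) (FArr V (pad_inclusion a b S)) (Comp (Mod R) (?f a) (?p a))"
      by (rule RM.Comp_assoc[OF p(1) fH inc, symmetric])
    finally show ?thesis unfolding sq .
  qed
  have "\<exists>!u. u \<in> Hom (Mod R) (?P a) L \<and> Comp (Mod R) k u = ?p a" for a
    by (rule RM.lift_mono[OF kH p(1) kinj]) (use kim Pel p(2) in auto)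
  \<comment> \<open>The image of \<open>k\<close> in each sort is the union of all levels, so each
    inclusion \<open>?p a\<close> lifts uniquely through the mono \<open>k\<close>. The cocone
    identities follow by cancelling \<open>k\<close>.\<close>
  then obtain c where c: "\<And>a. c a \<in> Hom (Mod R) (?P a) L" "\<And>a. Comp (Mod R) k (c a) = ?p a" by metis
  have kc: "rapp k r (rapp (c a) r x) = x" if "r \<in> Obj R" "x \<in> level V S a r" for a r x
    using RM.app_Comp[OF c(1) kH that(1), of x a] c(2)[of a] p(2)[OF that] Pel[OF that(1)] that(2) by simp
  have kmono: "is_mono (Mod R) k" using RM.is_mono_iff[OF kH] kinj by blast
  have kd: "Dom (Mod R) k = L" using kH by (simp add: Hom_iff)
  have cocone: "is_cocone nat_category (Mod R) PF L c"
    unfolding is_cocone_def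
  proof (intro conjI ballI LO)
    show "c a \<in> Hom (Mod R) (FObj PF a) L" for a using c(1) by (simp add: PF_def)
    fix e assume "e \<in> Arr nat_category"
    then obtain a b where e: "e = (a, b)" "a \<le> b" by auto
    have "Comp (Mod R) k (Comp (Mod R) (c b) (tr a b)) = Comp (Mod R) k (c a)"
      using RM.Comp_assoc[OF tr(1)[OF e(2)] c(1) kH] c(2) ptr[OF e(2)] by simp
    then have "Comp (Mod R) (c b) (tr a b) = c a"
      using kmono RM.Comp_in[OF tr(1)[OF e(2)] c(1)] c(1) kd unfolding is_mono_def by metis
    then show "Comp (Mod R) (c (Cod nat_category e)) (FArr PF e) = c (Dom nat_category e)"
      using e by (simp add: PF_def del: Mod_simps)
  qed
  \<comment> \<open>The legs are injective and jointly surjective onto \<open>L\<close>: an element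
    \<open>y\<close> lies in the leg at any \<open>a\<close> whose level contains
    \<open>rapp k r y\<close>.\<close>
  have col: "is_colimit nat_category (Mod R) PF L c"
  proof (rule RM.is_colimit_union[OF category_nat_category PF cocone])
    show "\<exists>l\<in>Obj nat_category. Hom nat_category a l \<noteq> {} \<and> Hom nat_category b l \<noteq> {}" for a b
      by (rule bexI[of _ "max a b"]) (simp_all add: Hom_nat_category)
    show "inj_on (rapp (c a) r) (el (rmd (FObj PF a)) r)" if "r \<in> Obj R" for a r
      using kc[OF that] Pel[OF that] by (auto simp: PF_def inj_on_def) metis
    show "\<exists>a\<in>Obj nat_category. y \<in> rapp (c a) r ` el (rmd (FObj PF a)) r" if r: "r \<in> Obj R" and y: "y \<in> el (rmd L) r" for r y
    proof -
      obtain a where a: "rapp k r y \<in> level V S a r" using kim[OF r] y by blast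
      have "rapp (c a) r (rapp k r y) \<in> el (rmd L) r" using RM.app_el[OF c(1) r] Pel[OF r] a by simp
      then have "rapp (c a) r (rapp k r y) = y" using inj_onD[OF kinj[OF r] kc[OF r a]] y by blast
      then show ?thesis using a Pel[OF r] by (intro bexI[of _ a] image_eqI[of _ _ "rapp k r y"]) (simp_all add: PF_def)
    qed
  qed
  have psi: "App (psi a V) S = ?f a" for a using S by (simp add: psi_def)
  have tsub: "torsion_subobject (Mod R) T (FObj (shift a V) S) (t a)" for a
    unfolding torsion_subobject_def using RT.torsion tg by (intro exI[of _ F] exI[of _ "g a"]) simp
  have pd: "Dom (Mod R) (?p a) = ?P a" for a using p(1)[of a] unfolding Hom_iff by blast
  show ?thesis unfolding is_torsion_colimit_def k_def[symmetric] kd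
  proof (rule conjI[rotated], rule exI[of _ t], rule exI[of _ ?p], rule exI[of _ q], rule exI[of _ PF],
      rule exI[of _ c], intro conjI allI impI)
    show "k \<in> Hom (Mod R) L (FObj V S)" using kH by (simp add: X_def)
    show "is_pullback (Mod R) (App (psi a V) S) (t a) (?p a) (q a)" for a using q(2) psi by simp
    show "FObj PF a = Dom (Mod R) (?p a)" for a using pd by (simp add: PF_def)
    show "Comp (Mod R) (?p b) (FArr PF (a, b)) = ?p a" if "a \<le> b" for a b using ptr[OF that] by (simp add: PF_def del: Mod_simps)
    show "Comp (Mod R) (t b) (Comp (Mod R) (q b) (FArr PF (a, b))) =
        Comp (Mod R) (FArr V (pad_inclusion a b S)) (Comp (Mod R) (t a) (q a))" if "a \<le> b" for a b
      using ttr[OF that] by (simp add: PF_def del: Mod_simps)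
  qed (rule tsub PF col c(2))+
qed

end

theorem theorem2:
  fixes R :: "('u, 'u) preadd"
  assumes universe: "infinite (UNIV :: 'u set)"
    and preadditive: "preadditive_category R"
    and noeth: "locally_noetherian TYPE('u) (Mod R)"
  shows "serre_subcategory (FI_Mod R) (FI_sfg R) \<and>
    (\<forall>T F. hereditary_torsion_theory (Mod R) T F \<longrightarrow>
      hereditary_torsion_class (full_subcategory (FI_Mod R) (FI_sfg R)) (T_bar_sfg R T) \<and>
      (\<forall>V\<in>FI_sfg R. \<forall>i.
        torsion_subobject (full_subcategory (FI_Mod R) (FI_sfg R)) (T_bar_sfg R T) V i \<longrightarrow>
        (\<forall>S. finite S \<longrightarrow> is_torsion_colimit R T V S (App i S))))"
proof -
  interpret noetherian_ring_category R
    by (intro noetherian_ring_category.intro ring_category.intro preadditive ring_category_axioms.intro universe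
        noetherian_ring_category_axioms.intro noeth)
  show ?thesis
  proof (intro conjI serre_FI_sfg allI impI)
    fix T F assume h: "hereditary_torsion_theory (Mod R) T F"
    interpret FI_torsion R T F by unfold_locales (rule h)
    show "hereditary_torsion_class sfg (T_bar_sfg R T)"
      using hereditary_sfg by (auto simp: hereditary_torsion_class_def)
    show "\<forall>V\<in>FI_sfg R. \<forall>i. torsion_subobject sfg (T_bar_sfg R T) V i \<longrightarrow>
        (\<forall>S. finite S \<longrightarrow> is_torsion_colimit R T V S (App i S))"
      using torsion_colimit by blast
  qed
qed

end
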